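(* Let $d\in\{2,3\}$ and $s>\frac d2$. The data-to-solution map of the non-resistive MHD system $$\begin{cases}\partial_t u+u\cdot\nabla u-\Delta u+\nabla P=b\cdot\nabla b,\\ \partial_t b+u\cdot\nabla b=b\cdot\nabla u,\\ \mathrm{div}\,u=\mathrm{div}\,b=0,\end{cases}\qquad (u,b)|_{t=0}=(u_0,b_0),$$ on $\mathbb{R}^d$ is not uniformly continuous from bounded subsets of $H^s$ into $\mathcal{C}([0,T];H^s)$, in the following sense: there exist a time $T>0$, constants $C,c>0$, and two sequences of solutions $(u^n,b^n)$ and $(v^n,c^n)$ of this system on $[0,T]$, with initial data $(u^n_0,b^n_0)$ and $(v^n_0,c^n_0)$ respectively, such that $$\|u^n_0\|_{H^s}+\|b^n_0\|_{H^s}+\|v^n_0\|_{H^s}+\|c^n_0\|_{H^s}\le C\quad\text{for all } n,$$ $$\lim_{n\to\infty}\big(\|u^n_0-v^n_0\|_{H^s}+\|b^n_0-c^n_0\|_{H^s}\big)=0,$$ $$\liminf_{n\to\infty}\big(\|u^n(t)-v^n(t)\|_{H^s}+\|b^n(t)-c^n(t)\|_{H^s}\big)\ge c\,|\sin t|\quad\text{for all } t\in[0,T].$$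
   Context: $H^s=H^s(\mathbb{R}^d)$ is the standard inhomogeneous Sobolev space with $\|f\|_{H^s}^2=\int_{\mathbb{R}^d}(1+|\xi|^2)^s|\hat f(\xi)|^2\,d\xi$, used componentwise for vector fields. The unknowns are the vector fields $u,b$ (valued in $\mathbb{R}^d$) and the scalar pressure $P$; initial data are divergence-free vector fields in $H^s$. A solution on $[0,T]$ means $(u,b)$ with $u,b\in\mathcal{C}([0,T];H^s)$ and $\nabla u\in L^2(0,T;H^s)$, satisfying the system for some $P$ (in the sense of distributions) together with the initial condition. Known local well-posedness (Fefferman et al.): for $d\in\{2,3\}$, $s>\frac d2$ and divergence-free $u_0,b_0\in H^s(\mathbb{R}^d)$ there is a time $T=T(s,\|u_0\|_{H^s},\|b_0\|_{H^s})>0$ such that the system has a unique solution on $[0,T]$ in this class. *)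

theory Defs
  imports "HOL-Analysis.Analysis"
begin

section \<open>Test functions and weak derivatives\<close>

abbreviation dderiv :: "'a::euclidean_space \<Rightarrow> ('a \<Rightarrow> real) \<Rightarrow> 'a \<Rightarrow> real" where
  "dderiv e f \<equiv> (\<lambda>z. frechet_derivative f (at z) e)"

text \<open>Since \<open>smooth_fun\<close> is coinductive, all iterated directional derivatives exist and are
  differentiable, hence continuous: the predicate says that f is of class \<open>C\<^sup>\<infinity>\<close> on the
  whole space.\<close>

coinductive smooth_fun :: "('a::euclidean_space \<Rightarrow> real) \<Rightarrow> bool" where
  "\<lbrakk>\<And>z. f differentiable at z; \<And>e. smooth_fun (dderiv e f)\<rbrakk> \<Longrightarrow> smooth_fun f"

definition test_fun :: "'a::euclidean_space set \<Rightarrow> ('a \<Rightarrow> real) \<Rightarrow> bool" where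
  "test_fun \<Omega> \<phi> \<longleftrightarrow> smooth_fun \<phi> \<and>
     compact (closure {z. \<phi> z \<noteq> 0}) \<and> closure {z. \<phi> z \<noteq> 0} \<subseteq> \<Omega>"

definition loc_integrable :: "'a::euclidean_space set \<Rightarrow> ('a \<Rightarrow> 'b::euclidean_space) \<Rightarrow> bool" where
  "loc_integrable \<Omega> f \<longleftrightarrow> (\<forall>K. compact K \<and> K \<subseteq> \<Omega> \<longrightarrow> set_integrable lborel K f)"

text \<open>\<open>D x $ i $ j\<close> is the weak derivative of the i-th component in the j-th direction.\<close>

definition weak_gradient :: "(real^'d \<Rightarrow> real^'d) \<Rightarrow> (real^'d \<Rightarrow> real^'d^'d) \<Rightarrow> bool" where
  "weak_gradient f D \<longleftrightarrow> loc_integrable UNIV f \<and> loc_integrable UNIV D \<and>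
     (\<forall>\<phi>. test_fun UNIV \<phi> \<longrightarrow> (\<forall>i j.
        (LINT x|lborel. D x $ i $ j * \<phi> x)
          = - (LINT x|lborel. f x $ i * dderiv (axis j 1) \<phi> x)))"

definition weak_div_free :: "(real^'d \<Rightarrow> real^'d) \<Rightarrow> bool" where
  "weak_div_free f \<longleftrightarrow> (\<forall>\<phi>. test_fun UNIV \<phi> \<longrightarrow>
     (LINT x|lborel. (\<Sum>j\<in>UNIV. f x $ j * dderiv (axis j 1) \<phi> x)) = 0)"


section \<open>Fourier transform and Sobolev spaces\<close>

definition square_integrable :: "('a::euclidean_space \<Rightarrow> 'b::euclidean_space) \<Rightarrow> bool" where
  "square_integrable f \<longleftrightarrow> f \<in> borel_measurable lborel \<and> integrable lborel (\<lambda>x. (norm (f x))\<^sup>2)"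

definition fourier_trunc :: "real \<Rightarrow> ('a::euclidean_space \<Rightarrow> real) \<Rightarrow> 'a \<Rightarrow> complex" where
  "fourier_trunc R f \<xi> = (LINT x:cball 0 R|lborel. exp (- \<i> * of_real (x \<bullet> \<xi>)) * of_real (f x))"

text \<open>Plancherel's definition of the Fourier transform of a square integrable function: the
  \<open>L\<^sup>2\<close> limit of the Fourier integrals over balls of radius R. It is determined up to null
  sets.\<close>

definition is_fourier :: "('a::euclidean_space \<Rightarrow> real) \<Rightarrow> ('a \<Rightarrow> complex) \<Rightarrow> bool" where
  "is_fourier f g \<longleftrightarrow> square_integrable g \<and>
     ((\<lambda>R. \<integral>\<^sup>+ \<xi>. ennreal ((norm (fourier_trunc R f \<xi> - g \<xi>))\<^sup>2) \<partial>lborel) \<longlongrightarrow> 0) at_top"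

definition fourier :: "('a::euclidean_space \<Rightarrow> real) \<Rightarrow> 'a \<Rightarrow> complex" where
  "fourier f = (SOME g. is_fourier f g)"

text \<open>The space \<open>H\<^sup>s\<close>, for \<open>s \<ge> 0\<close> only (so that it is contained in \<open>L\<^sup>2\<close>). Its elements are
  represented by Borel functions; \<open>Hs_norm\<close> is meaningful for members of the space and
  depends only on the almost-everywhere class.\<close>

definition in_Hs :: "real \<Rightarrow> ('a::euclidean_space \<Rightarrow> 'b::euclidean_space) \<Rightarrow> bool" where
  "in_Hs s f \<longleftrightarrow> square_integrable f \<and>
     (\<forall>e\<in>Basis. integrable lborel
        (\<lambda>\<xi>. (1 + (norm \<xi>)\<^sup>2) powr s * (norm (fourier (\<lambda>x. f x \<bullet> e) \<xi>))\<^sup>2))"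

definition Hs_norm :: "real \<Rightarrow> ('a::euclidean_space \<Rightarrow> 'b::euclidean_space) \<Rightarrow> real" where
  "Hs_norm s f = sqrt (\<Sum>e\<in>Basis. LINT \<xi>|lborel.
     (1 + (norm \<xi>)\<^sup>2) powr s * (norm (fourier (\<lambda>x. f x \<bullet> e) \<xi>))\<^sup>2)"

definition C_Hs :: "real \<Rightarrow> real \<Rightarrow> (real \<Rightarrow> 'a::euclidean_space \<Rightarrow> 'b::euclidean_space) \<Rightarrow> bool" where
  "C_Hs T s u \<longleftrightarrow> (\<forall>t\<in>{0..T}. in_Hs s (u t) \<and>
     ((\<lambda>\<tau>. Hs_norm s (\<lambda>x. u \<tau> x - u t x)) \<longlongrightarrow> 0) (at t within {0..T}))"

text \<open>\<open>L\<^sup>2(0,T;H\<^sup>s)\<close>. The pairings with test functions separate the points of the separable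
  Hilbert space \<open>H\<^sup>s\<close>, so their measurability in t amounts to strong measurability.\<close>

definition L2_Hs :: "real \<Rightarrow> real \<Rightarrow> (real \<Rightarrow> 'a::euclidean_space \<Rightarrow> 'b::euclidean_space) \<Rightarrow> bool" where
  "L2_Hs T s F \<longleftrightarrow>
     (AE t in lborel. t \<in> {0<..<T} \<longrightarrow> in_Hs s (F t)) \<and>
     (\<forall>\<phi>. test_fun UNIV \<phi> \<longrightarrow> (\<forall>e\<in>Basis.
        set_borel_measurable lebesgue {0<..<T} (\<lambda>t. LINT x|lborel. (F t x \<bullet> e) * \<phi> x))) \<and>
     set_integrable lebesgue {0<..<T} (\<lambda>t. (Hs_norm s (F t))\<^sup>2)"


section \<open>The non-resistive MHD system\<close>

text \<open>Fields on space-time are tested against functions of \<open>(t, x)\<close> with compact support in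
  \<open>(0,T) \<times> \<real>\<^sup>d\<close>. Space-time integrals involving the fields are iterated ones, as \<open>u t\<close> is only
  determined almost everywhere for each t and joint measurability therefore depends on the
  chosen representatives.\<close>

abbreviation spacetime :: "real \<Rightarrow> (real \<times> (real^'d)) set" where
  "spacetime T \<equiv> {0<..<T} \<times> UNIV"

abbreviation d_t :: "(real \<times> (real^'d) \<Rightarrow> real) \<Rightarrow> real \<times> (real^'d) \<Rightarrow> real" where
  "d_t \<phi> \<equiv> dderiv (1, 0) \<phi>"

abbreviation d_x :: "'d::finite \<Rightarrow> (real \<times> (real^'d) \<Rightarrow> real) \<Rightarrow> real \<times> (real^'d) \<Rightarrow> real" where
  "d_x j \<phi> \<equiv> dderiv (0, axis j 1) \<phi>"

text \<open>The i-th component of \<open>w \<cdot> \<nabla>f\<close>, where D is the gradient of f.\<close>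

definition advect :: "real^'d \<Rightarrow> real^'d^'d \<Rightarrow> 'd \<Rightarrow> real" where
  "advect w D i = (\<Sum>j\<in>UNIV. w $ j * D $ i $ j)"

definition momentum_eq :: "real \<Rightarrow> (real \<Rightarrow> real^'d \<Rightarrow> real^'d) \<Rightarrow> (real \<Rightarrow> real^'d \<Rightarrow> real^'d^'d) \<Rightarrow>
    (real \<Rightarrow> real^'d \<Rightarrow> real^'d) \<Rightarrow> (real \<Rightarrow> real^'d \<Rightarrow> real^'d^'d) \<Rightarrow>
    (real \<times> (real^'d) \<Rightarrow> real) \<Rightarrow> bool" where
  "momentum_eq T u Du b Db P \<longleftrightarrow> (\<forall>\<phi>. test_fun (spacetime T) \<phi> \<longrightarrow> (\<forall>i.
     (LINT t:{0<..<T}|lborel. LINT x|lborel.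
          - u t x $ i * d_t \<phi> (t, x)
          + advect (u t x) (Du t x) i * \<phi> (t, x)
          - u t x $ i * (\<Sum>j\<in>UNIV. d_x j (d_x j \<phi>) (t, x)))
       - (LINT z|lborel. P z * d_x i \<phi> z)
     = (LINT t:{0<..<T}|lborel. LINT x|lborel. advect (b t x) (Db t x) i * \<phi> (t, x))))"

definition induction_eq :: "real \<Rightarrow> (real \<Rightarrow> real^'d \<Rightarrow> real^'d) \<Rightarrow> (real \<Rightarrow> real^'d \<Rightarrow> real^'d^'d) \<Rightarrow>
    (real \<Rightarrow> real^'d \<Rightarrow> real^'d) \<Rightarrow> (real \<Rightarrow> real^'d \<Rightarrow> real^'d^'d) \<Rightarrow> bool" where
  "induction_eq T u Du b Db \<longleftrightarrow> (\<forall>\<phi>. test_fun (spacetime T) \<phi> \<longrightarrow> (\<forall>i.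
     (LINT t:{0<..<T}|lborel. LINT x|lborel.
          - b t x $ i * d_t \<phi> (t, x)
          + advect (u t x) (Db t x) i * \<phi> (t, x))
     = (LINT t:{0<..<T}|lborel. LINT x|lborel. advect (b t x) (Du t x) i * \<phi> (t, x))))"

definition div_eq :: "real \<Rightarrow> (real \<Rightarrow> real^'d \<Rightarrow> real^'d) \<Rightarrow> bool" where
  "div_eq T w \<longleftrightarrow> (\<forall>\<phi>. test_fun (spacetime T) \<phi> \<longrightarrow>
     (LINT t:{0<..<T}|lborel. LINT x|lborel. (\<Sum>j\<in>UNIV. w t x $ j * d_x j \<phi> (t, x))) = 0)"

text \<open>Solutions on \<open>[0,T]\<close> with initial data \<open>(u0, b0)\<close>. It is no restriction that the weak
  gradients exist for every t: the notion is used for \<open>s > d/2 \<ge> 1\<close> only.\<close>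

definition mhd_solution :: "real \<Rightarrow> real \<Rightarrow> (real^'d \<Rightarrow> real^'d) \<Rightarrow> (real^'d \<Rightarrow> real^'d) \<Rightarrow>
    (real \<Rightarrow> real^'d \<Rightarrow> real^'d) \<Rightarrow> (real \<Rightarrow> real^'d \<Rightarrow> real^'d) \<Rightarrow> bool" where
  "mhd_solution s T u0 b0 u b \<longleftrightarrow>
     in_Hs s u0 \<and> weak_div_free u0 \<and> in_Hs s b0 \<and> weak_div_free b0 \<and>
     C_Hs T s u \<and> C_Hs T s b \<and>
     (AE x in lborel. u 0 x = u0 x) \<and> (AE x in lborel. b 0 x = b0 x) \<and>
     (\<exists>Du Db P.
        (\<forall>t\<in>{0..T}. weak_gradient (u t) (Du t) \<and> weak_gradient (b t) (Db t)) \<and>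
        L2_Hs T s Du \<and>
        loc_integrable (spacetime T) P \<and>
        momentum_eq T u Du b Db P \<and>
        induction_eq T u Du b Db \<and>
        div_eq T u \<and> div_eq T b)"

end

theory Submission
  imports Defs "HOL-Probability.Probability"
begin

text \<open>A velocity of size \<open>1/n\<close> tends to zero, but within unit time it moves a magnetic field of
  frequency n by a distance comparable to the wave length. Take \<open>u\<^sub>0 = \<theta>/n V\<close> with a low frequency
  divergence free V, and \<open>b\<^sub>0\<close> of size 1 in \<open>H\<^sup>s\<close> with frequencies near \<open>\<plusminus>\<pi>n e\<^sub>i\<close>. For \<open>\<theta> = 1\<close> and
  \<open>\<theta> = 0\<close> the data approach each other, while at time 0 the derivatives of the magnetic fields
  differ by \<open>b\<^sub>0 \<cdot> \<nabla>u\<^sub>0 - u\<^sub>0 \<cdot> \<nabla>b\<^sub>0\<close>, which has size 1 in \<open>H\<^sup>s\<close>. A Taylor expansion to first order in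
  time then bounds the difference of the solutions from below by \<open>c t\<close>, on a time interval that does
  not depend on n.

  For such data, solutions are constructed by a contraction argument for the amplitudes of sine
  transforms \<open>\<integral> sin (x \<cdot> \<xi>) U(t,\<xi>) d\<xi>\<close>, with the weights \<open>S(\<xi>) exp (- (1 - \<Lambda> t) |\<xi>| / n)\<close>: as in the
  Cauchy-Kovalevskaya theorem, the shrinking radius of analyticity absorbs the derivative in the
  nonlinear terms, and it can do so on a uniform time interval because the rescaled nonlinear
  terms carry the coefficient \<open>1/n\<close>. The weight S obeys \<open>S * S \<le> K S\<close> for the convolution with K
  independent of n, although it is bounded below near 0 and near \<open>\<plusminus>\<pi>n e\<^sub>i\<close>.\<close>

text \<open>The obstacle is the existence time, which must not shrink as the frequency n of the
  magnetic datum grows. A radius of analyticity of only 1/n suffices: exp (-|\<xi>|/n) is of order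
  one up to |\<xi>| of order n, so it does not spoil the H^s bounds of the data, and a radius
  shrinking at speed \<Lambda>/n pays for a derivative |\<xi>| that comes with a coefficient at most
  1/n. For the (B,B) term the coefficient is \<open>n\<^sup>1\<^sup>-\<^sup>2\<^sup>s\<close>, which
  is at most 1/n because s > d/2 \<ge> 1. An exponential with rate 1/n has an integral that grows
  with n, so integrability uniform in n has to come from S. Convolutions of amplitudes near 0 and
  near +-pi n e_i reach every multiple of pi n e_i, and S must tolerate all of them; this leads to a
  weight in |sin (\<xi>_i/n)| and to the frequency pi n of the data. Odd fields are preserved by the
  system. Their amplitudes stay real and odd, while gradients and the pressure are cosine
  transforms. The time T is also taken so small that the quadratic Taylor remainders use up at most
  half of the linear term; the bound with |sin t| then follows from |sin t| \<le> t.\<close>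

section \<open>Domination, product integrals and exponential majorants\<close>

lemma
  fixes f :: "'a \<Rightarrow> 'b::{banach,second_countable_topology}"
  assumes g: "integrable M g" and f: "f \<in> borel_measurable M" and le: "\<And>x. norm (f x) \<le> g x"
  shows integrable_dominated: "integrable M f"
    and norm_integral_dominated: "norm (integral\<^sup>L M f) \<le> integral\<^sup>L M g"
proof -
  show i: "integrable M f"
    by (rule Bochner_Integration.integrable_bound[OF g f]) (use le in \<open>auto intro!: AE_I2 intro: order_trans[OF _ abs_ge_self]\<close>)
  show "norm (integral\<^sup>L M f) \<le> integral\<^sup>L M g"
    by (rule order_trans[OF integral_norm_bound]) (intro Bochner_Integration.integral_mono integrable_norm i g le)
qed

text \<open>Lebesgue measure is the image of a product of one-dimensional Lebesgue measures under
  the coordinate map. This serves the Gaussians and, later, the product majorant of the weight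
  \<open>wS\<close>.\<close>

lemma integrable_prod_Basis:
  fixes f :: "'a::euclidean_space \<Rightarrow> real \<Rightarrow> 'b::{real_normed_field,banach,second_countable_topology}"
  assumes "\<And>b. b \<in> Basis \<Longrightarrow> integrable lborel (f b)"
  shows "integrable lborel (\<lambda>x::'a. \<Prod>b\<in>Basis. f b (x \<bullet> b))"
    and "(LINT x|lborel. (\<Prod>b\<in>Basis. f b ((x::'a) \<bullet> b))) = (\<Prod>b\<in>Basis. LINT y|lborel. f b y)"
proof -
  interpret product_sigma_finite "\<lambda>_::'a. lborel :: real measure" ..
  have m: "(\<lambda>x::'a. \<Prod>b\<in>Basis. f b (x \<bullet> b)) \<in> borel_measurable borel"
  proof (intro borel_measurable_prod)
    fix b :: 'a assume "b \<in> Basis"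
    then have "f b \<in> borel_measurable borel"
      using borel_measurable_integrable[OF assms] by simp
    then show "(\<lambda>x. f b (x \<bullet> b)) \<in> borel_measurable borel"
      by (rule measurable_compose[rotated]) (intro borel_measurable_continuous_onI continuous_intros)
  qed
  have [measurable]: "(\<lambda>g::'a\<Rightarrow>real. \<Sum>b\<in>Basis. g b *\<^sub>R b) \<in> measurable (\<Pi>\<^sub>M b\<in>Basis. lborel) borel"
    by measurable
  have e: "(\<Prod>b\<in>Basis. f b ((\<Sum>c\<in>Basis. g c *\<^sub>R c) \<bullet> b)) = (\<Prod>b\<in>Basis. f b (g b))" for g :: "'a \<Rightarrow> real"
    by (intro prod.cong) (auto simp: inner_sum_left_Basis)
  show "integrable lborel (\<lambda>x::'a. \<Prod>b\<in>Basis. f b (x \<bullet> b))"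
    by (subst lborel_eq, subst integrable_distr_eq) (use m assms in \<open>auto simp: e intro!: product_integrable_prod\<close>)
  show "(LINT x|lborel. (\<Prod>b\<in>Basis. f b ((x::'a) \<bullet> b))) = (\<Prod>b\<in>Basis. LINT y|lborel. f b y)"
    by (subst lborel_eq, subst integral_distr) (use m assms in \<open>auto simp: e intro!: product_integral_prod\<close>)
qed

lemma integrable_inverse_1_plus_square_lborel: "integrable lborel (\<lambda>x::real. inverse (1 + x\<^sup>2))"
  using integrable_inverse_1_plus_square
  unfolding set_integrable_def einterval_eq_UNIV by (simp only: indicator_UNIV scaleR_one)

lemma integrable_exp_abs:
  assumes "a > 0" shows "integrable lborel (\<lambda>x::real. exp (- (a * \<bar>x\<bar>)))"
proof (rule Bochner_Integration.integrable_bound)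
  \<comment> \<open>With this m, m (1 + x^2) stays below 1 + a|x| + (a|x|)^2/2, hence below exp
    (a|x|).\<close>
  define m where "m = min 1 (a\<^sup>2 / 2)"
  have m: "m > 0" using assms by (auto simp: m_def)
  show "integrable lborel (\<lambda>x::real. inverse m * inverse (1 + x\<^sup>2))"
    by (intro integrable_mult_right integrable_inverse_1_plus_square_lborel)
  show "AE x in lborel. norm (exp (- (a * \<bar>x\<bar>))) \<le> norm (inverse m * inverse (1 + x\<^sup>2))"
  proof (rule AE_I2)
    fix x :: real
    have "m * (1 + x\<^sup>2) = m + m * x\<^sup>2" by (simp add: algebra_simps)
    also have "\<dots> \<le> 1 + (a\<^sup>2/2) * x\<^sup>2"
      by (intro add_mono mult_right_mono) (simp_all add: m_def)
    also have "\<dots> \<le> 1 + a * \<bar>x\<bar> + (a * \<bar>x\<bar>)\<^sup>2/2" using assms by (auto simp: power_mult_distrib)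
    also have "\<dots> \<le> exp (a * \<bar>x\<bar>)" using assms by (intro exp_lower_Taylor_quadratic) auto
    finally have "m * (1 + x\<^sup>2) \<le> exp (a * \<bar>x\<bar>)" .
    moreover have p: "1 + x\<^sup>2 > 0" by (intro add_pos_nonneg) auto
    ultimately have "inverse (exp (a * \<bar>x\<bar>)) \<le> inverse (m * (1 + x\<^sup>2))"
      by (intro le_imp_inverse_le mult_pos_pos m)
    then have "exp (- (a * \<bar>x\<bar>)) \<le> inverse m * inverse (1 + x\<^sup>2)"
      by (simp only: exp_minus inverse_mult_distrib)
    then show "norm (exp (- (a * \<bar>x\<bar>))) \<le> norm (inverse m * inverse (1 + x\<^sup>2))"
      unfolding real_norm_def abs_exp_cancel by (rule order_trans[OF _ abs_ge_self])
  qed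
  show "(\<lambda>x::real. exp (- (a * \<bar>x\<bar>))) \<in> borel_measurable lborel" by measurable
qed

text \<open>The rate r is shared equally among the coordinates: the sum of the |x . b| is at most
  DIM times the norm, so a product of one-dimensional exponentials with rate r / DIM is a
  majorant.\<close>

lemma integrable_exp_norm:
  assumes "r > 0" shows "integrable lborel (\<lambda>x::'a::euclidean_space. exp (- (r * norm x)))"
proof (rule Bochner_Integration.integrable_bound)
  let ?a = "r / DIM('a)"
  show "integrable lborel (\<lambda>x::'a. \<Prod>b\<in>Basis. exp (- (?a * \<bar>x \<bullet> b\<bar>)))"
    by (intro integrable_prod_Basis integrable_exp_abs) (use assms in auto)
  show "AE x in lborel. norm (exp (- (r * norm (x::'a)))) \<le> norm (\<Prod>b\<in>Basis. exp (- (?a * \<bar>x \<bullet> b\<bar>)))"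
  proof (rule AE_I2)
    fix x :: 'a
    have "(\<Sum>b\<in>Basis. ?a * \<bar>x \<bullet> b\<bar>) \<le> (\<Sum>b\<in>(Basis::'a set). ?a * norm x)"
      using assms by (intro sum_mono mult_left_mono) (auto simp: Basis_le_norm)
    then have "(\<Sum>b\<in>Basis. ?a * \<bar>x \<bullet> b\<bar>) \<le> r * norm x" by simp
    then show "norm (exp (- (r * norm x))) \<le> norm (\<Prod>b\<in>Basis. exp (- (?a * \<bar>x \<bullet> b\<bar>)))"
      by (simp only: exp_sum[OF finite_Basis, symmetric] real_norm_def abs_exp_cancel sum_negf exp_le_cancel_iff neg_le_iff_le)
  qed
qed auto

lemma integrable_exp_bound:
  fixes f :: "'a::euclidean_space \<Rightarrow> 'b::{banach,second_countable_topology}"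
  assumes "f \<in> borel_measurable borel" "r > 0" "\<And>x. norm (f x) \<le> C * exp (- (r * norm x))"
  shows "integrable lborel f"
proof (rule Bochner_Integration.integrable_bound[OF integrable_mult_right[OF integrable_exp_norm[OF assms(2)], of C]])
  show "AE x in lborel. norm (f x) \<le> norm (C * exp (- (r * norm x)))"
    unfolding real_norm_def by (intro AE_I2 order_trans[OF assms(3) abs_ge_self])
qed (use assms in auto)

text \<open>The left side is at most (1 + |x|)^k with k = 2s, and y \<le> (k/r) exp (r y / k) for y
  = 1 + |x| can be raised to the power k.\<close>

lemma powr_le_exp:
  assumes "r > 0" "s > 0"
  shows "\<exists>C>0. \<forall>x::'a::real_normed_vector. (1 + (norm x)\<^sup>2) powr s \<le> C * exp (r * norm x)"
proof -
  define k where "k = 2 * s"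
  have k: "k > 0" using assms by (simp add: k_def)
  have "(1 + (norm x)\<^sup>2) powr s \<le> (k / r) powr k * exp r * exp (r * norm x)" for x :: 'a
  proof -
    define y where "y = norm x"
    have y: "y \<ge> 0" by (simp add: y_def)
    have "1 + y\<^sup>2 \<le> (1 + y)\<^sup>2" using y by (simp add: power2_eq_square algebra_simps)
    then have "(1 + y\<^sup>2) powr s \<le> ((1 + y)\<^sup>2) powr s" using assms by (intro powr_mono2) auto
    also have "\<dots> = (1 + y) powr k" using y by (simp add: k_def powr_powr flip: powr_numeral)
    also have "\<dots> \<le> ((k / r) * exp (r * (1 + y) / k)) powr k"
    proof (rule powr_mono2)
      have "r * (1 + y) / k \<le> exp (r * (1 + y) / k)"
        using exp_ge_add_one_self[of "r * (1 + y) / k"] by linarith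
      then have "(k / r) * (r * (1 + y) / k) \<le> (k / r) * exp (r * (1 + y) / k)"
        using k assms by (intro mult_left_mono) auto
      then show "1 + y \<le> k / r * exp (r * (1 + y) / k)" using k assms by simp
    qed (use y k in auto)
    also have "\<dots> = (k / r) powr k * exp (r * (1 + y))"
      using k assms by (subst powr_mult) (auto simp: exp_powr_real)
    finally show ?thesis by (simp add: y_def distrib_left exp_add mult.assoc)
  qed
  moreover have "(k / r) powr k * exp r > 0" using k assms by simp
  ultimately show ?thesis by blast
qed

lemma integrable_pair_mult:
  fixes f :: "'a::euclidean_space \<Rightarrow> real" and g :: "'b::euclidean_space \<Rightarrow> real"
  assumes f: "integrable lborel f" and g: "integrable lborel g"
  shows "integrable (lborel \<Otimes>\<^sub>M lborel) (\<lambda>(x, y). f x * g y)"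
proof -
  have [measurable]: "f \<in> borel_measurable borel" "g \<in> borel_measurable borel" using f g by auto
  have m: "(\<lambda>(x, y). f x * g y) \<in> borel_measurable (lborel \<Otimes>\<^sub>M lborel)" by measurable
  show ?thesis
    using f g m by (intro lborel_pair.Fubini_integrable) (auto simp: abs_mult)
qed

lemma integrable_pair_bound:
  fixes k :: "'a::euclidean_space \<times> 'b::euclidean_space \<Rightarrow> 'c::{banach,second_countable_topology}"
  assumes "integrable lborel f" "integrable lborel g" "k \<in> borel_measurable borel"
    and "\<And>x y. norm (k (x, y)) \<le> f x * g y"
  shows "integrable (lborel \<Otimes>\<^sub>M lborel) k"
proof (rule Bochner_Integration.integrable_bound[OF integrable_pair_mult[OF assms(1,2)]])
  show "AE z in lborel \<Otimes>\<^sub>M lborel. norm (k z) \<le> norm (case z of (x, y) \<Rightarrow> f x * g y)"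
    using assms(4) by (intro AE_I2) (force intro: order_trans[OF _ abs_ge_self])
qed (use assms(3) in \<open>auto simp: lborel_prod\<close>)

subsection \<open>Gaussians\<close>

text \<open>This is the characteristic function of the standard normal distribution after the
  substitution that scales the variable by a.\<close>

lemma gaussian_fourier_real:
  assumes "a > 0"
  shows "integrable lborel (\<lambda>x::real. cis (t * x) * of_real (exp (- ((a * x)\<^sup>2 / 2))))"
    and "(LINT x|lborel. cis (t * x) * of_real (exp (- ((a * x)\<^sup>2 / 2)))) = of_real (sqrt (2 * pi) / a * exp (- ((t / a)\<^sup>2 / 2)))"
proof -
  let ?g = "\<lambda>u y::real. cis (u * y) * of_real (exp (- (y\<^sup>2 / 2)))"
  have "char std_normal_distribution = (\<lambda>u. LINT x|lborel. std_normal_density x *\<^sub>R iexp (u * x))"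
    unfolding char_def by (intro ext, subst integral_density) auto
  also have "\<dots> = (\<lambda>u. LINT x|lborel. of_real (1 / sqrt (2 * pi)) * ?g u x)"
    by (intro ext Bochner_Integration.integral_cong refl)
      (simp add: std_normal_density_def cis_conv_exp scaleR_conv_of_real)
  finally have c: "of_real (1 / sqrt (2 * pi)) * (LINT x|lborel. ?g u x) = complex_of_real (exp (- (u^2) / 2))" for u
    by (subst integral_mult_right_zero[symmetric]) (simp only: char_std_normal_distribution fun_eq_iff)
  have gi: "integrable lborel (?g u)" for u
  proof -
    have "integrable lborel (\<lambda>x. sqrt (2 * pi) * std_normal_density x)" by (intro integrable_mult_right integrable_normal_density) simp
    then have "integrable lborel (\<lambda>x::real. exp (- (x\<^sup>2 / 2)))" by (simp add: std_normal_density_def)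
    then show ?thesis by (rule Bochner_Integration.integrable_bound) (auto simp: norm_mult intro!: borel_measurable_continuous_onI continuous_intros)
  qed
  have g: "(LINT x|lborel. ?g u x) = of_real (sqrt (2 * pi) * exp (- (u^2 / 2)))" for u
  proof -
    have "complex_of_real (sqrt (2 * pi)) * of_real (1 / sqrt (2 * pi)) = 1"
      by (simp flip: of_real_mult)
    then have "(LINT x|lborel. ?g u x) = of_real (sqrt (2 * pi)) * (of_real (1 / sqrt (2 * pi)) * (LINT x|lborel. ?g u x))"
      by (simp only: mult.assoc[symmetric] mult_1_left)
    then show ?thesis unfolding c by simp
  qed
  have eq: "?g (t / a) (0 + a * x) = cis (t * x) * of_real (exp (- ((a * x)\<^sup>2 / 2)))" for x
    using assms by simp
  have "integrable lborel (\<lambda>x. ?g (t / a) (0 + a * x))"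
    by (rule lborel_integrable_real_affine[OF gi]) (use assms in auto)
  then show "integrable lborel (\<lambda>x::real. cis (t * x) * of_real (exp (- ((a * x)\<^sup>2 / 2))))"
    unfolding eq .
  have "(LINT x|lborel. ?g (t / a) x) = \<bar>a\<bar> *\<^sub>R (LINT x|lborel. ?g (t / a) (0 + a * x))"
    by (rule lborel_integral_real_affine) (use assms in auto)
  then have X: "of_real a * (LINT x|lborel. cis (t * x) * of_real (exp (- ((a * x)\<^sup>2 / 2)))) = of_real (sqrt (2 * pi) * exp (- ((t/a)^2 / 2)))"
    unfolding g unfolding eq using assms by (simp only: scaleR_conv_of_real abs_of_pos)
  have "(LINT x|lborel. cis (t * x) * of_real (exp (- ((a * x)\<^sup>2 / 2)))) = of_real a * (LINT x|lborel. cis (t * x) * of_real (exp (- ((a * x)\<^sup>2 / 2)))) / of_real a"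
    using assms by simp
  also have "\<dots> = of_real (sqrt (2 * pi) / a * exp (- ((t / a)\<^sup>2 / 2)))"
    unfolding X by simp
  finally show "(LINT x|lborel. cis (t * x) * of_real (exp (- ((a * x)\<^sup>2 / 2)))) = of_real (sqrt (2 * pi) / a * exp (- ((t / a)\<^sup>2 / 2)))" .
qed

lemma norm_power2_Basis: "(norm (x::'a::euclidean_space))\<^sup>2 = (\<Sum>b\<in>Basis. (x \<bullet> b)\<^sup>2)"
  by (subst power2_norm_eq_inner, subst euclidean_inner) (simp add: power2_eq_square)

lemma gaussian_fourier:
  assumes "a > 0"
  shows "integrable lborel (\<lambda>x::'a::euclidean_space. cis (x \<bullet> \<xi>) * of_real (exp (- ((a * norm x)\<^sup>2 / 2))))" (is ?i)
    and "(LINT x|lborel. cis (x \<bullet> \<xi>) * of_real (exp (- ((a * norm (x::'a))\<^sup>2 / 2)))) = of_real ((sqrt (2 * pi) / a) ^ DIM('a) * exp (- ((norm \<xi> / a)\<^sup>2 / 2)))" (is ?e)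
proof -
  let ?f = "\<lambda>b x. cis ((\<xi> \<bullet> b) * x) * complex_of_real (exp (- ((a * x)\<^sup>2 / 2)))"
  have cis_sum: "cis (sum g A) = (\<Prod>b\<in>A. cis (g b))" if "finite A" for g :: "'a \<Rightarrow> real" and A
    using that by (induction A rule: finite_induct) (auto simp flip: cis_mult)
  have e: "cis (x \<bullet> \<xi>) * of_real (exp (- ((a * norm x)\<^sup>2 / 2))) = (\<Prod>b\<in>Basis. ?f b (x \<bullet> b))" for x :: 'a
  proof -
    have "- ((a * norm x)\<^sup>2 / 2) = (\<Sum>b\<in>Basis. - ((a * (x \<bullet> b))\<^sup>2 / 2))"
      by (simp add: power_mult_distrib norm_power2_Basis sum_distrib_left sum_divide_distrib sum_negf)
    then have 1: "complex_of_real (exp (- ((a * norm x)\<^sup>2 / 2))) = (\<Prod>b\<in>Basis. complex_of_real (exp (- ((a * (x \<bullet> b))\<^sup>2 / 2))))"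
      by (simp add: exp_sum)
    have 2: "cis (x \<bullet> \<xi>) = (\<Prod>b\<in>Basis. cis ((\<xi> \<bullet> b) * (x \<bullet> b)))"
      by (subst euclidean_inner) (simp add: cis_sum mult.commute)
    show ?thesis unfolding 1 2 by (simp add: prod.distrib)
  qed
  show ?i unfolding e by (rule integrable_prod_Basis) (use gaussian_fourier_real[OF assms] in auto)
  have "(LINT x|lborel. (\<Prod>b\<in>Basis. ?f b ((x::'a) \<bullet> b))) = (\<Prod>b\<in>Basis. LINT y|lborel. ?f b y)"
    by (rule integrable_prod_Basis) (use gaussian_fourier_real[OF assms] in auto)
  also have "\<dots> = (\<Prod>b\<in>(Basis::'a set). of_real (sqrt (2 * pi) / a * exp (- (((\<xi> \<bullet> b) / a)\<^sup>2 / 2))))"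
    by (intro prod.cong refl gaussian_fourier_real assms)
  also have "\<dots> = of_real ((sqrt (2 * pi) / a) ^ DIM('a) * exp (\<Sum>b\<in>Basis. - (((\<xi> \<bullet> b) / a)\<^sup>2 / 2)))"
    by (simp add: prod.distrib exp_sum prod_dividef power_divide)
  also have "(\<Sum>b\<in>Basis. - (((\<xi> \<bullet> b) / a)\<^sup>2 / 2)) = - ((norm \<xi> / a)\<^sup>2 / 2)"
    by (simp add: power_divide norm_power2_Basis sum_divide_distrib sum_negf)
  finally show ?e unfolding e .
qed

lemma gaussian_integral:
  assumes "a > 0"
  shows "integrable lborel (\<lambda>x::'a::euclidean_space. exp (- ((a * norm x)\<^sup>2 / 2)))"
    and "(LINT x|lborel. exp (- ((a * norm (x::'a))\<^sup>2 / 2))) = (sqrt (2 * pi) / a) ^ DIM('a)"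
proof -
  have i: "integrable lborel (\<lambda>x::'a. complex_of_real (exp (- ((a * norm x)\<^sup>2 / 2))))"
    using gaussian_fourier(1)[OF assms, of 0] by simp
  then show "integrable lborel (\<lambda>x::'a. exp (- ((a * norm x)\<^sup>2 / 2)))"
    by (simp only: complex_of_real_integrable_eq)
  have "complex_of_real (LINT x|lborel. exp (- ((a * norm (x::'a))\<^sup>2 / 2))) = of_real ((sqrt (2 * pi) / a) ^ DIM('a))"
    using gaussian_fourier(2)[OF assms, of "0::'a"] by simp
  then show "(LINT x|lborel. exp (- ((a * norm (x::'a))\<^sup>2 / 2))) = (sqrt (2 * pi) / a) ^ DIM('a)"
    by (simp only: of_real_eq_iff)
qed

subsection \<open>The Fourier transform\<close>

definition FT :: "('a::euclidean_space \<Rightarrow> complex) \<Rightarrow> 'a \<Rightarrow> complex" where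
  "FT h \<xi> = (LINT x|lborel. cis (- (x \<bullet> \<xi>)) * h x)"

lemma continuous_cis: "continuous_on A f \<Longrightarrow> continuous_on A (\<lambda>x. cis (f x))"
  unfolding cis_conv_exp by (intro continuous_intros)

lemma borel_measurable_cis[measurable (raw)]:
  "f \<in> borel_measurable M \<Longrightarrow> (\<lambda>x. cis (f x)) \<in> borel_measurable M"
  by (rule borel_measurable_continuous_on[OF continuous_cis[OF continuous_on_id]])

lemma borel_measurable_cnj[measurable (raw)]:
  "f \<in> borel_measurable M \<Longrightarrow> (\<lambda>x. cnj (f x)) \<in> borel_measurable M"
  by (rule borel_measurable_continuous_on[OF continuous_on_cnj[OF continuous_on_id]])

lemma integrable_cis_mult:
  assumes "integrable lborel h"
  shows "integrable lborel (\<lambda>x::'a::euclidean_space. cis (x \<bullet> \<xi>) * h x)"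
    and "integrable lborel (\<lambda>x::'a. cis (- (x \<bullet> \<xi>)) * h x)"
  using assms by (auto intro!: Bochner_Integration.integrable_bound[OF assms] AE_I2 simp: norm_mult)

lemma borel_measurable_FT[measurable]:
  assumes [measurable]: "h \<in> borel_measurable borel"
  shows "FT h \<in> borel_measurable borel"
proof -
  have "(\<lambda>\<xi>. LINT x|lborel. cis (- (x \<bullet> \<xi>)) * h x) \<in> borel_measurable lborel"
    by (rule lborel.borel_measurable_lebesgue_integral) (auto simp: split_beta' intro!: borel_measurable_times borel_measurable_cis)
  then show ?thesis by (simp add: FT_def[abs_def])
qed

lemma lborel_distr_reflect: "distr lborel borel (\<lambda>x. t - x) = (lborel :: 'a::euclidean_space measure)"
  using lborel_affine[of "-1" t] by (simp add: density_1 flip: one_ennreal_def)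

lemma lborel_distr_translate: "distr lborel borel (\<lambda>x. t + x) = (lborel :: 'a::euclidean_space measure)"
  using lborel_affine[of 1 t] by (simp add: density_1 flip: one_ennreal_def)

lemma
  fixes f :: "'a::euclidean_space \<Rightarrow> 'b::{banach,second_countable_topology}"
  assumes [measurable]: "f \<in> borel_measurable borel"
  shows integral_lborel_reflect: "(LINT x|lborel. f (t - x)) = (LINT x|lborel. f x)"
    and integrable_lborel_reflect: "integrable lborel (\<lambda>x. f (t - x)) \<longleftrightarrow> integrable lborel f"
    and integral_lborel_translate: "(LINT x|lborel. f (t + x)) = (LINT x|lborel. f x)"
    and integrable_lborel_translate: "integrable lborel (\<lambda>x. f (t + x)) \<longleftrightarrow> integrable lborel f"
proof -
  show "(LINT x|lborel. f (t - x)) = (LINT x|lborel. f x)"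
    by (subst (2) lborel_distr_reflect[of t, symmetric], subst integral_distr) measurable
  show "integrable lborel (\<lambda>x. f (t - x)) \<longleftrightarrow> integrable lborel f"
    by (subst (2) lborel_distr_reflect[of t, symmetric], subst integrable_distr_eq) measurable
  show "(LINT x|lborel. f (t + x)) = (LINT x|lborel. f x)"
    by (subst (2) lborel_distr_translate[of t, symmetric], subst integral_distr) measurable
  show "integrable lborel (\<lambda>x. f (t + x)) \<longleftrightarrow> integrable lborel f"
    by (subst (2) lborel_distr_translate[of t, symmetric], subst integrable_distr_eq) measurable
qed

lemma nn_integral_lborel_reflect:
  assumes [measurable]: "f \<in> borel_measurable (borel :: 'a::euclidean_space measure)"
  shows "(\<integral>\<^sup>+ x. f (t - x) \<partial>lborel) = (\<integral>\<^sup>+ x. f x \<partial>lborel)"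
  by (subst (2) lborel_distr_reflect[of t, symmetric], subst nn_integral_distr) measurable

lemma nn_integral_lborel_translate:
  assumes [measurable]: "f \<in> borel_measurable (borel :: 'a::euclidean_space measure)"
  shows "(\<integral>\<^sup>+ x. f (t + x) \<partial>lborel) = (\<integral>\<^sup>+ x. f x \<partial>lborel)"
  by (subst (2) lborel_distr_translate[of t, symmetric], subst nn_integral_distr) measurable

text \<open>Testing against a Gaussian turns the square of the transform into a convolution with an
  approximate identity of total mass \<open>(2\<pi>)\<^sup>d\<close>.\<close>

lemma bessel_gaussian:
  fixes h :: "'a::euclidean_space \<Rightarrow> complex"
  assumes h: "integrable lborel h" and h2: "integrable lborel (\<lambda>x. (norm (h x))\<^sup>2)" and a: "a > 0"
  shows "(\<integral>\<^sup>+ \<xi>. ennreal ((norm (FT h \<xi>))\<^sup>2 * exp (- ((a * norm \<xi>)\<^sup>2 / 2))) \<partial>lborel)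
     \<le> ennreal ((2 * pi) ^ DIM('a) * (LINT x|lborel. (norm (h x))\<^sup>2))"
proof -
  let ?g = "\<lambda>\<xi>::'a. exp (- ((a * norm \<xi>)\<^sup>2 / 2))"
  let ?K = "\<lambda>x::'a. (sqrt (2 * pi) / a) ^ DIM('a) * exp (- ((norm x / a)\<^sup>2 / 2))"
  have hm[measurable]: "h \<in> borel_measurable borel" using h by auto
  have nh: "integrable lborel (\<lambda>x. norm (h x))" using h by auto
  have gi: "integrable lborel ?g" by (rule gaussian_integral[OF a])
  let ?p = "\<lambda>(x::'a, y::'a). h x * cnj (h y)"
  have pm[measurable]: "?p \<in> borel_measurable borel"
    unfolding borel_prod[symmetric] by measurable
  have pint: "integrable lborel (\<lambda>(x::'a, y::'a). norm (h x) * norm (h y))"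
    using integrable_pair_mult[OF nh nh] by (simp add: lborel_prod)
  \<comment> \<open>The squared modulus becomes a single integral over pairs (x, y), so that after
    multiplication by the Gaussian the frequency integral can be carried out first.\<close>
  have sq: "complex_of_real ((norm (FT h \<xi>))\<^sup>2) = (LINT z|lborel. cis (- ((fst z - snd z) \<bullet> \<xi>)) * ?p z)" for \<xi>
  proof -
    have "complex_of_real ((norm (FT h \<xi>))\<^sup>2) = FT h \<xi> * cnj (FT h \<xi>)"
      by (rule complex_norm_square)
    also have "\<dots> = (LINT x|lborel. LINT y|lborel. cis (- ((x - y) \<bullet> \<xi>)) * (h x * cnj (h y)))"
    proof -
      have "cnj (FT h \<xi>) = (LINT y|lborel. cis (y \<bullet> \<xi>) * cnj (h y))"
        unfolding FT_def by (subst Bochner_Integration.integral_cnj[symmetric]) (simp add: cis_cnj)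
      moreover have "cis (- ((x - y) \<bullet> \<xi>)) * (h x * cnj (h y)) = (cis (- (x \<bullet> \<xi>)) * h x) * (cis (y \<bullet> \<xi>) * cnj (h y))" for x y
      proof -
        have "cis (- ((x - y) \<bullet> \<xi>)) = cis (- (x \<bullet> \<xi>)) * cis (y \<bullet> \<xi>)"
          by (simp add: inner_diff_left cis_mult)
        then show ?thesis by simp
      qed
      ultimately show ?thesis
        by (simp only: integral_mult_right_zero) (simp only: FT_def integral_mult_left_zero)
    qed
    also have "\<dots> = (LINT z|(lborel \<Otimes>\<^sub>M lborel). (case z of (x, y) \<Rightarrow> cis (- ((x - y) \<bullet> \<xi>)) * (h x * cnj (h y))))"
      using lborel_pair.integral_fst'[OF integrable_pair_bound[OF nh nh, of "\<lambda>(x, y). cis (- ((x - y) \<bullet> \<xi>)) * (h x * cnj (h y))"]]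
      by (simp add: norm_mult borel_prod[symmetric])
    finally show ?thesis by (simp add: lborel_prod split_beta)
  qed
  let ?k = "\<lambda>(\<xi>, z). cis (- ((fst z - snd z) \<bullet> \<xi>)) * of_real (?g \<xi>) * ?p z"
  have ki: "integrable (lborel \<Otimes>\<^sub>M lborel) ?k"
    by (rule integrable_pair_bound[OF gi pint]) (auto simp: norm_mult borel_prod[symmetric] split_beta)
  have Kint: "integrable lborel ?K"
    using gaussian_integral(1)[of "1/a", where 'a='a] a by (intro integrable_mult_right) simp
  have KI: "(LINT x|lborel. ?K x) = (2 * pi) ^ DIM('a)"
  proof -
    have "(LINT x|lborel. ?K x) = (sqrt (2 * pi) / a) ^ DIM('a) * (sqrt (2 * pi) / (1 / a)) ^ DIM('a)"
      using gaussian_integral(2)[of "1/a", where 'a='a] a by simp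
    also have "\<dots> = ((sqrt (2 * pi) / a) * (sqrt (2 * pi) / (1 / a))) ^ DIM('a)"
      by (rule power_mult_distrib[symmetric])
    also have "(sqrt (2 * pi) / a) * (sqrt (2 * pi) / (1 / a)) = 2 * pi"
      using a by simp
    finally show ?thesis .
  qed
  have "complex_of_real (LINT \<xi>|lborel. (norm (FT h \<xi>))\<^sup>2 * ?g \<xi>) = (LINT \<xi>|lborel. LINT z|lborel. ?k (\<xi>, z))"
    unfolding integral_complex_of_real[symmetric]
  proof (intro Bochner_Integration.integral_cong refl)
    fix \<xi>
    have "complex_of_real ((norm (FT h \<xi>))\<^sup>2 * ?g \<xi>) = (LINT z|lborel. cis (- ((fst z - snd z) \<bullet> \<xi>)) * ?p z) * of_real (?g \<xi>)"
      by (simp only: of_real_mult sq)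
    also have "\<dots> = (LINT z|lborel. cis (- ((fst z - snd z) \<bullet> \<xi>)) * ?p z * of_real (?g \<xi>))"
      by (rule integral_mult_left_zero[symmetric])
    also have "\<dots> = (LINT z|lborel. ?k (\<xi>, z))"
      by (intro Bochner_Integration.integral_cong refl) (simp add: mult_ac)
    finally show "complex_of_real ((norm (FT h \<xi>))\<^sup>2 * ?g \<xi>) = (LINT z|lborel. ?k (\<xi>, z))" .
  qed
  also have "\<dots> = (LINT z|lborel. LINT \<xi>|lborel. ?k (\<xi>, z))"
    using lborel_pair.Fubini_integral[of "\<lambda>\<xi> z. ?k (\<xi>, z)"] ki by simp
  also have "\<dots> = (LINT z|lborel. ?p z * of_real (?K (fst z - snd z)))"
  proof (intro Bochner_Integration.integral_cong refl)
    fix z :: "'a \<times> 'a"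
    have "(LINT \<xi>|lborel. ?k (\<xi>, z)) = ?p z * (LINT \<xi>|lborel. cis (\<xi> \<bullet> (snd z - fst z)) * of_real (?g \<xi>))"
      by (subst integral_mult_right_zero[symmetric]) (simp add: inner_commute inner_diff_left inner_diff_right mult_ac)
    then show "(LINT \<xi>|lborel. ?k (\<xi>, z)) = ?p z * of_real (?K (fst z - snd z))"
      by (simp only: gaussian_fourier(2)[OF a]) (simp only: norm_minus_commute)
  qed
  finally have eq: "complex_of_real (LINT \<xi>|lborel. (norm (FT h \<xi>))\<^sup>2 * ?g \<xi>) = (LINT z|lborel. ?p z * of_real (?K (fst z - snd z)))" .
  have "\<bar>LINT \<xi>|lborel. (norm (FT h \<xi>))\<^sup>2 * ?g \<xi>\<bar> = norm (LINT z|lborel. ?p z * of_real (?K (fst z - snd z)))"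
    unfolding eq[symmetric] by (simp only: norm_of_real)
  also have "\<dots> \<le> (LINT z|lborel. norm (h (fst z)) * norm (h (snd z)) * ?K (fst z - snd z))"
    by (rule order_trans[OF integral_norm_bound]) (use a in \<open>auto simp: norm_mult split_beta norm_power norm_divide intro!: Bochner_Integration.integral_mono\<close>)
  finally have 1: "\<bar>LINT \<xi>|lborel. (norm (FT h \<xi>))\<^sup>2 * ?g \<xi>\<bar>
      \<le> (LINT z|lborel. norm (h (fst z)) * norm (h (snd z)) * ?K (fst z - snd z))" .
  have K0: "?K x \<ge> 0" for x using a by simp
  have Km[measurable]: "?K \<in> borel_measurable borel" by measurable
  have Knn: "(\<integral>\<^sup>+ x. ennreal (?K x) \<partial>lborel) = ennreal ((2 * pi) ^ DIM('a))"
    by (simp only: nn_integral_eq_integral[OF Kint AE_I2[OF K0]] KI)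
  have hnn: "(\<integral>\<^sup>+ x. ennreal ((norm (h x))\<^sup>2) \<partial>lborel) = ennreal (LINT x|lborel. (norm (h x))\<^sup>2)"
    using h2 by (subst nn_integral_eq_integral) auto
  have intK: "integrable lborel (\<lambda>z. norm (h (fst z)) * norm (h (snd z)) * ?K (fst z - snd z))"
  proof (rule Bochner_Integration.integrable_bound[OF integrable_mult_right[OF pint, of "(sqrt (2 * pi) / a) ^ DIM('a)"]])
    show "(\<lambda>z. norm (h (fst z)) * norm (h (snd z)) * ?K (fst z - snd z)) \<in> borel_measurable lborel"
      by (simp add: borel_prod[symmetric])
    have "norm (h x) * norm (h y) * ?K (x - y) \<le> norm (h x) * norm (h y) * (sqrt (2 * pi) / a) ^ DIM('a)" for x y
      using a by (intro mult_left_mono) auto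
    then show "AE z in lborel. norm (norm (h (fst z)) * norm (h (snd z)) * ?K (fst z - snd z))
         \<le> norm ((sqrt (2 * pi) / a) ^ DIM('a) * (case z of (x, y) \<Rightarrow> norm (h x) * norm (h y)))"
      using a by (intro AE_I2) (auto simp: split_beta abs_mult mult_ac)
  qed
  have A: "(\<integral>\<^sup>+ z. ennreal ((norm (h (fst z)))\<^sup>2 * ?K (fst z - snd z)) \<partial>lborel) = ennreal (LINT x|lborel. (norm (h x))\<^sup>2) * ennreal ((2 * pi) ^ DIM('a))"
  proof -
    have "(\<integral>\<^sup>+ z. ennreal ((norm (h (fst z)))\<^sup>2 * ?K (fst z - snd z)) \<partial>lborel)
        = (\<integral>\<^sup>+ x. \<integral>\<^sup>+ y. ennreal ((norm (h x))\<^sup>2 * ?K (x - y)) \<partial>lborel \<partial>lborel)"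
      by (subst lborel_prod[symmetric], subst lborel.nn_integral_fst[symmetric]) simp_all
    also have "\<dots> = (\<integral>\<^sup>+ x. ennreal ((norm (h x))\<^sup>2) * ennreal ((2 * pi) ^ DIM('a)) \<partial>lborel)"
    proof (intro nn_integral_cong)
      fix x
      have "(\<integral>\<^sup>+ y. ennreal ((norm (h x))\<^sup>2 * ?K (x - y)) \<partial>lborel) = ennreal ((norm (h x))\<^sup>2) * (\<integral>\<^sup>+ y. ennreal (?K (x - y)) \<partial>lborel)"
        using K0 by (simp only: ennreal_mult zero_le_power2) (simp add: nn_integral_cmult)
      then show "(\<integral>\<^sup>+ y. ennreal ((norm (h x))\<^sup>2 * ?K (x - y)) \<partial>lborel) = ennreal ((norm (h x))\<^sup>2) * ennreal ((2 * pi) ^ DIM('a))"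
        by (simp only: nn_integral_lborel_reflect[of "\<lambda>y. ennreal (?K y)"] Knn) (simp add: nn_integral_lborel_reflect[of "\<lambda>y. ennreal (?K y)"] Knn)
    qed
    finally show ?thesis by (simp add: nn_integral_multc hnn)
  qed
  have B: "(\<integral>\<^sup>+ z. ennreal ((norm (h (snd z)))\<^sup>2 * ?K (fst z - snd z)) \<partial>lborel) = ennreal (LINT x|lborel. (norm (h x))\<^sup>2) * ennreal ((2 * pi) ^ DIM('a))"
  proof -
    have "(\<integral>\<^sup>+ z. ennreal ((norm (h (snd z)))\<^sup>2 * ?K (fst z - snd z)) \<partial>lborel)
        = (\<integral>\<^sup>+ y. \<integral>\<^sup>+ x. ennreal ((norm (h y))\<^sup>2 * ?K (- y + x)) \<partial>lborel \<partial>lborel)"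
      by (subst lborel_prod[symmetric], subst lborel_pair.nn_integral_snd[symmetric]) simp_all
    also have "\<dots> = (\<integral>\<^sup>+ x. ennreal ((norm (h x))\<^sup>2) * ennreal ((2 * pi) ^ DIM('a)) \<partial>lborel)"
    proof (intro nn_integral_cong)
      fix x
      have "(\<integral>\<^sup>+ y. ennreal ((norm (h x))\<^sup>2 * ?K (- x + y)) \<partial>lborel) = ennreal ((norm (h x))\<^sup>2) * (\<integral>\<^sup>+ y. ennreal (?K (- x + y)) \<partial>lborel)"
        using K0 by (simp only: ennreal_mult zero_le_power2) (simp add: nn_integral_cmult)
      then show "(\<integral>\<^sup>+ y. ennreal ((norm (h x))\<^sup>2 * ?K (- x + y)) \<partial>lborel) = ennreal ((norm (h x))\<^sup>2) * ennreal ((2 * pi) ^ DIM('a))"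
        by (simp add: nn_integral_lborel_translate[of "\<lambda>y. ennreal (?K y)"] Knn del: uminus_add_conv_diff)
    qed
    finally show ?thesis by (simp add: nn_integral_multc hnn)
  qed
  let ?I = "LINT x|lborel. (norm (h x))\<^sup>2"
  have "ennreal (LINT z|lborel. norm (h (fst z)) * norm (h (snd z)) * ?K (fst z - snd z))
      = (\<integral>\<^sup>+ z. ennreal (norm (h (fst z)) * norm (h (snd z)) * ?K (fst z - snd z)) \<partial>lborel)"
    using intK K0 by (subst nn_integral_eq_integral) (auto intro!: AE_I2 mult_nonneg_nonneg)
  \<comment> \<open>A Schur test: 2ab \<le> a^2 + b^2 leaves the square of h in one variable, and
    integrating the Gaussian kernel over the other variable gives (2 pi)^d in both cases.\<close>
  also have "\<dots> \<le> (\<integral>\<^sup>+ z. ennreal (1/2) * (ennreal ((norm (h (fst z)))\<^sup>2 * ?K (fst z - snd z)) + ennreal ((norm (h (snd z)))\<^sup>2 * ?K (fst z - snd z))) \<partial>lborel)"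
  proof (intro nn_integral_mono)
    fix z :: "'a \<times> 'a"
    have "norm (h (fst z)) * norm (h (snd z)) \<le> 1/2 * ((norm (h (fst z)))\<^sup>2 + (norm (h (snd z)))\<^sup>2)"
      using sum_squares_bound[of "norm (h (fst z))" "norm (h (snd z))"] by simp
    then have "norm (h (fst z)) * norm (h (snd z)) * ?K (fst z - snd z) \<le> 1/2 * ((norm (h (fst z)))\<^sup>2 + (norm (h (snd z)))\<^sup>2) * ?K (fst z - snd z)"
      by (rule mult_right_mono[OF _ K0])
    also have "\<dots> = 1/2 * ((norm (h (fst z)))\<^sup>2 * ?K (fst z - snd z) + (norm (h (snd z)))\<^sup>2 * ?K (fst z - snd z))"
      by (simp only: distrib_right distrib_left mult.assoc)
    finally show "ennreal (norm (h (fst z)) * norm (h (snd z)) * ?K (fst z - snd z))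
      \<le> ennreal (1/2) * (ennreal ((norm (h (fst z)))\<^sup>2 * ?K (fst z - snd z)) + ennreal ((norm (h (snd z)))\<^sup>2 * ?K (fst z - snd z)))"
      using K0 by (subst ennreal_plus[symmetric], simp, simp, subst ennreal_mult[symmetric]) (auto intro!: ennreal_leI add_nonneg_nonneg)
  qed
  also have "\<dots> = ennreal (1/2) * (ennreal ?I * ennreal ((2 * pi) ^ DIM('a)) + ennreal ?I * ennreal ((2 * pi) ^ DIM('a)))"
  proof -
    have "(\<lambda>z. ennreal ((norm (h (fst z)))\<^sup>2 * ?K (fst z - snd z))) \<in> borel_measurable lborel"
      "(\<lambda>z. ennreal ((norm (h (snd z)))\<^sup>2 * ?K (fst z - snd z))) \<in> borel_measurable lborel"
      by (simp_all add: borel_prod[symmetric])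
    then show ?thesis by (simp only: nn_integral_cmult nn_integral_add A B borel_measurable_add)
  qed
  also have "\<dots> = ennreal (1/2 * (?I * (2 * pi) ^ DIM('a) + ?I * (2 * pi) ^ DIM('a)))"
  proof -
    have I: "?I \<ge> 0" by simp
    have m: "ennreal ?I * ennreal ((2 * pi) ^ DIM('a)) = ennreal (?I * (2 * pi) ^ DIM('a))"
      by (rule ennreal_mult[symmetric, OF I]) simp
    have J: "?I * (2 * pi) ^ DIM('a) \<ge> 0" using I by (intro mult_nonneg_nonneg) auto
    have h: "(0::real) \<le> 1 / 2" by simp
    show ?thesis unfolding m ennreal_plus[OF J J, symmetric]
      by (rule ennreal_mult[symmetric, OF h add_nonneg_nonneg[OF J J]])
  qed
  also have "1/2 * (?I * (2 * pi) ^ DIM('a) + ?I * (2 * pi) ^ DIM('a)) = (2 * pi) ^ DIM('a) * ?I"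
    by simp
  finally have 2: "ennreal (LINT z|lborel. norm (h (fst z)) * norm (h (snd z)) * ?K (fst z - snd z)) \<le> ennreal ((2 * pi) ^ DIM('a) * ?I)" .
  have "(\<integral>\<^sup>+ \<xi>. ennreal ((norm (FT h \<xi>))\<^sup>2 * ?g \<xi>) \<partial>lborel) = ennreal (LINT \<xi>|lborel. (norm (FT h \<xi>))\<^sup>2 * ?g \<xi>)"
  proof (rule nn_integral_eq_integral)
    have b: "norm (FT h \<xi>) \<le> (LINT x|lborel. norm (h x))" for \<xi>
      unfolding FT_def by (rule order_trans[OF integral_norm_bound]) (simp add: norm_mult)
    show "integrable lborel (\<lambda>\<xi>. (norm (FT h \<xi>))\<^sup>2 * ?g \<xi>)"
      by (rule Bochner_Integration.integrable_bound[OF integrable_mult_right[OF gi, of "(LINT x|lborel. norm (h x))\<^sup>2"]])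
        (auto intro!: AE_I2 mult_right_mono power_mono b)
  qed auto
  also have "\<dots> \<le> ennreal (LINT z|lborel. norm (h (fst z)) * norm (h (snd z)) * ?K (fst z - snd z))"
    using 1 by (intro ennreal_leI) linarith
  finally show ?thesis using 2 by (rule order_trans)
qed

text \<open>Fatou's lemma removes the Gaussian factor of \<open>bessel_gaussian\<close> along a =
  1/(k+1), since its bound does not depend on a.\<close>

lemma bessel_inequality:
  fixes h :: "'a::euclidean_space \<Rightarrow> complex"
  assumes h: "integrable lborel h" and h2: "integrable lborel (\<lambda>x. (norm (h x))\<^sup>2)"
  shows "(\<integral>\<^sup>+ \<xi>. ennreal ((norm (FT h \<xi>))\<^sup>2) \<partial>lborel)
     \<le> ennreal ((2 * pi) ^ DIM('a) * (LINT x|lborel. (norm (h x))\<^sup>2))"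
proof -
  have [measurable]: "h \<in> borel_measurable borel" using h by auto
  let ?f = "\<lambda>k \<xi>. ennreal ((norm (FT h \<xi>))\<^sup>2 * exp (- ((inverse (real (Suc k)) * norm \<xi>)\<^sup>2 / 2)))"
  have "(\<lambda>k. ?f k \<xi>) \<longlonglongrightarrow> ennreal ((norm (FT h \<xi>))\<^sup>2 * exp (- ((0 * norm \<xi>)\<^sup>2 / 2)))" for \<xi>
    by (intro tendsto_ennrealI tendsto_intros LIMSEQ_inverse_real_of_nat) auto
  then have lim: "ennreal ((norm (FT h \<xi>))\<^sup>2) = liminf (\<lambda>k. ?f k \<xi>)" for \<xi>
    by (intro lim_imp_Liminf[symmetric]) auto
  have "(\<integral>\<^sup>+ \<xi>. liminf (\<lambda>k. ?f k \<xi>) \<partial>lborel) \<le> liminf (\<lambda>k. \<integral>\<^sup>+ \<xi>. ?f k \<xi> \<partial>lborel)"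
    by (rule nn_integral_liminf) measurable
  also have "\<dots> \<le> liminf (\<lambda>k. ennreal ((2 * pi) ^ DIM('a) * (LINT x|lborel. (norm (h x))\<^sup>2)))"
    by (intro Liminf_mono always_eventually allI bessel_gaussian[OF h h2]) auto
  finally show ?thesis unfolding lim[symmetric] by (simp only: Liminf_const[OF sequentially_bot])
qed

lemma integral_lborel_scale:
  fixes f :: "'a::euclidean_space \<Rightarrow> complex"
  assumes [measurable]: "f \<in> borel_measurable borel" and "a > 0"
  shows "(LINT x|lborel. f x) = of_real (a ^ DIM('a)) * (LINT y|lborel. f (t + a *\<^sub>R y))"
proof -
  have "(LINT x|lborel. f x) = (LINT x|density (distr lborel borel (\<lambda>x. t + a *\<^sub>R x)) (\<lambda>_. ennreal (\<bar>a\<bar> ^ DIM('a))). f x)"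
    using lborel_affine[of a t] assms by simp
  also have "\<dots> = (LINT x|distr lborel borel (\<lambda>x. t + a *\<^sub>R x). (a ^ DIM('a)) *\<^sub>R f x)"
    using assms by (subst integral_density) auto
  also have "\<dots> = (LINT y|lborel. (a ^ DIM('a)) *\<^sub>R f (t + a *\<^sub>R y))"
    by (subst integral_distr) auto
  finally show ?thesis by (simp add: scaleR_conv_of_real)
qed

lemma ennreal_le_linear:
  assumes "x \<le> m * p + k * q" "0 \<le> p" "0 \<le> q" "0 \<le> k" "0 \<le> m"
  shows "ennreal x \<le> ennreal m * ennreal p + ennreal k * ennreal q"
proof -
  have "ennreal x \<le> ennreal (m * p + k * q)" using assms(1) by (rule ennreal_leI)
  also have "\<dots> = ennreal (m * p) + ennreal (k * q)" using assms by (intro ennreal_plus mult_nonneg_nonneg)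
  also have "\<dots> = ennreal m * ennreal p + ennreal k * ennreal q" using assms by (simp only: ennreal_mult)
  finally show ?thesis .
qed

lemma fourier_trunc_eq_FT: "fourier_trunc R f = FT (\<lambda>x. of_real (indicator (cball 0 R) x * f x))"
  by (auto simp: fun_eq_iff fourier_trunc_def FT_def set_lebesgue_integral_def cis_conv_exp scaleR_conv_of_real
      mult_ac intro!: Bochner_Integration.integral_cong)

text \<open>Comparison with the Gaussian cut-off \<open>f \<gamma>\<^sub>a\<close>, \<open>a = 1/R\<close>, whose transform is an explicit
  mollification of \<open>G\<close>.\<close>

lemma is_fourier_synthesis:
  fixes f :: "'a::euclidean_space \<Rightarrow> real" and G :: "'a \<Rightarrow> complex"
  assumes contG: "continuous_on UNIV G" and r: "r > 0"
    and dec: "\<And>\<xi>. norm (G \<xi>) \<le> C * exp (- (r * norm \<xi>))"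
    and f: "\<And>x. complex_of_real (f x) = (LINT \<xi>|lborel. cis (x \<bullet> \<xi>) * G \<xi>)"
  shows "square_integrable f" and "is_fourier f (\<lambda>\<xi>. of_real ((2 * pi) ^ DIM('a)) * G \<xi>)"
proof -
  define c where "c = (2 * pi) ^ DIM('a)"
  have c0: "c > 0" by (simp add: c_def)
  have C0: "C \<ge> 0" using order_trans[OF norm_ge_zero dec[of 0]] by simp
  have Gm[measurable]: "G \<in> borel_measurable borel" using contG by (rule borel_measurable_continuous_onI)
  have Gi: "integrable lborel G" by (rule integrable_exp_bound[OF Gm r dec])
  have dec2: "norm ((norm (G \<xi>))\<^sup>2) \<le> C\<^sup>2 * exp (- (2 * r * norm \<xi>))" for \<xi>
  proof -
    have "(norm (G \<xi>))\<^sup>2 \<le> (C * exp (- (r * norm \<xi>)))\<^sup>2" by (intro power_mono dec) auto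
    then show ?thesis by (simp add: power_mult_distrib flip: exp_double) (simp add: mult.assoc)
  qed
  have G2i: "integrable lborel (\<lambda>\<xi>. (norm (G \<xi>))\<^sup>2)"
    by (rule integrable_exp_bound[OF _ _ dec2]) (use r in auto)
  have fFT: "complex_of_real (f x) = FT G (0 - x)" for x
    by (simp add: f FT_def inner_commute)
  have [measurable]: "(\<lambda>x. FT G (0 - x)) \<in> borel_measurable borel" by measurable
  have fRe: "f = (\<lambda>x. Re (FT G (0 - x)))" using fFT by (metis Re_complex_of_real)
  have fm[measurable]: "f \<in> borel_measurable borel" unfolding fRe by measurable
  have nf: "\<bar>f x\<bar> = norm (FT G (0 - x))" for x using fFT by (metis norm_of_real)
  have fM: "\<bar>f x\<bar> \<le> (LINT \<xi>|lborel. norm (G \<xi>))" for x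
    unfolding nf FT_def by (rule order_trans[OF integral_norm_bound]) (simp add: norm_mult)
  have f2i: "integrable lborel (\<lambda>x. (f x)\<^sup>2)"
  proof (rule integrableI_bounded)
    have "(\<integral>\<^sup>+ x. ennreal (norm ((f x)\<^sup>2)) \<partial>lborel) = (\<integral>\<^sup>+ x. ennreal ((norm (FT G (0 - x)))\<^sup>2) \<partial>lborel)"
      by (simp only: nf[symmetric] power2_abs real_norm_def abs_power2)
    also have "\<dots> = (\<integral>\<^sup>+ x. ennreal ((norm (FT G x))\<^sup>2) \<partial>lborel)"
      by (rule nn_integral_lborel_reflect) measurable
    also have "\<dots> \<le> ennreal (c * (LINT x|lborel. (norm (G x))\<^sup>2))"
      unfolding c_def by (rule bessel_inequality[OF Gi G2i])
    also have "\<dots> < \<infinity>" by simp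
    finally show "(\<integral>\<^sup>+ x. ennreal (norm ((f x)\<^sup>2)) \<partial>lborel) < \<infinity>" .
  qed auto
  show "square_integrable f" using f2i by (simp add: square_integrable_def)
  \<comment> \<open>\<open>\<gamma> a\<close> is the Gaussian cut-off, \<phi> the standard Gaussian
    density, and \<open>E a\<close> the mean of G over Gaussian displacements of size a. The fact
    \<open>FT\<gamma>\<close> identifies the transform of the cut-off function as c times
    \<open>E a\<close>.\<close>
  define \<gamma> where "\<gamma> a x = exp (- ((a * norm (x::'a))\<^sup>2 / 2))" for a x
  define \<phi> where "\<phi> y = \<gamma> 1 y / sqrt (2 * pi) ^ DIM('a)" for y :: 'a
  define E where "E a \<xi> = (LINT y|lborel. G (\<xi> + a *\<^sub>R y) * of_real (\<phi> y))" for a :: real and \<xi>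
  have \<gamma>m[measurable]: "\<gamma> a \<in> borel_measurable borel" for a unfolding \<gamma>_def by measurable
  have \<phi>m[measurable]: "\<phi> \<in> borel_measurable borel" unfolding \<phi>_def by measurable
  have \<gamma>01: "0 < \<gamma> a x" "\<gamma> a x \<le> 1" for a x by (auto simp: \<gamma>_def)
  have \<phi>0: "\<phi> y \<ge> 0" for y by (simp add: \<phi>_def \<gamma>_def)
  have \<phi>i: "integrable lborel \<phi>" and \<phi>1: "(LINT y|lborel. \<phi> y) = 1"
    using gaussian_integral[of 1, where 'a='a] by (auto simp: \<phi>_def[abs_def] \<gamma>_def)
  \<comment> \<open>This moment lets \<open>E a\<close> inherit the exponential decay of G uniformly
    in a \<le> 1. It is finite by completing the square: r|y| - |y|^2/2 \<le> r^2 - |y|^2/4.\<close>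
  have \<phi>r: "integrable lborel (\<lambda>y. exp (r * norm y) * \<phi> y)"
  proof (rule Bochner_Integration.integrable_bound)
    show "integrable lborel (\<lambda>y::'a. exp (r\<^sup>2) / sqrt (2 * pi) ^ DIM('a) * exp (- ((1 / sqrt 2 * norm y)\<^sup>2 / 2)))"
      by (intro integrable_mult_right gaussian_integral) auto
    show "AE y in lborel. norm (exp (r * norm y) * \<phi> y) \<le> norm (exp (r\<^sup>2) / sqrt (2 * pi) ^ DIM('a) * exp (- ((1 / sqrt 2 * norm y)\<^sup>2 / 2)))"
    proof (rule AE_I2)
      fix y :: 'a
      have "0 \<le> (norm y / 2 - r)\<^sup>2" by simp
      then have "r * norm y - (norm y)\<^sup>2 / 2 \<le> r\<^sup>2 - (norm y)\<^sup>2 / 4"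
        by (simp add: power2_eq_square algebra_simps)
      then have "exp (r * norm y) * exp (- ((norm y)\<^sup>2 / 2)) \<le> exp (r\<^sup>2) * exp (- ((norm y)\<^sup>2 / 4))"
        by (simp flip: exp_add)
      then have "exp (r * norm y) * exp (- ((norm y)\<^sup>2 / 2)) / sqrt (2 * pi) ^ DIM('a) \<le> exp (r\<^sup>2) * exp (- ((norm y)\<^sup>2 / 4)) / sqrt (2 * pi) ^ DIM('a)"
        by (rule divide_right_mono) simp
      then show "norm (exp (r * norm y) * \<phi> y) \<le> norm (exp (r\<^sup>2) / sqrt (2 * pi) ^ DIM('a) * exp (- ((1 / sqrt 2 * norm y)\<^sup>2 / 2)))"
        by (simp add: \<phi>_def \<gamma>_def power_mult_distrib power_divide)
    qed
  qed measurable
  define L where "L = (LINT y|lborel. exp (r * norm y) * \<phi> y)"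
  have L0: "L \<ge> 0" unfolding L_def using \<phi>0 by simp
  have f\<gamma>i: "integrable lborel (\<lambda>x. f x * \<gamma> a x)" if "a > 0" for a
    unfolding \<gamma>_def
    by (rule Bochner_Integration.integrable_bound[OF integrable_mult_right[OF gaussian_integral(1)[OF that], of "LINT \<xi>|lborel. norm (G \<xi>)"]])
      (auto intro!: AE_I2 mult_right_mono fM simp: abs_mult)
  have FT\<gamma>: "FT (\<lambda>x. of_real (f x * \<gamma> a x)) \<xi> = of_real c * E a \<xi>" if a: "a > 0" for a \<xi>
  proof -
    let ?k = "\<lambda>(x, \<eta>). cis (x \<bullet> (\<eta> - \<xi>)) * of_real (\<gamma> a x) * G \<eta>"
    have ki: "integrable (lborel \<Otimes>\<^sub>M lborel) ?k"
      by (rule integrable_pair_bound[OF gaussian_integral(1)[OF a] integrable_norm[OF Gi]])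
         (auto simp: norm_mult borel_prod[symmetric] split_beta \<gamma>_def)
    have "FT (\<lambda>x. of_real (f x * \<gamma> a x)) \<xi> = (LINT x|lborel. LINT \<eta>|lborel. ?k (x, \<eta>))"
      unfolding FT_def
    proof (intro Bochner_Integration.integral_cong refl)
      fix x
      have "cis (x \<bullet> (\<eta> - \<xi>)) * of_real (\<gamma> a x) * G \<eta> = (cis (- (x \<bullet> \<xi>)) * of_real (\<gamma> a x)) * (cis (x \<bullet> \<eta>) * G \<eta>)" for \<eta>
      proof -
        have "cis (x \<bullet> (\<eta> - \<xi>)) = cis (- (x \<bullet> \<xi>)) * cis (x \<bullet> \<eta>)" by (simp add: cis_mult inner_diff_right)
        then show ?thesis by simp
      qed
      then show "cis (- (x \<bullet> \<xi>)) * of_real (f x * \<gamma> a x) = (LINT \<eta>|lborel. ?k (x, \<eta>))"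
        by (simp only: prod.case integral_mult_right_zero f[symmetric] of_real_mult) simp
    qed
    also have "\<dots> = (LINT \<eta>|lborel. LINT x|lborel. ?k (x, \<eta>))"
      using lborel_pair.Fubini_integral[of "\<lambda>x \<eta>. ?k (x, \<eta>)"] ki by simp
    also have "\<dots> = (LINT \<eta>|lborel. of_real ((sqrt (2 * pi) / a) ^ DIM('a) * exp (- ((norm (\<eta> - \<xi>) / a)\<^sup>2 / 2))) * G \<eta>)"
      using gaussian_fourier(2)[OF a, where 'a='a] by (simp add: \<gamma>_def)
    also have "\<dots> = of_real (a ^ DIM('a)) * (LINT y|lborel. of_real ((sqrt (2 * pi) / a) ^ DIM('a) * exp (- ((norm ((\<xi> + a *\<^sub>R y) - \<xi>) / a)\<^sup>2 / 2))) * G (\<xi> + a *\<^sub>R y))"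
      by (rule integral_lborel_scale[OF _ a]) measurable
    also have "\<dots> = (LINT y|lborel. of_real c * (G (\<xi> + a *\<^sub>R y) * of_real (\<phi> y)))"
    proof (subst integral_mult_right_zero[symmetric], intro Bochner_Integration.integral_cong refl)
      fix y :: 'a
      have "a ^ DIM('a) * ((sqrt (2 * pi) / a) ^ DIM('a) * exp (- ((norm ((\<xi> + a *\<^sub>R y) - \<xi>) / a)\<^sup>2 / 2))) = c * \<phi> y"
      proof -
        define q where "q = sqrt (2 * pi) ^ DIM('a)"
        have q: "q > 0" by (simp add: q_def)
        have c: "c = q * q" unfolding c_def q_def power_mult_distrib[symmetric] by simp
        have n: "norm ((\<xi> + a *\<^sub>R y) - \<xi>) / a = norm y" using a by simp
        have \<phi>: "\<phi> y = exp (- ((norm y)\<^sup>2 / 2)) / q" by (simp add: \<phi>_def \<gamma>_def q_def)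
        show ?thesis unfolding n \<phi> c power_divide q_def[symmetric] using a q by simp
      qed
      then show "complex_of_real (a ^ DIM('a)) * (of_real ((sqrt (2 * pi) / a) ^ DIM('a) * exp (- ((norm ((\<xi> + a *\<^sub>R y) - \<xi>) / a)\<^sup>2 / 2))) * G (\<xi> + a *\<^sub>R y)) =
         of_real c * (G (\<xi> + a *\<^sub>R y) * of_real (\<phi> y))"
        by (simp only: mult.assoc[symmetric] of_real_mult[symmetric]) (simp add: mult_ac)
    qed
    finally show ?thesis by (simp add: E_def)
  qed
  have Em[measurable]: "E a \<in> borel_measurable borel" for a
  proof -
    have "E a \<in> borel_measurable lborel"
      unfolding E_def by (rule lborel.borel_measurable_lebesgue_integral) (simp add: borel_prod[symmetric])
    then show ?thesis by simp
  qed
  have Eb: "norm (E a \<xi>) \<le> C * L * exp (- (r * norm \<xi>))" if "0 < a" "a \<le> 1" for a \<xi>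
  proof -
    have b: "norm (G (\<xi> + a *\<^sub>R y) * of_real (\<phi> y)) \<le> (C * exp (- (r * norm \<xi>))) * (exp (r * norm y) * \<phi> y)" for y
    proof -
      have "norm \<xi> \<le> norm (\<xi> + a *\<^sub>R y) + norm (a *\<^sub>R y)" using norm_triangle_ineq4[of "\<xi> + a *\<^sub>R y" "a *\<^sub>R y"] by simp
      also have "norm (a *\<^sub>R y) \<le> 1 * norm y" using that by (simp add: mult_left_le_one_le)
      finally have "r * norm \<xi> \<le> r * (norm (\<xi> + a *\<^sub>R y) + norm y)" using r by (intro mult_left_mono) auto
      then have "exp (- (r * norm (\<xi> + a *\<^sub>R y))) \<le> exp (- (r * norm \<xi>)) * exp (r * norm y)"
        by (simp add: distrib_left flip: exp_add)
      then have "norm (G (\<xi> + a *\<^sub>R y)) \<le> C * (exp (- (r * norm \<xi>)) * exp (r * norm y))"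
        using C0 by (intro order_trans[OF dec] mult_left_mono)
      then have "norm (G (\<xi> + a *\<^sub>R y)) * \<phi> y \<le> C * (exp (- (r * norm \<xi>)) * exp (r * norm y)) * \<phi> y"
        using \<phi>0 by (rule mult_right_mono)
      then show ?thesis using \<phi>0 by (simp add: norm_mult mult_ac)
    qed
    have "norm (E a \<xi>) \<le> (LINT y|lborel. (C * exp (- (r * norm \<xi>))) * (exp (r * norm y) * \<phi> y))"
      unfolding E_def by (rule norm_integral_dominated[OF integrable_mult_right[OF \<phi>r] _ b]) measurable
    then show ?thesis by (simp only: integral_mult_right_zero L_def[symmetric]) (simp only: mult_ac)
  qed
  have main: "(\<lambda>n. \<integral>\<^sup>+ \<xi>. ennreal ((norm (fourier_trunc (X n) f \<xi> - of_real c * G \<xi>))\<^sup>2) \<partial>lborel) \<longlonglongrightarrow> 0"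
    if X: "filterlim X at_top sequentially" for X :: "nat \<Rightarrow> real"
  proof -
    \<comment> \<open>The maximum with 1 keeps \<open>a n\<close> in the interval (0,1], where the
      decay bound \<open>Eb\<close> holds; for large n it is simply 1/X n.\<close>
    define a where "a n = inverse (max 1 (X n))" for n
    have a: "0 < a n" "a n \<le> 1" for n by (auto simp: a_def inverse_le_1_iff)
    have a0: "a \<longlonglongrightarrow> 0"
    proof -
      have "filterlim (\<lambda>n. max 1 (X n)) at_top sequentially"
        by (rule filterlim_at_top_mono[OF X]) auto
      then show ?thesis unfolding a_def by (rule tendsto_inverse_0_at_top)
    qed
    let ?u = "\<lambda>n x. indicator (cball 0 (X n)) x * f x - f x * \<gamma> (a n) x"
    let ?v = "\<lambda>n \<xi>. E (a n) \<xi> - G \<xi>"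
    have u_le: "(?u n x)\<^sup>2 \<le> (f x)\<^sup>2" for n x
    proof -
      have "\<bar>indicator (cball 0 (X n)) x - \<gamma> (a n) x\<bar> \<le> 1"
        using \<gamma>01[of "a n" x] by (auto simp: indicator_def abs_le_iff)
      then have "\<bar>indicator (cball 0 (X n)) x - \<gamma> (a n) x\<bar> * \<bar>f x\<bar> \<le> 1 * \<bar>f x\<bar>" by (intro mult_right_mono) auto
      then have "\<bar>?u n x\<bar> \<le> \<bar>f x\<bar>" by (simp add: algebra_simps flip: abs_mult)
      then show ?thesis by (simp add: abs_le_square_iff)
    qed
    have um0[measurable]: "?u n \<in> borel_measurable borel" for n
      by (intro borel_measurable_diff borel_measurable_times borel_measurable_indicator fm \<gamma>m) auto
    have u2i: "integrable lborel (\<lambda>x. (?u n x)\<^sup>2)" for n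
      by (rule integrable_dominated[OF f2i]) (use u_le in \<open>auto intro!: borel_measurable_power um0\<close>)
    have ui: "integrable lborel (\<lambda>x. complex_of_real (?u n x))" for n
    proof -
      have "integrable lborel (\<lambda>x. indicator (cball 0 (X n)) x * f x)"
      proof (rule integrable_dominated)
        have I: "integrable lborel (indicator (cball 0 (X n)) :: 'a \<Rightarrow> real)"
          by (rule integrable_real_indicator) (use emeasure_compact_finite[of "cball (0::'a) (X n)"] in auto)
        show "integrable lborel (\<lambda>x::'a. indicator (cball 0 (X n)) x * (LINT \<xi>|lborel. norm (G \<xi>)) :: real)"
          by (rule integrable_mult_left) (rule I)
        show "norm (indicator (cball 0 (X n)) x * f x) \<le> indicator (cball 0 (X n)) x * (LINT \<xi>|lborel. norm (G \<xi>))" for x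
          using fM[of x] by (auto simp: indicator_def)
      qed (intro borel_measurable_times borel_measurable_indicator, use fm in auto)
      then show ?thesis using f\<gamma>i[OF a(1)] by (simp only: complex_of_real_integrable_eq) auto
    qed
    have U: "(\<lambda>n. \<integral>\<^sup>+ x. ennreal ((?u n x)\<^sup>2) \<partial>lborel) \<longlonglongrightarrow> (\<integral>\<^sup>+ x. 0 \<partial>(lborel :: 'a measure))"
    proof (rule nn_integral_dominated_convergence[where w="\<lambda>x. ennreal ((f x)\<^sup>2)"])
      show "AE x in lborel. (\<lambda>n. ennreal ((?u n x)\<^sup>2)) \<longlonglongrightarrow> 0"
      proof (rule AE_I2)
        fix x :: 'a
        have "\<forall>\<^sub>F n in sequentially. norm x \<le> X n" using X by (simp add: filterlim_at_top)
        then have "\<forall>\<^sub>F n in sequentially. f x - f x * \<gamma> (a n) x = ?u n x" by eventually_elim auto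
        moreover have "(\<lambda>n. f x - f x * \<gamma> (a n) x) \<longlonglongrightarrow> f x - f x * exp (- ((0 * norm x)\<^sup>2 / 2))"
          unfolding \<gamma>_def by (intro tendsto_intros a0) auto
        ultimately have "(\<lambda>n. ?u n x) \<longlonglongrightarrow> 0" by (auto intro: Lim_transform_eventually)
        then have "(\<lambda>n. ennreal ((?u n x)\<^sup>2)) \<longlonglongrightarrow> ennreal (0\<^sup>2)" by (intro tendsto_ennrealI tendsto_intros)
        then show "(\<lambda>n. ennreal ((?u n x)\<^sup>2)) \<longlonglongrightarrow> 0" by simp
      qed
      show "(\<integral>\<^sup>+ x. ennreal ((f x)\<^sup>2) \<partial>lborel) < \<infinity>" using f2i by (simp add: integrable_iff_bounded)
    qed (use um0 in \<open>auto intro!: AE_I2 ennreal_leI u_le borel_measurable_power measurable_compose[OF _ measurable_ennreal]\<close>)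
    have V: "(\<lambda>n. \<integral>\<^sup>+ \<xi>. ennreal ((norm (?v n \<xi>))\<^sup>2) \<partial>lborel) \<longlonglongrightarrow> (\<integral>\<^sup>+ x. 0 \<partial>(lborel :: 'a measure))"
    proof (rule nn_integral_dominated_convergence[where w="\<lambda>\<xi>. ennreal ((C * L + C)\<^sup>2 * exp (- (2 * r * norm \<xi>)))"])
      show "AE \<xi> in lborel. (\<lambda>n. ennreal ((norm (?v n \<xi>))\<^sup>2)) \<longlonglongrightarrow> 0"
      proof (rule AE_I2)
        fix \<xi> :: 'a
        have "(\<lambda>n. E (a n) \<xi>) \<longlonglongrightarrow> (LINT y|lborel. G \<xi> * of_real (\<phi> y))"
          unfolding E_def
        proof (rule integral_dominated_convergence[where w="\<lambda>y. C * \<phi> y"])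
          show "integrable lborel (\<lambda>y. C * \<phi> y)" using \<phi>i by simp
          show "AE y in lborel. (\<lambda>n. G (\<xi> + a n *\<^sub>R y) * of_real (\<phi> y)) \<longlonglongrightarrow> G \<xi> * of_real (\<phi> y)"
          proof (intro AE_I2 tendsto_intros)
            fix y
            have "(\<lambda>n. \<xi> + a n *\<^sub>R y) \<longlonglongrightarrow> \<xi> + 0 *\<^sub>R y" by (intro tendsto_intros a0)
            then have "(\<lambda>n. \<xi> + a n *\<^sub>R y) \<longlonglongrightarrow> \<xi>" by simp
            then show "(\<lambda>n. G (\<xi> + a n *\<^sub>R y)) \<longlonglongrightarrow> G \<xi>"
              by (rule continuous_on_tendsto_compose[OF contG]) auto
          qed
          show "AE y in lborel. norm (G (\<xi> + a n *\<^sub>R y) * of_real (\<phi> y)) \<le> C * \<phi> y" for n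
          proof (rule AE_I2)
            fix y
            have "norm (G (\<xi> + a n *\<^sub>R y)) \<le> C"
              using r C0 by (intro order_trans[OF dec] mult_right_le_one_le) auto
            then show "norm (G (\<xi> + a n *\<^sub>R y) * of_real (\<phi> y)) \<le> C * \<phi> y"
              using \<phi>0[of y] by (simp add: norm_mult mult_right_mono)
          qed
        qed measurable
        then have "(\<lambda>n. E (a n) \<xi>) \<longlonglongrightarrow> G \<xi>" using \<phi>1 by simp
        then have "(\<lambda>n. (norm (?v n \<xi>))\<^sup>2) \<longlonglongrightarrow> (norm (G \<xi> - G \<xi>))\<^sup>2" by (intro tendsto_intros)
        then have "(\<lambda>n. ennreal ((norm (?v n \<xi>))\<^sup>2)) \<longlonglongrightarrow> ennreal ((norm (G \<xi> - G \<xi>))\<^sup>2)" by (rule tendsto_ennrealI)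
        then show "(\<lambda>n. ennreal ((norm (?v n \<xi>))\<^sup>2)) \<longlonglongrightarrow> 0" by simp
      qed
      have "integrable lborel (\<lambda>\<xi>::'a. (C * L + C)\<^sup>2 * exp (- (2 * r * norm \<xi>)))"
        by (intro integrable_mult_right integrable_exp_norm) (use r in auto)
      then have "(\<integral>\<^sup>+ \<xi>. ennreal ((C * L + C)\<^sup>2 * exp (- (2 * r * norm (\<xi>::'a)))) \<partial>lborel)
          = ennreal (LINT \<xi>|lborel. (C * L + C)\<^sup>2 * exp (- (2 * r * norm (\<xi>::'a))))"
        by (rule nn_integral_eq_integral) auto
      then show "(\<integral>\<^sup>+ \<xi>. ennreal ((C * L + C)\<^sup>2 * exp (- (2 * r * norm (\<xi>::'a)))) \<partial>lborel) < \<infinity>"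
        by (simp only: ennreal_less_top infinity_ennreal_def)
      show "AE \<xi> in lborel. ennreal ((norm (?v n \<xi>))\<^sup>2) \<le> ennreal ((C * L + C)\<^sup>2 * exp (- (2 * r * norm \<xi>)))" for n
      proof (intro AE_I2 ennreal_leI)
        fix \<xi> :: 'a
        have "norm (?v n \<xi>) \<le> C * L * exp (- (r * norm \<xi>)) + C * exp (- (r * norm \<xi>))"
          by (intro order_trans[OF norm_triangle_ineq4] add_mono Eb a dec)
        then have "norm (?v n \<xi>) \<le> (C * L + C) * exp (- (r * norm \<xi>))" by (simp add: distrib_right)
        then have "(norm (?v n \<xi>))\<^sup>2 \<le> ((C * L + C) * exp (- (r * norm \<xi>)))\<^sup>2" by (intro power_mono) auto
        also have "\<dots> = (C * L + C)\<^sup>2 * exp (- (2 * r * norm \<xi>))"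
          by (simp add: power_mult_distrib mult.assoc flip: exp_double)
        finally show "(norm (?v n \<xi>))\<^sup>2 \<le> (C * L + C)\<^sup>2 * exp (- (2 * r * norm \<xi>))" .
      qed
    qed measurable
    \<comment> \<open>The error is the transform of the difference of the sharp and the Gaussian
      cut-off, controlled by Bessel's inequality, plus c times the mollification error
      \<open>?v\<close>. Both tend to zero by dominated convergence (\<open>U\<close> and
      \<open>V\<close>).\<close>
    have pt: "(norm (fourier_trunc (X n) f \<xi> - of_real c * G \<xi>))\<^sup>2 \<le> 2 * (norm (FT (\<lambda>x. of_real (?u n x)) \<xi>))\<^sup>2 + 2 * c\<^sup>2 * (norm (?v n \<xi>))\<^sup>2" for n \<xi>
    proof -
      have i1: "integrable lborel (\<lambda>x. cis (- (x \<bullet> \<xi>)) * of_real (?u n x))"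
        by (rule integrable_cis_mult[OF ui])
      have i2: "integrable lborel (\<lambda>x. cis (- (x \<bullet> \<xi>)) * of_real (f x * \<gamma> (a n) x))"
        by (rule integrable_cis_mult) (use f\<gamma>i[OF a(1)] in \<open>simp only: complex_of_real_integrable_eq\<close>)
      have "FT (\<lambda>x. of_real (?u n x)) \<xi> + FT (\<lambda>x. of_real (f x * \<gamma> (a n) x)) \<xi> = fourier_trunc (X n) f \<xi>"
        unfolding fourier_trunc_eq_FT FT_def
        by (subst Bochner_Integration.integral_add[OF i1 i2, symmetric]) (simp add: algebra_simps)
      then have "fourier_trunc (X n) f \<xi> - of_real c * G \<xi> = FT (\<lambda>x. of_real (?u n x)) \<xi> + of_real c * ?v n \<xi>"
        by (simp only: FT\<gamma>[OF a(1)]) (simp add: algebra_simps)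
      then have "norm (fourier_trunc (X n) f \<xi> - of_real c * G \<xi>) \<le> norm (FT (\<lambda>x. of_real (?u n x)) \<xi>) + c * norm (?v n \<xi>)"
        using norm_triangle_ineq[of "FT (\<lambda>x. of_real (?u n x)) \<xi>" "of_real c * ?v n \<xi>"] c0 by (simp add: norm_mult)
      then have "(norm (fourier_trunc (X n) f \<xi> - of_real c * G \<xi>))\<^sup>2 \<le> (norm (FT (\<lambda>x. of_real (?u n x)) \<xi>) + c * norm (?v n \<xi>))\<^sup>2"
        by (intro power_mono) auto
      also have "\<dots> \<le> 2 * (norm (FT (\<lambda>x. of_real (?u n x)) \<xi>))\<^sup>2 + 2 * (c * norm (?v n \<xi>))\<^sup>2"
        using sum_squares_bound[of "norm (FT (\<lambda>x. of_real (?u n x)) \<xi>)" "c * norm (?v n \<xi>)"] by (simp add: power2_sum)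
      finally show ?thesis by (simp add: power_mult_distrib)
    qed
    have um[measurable]: "(\<lambda>x. complex_of_real (?u n x)) \<in> borel_measurable borel" for n
      by (rule measurable_compose[OF um0]) measurable
    have le: "(\<integral>\<^sup>+ \<xi>. ennreal ((norm (fourier_trunc (X n) f \<xi> - of_real c * G \<xi>))\<^sup>2) \<partial>lborel)
      \<le> ennreal (2 * c) * (\<integral>\<^sup>+ x. ennreal ((?u n x)\<^sup>2) \<partial>lborel) + ennreal (2 * c\<^sup>2) * (\<integral>\<^sup>+ \<xi>. ennreal ((norm (?v n \<xi>))\<^sup>2) \<partial>lborel)" for n
    proof -
      define F where "F = FT (\<lambda>x. complex_of_real (?u n x))"
      have Fm[measurable]: "F \<in> borel_measurable borel" unfolding F_def by (rule borel_measurable_FT[OF um])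
      have "(\<integral>\<^sup>+ \<xi>. ennreal ((norm (fourier_trunc (X n) f \<xi> - of_real c * G \<xi>))\<^sup>2) \<partial>lborel)
        \<le> (\<integral>\<^sup>+ \<xi>. ennreal 2 * ennreal ((norm (F \<xi>))\<^sup>2) + ennreal (2 * c\<^sup>2) * ennreal ((norm (?v n \<xi>))\<^sup>2) \<partial>lborel)"
        unfolding F_def by (intro nn_integral_mono ennreal_le_linear pt) (use c0 in auto)
      also have "\<dots> = ennreal 2 * (\<integral>\<^sup>+ \<xi>. ennreal ((norm (F \<xi>))\<^sup>2) \<partial>lborel) + ennreal (2 * c\<^sup>2) * (\<integral>\<^sup>+ \<xi>. ennreal ((norm (?v n \<xi>))\<^sup>2) \<partial>lborel)"
        by (subst nn_integral_add, measurable, subst nn_integral_cmult, measurable, subst nn_integral_cmult, measurable)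
      also have "(\<integral>\<^sup>+ \<xi>. ennreal ((norm (F \<xi>))\<^sup>2) \<partial>lborel) \<le> ennreal (c * (LINT x|lborel. (norm (complex_of_real (?u n x)))\<^sup>2))"
        unfolding c_def F_def by (rule bessel_inequality[OF ui]) (use u2i in \<open>simp only: norm_of_real power2_abs\<close>)
      also have "\<dots> = ennreal c * (\<integral>\<^sup>+ x. ennreal ((?u n x)\<^sup>2) \<partial>lborel)"
        using c0 u2i by (subst nn_integral_eq_integral) (auto simp: ennreal_mult simp del: of_real_mult of_real_diff)
      finally show ?thesis
        using c0 by (simp add: add_mono mult_left_mono ennreal_mult mult.assoc)
    qed
    have lim: "(\<lambda>n. ennreal (2 * c) * (\<integral>\<^sup>+ x. ennreal ((?u n x)\<^sup>2) \<partial>lborel) + ennreal (2 * c\<^sup>2) * (\<integral>\<^sup>+ \<xi>. ennreal ((norm (?v n \<xi>))\<^sup>2) \<partial>lborel))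
       \<longlonglongrightarrow> ennreal (2 * c) * (\<integral>\<^sup>+ x. 0 \<partial>(lborel :: 'a measure)) + ennreal (2 * c\<^sup>2) * (\<integral>\<^sup>+ x. 0 \<partial>(lborel :: 'a measure))"
      by (rule tendsto_add[OF ennreal_tendsto_cmult[OF _ U] ennreal_tendsto_cmult[OF _ V]]) auto
    show ?thesis
    proof (rule tendsto_sandwich[OF _ _ tendsto_const])
      show "\<forall>\<^sub>F n in sequentially. 0 \<le> (\<integral>\<^sup>+ \<xi>. ennreal ((norm (fourier_trunc (X n) f \<xi> - of_real c * G \<xi>))\<^sup>2) \<partial>lborel)"
        by (rule always_eventually) auto
      show "\<forall>\<^sub>F n in sequentially. (\<integral>\<^sup>+ \<xi>. ennreal ((norm (fourier_trunc (X n) f \<xi> - of_real c * G \<xi>))\<^sup>2) \<partial>lborel)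
        \<le> ennreal (2 * c) * (\<integral>\<^sup>+ x. ennreal ((?u n x)\<^sup>2) \<partial>lborel) + ennreal (2 * c\<^sup>2) * (\<integral>\<^sup>+ \<xi>. ennreal ((norm (?v n \<xi>))\<^sup>2) \<partial>lborel)"
        by (intro always_eventually allI le)
      show "(\<lambda>n. ennreal (2 * c) * (\<integral>\<^sup>+ x. ennreal ((?u n x)\<^sup>2) \<partial>lborel) + ennreal (2 * c\<^sup>2) * (\<integral>\<^sup>+ \<xi>. ennreal ((norm (?v n \<xi>))\<^sup>2) \<partial>lborel)) \<longlonglongrightarrow> 0"
        using lim by (simp only: nn_integral_const mult_zero_left mult_zero_right add_0)
    qed
  qed
  have "square_integrable (\<lambda>\<xi>. complex_of_real c * G \<xi>)"
    using G2i by (simp add: square_integrable_def norm_mult power_mult_distrib)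
  moreover have "((\<lambda>R. \<integral>\<^sup>+ \<xi>. ennreal ((norm (fourier_trunc R f \<xi> - of_real c * G \<xi>))\<^sup>2) \<partial>lborel) \<longlongrightarrow> 0) at_top"
    by (rule tendsto_at_topI_sequentially) (rule main)
  ultimately show "is_fourier f (\<lambda>\<xi>. of_real ((2 * pi) ^ DIM('a)) * G \<xi>)"
    by (simp only: is_fourier_def c_def)
qed

subsection \<open>Sobolev norms of sine and cosine transforms\<close>

text \<open>Both functions are limits in L^2 of the same truncated integrals. As
  \<open>fourier\<close> is only a choice among such limits, this is what allows an explicit
  transform to be inserted into Sobolev norms.\<close>

lemma is_fourier_unique:
  assumes f[measurable]: "f \<in> borel_measurable borel" and 1: "is_fourier f g1" and 2: "is_fourier f g2"
  shows "AE \<xi> in lborel. g1 \<xi> = g2 \<xi>"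
proof -
  have [measurable]: "g1 \<in> borel_measurable borel" "g2 \<in> borel_measurable borel"
    using 1 2 by (auto simp: is_fourier_def square_integrable_def)
  have m: "(\<lambda>x. complex_of_real (indicator (cball 0 R) x * f x)) \<in> borel_measurable borel" for R
    by (intro measurable_compose[OF borel_measurable_times[OF borel_measurable_indicator f]]) auto
  have [measurable]: "fourier_trunc R f \<in> borel_measurable borel" for R
    unfolding fourier_trunc_eq_FT by (rule borel_measurable_FT[OF m])
  let ?d = "\<lambda>g R. \<integral>\<^sup>+ \<xi>. ennreal ((norm (fourier_trunc R f \<xi> - g \<xi>))\<^sup>2) \<partial>lborel"
  have le: "(\<integral>\<^sup>+ \<xi>. ennreal ((norm (g1 \<xi> - g2 \<xi>))\<^sup>2) \<partial>lborel) \<le> ennreal 2 * ?d g1 R + ennreal 2 * ?d g2 R" for R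
  proof -
    have "(\<integral>\<^sup>+ \<xi>. ennreal ((norm (g1 \<xi> - g2 \<xi>))\<^sup>2) \<partial>lborel)
      \<le> (\<integral>\<^sup>+ \<xi>. ennreal 2 * ennreal ((norm (fourier_trunc R f \<xi> - g1 \<xi>))\<^sup>2) + ennreal 2 * ennreal ((norm (fourier_trunc R f \<xi> - g2 \<xi>))\<^sup>2) \<partial>lborel)"
    proof (intro nn_integral_mono ennreal_le_linear)
      fix \<xi>
      let ?a = "fourier_trunc R f \<xi> - g1 \<xi>" and ?b = "fourier_trunc R f \<xi> - g2 \<xi>"
      have "norm (g1 \<xi> - g2 \<xi>) \<le> norm ?a + norm ?b"
        using norm_triangle_ineq4[of ?b ?a] by simp
      then have "(norm (g1 \<xi> - g2 \<xi>))\<^sup>2 \<le> (norm ?a + norm ?b)\<^sup>2" by (intro power_mono) auto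
      also have "\<dots> \<le> 2 * (norm ?a)\<^sup>2 + 2 * (norm ?b)\<^sup>2"
        using sum_squares_bound[of "norm ?a" "norm ?b"] by (simp add: power2_sum)
      finally show "(norm (g1 \<xi> - g2 \<xi>))\<^sup>2 \<le> 2 * (norm ?a)\<^sup>2 + 2 * (norm ?b)\<^sup>2" .
    qed auto
    also have "\<dots> = ennreal 2 * ?d g1 R + ennreal 2 * ?d g2 R"
      by (subst nn_integral_add, measurable, subst nn_integral_cmult, measurable, subst nn_integral_cmult, measurable)
    finally show ?thesis .
  qed
  have "((\<lambda>R. ennreal 2 * ?d g1 R + ennreal 2 * ?d g2 R) \<longlongrightarrow> ennreal 2 * 0 + ennreal 2 * 0) at_top"
    using 1 2 by (intro tendsto_add[OF ennreal_tendsto_cmult ennreal_tendsto_cmult]) (auto simp: is_fourier_def)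
  then have "((\<lambda>R. ennreal 2 * ?d g1 R + ennreal 2 * ?d g2 R) \<longlongrightarrow> 0) at_top" by simp
  then have "(\<integral>\<^sup>+ \<xi>. ennreal ((norm (g1 \<xi> - g2 \<xi>))\<^sup>2) \<partial>lborel) \<le> 0"
    by (rule tendsto_lowerbound) (use le in auto)
  then have "(\<integral>\<^sup>+ \<xi>. ennreal ((norm (g1 \<xi> - g2 \<xi>))\<^sup>2) \<partial>lborel) = 0" by simp
  then have "AE \<xi> in lborel. ennreal ((norm (g1 \<xi> - g2 \<xi>))\<^sup>2) = 0"
    by (subst (asm) nn_integral_0_iff_AE) auto
  then show ?thesis by eventually_elim (auto simp: ennreal_eq_0_iff)
qed

text \<open>Half of the decay rate pays for the polynomial weight, the other half for
  integrability.\<close>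

lemma integrable_weight_exp:
  fixes f :: "'a::euclidean_space \<Rightarrow> 'b::{banach,second_countable_topology}"
  assumes m: "f \<in> borel_measurable borel" and "r > 0" "s > 0"
    and le: "\<And>x. norm (f x) \<le> C * ((1 + (norm x)\<^sup>2) powr s * exp (- (r * norm x)))"
  shows "integrable lborel f"
proof -
  obtain K where K: "K > 0" "\<And>x::'a. (1 + (norm x)\<^sup>2) powr s \<le> K * exp (r/2 * norm x)"
    using powr_le_exp[of "r/2" s, where 'a='a] assms by auto
  have b: "norm (f x) \<le> (\<bar>C\<bar> * K) * exp (- ((r/2) * norm x))" for x
  proof -
    have "(1 + (norm x)\<^sup>2) powr s * exp (- (r * norm x)) \<le> (K * exp (r/2 * norm x)) * exp (- (r * norm x))"
      by (intro mult_right_mono K) auto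
    also have "\<dots> = K * exp (- ((r/2) * norm x))" by (simp add: mult.assoc flip: exp_add)
    finally have "\<bar>C\<bar> * ((1 + (norm x)\<^sup>2) powr s * exp (- (r * norm x))) \<le> \<bar>C\<bar> * (K * exp (- ((r/2) * norm x)))"
      by (intro mult_left_mono) auto
    moreover have "norm (f x) \<le> \<bar>C\<bar> * ((1 + (norm x)\<^sup>2) powr s * exp (- (r * norm x)))"
      by (rule order_trans[OF le]) (intro mult_right_mono, auto)
    ultimately show ?thesis by simp
  qed
  show ?thesis by (rule integrable_exp_bound[OF m _ b]) (use assms in auto)
qed

lemma is_fourier_fourier: "is_fourier f g \<Longrightarrow> is_fourier f (fourier f)"
  unfolding fourier_def by (rule someI[of "is_fourier f"])

text \<open>The phase z is -\<i> for sine transforms of odd amplitudes and 1 for cosine transforms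
  of even ones. Having modulus one, it drops out of all norms, so that both cases are settled by the
  real amplitude U.\<close>

lemma Hs_synthesis:
  fixes f :: "'a::euclidean_space \<Rightarrow> 'b::euclidean_space" and U :: "'a \<Rightarrow> 'b" and z :: complex
  assumes cont: "continuous_on UNIV U" and r: "r > 0" and s: "s > 0"
    and dec: "\<And>\<xi>. norm (U \<xi>) \<le> C * exp (- (r * norm \<xi>))" and z: "norm z = 1"
    and f: "\<And>x e. e \<in> Basis \<Longrightarrow> complex_of_real (f x \<bullet> e) = (LINT \<xi>|lborel. cis (x \<bullet> \<xi>) * (z * of_real (U \<xi> \<bullet> e)))"
  shows "square_integrable f" and "in_Hs s f"
    and "Hs_norm s f = (2 * pi) ^ DIM('a) * sqrt (LINT \<xi>|lborel. (1 + (norm \<xi>)\<^sup>2) powr s * (norm (U \<xi>))\<^sup>2)"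
    and "integrable lborel (\<lambda>\<xi>. (1 + (norm \<xi>)\<^sup>2) powr s * (norm (U \<xi>))\<^sup>2)"
proof -
  let ?c = "(2 * pi) ^ DIM('a)"
  let ?w = "\<lambda>\<xi>::'a. (1 + (norm \<xi>)\<^sup>2) powr s"
  have Um[measurable]: "U \<in> borel_measurable borel" using cont by (rule borel_measurable_continuous_onI)
  have C0: "C \<ge> 0" using order_trans[OF norm_ge_zero dec[of 0]] by simp
  have dec2: "(norm (U \<xi>))\<^sup>2 \<le> C\<^sup>2 * exp (- (2 * r * norm \<xi>))" for \<xi>
  proof -
    have "(norm (U \<xi>))\<^sup>2 \<le> (C * exp (- (r * norm \<xi>)))\<^sup>2" by (intro power_mono dec) auto
    then show ?thesis by (simp add: power_mult_distrib mult.assoc flip: exp_double)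
  qed
  have le1: "norm (?w \<xi> * (norm (U \<xi>))\<^sup>2) \<le> C\<^sup>2 * (?w \<xi> * exp (- ((2 * r) * norm \<xi>)))" for \<xi>
    using mult_left_mono[OF dec2[of \<xi>], of "?w \<xi>"] by (simp add: abs_mult mult_ac)
  show I: "integrable lborel (\<lambda>\<xi>. ?w \<xi> * (norm (U \<xi>))\<^sup>2)"
    by (rule integrable_weight_exp[OF _ _ s le1]) (use r in auto)
  have comp: "square_integrable (\<lambda>x. f x \<bullet> e)" "is_fourier (\<lambda>x. f x \<bullet> e) (\<lambda>\<xi>. of_real ?c * (z * of_real (U \<xi> \<bullet> e)))" if e: "e \<in> Basis" for e
  proof -
    have c: "continuous_on UNIV (\<lambda>\<xi>. z * complex_of_real (U \<xi> \<bullet> e))"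
      by (intro continuous_intros cont)
    have d: "norm (z * complex_of_real (U \<xi> \<bullet> e)) \<le> C * exp (- (r * norm \<xi>))" for \<xi>
      using order_trans[OF Basis_le_norm[OF e] dec] by (simp add: norm_mult z)
    show "square_integrable (\<lambda>x. f x \<bullet> e)" by (rule is_fourier_synthesis[OF c r d f[OF e]])
    show "is_fourier (\<lambda>x. f x \<bullet> e) (\<lambda>\<xi>. of_real ?c * (z * of_real (U \<xi> \<bullet> e)))"
      by (rule is_fourier_synthesis[OF c r d f[OF e]])
  qed
  have fe: "(\<lambda>x. f x \<bullet> e) \<in> borel_measurable borel" if "e \<in> Basis" for e
    using comp(1)[OF that] by (simp add: square_integrable_def)
  have fm: "f \<in> borel_measurable borel"
    by (subst borel_measurable_euclidean_space) (use fe in auto)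
  have "integrable lborel (\<lambda>x. \<Sum>e\<in>Basis. (f x \<bullet> e)\<^sup>2)"
    using comp(1) by (intro Bochner_Integration.integrable_sum) (auto simp: square_integrable_def)
  then show "square_integrable f"
    using fm by (simp add: square_integrable_def norm_power2_Basis)
  have AEe: "AE \<xi> in lborel. ?w \<xi> * (norm (fourier (\<lambda>x. f x \<bullet> e) \<xi>))\<^sup>2 = ?c\<^sup>2 * (?w \<xi> * (U \<xi> \<bullet> e)\<^sup>2)" if e: "e \<in> Basis" for e
  proof -
    have "is_fourier (\<lambda>x. f x \<bullet> e) (fourier (\<lambda>x. f x \<bullet> e))"
      by (rule is_fourier_fourier[OF comp(2)[OF e]])
    from is_fourier_unique[OF fe[OF e] this comp(2)[OF e]] show ?thesis
      by eventually_elim (simp add: norm_mult z power_mult_distrib norm_power)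
  qed
  have Fm: "(\<lambda>\<xi>. ?w \<xi> * (norm (fourier (\<lambda>x. f x \<bullet> e) \<xi>))\<^sup>2) \<in> borel_measurable lborel" if e: "e \<in> Basis" for e
  proof -
    have "is_fourier (\<lambda>x. f x \<bullet> e) (fourier (\<lambda>x. f x \<bullet> e))"
      by (rule is_fourier_fourier[OF comp(2)[OF e]])
    then have [measurable]: "fourier (\<lambda>x. f x \<bullet> e) \<in> borel_measurable borel"
      by (simp add: is_fourier_def square_integrable_def)
    show ?thesis by measurable
  qed
  have Ie: "integrable lborel (\<lambda>\<xi>. ?w \<xi> * (U \<xi> \<bullet> e)\<^sup>2)" if e: "e \<in> Basis" for e
  proof (rule integrable_dominated[OF I])
    show "norm (?w \<xi> * (U \<xi> \<bullet> e)\<^sup>2) \<le> ?w \<xi> * (norm (U \<xi>))\<^sup>2" for \<xi>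
      using power_mono[OF Basis_le_norm[OF e, of "U \<xi>"], of 2] by (simp add: abs_mult mult_left_mono)
  qed measurable
  have Ee: "(LINT \<xi>|lborel. ?w \<xi> * (norm (fourier (\<lambda>x. f x \<bullet> e) \<xi>))\<^sup>2) = ?c\<^sup>2 * (LINT \<xi>|lborel. ?w \<xi> * (U \<xi> \<bullet> e)\<^sup>2)" if e: "e \<in> Basis" for e
    by (subst integral_cong_AE[OF Fm[OF e] _ AEe[OF e]]) auto
  show "in_Hs s f"
    unfolding in_Hs_def
  proof (intro conjI ballI)
    fix e :: 'b assume e: "e \<in> Basis"
    show "integrable lborel (\<lambda>\<xi>. ?w \<xi> * (norm (fourier (\<lambda>x. f x \<bullet> e) \<xi>))\<^sup>2)"
      by (subst integrable_cong_AE[OF Fm[OF e] _ AEe[OF e]]) (use Ie[OF e] in auto)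
  qed fact
  have "(\<Sum>e\<in>Basis. LINT \<xi>|lborel. ?w \<xi> * (norm (fourier (\<lambda>x. f x \<bullet> e) \<xi>))\<^sup>2)
      = ?c\<^sup>2 * (LINT \<xi>|lborel. (\<Sum>e\<in>Basis. ?w \<xi> * (U \<xi> \<bullet> e)\<^sup>2))"
    using Ie by (subst Bochner_Integration.integral_sum) (simp_all add: Ee sum_distrib_left)
  also have "(\<lambda>\<xi>. \<Sum>e\<in>Basis. ?w \<xi> * (U \<xi> \<bullet> e)\<^sup>2) = (\<lambda>\<xi>. ?w \<xi> * (norm (U \<xi>))\<^sup>2)"
    by (simp add: norm_power2_Basis sum_distrib_left)
  finally show "Hs_norm s f = ?c * sqrt (LINT \<xi>|lborel. ?w \<xi> * (norm (U \<xi>))\<^sup>2)"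
    unfolding Hs_norm_def by (simp add: real_sqrt_mult)
qed

text \<open>For odd U the Fourier transform of this function is -\<i> (2 pi)^d U, so an odd real
  field is described by a real amplitude and no Hermitian symmetry has to be tracked.\<close>

definition sinT :: "('a::euclidean_space \<Rightarrow> 'b::euclidean_space) \<Rightarrow> 'a \<Rightarrow> 'b" where
  "sinT U x = (LINT \<xi>|lborel. sin (x \<bullet> \<xi>) *\<^sub>R U \<xi>)"

definition cosT :: "('a::euclidean_space \<Rightarrow> 'b::euclidean_space) \<Rightarrow> 'a \<Rightarrow> 'b" where
  "cosT U x = (LINT \<xi>|lborel. cos (x \<bullet> \<xi>) *\<^sub>R U \<xi>)"

lemma
  fixes U :: "'a::euclidean_space \<Rightarrow> 'b::euclidean_space"
  assumes U: "integrable lborel U"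
  shows integrable_sin: "integrable lborel (\<lambda>\<xi>. sin (x \<bullet> \<xi>) *\<^sub>R U \<xi>)"
    and integrable_cos: "integrable lborel (\<lambda>\<xi>. cos (x \<bullet> \<xi>) *\<^sub>R U \<xi>)"
proof -
  have [measurable]: "U \<in> borel_measurable borel" using U by auto
  have "norm (sin (x \<bullet> \<xi>) *\<^sub>R U \<xi>) \<le> norm (U \<xi>)" "norm (cos (x \<bullet> \<xi>) *\<^sub>R U \<xi>) \<le> norm (U \<xi>)" for \<xi>
    by (auto intro!: mult_left_le_one_le)
  then show "integrable lborel (\<lambda>\<xi>. sin (x \<bullet> \<xi>) *\<^sub>R U \<xi>)" "integrable lborel (\<lambda>\<xi>. cos (x \<bullet> \<xi>) *\<^sub>R U \<xi>)"
    by (auto intro!: integrable_dominated[OF integrable_norm[OF U]])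
qed

lemma integral_odd_eq_0:
  fixes g :: "'a::euclidean_space \<Rightarrow> 'b::{banach,second_countable_topology}"
  assumes m: "g \<in> borel_measurable borel" and odd: "\<And>x. g (- x) = - g x"
  shows "(LINT x|lborel. g x) = 0"
proof -
  have "(LINT x|lborel. g x) = (LINT x|lborel. g (0 - x))" by (rule integral_lborel_reflect[OF m, symmetric])
  also have "\<dots> = - (LINT x|lborel. g x)" by (simp add: odd)
  finally have "2 *\<^sub>R (LINT x|lborel. g x) = 0"
    unfolding scaleR_2 eq_neg_iff_add_eq_0 .
  then show ?thesis by simp
qed

lemma Hs_sinT:
  fixes U :: "'a::euclidean_space \<Rightarrow> 'b::euclidean_space"
  assumes cont: "continuous_on UNIV U" and r: "r > 0" and s: "s > 0"
    and dec: "\<And>\<xi>. norm (U \<xi>) \<le> C * exp (- (r * norm \<xi>))" and odd: "\<And>\<xi>. U (- \<xi>) = - U \<xi>"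
  shows "in_Hs s (sinT U)"
    and "Hs_norm s (sinT U) = (2 * pi) ^ DIM('a) * sqrt (LINT \<xi>|lborel. (1 + (norm \<xi>)\<^sup>2) powr s * (norm (U \<xi>))\<^sup>2)"
    and "integrable lborel (\<lambda>\<xi>. (1 + (norm \<xi>)\<^sup>2) powr s * (norm (U \<xi>))\<^sup>2)"
proof -
  have Um[measurable]: "U \<in> borel_measurable borel" using cont by (rule borel_measurable_continuous_onI)
  have Ui: "integrable lborel U" by (rule integrable_exp_bound[OF Um r dec])
  have *: "complex_of_real (sinT U x \<bullet> e) = (LINT \<xi>|lborel. cis (x \<bullet> \<xi>) * (- \<i> * of_real (U \<xi> \<bullet> e)))" if "e \<in> Basis" for x e
  proof -
    have i: "integrable lborel (\<lambda>\<xi>. sin (x \<bullet> \<xi>) * (U \<xi> \<bullet> e))" "integrable lborel (\<lambda>\<xi>. cos (x \<bullet> \<xi>) * (U \<xi> \<bullet> e))"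
      using integrable_inner_left[OF integrable_sin[OF Ui, of x], of e] integrable_inner_left[OF integrable_cos[OF Ui, of x], of e] by auto
    have 0: "(LINT \<xi>|lborel. cos (x \<bullet> \<xi>) * (U \<xi> \<bullet> e)) = 0"
      by (rule integral_odd_eq_0) (simp_all add: odd)
    have "(LINT \<xi>|lborel. cis (x \<bullet> \<xi>) * (- \<i> * of_real (U \<xi> \<bullet> e)))
      = (LINT \<xi>|lborel. complex_of_real (sin (x \<bullet> \<xi>) * (U \<xi> \<bullet> e)) - \<i> * complex_of_real (cos (x \<bullet> \<xi>) * (U \<xi> \<bullet> e)))"
      by (intro Bochner_Integration.integral_cong refl) (simp add: complex_eq_iff)
    also have "\<dots> = complex_of_real (LINT \<xi>|lborel. sin (x \<bullet> \<xi>) * (U \<xi> \<bullet> e)) - \<i> * complex_of_real (LINT \<xi>|lborel. cos (x \<bullet> \<xi>) * (U \<xi> \<bullet> e))"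
      using i by (subst Bochner_Integration.integral_diff) (auto simp only: complex_of_real_integrable_eq integral_complex_of_real integral_mult_right_zero intro!: integrable_mult_right)
    also have "(LINT \<xi>|lborel. sin (x \<bullet> \<xi>) * (U \<xi> \<bullet> e)) = sinT U x \<bullet> e"
      unfolding sinT_def using integral_inner_left[OF integrable_sin[OF Ui, of x], of e] by simp
    finally show ?thesis by (simp add: 0)
  qed
  note H = Hs_synthesis[OF cont r s dec _ *]
  show "in_Hs s (sinT U)" by (rule H) auto
  show "Hs_norm s (sinT U) = (2 * pi) ^ DIM('a) * sqrt (LINT \<xi>|lborel. (1 + (norm \<xi>)\<^sup>2) powr s * (norm (U \<xi>))\<^sup>2)"
    by (rule H) auto
  show "integrable lborel (\<lambda>\<xi>. (1 + (norm \<xi>)\<^sup>2) powr s * (norm (U \<xi>))\<^sup>2)" by (rule H) auto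
qed

lemma Hs_cosT:
  fixes U :: "'a::euclidean_space \<Rightarrow> 'b::euclidean_space"
  assumes cont: "continuous_on UNIV U" and r: "r > 0" and s: "s > 0"
    and dec: "\<And>\<xi>. norm (U \<xi>) \<le> C * exp (- (r * norm \<xi>))" and even: "\<And>\<xi>. U (- \<xi>) = U \<xi>"
  shows "in_Hs s (cosT U)"
    and "Hs_norm s (cosT U) = (2 * pi) ^ DIM('a) * sqrt (LINT \<xi>|lborel. (1 + (norm \<xi>)\<^sup>2) powr s * (norm (U \<xi>))\<^sup>2)"
proof -
  have Um[measurable]: "U \<in> borel_measurable borel" using cont by (rule borel_measurable_continuous_onI)
  have Ui: "integrable lborel U" by (rule integrable_exp_bound[OF Um r dec])
  have *: "complex_of_real (cosT U x \<bullet> e) = (LINT \<xi>|lborel. cis (x \<bullet> \<xi>) * (1 * of_real (U \<xi> \<bullet> e)))" if "e \<in> Basis" for x e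
  proof -
    have i: "integrable lborel (\<lambda>\<xi>. sin (x \<bullet> \<xi>) * (U \<xi> \<bullet> e))" "integrable lborel (\<lambda>\<xi>. cos (x \<bullet> \<xi>) * (U \<xi> \<bullet> e))"
      using integrable_inner_left[OF integrable_sin[OF Ui, of x], of e] integrable_inner_left[OF integrable_cos[OF Ui, of x], of e] by auto
    have 0: "(LINT \<xi>|lborel. sin (x \<bullet> \<xi>) * (U \<xi> \<bullet> e)) = 0"
      by (rule integral_odd_eq_0) (simp_all add: even)
    have "(LINT \<xi>|lborel. cis (x \<bullet> \<xi>) * (1 * of_real (U \<xi> \<bullet> e)))
      = (LINT \<xi>|lborel. complex_of_real (cos (x \<bullet> \<xi>) * (U \<xi> \<bullet> e)) + \<i> * complex_of_real (sin (x \<bullet> \<xi>) * (U \<xi> \<bullet> e)))"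
      by (intro Bochner_Integration.integral_cong refl) (simp add: complex_eq_iff)
    also have "\<dots> = complex_of_real (LINT \<xi>|lborel. cos (x \<bullet> \<xi>) * (U \<xi> \<bullet> e)) + \<i> * complex_of_real (LINT \<xi>|lborel. sin (x \<bullet> \<xi>) * (U \<xi> \<bullet> e))"
      using i by (subst Bochner_Integration.integral_add) (auto simp only: complex_of_real_integrable_eq integral_complex_of_real integral_mult_right_zero intro!: integrable_mult_right)
    also have "(LINT \<xi>|lborel. cos (x \<bullet> \<xi>) * (U \<xi> \<bullet> e)) = cosT U x \<bullet> e"
      unfolding cosT_def using integral_inner_left[OF integrable_cos[OF Ui, of x], of e] by simp
    finally show ?thesis by (simp add: 0)
  qed
  note H = Hs_synthesis[OF cont r s dec _ *]
  show "in_Hs s (cosT U)" by (rule H) auto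
  show "Hs_norm s (cosT U) = (2 * pi) ^ DIM('a) * sqrt (LINT \<xi>|lborel. (1 + (norm \<xi>)\<^sup>2) powr s * (norm (U \<xi>))\<^sup>2)"
    by (rule H) auto
qed

subsection \<open>Continuity of parametric integrals\<close>

text \<open>Dominated convergence along sequences. The majorant may change from point to point, as
  required for \<open>adv\<close>, whose integrand contains the unbounded factor \<zeta>.\<close>

lemma continuous_on_LINT:
  fixes f :: "'p::metric_space \<Rightarrow> 'a \<Rightarrow> 'b::{banach,second_countable_topology}"
  assumes m: "\<And>p. f p \<in> borel_measurable M" and c: "\<And>x. continuous_on UNIV (\<lambda>p. f p x)"
    and b: "\<And>p. \<exists>d>0. \<exists>g. integrable M g \<and> (\<forall>q\<in>ball p d. \<forall>x. norm (f q x) \<le> g x)"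
  shows "continuous_on UNIV (\<lambda>p. LINT x|M. f p x)"
  unfolding continuous_on_sequentially
proof (intro ballI allI impI)
  fix u :: "nat \<Rightarrow> 'p" and p assume "p \<in> UNIV" and u: "(\<forall>n. u n \<in> UNIV) \<and> u \<longlonglongrightarrow> p"
  obtain d g where d: "d > 0" and g: "integrable M g" and le: "\<And>q x. q \<in> ball p d \<Longrightarrow> norm (f q x) \<le> g x"
    using b[of p] by metis
  have ev: "\<forall>\<^sub>F n in sequentially. u n \<in> ball p d"
    using u d by (intro topological_tendstoD[of u p]) auto
  then obtain k where k: "\<And>n. n \<ge> k \<Longrightarrow> u n \<in> ball p d" by (auto simp: eventually_sequentially)
  have uk: "(\<lambda>n. u (n + k)) \<longlonglongrightarrow> p" using u by (intro LIMSEQ_ignore_initial_segment) auto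
  have "(\<lambda>n. LINT x|M. f (u (n + k)) x) \<longlonglongrightarrow> (LINT x|M. f p x)"
  proof (rule integral_dominated_convergence[OF m m g])
    show "AE x in M. (\<lambda>n. f (u (n + k)) x) \<longlonglongrightarrow> f p x"
      by (intro AE_I2 continuous_on_tendsto_compose[OF c uk]) auto
    show "AE x in M. norm (f (u (n + k)) x) \<le> g x" for n
      by (intro AE_I2 le k) simp
  qed
  then show "((\<lambda>p. LINT x|M. f p x) \<circ> u) \<longlonglongrightarrow> (LINT x|M. f p x)"
    unfolding comp_def by (rule LIMSEQ_offset)
qed

lemma continuous_on_slice:
  assumes "continuous_on UNIV (\<lambda>z. U (fst z) (snd z))"
  shows "continuous_on UNIV (U t)" and "continuous_on UNIV (\<lambda>t. U t \<xi>)"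
proof -
  have "continuous_on UNIV (\<lambda>\<xi>. (t, \<xi>))" "continuous_on UNIV (\<lambda>t. (t, \<xi>))"
    by (intro continuous_intros)+
  then show "continuous_on UNIV (U t)" "continuous_on UNIV (\<lambda>t. U t \<xi>)"
    using continuous_on_compose2[OF assms, of UNIV "\<lambda>\<xi>. (t, \<xi>)"] continuous_on_compose2[OF assms, of UNIV "\<lambda>t. (t, \<xi>)"]
    by auto
qed

lemma continuous_on_weighted_square:
  fixes U :: "real \<Rightarrow> 'a::euclidean_space \<Rightarrow> 'b::euclidean_space"
  assumes cont: "continuous_on UNIV (\<lambda>z. U (fst z) (snd z))" and r: "r > 0" and s: "s > 0"
    and dec: "\<And>t \<xi>. norm (U t \<xi>) \<le> C * exp (- (r * norm \<xi>))"
  shows "continuous_on UNIV (\<lambda>t. LINT \<xi>|lborel. (1 + (norm \<xi>)\<^sup>2) powr s * (norm (U t \<xi>))\<^sup>2)"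
proof (rule continuous_on_LINT)
  let ?w = "\<lambda>\<xi>::'a. (1 + (norm \<xi>)\<^sup>2) powr s"
  have [measurable]: "U t \<in> borel_measurable borel" for t
    by (rule borel_measurable_continuous_onI) (rule continuous_on_slice(1)[OF cont])
  show "(\<lambda>\<xi>. ?w \<xi> * (norm (U t \<xi>))\<^sup>2) \<in> borel_measurable lborel" for t by measurable
  show "continuous_on UNIV (\<lambda>t. ?w \<xi> * (norm (U t \<xi>))\<^sup>2)" for \<xi>
    by (intro continuous_intros continuous_on_slice(2)[OF cont])
  show "\<exists>d>0. \<exists>g. integrable lborel g \<and> (\<forall>q\<in>ball t d. \<forall>\<xi>. norm (?w \<xi> * (norm (U q \<xi>))\<^sup>2) \<le> g \<xi>)" for t
  proof (intro exI[of _ 1] exI[of _ "\<lambda>\<xi>. C\<^sup>2 * (?w \<xi> * exp (- ((2 * r) * norm \<xi>)))"] conjI ballI allI)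
    show "integrable lborel (\<lambda>\<xi>. C\<^sup>2 * (?w \<xi> * exp (- ((2 * r) * norm \<xi>))))"
      by (rule integrable_weight_exp[OF _ _ s, of _ "2 * r" "C\<^sup>2"]) (use r in \<open>auto simp: abs_mult\<close>)
    fix q \<xi>
    have "(norm (U q \<xi>))\<^sup>2 \<le> (C * exp (- (r * norm \<xi>)))\<^sup>2" by (intro power_mono dec) auto
    then have "(norm (U q \<xi>))\<^sup>2 \<le> C\<^sup>2 * exp (- (2 * r * norm \<xi>))"
      by (simp add: power_mult_distrib mult.assoc flip: exp_double)
    then show "norm (?w \<xi> * (norm (U q \<xi>))\<^sup>2) \<le> C\<^sup>2 * (?w \<xi> * exp (- ((2 * r) * norm \<xi>)))"
      using mult_left_mono[of "(norm (U q \<xi>))\<^sup>2" "C\<^sup>2 * exp (- (2 * r * norm \<xi>))" "?w \<xi>"] by (simp add: abs_mult mult_ac)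
  qed auto
qed

lemma sinT_diff:
  fixes U V :: "'a::euclidean_space \<Rightarrow> 'b::euclidean_space"
  assumes "integrable lborel U" "integrable lborel V"
  shows "sinT U x - sinT V x = sinT (\<lambda>\<xi>. U \<xi> - V \<xi>) x"
  unfolding sinT_def by (subst Bochner_Integration.integral_diff[symmetric]) (auto intro!: integrable_sin assms simp: scaleR_diff_right)

lemma C_Hs_sinT:
  fixes U :: "real \<Rightarrow> 'a::euclidean_space \<Rightarrow> 'b::euclidean_space"
  assumes cont: "continuous_on UNIV (\<lambda>z. U (fst z) (snd z))" and r: "r > 0" and s: "s > 0"
    and dec: "\<And>t \<xi>. norm (U t \<xi>) \<le> C * exp (- (r * norm \<xi>))" and odd: "\<And>t \<xi>. U t (- \<xi>) = - U t \<xi>"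
  shows "C_Hs T s (\<lambda>t. sinT (U t))"
  unfolding C_Hs_def
proof (intro ballI conjI)
  fix t assume "t \<in> {0..T}"
  note c = continuous_on_slice(1)[OF cont]
  show "in_Hs s (sinT (U t))" by (rule Hs_sinT[OF c r s dec odd])
  have i: "integrable lborel (U \<tau>)" for \<tau>
    by (rule integrable_exp_bound[OF _ r dec]) (rule borel_measurable_continuous_onI[OF c])
  \<comment> \<open>With t fixed, the norm of the difference is an explicit integral of
    \<open>V \<tau>\<close> that depends continuously on \<tau> and vanishes at \<tau> = t.\<close>
  define V where "V \<tau> \<xi> = U \<tau> \<xi> - U t \<xi>" for \<tau> \<xi>
  have contV: "continuous_on UNIV (\<lambda>z. V (fst z) (snd z))"
    unfolding V_def by (intro continuous_intros cont continuous_on_compose2[OF c]) auto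
  have decV: "norm (V \<tau> \<xi>) \<le> (2 * C) * exp (- (r * norm \<xi>))" for \<tau> \<xi>
    unfolding V_def using norm_triangle_ineq4[of "U \<tau> \<xi>" "U t \<xi>"] dec[of \<tau> \<xi>] dec[of t \<xi>] by linarith
  have oddV: "V \<tau> (- \<xi>) = - V \<tau> \<xi>" for \<tau> \<xi> by (simp add: V_def odd)
  have N: "Hs_norm s (\<lambda>x. sinT (U \<tau>) x - sinT (U t) x) = (2 * pi) ^ DIM('a) * sqrt (LINT \<xi>|lborel. (1 + (norm \<xi>)\<^sup>2) powr s * (norm (V \<tau> \<xi>))\<^sup>2)" for \<tau>
    using Hs_sinT(2)[OF continuous_on_slice(1)[OF contV] r s decV oddV]
    by (simp add: sinT_diff[OF i i] V_def)
  have "continuous_on UNIV (\<lambda>\<tau>. (2 * pi) ^ DIM('a) * sqrt (LINT \<xi>|lborel. (1 + (norm \<xi>)\<^sup>2) powr s * (norm (V \<tau> \<xi>))\<^sup>2))"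
    by (intro continuous_intros continuous_on_weighted_square[OF contV r s decV])
  then have "((\<lambda>\<tau>. (2 * pi) ^ DIM('a) * sqrt (LINT \<xi>|lborel. (1 + (norm \<xi>)\<^sup>2) powr s * (norm (V \<tau> \<xi>))\<^sup>2)) \<longlongrightarrow>
      (2 * pi) ^ DIM('a) * sqrt (LINT \<xi>|lborel. (1 + (norm \<xi>)\<^sup>2) powr s * (norm (V t \<xi>))\<^sup>2)) (at t)"
    by (simp add: continuous_on_def)
  then have "((\<lambda>\<tau>. (2 * pi) ^ DIM('a) * sqrt (LINT \<xi>|lborel. (1 + (norm \<xi>)\<^sup>2) powr s * (norm (V \<tau> \<xi>))\<^sup>2)) \<longlongrightarrow> 0) (at t)"
    by (simp add: V_def)
  then show "((\<lambda>\<tau>. Hs_norm s (\<lambda>x. sinT (U \<tau>) x - sinT (U t) x)) \<longlongrightarrow> 0) (at t within {0..T})"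
    unfolding N by (rule tendsto_within_subset) simp
qed

subsection \<open>Test functions and integration by parts\<close>

lemma smooth_fun_differentiable: "smooth_fun f \<Longrightarrow> f differentiable at z"
  by (erule smooth_fun.cases) auto

lemma smooth_fun_dderiv: "smooth_fun f \<Longrightarrow> smooth_fun (dderiv e f)"
  by (erule smooth_fun.cases) auto

lemma smooth_fun_continuous: "smooth_fun f \<Longrightarrow> continuous_on UNIV f"
  by (intro continuous_at_imp_continuous_on ballI differentiable_imp_continuous_within smooth_fun_differentiable)

lemma dderiv_has_real_derivative:
  assumes "f differentiable at z"
  shows "((\<lambda>h. f (z + h *\<^sub>R e)) has_real_derivative dderiv e f z) (at 0)"
proof -
  have f: "(f has_derivative frechet_derivative f (at z)) (at (z + 0 *\<^sub>R e))"
    using assms frechet_derivative_works by force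
  have "((\<lambda>h. z + h *\<^sub>R e) has_derivative (\<lambda>h. h *\<^sub>R e)) (at 0)"
    by (auto intro!: derivative_eq_intros)
  then have "((\<lambda>h. f (z + h *\<^sub>R e)) has_derivative (\<lambda>h. frechet_derivative f (at z) (h *\<^sub>R e))) (at 0)"
    by (rule has_derivative_compose[of "\<lambda>h. z + h *\<^sub>R e" "\<lambda>h. h *\<^sub>R e" 0 UNIV f, OF _ f])
  moreover have "frechet_derivative f (at z) (h *\<^sub>R e) = dderiv e f z * h" for h
    using linear_frechet_derivative[OF assms] by (simp add: linear_cmul)
  ultimately show ?thesis by (simp add: has_field_derivative_def)
qed

lemma has_real_derivative_locally_0:
  assumes "(f has_real_derivative D) (at 0)" "\<forall>\<^sub>F h in nhds 0. f h = (0::real)"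
  shows "D = 0"
proof -
  have "((\<lambda>_. 0) has_real_derivative D) (at 0)"
    using assms(1) by (subst DERIV_cong_ev[OF refl _ refl, of _ f]) (use assms(2) in \<open>auto elim: eventually_mono\<close>)
  then show ?thesis using DERIV_const DERIV_unique by blast
qed

lemma eventually_line_notin:
  assumes "closed K" "z \<notin> K"
  shows "\<forall>\<^sub>F h in nhds 0. z + h *\<^sub>R e \<notin> (K :: 'a::real_normed_vector set)"
proof -
  have "continuous_on UNIV (\<lambda>h. z + h *\<^sub>R e)" by (intro continuous_intros)
  then have "open ((\<lambda>h. z + h *\<^sub>R e) -` (- K))" using assms by (intro open_vimage) auto
  then show ?thesis
    unfolding eventually_nhds by (intro exI[of _ "(\<lambda>h. z + h *\<^sub>R e) -` (- K)"]) (use assms in simp)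
qed

lemma test_fun_support:
  assumes "test_fun \<Omega> \<phi>"
  obtains K where "compact K" "K \<subseteq> \<Omega>" "\<And>z. z \<notin> K \<Longrightarrow> \<phi> z = 0"
proof (rule that)
  show "compact (closure {z. \<phi> z \<noteq> 0})" "closure {z. \<phi> z \<noteq> 0} \<subseteq> \<Omega>" using assms by (auto simp: test_fun_def)
  show "z \<notin> closure {z. \<phi> z \<noteq> 0} \<Longrightarrow> \<phi> z = 0" for z using closure_subset[of "{z. \<phi> z \<noteq> 0}"] by blast
qed

lemma test_fun_dderiv:
  assumes "test_fun \<Omega> \<phi>" shows "test_fun \<Omega> (dderiv e \<phi>)"
proof -
  let ?K = "closure {z. \<phi> z \<noteq> 0}"
  have s: "smooth_fun \<phi>" and K: "compact ?K" "?K \<subseteq> \<Omega>" using assms by (auto simp: test_fun_def)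
  have "dderiv e \<phi> z = 0" if z: "z \<notin> ?K" for z
  proof (rule has_real_derivative_locally_0[OF dderiv_has_real_derivative[OF smooth_fun_differentiable[OF s]]])
    show "\<forall>\<^sub>F h in nhds 0. \<phi> (z + h *\<^sub>R e) = 0"
      using eventually_line_notin[OF closed_closure z, of e]
      by eventually_elim (use closure_subset[of "{z. \<phi> z \<noteq> 0}"] in blast)
  qed
  then have "{z. dderiv e \<phi> z \<noteq> 0} \<subseteq> ?K" by blast
  then have sub: "closure {z. dderiv e \<phi> z \<noteq> 0} \<subseteq> ?K" by (simp add: closure_minimal)
  then have "compact (closure {z. dderiv e \<phi> z \<noteq> 0})"
    using K(1) by (metis closed_closure compact_Int_closed inf.absorb_iff2)
  then show ?thesis using sub K smooth_fun_dderiv[OF s] by (auto simp: test_fun_def)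
qed

lemma test_fun_continuous: "test_fun \<Omega> \<phi> \<Longrightarrow> continuous_on UNIV \<phi>"
  by (simp add: test_fun_def smooth_fun_continuous)

lemma test_fun_bounded:
  assumes "test_fun \<Omega> \<phi>" obtains M where "\<And>z. \<bar>\<phi> z\<bar> \<le> M"
proof -
  obtain K where K: "compact K" "\<And>z. z \<notin> K \<Longrightarrow> \<phi> z = 0" using test_fun_support[OF assms] by metis
  have "compact (\<phi> ` K)" by (rule compact_continuous_image[OF continuous_on_subset[OF test_fun_continuous[OF assms]] K(1)]) simp
  then obtain M where M: "\<And>y. y \<in> \<phi> ` K \<Longrightarrow> \<bar>y\<bar> \<le> M"
    using compact_imp_bounded bounded_real by (metis)
  have "\<bar>\<phi> z\<bar> \<le> max M 0" for z using M[of "\<phi> z"] K(2)[of z] by (cases "z \<in> K") auto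
  then show thesis by (rule that)
qed

lemma integrable_compact_support:
  fixes f :: "'a::euclidean_space \<Rightarrow> real"
  assumes K: "compact K" and m: "f \<in> borel_measurable borel" and b: "\<And>z. \<bar>f z\<bar> \<le> M" and z: "\<And>z. z \<notin> K \<Longrightarrow> f z = 0"
  shows "integrable lborel f"
proof (rule integrable_dominated)
  have "integrable lborel (indicator K :: 'a \<Rightarrow> real)"
    by (rule integrable_real_indicator) (use emeasure_compact_finite[OF K] compact_imp_closed[OF K] in auto)
  then show "integrable lborel (\<lambda>x. \<bar>M\<bar> * indicator K x)" by simp
  show "norm (f x) \<le> \<bar>M\<bar> * indicator K x" for x
    using b[of x] z[of x] by (auto simp: indicator_def)
qed (use m in simp)

lemma test_fun_integrable:
  assumes "test_fun \<Omega> (\<phi> :: 'a::euclidean_space \<Rightarrow> real)" shows "integrable lborel \<phi>"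
proof -
  obtain K where K: "compact K" "\<And>z. z \<notin> K \<Longrightarrow> \<phi> z = 0" using test_fun_support[OF assms] by metis
  obtain M where M: "\<And>z. \<bar>\<phi> z\<bar> \<le> M" using test_fun_bounded[OF assms] by metis
  show ?thesis
    by (rule integrable_compact_support[OF K(1) _ M K(2)]) (rule borel_measurable_continuous_onI[OF test_fun_continuous[OF assms]])
qed

text \<open>The difference quotients have integral zero by translation invariance.\<close>

lemma integral_directional_derivative_eq_0:
  fixes F F' :: "'a::euclidean_space \<Rightarrow> real"
  assumes d: "\<And>z. ((\<lambda>h. F (z + h *\<^sub>R e)) has_real_derivative F' z) (at 0)"
    and m[measurable]: "F \<in> borel_measurable borel" "F' \<in> borel_measurable borel"
    and b: "\<And>z. \<bar>F z\<bar> \<le> M" "\<And>z. \<bar>F' z\<bar> \<le> M'" and K: "compact K" "\<And>z. z \<notin> K \<Longrightarrow> F z = 0"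
  shows "(LINT z|lborel. F' z) = 0"
proof -
  have dh: "((\<lambda>h. F (z + h *\<^sub>R e)) has_real_derivative F' (z + k *\<^sub>R e)) (at k)" for z k
    using d[of "z + k *\<^sub>R e"] DERIV_shift[of "\<lambda>h. F (z + h *\<^sub>R e)" "F' (z + k *\<^sub>R e)" 0 k]
    by (simp add: algebra_simps)
  have Fi: "integrable lborel F" by (rule integrable_compact_support[OF K(1) m(1) b(1) K(2)])
  define h where "h n = inverse (real (Suc n))" for n
  have h: "h n > 0" "h n \<le> 1" for n by (auto simp: h_def inverse_le_1_iff)
  have h0: "h \<longlonglongrightarrow> 0" unfolding h_def by (rule LIMSEQ_inverse_real_of_nat)
  define q where "q n z = (F (h n *\<^sub>R e + z) - F z) / h n" for n z
  obtain R where R: "\<And>z. z \<in> K \<Longrightarrow> norm z \<le> R"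
    using compact_imp_bounded[OF K(1)] unfolding bounded_iff by metis
  have q0: "(LINT z|lborel. q n z) = 0" for n
    unfolding q_def using Fi by (simp add: integral_lborel_translate integrable_lborel_translate)
  \<comment> \<open>For steps of length at most 1 the difference quotients vanish outside the ball
    of radius R + |e|, and the mean value theorem bounds them by M'; this gives a common
    majorant.\<close>
  have "(\<lambda>n. LINT z|lborel. q n z) \<longlonglongrightarrow> (LINT z|lborel. F' z)"
  proof (rule integral_dominated_convergence[where w="\<lambda>z. M' * indicator (cball 0 (R + norm e)) z"])
    have "integrable lborel (indicator (cball 0 (R + norm e)) :: 'a \<Rightarrow> real)"
      by (rule integrable_real_indicator) (use emeasure_compact_finite[of "cball (0::'a) (R + norm e)"] in auto)
    then show "integrable lborel (\<lambda>z::'a. M' * indicator (cball 0 (R + norm e)) z)" by simp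
    show "AE z in lborel. (\<lambda>n. q n z) \<longlonglongrightarrow> F' z"
    proof (rule AE_I2)
      fix z
      have "((\<lambda>k. (F (z + k *\<^sub>R e) - F z) / k) \<longlongrightarrow> F' z) (at 0)"
        using d[of z] unfolding DERIV_def by simp
      moreover have "filterlim h (at 0) sequentially"
        unfolding filterlim_at using h0 h(1) by (simp add: less_imp_neq[symmetric])
      ultimately have "(\<lambda>n. (F (z + h n *\<^sub>R e) - F z) / h n) \<longlonglongrightarrow> F' z"
        by (rule filterlim_compose)
      then show "(\<lambda>n. q n z) \<longlonglongrightarrow> F' z" by (simp add: q_def add.commute)
    qed
    show "AE z in lborel. norm (q n z) \<le> M' * indicator (cball 0 (R + norm e)) z" for n
    proof (rule AE_I2)
      fix z :: 'a
      have "\<exists>k. 0 < k \<and> k < h n \<and> F (z + h n *\<^sub>R e) - F (z + 0 *\<^sub>R e) = (h n - 0) * F' (z + k *\<^sub>R e)"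
        using MVT2[OF h(1)[of n], of "\<lambda>k. F (z + k *\<^sub>R e)" "\<lambda>k. F' (z + k *\<^sub>R e)"] dh by blast
      then obtain k where k: "q n z = F' (z + k *\<^sub>R e)" using h(1)[of n] by (auto simp: q_def add.commute)
      show "norm (q n z) \<le> M' * indicator (cball 0 (R + norm e)) z"
      proof (cases "z \<in> cball 0 (R + norm e)")
        case True then show ?thesis using b(2) k by simp
      next
        case False
        have "z \<notin> K" using False R[of z] norm_ge_zero[of e] by (auto simp del: norm_ge_zero)
        moreover have "h n *\<^sub>R e + z \<notin> K"
        proof
          assume "h n *\<^sub>R e + z \<in> K"
          then have "norm (h n *\<^sub>R e + z) \<le> R" by (rule R)
          moreover have "norm z \<le> norm (h n *\<^sub>R e + z) + norm (h n *\<^sub>R e)"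
            using norm_triangle_ineq4[of "h n *\<^sub>R e + z" "h n *\<^sub>R e"] by simp
          moreover have "norm (h n *\<^sub>R e) \<le> norm e" using h[of n] by (simp add: mult_left_le_one_le)
          ultimately show False using False by simp
        qed
        ultimately show ?thesis using K(2) False by (simp add: q_def)
      qed
    qed
    show "q n \<in> borel_measurable lborel" for n unfolding q_def by measurable
  qed measurable
  then show ?thesis unfolding q0 using LIMSEQ_const_iff LIMSEQ_unique tendsto_const by metis
qed

text \<open>The derivative of the product \<phi> E integrates to zero. Differentiability of E is
  asked on \<Omega> only, because the amplitudes satisfy their differential equations on an open
  time interval.\<close>

lemma integral_by_parts_test:
  fixes E E' :: "'a::euclidean_space \<Rightarrow> real"
  assumes \<phi>: "test_fun \<Omega> \<phi>"
    and d: "\<And>z. z \<in> \<Omega> \<Longrightarrow> ((\<lambda>h. E (z + h *\<^sub>R e)) has_real_derivative E' z) (at 0)"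
    and m[measurable]: "E \<in> borel_measurable borel" "E' \<in> borel_measurable borel"
    and b: "\<And>z. \<bar>E z\<bar> \<le> M" "\<And>z. z \<in> \<Omega> \<Longrightarrow> \<bar>E' z\<bar> \<le> M'"
  shows "(LINT z|lborel. dderiv e \<phi> z * E z) = - (LINT z|lborel. \<phi> z * E' z)"
proof -
  note \<phi>' = test_fun_dderiv[OF \<phi>, of e]
  have s: "smooth_fun \<phi>" and K: "compact (closure {z. \<phi> z \<noteq> 0})" "closure {z. \<phi> z \<noteq> 0} \<subseteq> \<Omega>"
    using \<phi> by (auto simp: test_fun_def)
  let ?K = "closure {z. \<phi> z \<noteq> 0}"
  have \<phi>K: "\<phi> z = 0" if "z \<notin> ?K" for z using that closure_subset[of "{z. \<phi> z \<noteq> 0}"] by blast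
  have \<phi>K': "dderiv e \<phi> z = 0" if "z \<notin> ?K" for z
  proof (rule has_real_derivative_locally_0[OF dderiv_has_real_derivative[OF smooth_fun_differentiable[OF s]]])
    show "\<forall>\<^sub>F h in nhds 0. \<phi> (z + h *\<^sub>R e) = 0"
      using eventually_line_notin[OF closed_closure that, of e] by eventually_elim (rule \<phi>K)
  qed
  have cm[measurable]: "\<phi> \<in> borel_measurable borel" "dderiv e \<phi> \<in> borel_measurable borel"
    using test_fun_continuous[OF \<phi>] test_fun_continuous[OF \<phi>'] by (auto intro: borel_measurable_continuous_onI)
  obtain N where N: "\<And>z. \<bar>\<phi> z\<bar> \<le> N" using test_fun_bounded[OF \<phi>] by metis
  obtain N' where N': "\<And>z. \<bar>dderiv e \<phi> z\<bar> \<le> N'" using test_fun_bounded[OF \<phi>'] by metis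
  have M0: "M \<ge> 0" "N \<ge> 0" "N' \<ge> 0" using order_trans[OF abs_ge_zero b(1)] order_trans[OF abs_ge_zero N] order_trans[OF abs_ge_zero N'] by auto
  let ?F = "\<lambda>z. \<phi> z * E z"
  let ?F' = "\<lambda>z. dderiv e \<phi> z * E z + \<phi> z * E' z"
  have b1: "\<bar>dderiv e \<phi> z * E z\<bar> \<le> N' * M" for z
    unfolding abs_mult by (intro mult_mono N' b M0) auto
  have b2: "\<bar>\<phi> z * E' z\<bar> \<le> N * \<bar>M'\<bar>" for z
  proof (cases "z \<in> ?K")
    case True then show ?thesis unfolding abs_mult using b(2)[of z] K by (intro mult_mono N M0) auto
  next
    case False
    then have "\<phi> z = 0" by (rule \<phi>K)
    then show ?thesis using M0 by simp
  qed
  have i1: "integrable lborel (\<lambda>z. dderiv e \<phi> z * E z)"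
    by (rule integrable_compact_support[OF K(1) borel_measurable_times[OF cm(2) m(1)] b1]) (drule \<phi>K', simp only: mult_zero_left)
  have i2: "integrable lborel (\<lambda>z. \<phi> z * E' z)"
    by (rule integrable_compact_support[OF K(1) borel_measurable_times[OF cm(1) m(2)] b2]) (drule \<phi>K, simp only: mult_zero_left)
  have "(LINT z|lborel. ?F' z) = 0"
  proof (rule integral_directional_derivative_eq_0[of ?F e _ "N * M" "N' * M + N * \<bar>M'\<bar>" ?K])
    fix z
    show "((\<lambda>h. ?F (z + h *\<^sub>R e)) has_real_derivative ?F' z) (at 0)"
    proof (cases "z \<in> ?K")
      case True
      then have "z \<in> \<Omega>" using K(2) by (rule rev_subsetD)
      have "((\<lambda>h. ?F (z + h *\<^sub>R e)) has_real_derivative dderiv e \<phi> z * E (z + 0 *\<^sub>R e) + E' z * \<phi> (z + 0 *\<^sub>R e)) (at 0)"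
        by (rule DERIV_mult[OF dderiv_has_real_derivative[OF smooth_fun_differentiable[OF s]] d[OF \<open>z \<in> \<Omega>\<close>]])
      then show ?thesis by (simp only: scaleR_zero_left add_0_right mult.commute[of "E' z"])
    next
      \<comment> \<open>Off the closed support the product vanishes along a short piece of the line
        through z, whatever E does there.\<close>
      case False
      have F': "?F' z = 0" unfolding \<phi>K[OF False] \<phi>K'[OF False] by (simp only: mult_zero_left add_0_right)
      have "\<forall>\<^sub>F h in nhds 0. 0 = ?F (z + h *\<^sub>R e)"
        using eventually_line_notin[OF closed_closure False, of e] by eventually_elim (drule \<phi>K, simp only: mult_zero_left)
      from DERIV_cong_ev[OF refl this refl, THEN iffD1, OF DERIV_const]
      show ?thesis unfolding F' .
    qed
    show "\<bar>?F z\<bar> \<le> N * M" unfolding abs_mult by (intro mult_mono N b M0) auto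
    show "\<bar>?F' z\<bar> \<le> N' * M + N * \<bar>M'\<bar>" by (rule order_trans[OF abs_triangle_ineq add_mono[OF b1 b2]])
    show "compact ?K" by (rule K)
    show "z \<notin> ?K \<Longrightarrow> ?F z = 0" by (drule \<phi>K, simp only: mult_zero_left)
    show "?F \<in> borel_measurable borel" by (rule borel_measurable_times[OF cm(1) m(1)])
    show "?F' \<in> borel_measurable borel"
      by (rule borel_measurable_add[OF borel_measurable_times[OF cm(2) m(1)] borel_measurable_times[OF cm(1) m(2)]])
  qed
  then show ?thesis using i1 i2 by simp
qed

subsection \<open>Testing sine and cosine transforms\<close>

lemma borel_measurable_LINT:
  fixes K :: "'z::euclidean_space \<times> 'a::euclidean_space \<Rightarrow> real"
  assumes "K \<in> borel_measurable borel"
  shows "(\<lambda>z. LINT \<xi>|lborel. K (z, \<xi>)) \<in> borel_measurable borel"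
proof -
  have "(\<lambda>(z, \<xi>). K (z, \<xi>)) \<in> borel_measurable (borel \<Otimes>\<^sub>M lborel)"
    using assms by (simp add: borel_prod[symmetric] cong: measurable_cong_sets)
  then show ?thesis by (rule lborel.borel_measurable_lebesgue_integral)
qed

lemma
  fixes K :: "'z::euclidean_space \<times> 'a::euclidean_space \<Rightarrow> real"
  assumes \<psi>: "integrable lborel \<psi>" and m: "K \<in> borel_measurable borel"
    and b: "\<And>z \<xi>. \<bar>K (z, \<xi>)\<bar> \<le> g \<xi>" and g: "integrable lborel g"
  shows integrable_test: "integrable lborel (\<lambda>z. \<psi> z * (LINT \<xi>|lborel. K (z, \<xi>)))"
    and Fubini_test: "(LINT z|lborel. \<psi> z * (LINT \<xi>|lborel. K (z, \<xi>))) = (LINT \<xi>|lborel. LINT z|lborel. \<psi> z * K (z, \<xi>))"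
proof -
  let ?k = "\<lambda>w. \<psi> (fst w) * K w"
  have \<psi>m: "\<psi> \<in> borel_measurable borel" using \<psi> by auto
  have fm: "(\<lambda>w::'z\<times>'a. \<psi> (fst w)) \<in> borel_measurable borel"
    by (rule measurable_compose[OF _ \<psi>m]) (intro borel_measurable_continuous_onI continuous_intros)
  have "integrable (lborel \<Otimes>\<^sub>M lborel) ?k"
  proof (rule integrable_pair_bound[OF integrable_norm[OF \<psi>] g])
    show "?k \<in> borel_measurable borel" by (rule borel_measurable_times[OF fm m])
    show "norm (?k (z, \<xi>)) \<le> norm (\<psi> z) * g \<xi>" for z \<xi>
      using b by (simp add: abs_mult mult_left_mono)
  qed
  moreover have "?k = (\<lambda>(z, \<xi>). \<psi> z * K (z, \<xi>))" by (simp add: fun_eq_iff)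
  ultimately have k: "integrable (lborel \<Otimes>\<^sub>M lborel) (\<lambda>(z, \<xi>). \<psi> z * K (z, \<xi>))" by simp
  show "integrable lborel (\<lambda>z. \<psi> z * (LINT \<xi>|lborel. K (z, \<xi>)))"
    using lborel_pair.integrable_fst'[OF k] by simp
  show "(LINT z|lborel. \<psi> z * (LINT \<xi>|lborel. K (z, \<xi>))) = (LINT \<xi>|lborel. LINT z|lborel. \<psi> z * K (z, \<xi>))"
    using lborel_pair.Fubini_integral[OF k] by simp
qed

text \<open>One statement covers two situations: P is the identity for fields on space, and
  \<open>snd\<close> for fields on space-time, where H may depend on time as long as it is constant
  along e. The derivative then falls on the trigonometric factor alone, frequency by frequency, and
  Fubini's theorem restores the frequency integral.\<close>

lemma
  fixes H :: "'z::euclidean_space \<Rightarrow> 'a::euclidean_space \<Rightarrow> real" and P :: "'z \<Rightarrow> 'a"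
  assumes \<phi>: "test_fun \<Omega> \<phi>" and P: "bounded_linear P"
    and H: "(\<lambda>w. H (fst w) (snd w)) \<in> borel_measurable borel"
    and inv: "\<And>z h \<xi>. H (z + h *\<^sub>R e) \<xi> = H z \<xi>"
    and b: "\<And>z \<xi>. \<bar>H z \<xi>\<bar> \<le> g \<xi>" and g: "integrable lborel g"
    and b': "\<And>z \<xi>. \<bar>(P e \<bullet> \<xi>) * H z \<xi>\<bar> \<le> g' \<xi>" and g': "integrable lborel g'"
  shows test_sin: "(LINT z|lborel. dderiv e \<phi> z * (LINT \<xi>|lborel. sin (P z \<bullet> \<xi>) * H z \<xi>))
      = - (LINT z|lborel. \<phi> z * (LINT \<xi>|lborel. cos (P z \<bullet> \<xi>) * ((P e \<bullet> \<xi>) * H z \<xi>)))"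
    and test_cos: "(LINT z|lborel. dderiv e \<phi> z * (LINT \<xi>|lborel. cos (P z \<bullet> \<xi>) * H z \<xi>))
      = (LINT z|lborel. \<phi> z * (LINT \<xi>|lborel. sin (P z \<bullet> \<xi>) * ((P e \<bullet> \<xi>) * H z \<xi>)))"
proof -
  note \<phi>i = test_fun_integrable[OF \<phi>] and \<phi>'i = test_fun_integrable[OF test_fun_dderiv[OF \<phi>]]
  have Pc: "continuous_on UNIV (\<lambda>w::'z\<times>'a. P (fst w))"
    by (rule bounded_linear.continuous_on[OF P]) (intro continuous_intros)
  have sc: "(\<lambda>w. sin (P (fst w) \<bullet> snd w)) \<in> borel_measurable borel" "(\<lambda>w. cos (P (fst w) \<bullet> snd w)) \<in> borel_measurable borel"
    "(\<lambda>w::'z\<times>'a. P e \<bullet> snd w) \<in> borel_measurable borel"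
    by (intro borel_measurable_continuous_onI continuous_intros Pc)+
  have b1: "\<bar>sin a * x\<bar> \<le> y" "\<bar>cos a * x\<bar> \<le> y" if "\<bar>x\<bar> \<le> y" for a x y :: real
    using that abs_sin_le_one[of a] abs_cos_le_one[of a] by (auto simp: abs_mult intro: order_trans[OF mult_left_le_one_le])
  have Hz: "(\<lambda>z. H z \<xi>) \<in> borel_measurable borel" for \<xi>
    using measurable_compose[of "\<lambda>z. (z, \<xi>)" borel borel "\<lambda>w. H (fst w) (snd w)", OF _ H]
    by (simp add: borel_measurable_continuous_onI continuous_intros)
  have pz: "(\<lambda>z. sin (P z \<bullet> \<xi>)) \<in> borel_measurable borel" "(\<lambda>z. cos (P z \<bullet> \<xi>)) \<in> borel_measurable borel" for \<xi>
    by (intro borel_measurable_continuous_onI continuous_intros bounded_linear.continuous_on[OF P])+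
  have ph: "((\<lambda>h. P (z + h *\<^sub>R e) \<bullet> \<xi>) has_real_derivative (P e \<bullet> \<xi>)) (at 0)" for z \<xi>
  proof -
    have "P (z + h *\<^sub>R e) \<bullet> \<xi> = P z \<bullet> \<xi> + h * (P e \<bullet> \<xi>)" for h
      using P by (simp add: bounded_linear.linear linear_add linear_cmul inner_add_left)
    then show ?thesis by (auto intro!: derivative_eq_intros)
  qed
  have P0: "P (z + 0 *\<^sub>R e) = P z" for z by simp
  have s: "(LINT z|lborel. dderiv e \<phi> z * (sin (P z \<bullet> \<xi>) * H z \<xi>)) = - (LINT z|lborel. \<phi> z * (cos (P z \<bullet> \<xi>) * ((P e \<bullet> \<xi>) * H z \<xi>)))" for \<xi>
  proof (rule integral_by_parts_test[OF \<phi>])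
    fix z show "((\<lambda>h. sin (P (z + h *\<^sub>R e) \<bullet> \<xi>) * H (z + h *\<^sub>R e) \<xi>) has_real_derivative cos (P z \<bullet> \<xi>) * ((P e \<bullet> \<xi>) * H z \<xi>)) (at 0)"
      unfolding inv by (auto intro!: derivative_eq_intros ph)
  qed (auto intro!: borel_measurable_times Hz pz b1[OF b] b1[OF b'])
  have c: "(LINT z|lborel. dderiv e \<phi> z * (cos (P z \<bullet> \<xi>) * H z \<xi>)) = - (LINT z|lborel. \<phi> z * (- (sin (P z \<bullet> \<xi>) * ((P e \<bullet> \<xi>) * H z \<xi>))))" for \<xi>
  proof (rule integral_by_parts_test[OF \<phi>])
    fix z show "((\<lambda>h. cos (P (z + h *\<^sub>R e) \<bullet> \<xi>) * H (z + h *\<^sub>R e) \<xi>) has_real_derivative - (sin (P z \<bullet> \<xi>) * ((P e \<bullet> \<xi>) * H z \<xi>))) (at 0)"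
      unfolding inv by (auto intro!: derivative_eq_intros ph)
    show "\<bar>- (sin (P z \<bullet> \<xi>) * ((P e \<bullet> \<xi>) * H z \<xi>))\<bar> \<le> g' \<xi>" unfolding abs_minus by (rule b1[OF b'])
  qed (auto intro!: borel_measurable_times borel_measurable_uminus Hz pz b1[OF b])
  show "(LINT z|lborel. dderiv e \<phi> z * (LINT \<xi>|lborel. sin (P z \<bullet> \<xi>) * H z \<xi>))
      = - (LINT z|lborel. \<phi> z * (LINT \<xi>|lborel. cos (P z \<bullet> \<xi>) * ((P e \<bullet> \<xi>) * H z \<xi>)))"
    using Fubini_test[OF \<phi>'i borel_measurable_times[OF sc(1) H] _ g] Fubini_test[OF \<phi>i borel_measurable_times[OF sc(2) borel_measurable_times[OF sc(3) H]] _ g']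
    by (simp add: b1 b b' s)
  show "(LINT z|lborel. dderiv e \<phi> z * (LINT \<xi>|lborel. cos (P z \<bullet> \<xi>) * H z \<xi>))
      = (LINT z|lborel. \<phi> z * (LINT \<xi>|lborel. sin (P z \<bullet> \<xi>) * ((P e \<bullet> \<xi>) * H z \<xi>)))"
    using Fubini_test[OF \<phi>'i borel_measurable_times[OF sc(2) H] _ g] Fubini_test[OF \<phi>i borel_measurable_times[OF sc(1) borel_measurable_times[OF sc(3) H]] _ g']
    by (simp add: b1 b b' c)
qed

text \<open>The time direction is the complementary case: the trigonometric factor is constant and
  the derivative falls on the amplitude.\<close>

lemma test_time:
  fixes U :: "real \<Rightarrow> 'a::euclidean_space \<Rightarrow> real"
  assumes \<phi>: "test_fun ({0<..<T} \<times> UNIV) \<phi>"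
    and U: "(\<lambda>w. U (fst w) (snd w)) \<in> borel_measurable borel" and U': "(\<lambda>w. U' (fst w) (snd w)) \<in> borel_measurable borel"
    and d: "\<And>t \<xi>. 0 < t \<Longrightarrow> t < T \<Longrightarrow> ((\<lambda>t. U t \<xi>) has_real_derivative U' t \<xi>) (at t)"
    and b: "\<And>t \<xi>. \<bar>U t \<xi>\<bar> \<le> g \<xi>" and g: "integrable lborel g"
    and b': "\<And>t \<xi>. \<bar>U' t \<xi>\<bar> \<le> g' \<xi>" and g': "integrable lborel g'"
  shows "(LINT z|lborel. dderiv (1, 0) \<phi> z * (LINT \<xi>|lborel. sin (snd z \<bullet> \<xi>) * U (fst z) \<xi>))
      = - (LINT z|lborel. \<phi> z * (LINT \<xi>|lborel. sin (snd z \<bullet> \<xi>) * U' (fst z) \<xi>))"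
proof -
  note \<phi>i = test_fun_integrable[OF \<phi>] and \<phi>'i = test_fun_integrable[OF test_fun_dderiv[OF \<phi>]]
  have sc: "(\<lambda>w::(real \<times> 'a) \<times> 'a. sin (snd (fst w) \<bullet> snd w)) \<in> borel_measurable borel"
    by (intro borel_measurable_continuous_onI continuous_intros)
  have b1: "\<bar>sin a * x\<bar> \<le> y" if "\<bar>x\<bar> \<le> y" for a x y :: real
    using that abs_sin_le_one[of a] by (auto simp: abs_mult intro: order_trans[OF mult_left_le_one_le])
  have Uw: "(\<lambda>w::(real \<times> 'a) \<times> 'a. H (fst (fst w)) (snd w)) \<in> borel_measurable borel" "(\<lambda>z::real \<times> 'a. H (fst z) \<xi>) \<in> borel_measurable borel"
    if H: "(\<lambda>w. H (fst w) (snd w)) \<in> borel_measurable borel" for H :: "real \<Rightarrow> 'a \<Rightarrow> real" and \<xi>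
    using measurable_compose[of "\<lambda>w::(real \<times> 'a) \<times> 'a. (fst (fst w), snd w)" borel borel "\<lambda>w. H (fst w) (snd w)", OF _ H]
      measurable_compose[of "\<lambda>z::real \<times> 'a. (fst z, \<xi>)" borel borel "\<lambda>w. H (fst w) (snd w)", OF _ H]
    by (simp_all add: borel_measurable_continuous_onI continuous_intros)
  have pz: "(\<lambda>z::real\<times>'a. sin (snd z \<bullet> \<xi>)) \<in> borel_measurable borel" for \<xi>
    by (intro borel_measurable_continuous_onI continuous_intros)
  have s: "(LINT z|lborel. dderiv (1, 0) \<phi> z * (sin (snd z \<bullet> \<xi>) * U (fst z) \<xi>)) = - (LINT z|lborel. \<phi> z * (sin (snd z \<bullet> \<xi>) * U' (fst z) \<xi>))" for \<xi>
  proof (rule integral_by_parts_test[OF \<phi>])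
    fix z :: "real \<times> 'a" assume "z \<in> {0<..<T} \<times> UNIV"
    then have "((\<lambda>t. U t \<xi>) has_real_derivative U' (fst z) \<xi>) (at (0 + fst z))" by (auto intro: d)
    then have "((\<lambda>h. U (fst z + h) \<xi>) has_real_derivative U' (fst z) \<xi>) (at 0)"
      unfolding DERIV_shift[of "\<lambda>t. U t \<xi>"] by (simp add: add.commute)
    then show "((\<lambda>h. sin (snd (z + h *\<^sub>R (1, 0)) \<bullet> \<xi>) * U (fst (z + h *\<^sub>R (1, 0))) \<xi>) has_real_derivative sin (snd z \<bullet> \<xi>) * U' (fst z) \<xi>) (at 0)"
      by (auto intro!: DERIV_cmult)
  qed (auto intro!: borel_measurable_times Uw(2)[OF U] Uw(2)[OF U'] pz b1[OF b] b1[OF b'])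
  show ?thesis
    using Fubini_test[OF \<phi>'i borel_measurable_times[OF sc Uw(1)[OF U]] _ g] Fubini_test[OF \<phi>i borel_measurable_times[OF sc Uw(1)[OF U']] _ g']
    by (simp add: b1 b b' s)
qed

text \<open>Links the iterated integrals in the definition of a weak solution with space-time
  integrals, in which integration by parts is carried out.\<close>

lemma iterated_LINT:
  fixes F :: "real \<times> 'a::euclidean_space \<Rightarrow> real"
  assumes F: "integrable lborel F" and z: "\<And>t x. t \<notin> {0<..<T} \<Longrightarrow> F (t, x) = 0"
  shows "(LINT t:{0<..<T}|lborel. LINT x|lborel. F (t, x)) = (LINT z|lborel. F z)"
proof -
  have "(LINT t:{0<..<T}|lborel. LINT x|lborel. F (t, x)) = (LINT t|lborel. LINT x|lborel. F (t, x))"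
    unfolding set_lebesgue_integral_def
  proof (intro Bochner_Integration.integral_cong refl)
    fix t show "indicator {0<..<T} t *\<^sub>R (LINT x|lborel. F (t, x)) = (LINT x|lborel. F (t, x))"
      by (cases "t \<in> {0<..<T}") (simp_all only: z indicator_simps scaleR_one scaleR_zero_left Bochner_Integration.integral_zero not_False_eq_True)
  qed
  also have "\<dots> = (LINT z|(lborel \<Otimes>\<^sub>M lborel). F z)"
    by (rule lborel_pair.integral_fst') (use F in \<open>simp add: lborel_prod\<close>)
  finally show ?thesis by (simp add: lborel_prod)
qed

subsection \<open>The bilinear term on the Fourier side\<close>

text \<open>The amplitude of (sinT U . grad) sinT B. The differentiated factor has frequency \<zeta>
  - \<eta>, but as U \<eta> is orthogonal to \<eta>, the output frequency \<zeta> can stand in its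
  place. The lost derivative is thus a factor \<zeta> outside the convolution, where the weights can
  absorb it.\<close>

definition adv :: "('a::euclidean_space \<Rightarrow> 'a) \<Rightarrow> ('a \<Rightarrow> 'b::euclidean_space) \<Rightarrow> 'a \<Rightarrow> 'b" where
  "adv U B \<zeta> = (LINT \<eta>|lborel. (\<zeta> \<bullet> U \<eta>) *\<^sub>R B (\<zeta> - \<eta>))"

text \<open>Half of the rate is kept as decay in the output frequency, the other half makes the
  convolution integral converge.\<close>

lemma exp_norm_conv:
  assumes "r \<ge> 0"
  shows "exp (- (r * norm (\<eta>::'a::real_normed_vector))) * exp (- (r * norm (\<zeta> - \<eta>))) \<le> exp (- (r/2 * norm \<zeta>)) * exp (- (r/2 * norm \<eta>))"
proof -
  have t: "norm \<zeta> \<le> norm \<eta> + norm (\<zeta> - \<eta>)" using norm_triangle_ineq[of \<eta> "\<zeta> - \<eta>"] by simp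
  have "r/2 * norm \<zeta> + r/2 * norm \<eta> \<le> r/2 * (norm \<eta> + norm (\<zeta> - \<eta>)) + r/2 * norm \<eta>"
    using assms t by (intro add_mono mult_left_mono) auto
  also have "\<dots> = r * norm \<eta> + r/2 * norm (\<zeta> - \<eta>)" by (simp add: algebra_simps)
  also have "\<dots> \<le> r * norm \<eta> + r * norm (\<zeta> - \<eta>)" using assms by (intro add_left_mono mult_right_mono) auto
  finally show ?thesis by (simp flip: exp_add)
qed

lemma adv_integrand_bound:
  assumes "norm (U \<eta>) \<le> C * exp (- (r * norm \<eta>))" "norm (B (\<zeta> - \<eta>)) \<le> C * exp (- (r * norm (\<zeta> - \<eta>)))" "r \<ge> 0"
  shows "norm ((\<zeta> \<bullet> U \<eta>) *\<^sub>R B (\<zeta> - \<eta>)) \<le> (C\<^sup>2 * norm \<zeta> * exp (- (r/2 * norm \<zeta>))) * exp (- (r/2 * norm \<eta>))"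
proof -
  have C0: "0 \<le> C" using order_trans[OF norm_ge_zero assms(1)] by (simp add: zero_le_mult_iff)
  have "norm ((\<zeta> \<bullet> U \<eta>) *\<^sub>R B (\<zeta> - \<eta>)) \<le> (norm \<zeta> * norm (U \<eta>)) * norm (B (\<zeta> - \<eta>))"
    by (simp add: Cauchy_Schwarz_ineq2 mult_right_mono)
  also have "\<dots> \<le> (norm \<zeta> * (C * exp (- (r * norm \<eta>)))) * (C * exp (- (r * norm (\<zeta> - \<eta>))))"
    using assms(1,2) C0 by (intro mult_mono mult_left_mono mult_nonneg_nonneg) auto
  also have "\<dots> = C\<^sup>2 * norm \<zeta> * (exp (- (r * norm \<eta>)) * exp (- (r * norm (\<zeta> - \<eta>))))"
    by (simp add: power2_eq_square mult_ac)
  also have "\<dots> \<le> C\<^sup>2 * norm \<zeta> * (exp (- (r/2 * norm \<zeta>)) * exp (- (r/2 * norm \<eta>)))"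
    by (intro mult_left_mono exp_norm_conv assms) auto
  finally show ?thesis by (simp add: mult.assoc)
qed

lemma borel_measurable_adv_integrand:
  fixes U :: "'a::euclidean_space \<Rightarrow> 'a" and B :: "'a \<Rightarrow> 'b::euclidean_space"
  assumes [measurable]: "U \<in> borel_measurable borel" "B \<in> borel_measurable borel"
  shows "(\<lambda>\<eta>. (\<zeta> \<bullet> U \<eta>) *\<^sub>R B (\<zeta> - \<eta>)) \<in> borel_measurable borel"
  by measurable

lemma
  assumes U: "continuous_on UNIV U" and B: "continuous_on UNIV B" and r: "r > 0"
    and decU: "\<And>\<xi>. norm (U \<xi>) \<le> C * exp (- (r * norm \<xi>))" and decB: "\<And>\<xi>. norm (B \<xi>) \<le> C * exp (- (r * norm \<xi>))"
  shows integrable_adv: "integrable lborel (\<lambda>\<eta>. (\<zeta> \<bullet> U \<eta>) *\<^sub>R B (\<zeta> - \<eta>))"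
    and norm_adv_le: "norm (adv U B \<zeta>) \<le> (C\<^sup>2 * (LINT \<eta>|lborel. exp (- (r/2 * norm (\<eta>::'a::euclidean_space))))) * (norm \<zeta> * exp (- (r/2 * norm (\<zeta>::'a))))"
proof -
  have m: "(\<lambda>\<eta>. (\<zeta> \<bullet> U \<eta>) *\<^sub>R B (\<zeta> - \<eta>)) \<in> borel_measurable lborel"
    using borel_measurable_adv_integrand[OF U[THEN borel_measurable_continuous_onI] B[THEN borel_measurable_continuous_onI]] by simp
  have i: "integrable lborel (\<lambda>\<eta>::'a. (C\<^sup>2 * norm \<zeta> * exp (- (r/2 * norm \<zeta>))) * exp (- (r/2 * norm \<eta>)))"
    by (intro integrable_mult_right integrable_exp_norm) (use r in auto)
  have le: "norm ((\<zeta> \<bullet> U \<eta>) *\<^sub>R B (\<zeta> - \<eta>)) \<le> (C\<^sup>2 * norm \<zeta> * exp (- (r/2 * norm \<zeta>))) * exp (- (r/2 * norm \<eta>))" for \<eta>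
    by (rule adv_integrand_bound[of U \<eta> C r B \<zeta>, OF decU decB]) (use r in auto)
  show "integrable lborel (\<lambda>\<eta>. (\<zeta> \<bullet> U \<eta>) *\<^sub>R B (\<zeta> - \<eta>))" by (rule integrable_dominated[OF i m le])
  have "norm (adv U B \<zeta>) \<le> (LINT \<eta>|lborel. (C\<^sup>2 * norm \<zeta> * exp (- (r/2 * norm \<zeta>))) * exp (- (r/2 * norm (\<eta>::'a))))"
    unfolding adv_def by (rule norm_integral_dominated[OF i m le])
  also have "\<dots> = (C\<^sup>2 * norm \<zeta> * exp (- (r/2 * norm \<zeta>))) * (LINT \<eta>|lborel. exp (- (r/2 * norm (\<eta>::'a))))"
    by (rule integral_mult_right_zero)
  finally show "norm (adv U B \<zeta>) \<le> (C\<^sup>2 * (LINT \<eta>|lborel. exp (- (r/2 * norm (\<eta>::'a))))) * (norm \<zeta> * exp (- (r/2 * norm \<zeta>)))"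
    by (simp add: mult_ac)
qed

lemma continuous_on_adv:
  fixes U :: "real \<Rightarrow> 'a::euclidean_space \<Rightarrow> 'a" and B :: "real \<Rightarrow> 'a \<Rightarrow> 'b::euclidean_space"
  assumes U: "continuous_on UNIV (\<lambda>z. U (fst z) (snd z))" and B: "continuous_on UNIV (\<lambda>z. B (fst z) (snd z))"
    and g: "integrable lborel g" "\<And>t \<xi>. norm (U t \<xi>) \<le> g \<xi>" and c: "\<And>t \<xi>. norm (B t \<xi>) \<le> c"
  shows "continuous_on UNIV (\<lambda>z. adv (U (fst z)) (B (fst z)) (snd z))"
  unfolding adv_def
proof (rule continuous_on_LINT)
  fix p :: "real \<times> 'a"
  show "(\<lambda>\<eta>. (snd p \<bullet> U (fst p) \<eta>) *\<^sub>R B (fst p) (snd p - \<eta>)) \<in> borel_measurable lborel"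
    using borel_measurable_adv_integrand[OF continuous_on_slice(1)[OF U, THEN borel_measurable_continuous_onI] continuous_on_slice(1)[OF B, THEN borel_measurable_continuous_onI]] by simp
  have "integrable lborel (\<lambda>\<eta>. ((norm (snd p) + 1) * c) * g \<eta>)" using g by simp
  moreover have "norm ((snd q \<bullet> U (fst q) \<eta>) *\<^sub>R B (fst q) (snd q - \<eta>)) \<le> ((norm (snd p) + 1) * c) * g \<eta>" if "q \<in> ball p 1" for q \<eta>
  proof -
    have q: "norm (snd q) \<le> norm (snd p) + 1"
      using that dist_snd_le[of p q] norm_triangle_sub[of "snd q" "snd p"] by (simp add: dist_norm norm_minus_commute)
    have "norm ((snd q \<bullet> U (fst q) \<eta>) *\<^sub>R B (fst q) (snd q - \<eta>)) \<le> ((norm (snd p) + 1) * g \<eta>) * c"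
    proof -
      have "\<bar>snd q \<bullet> U (fst q) \<eta>\<bar> \<le> norm (snd q) * norm (U (fst q) \<eta>)" by (rule Cauchy_Schwarz_ineq2)
      also have "\<dots> \<le> (norm (snd p) + 1) * g \<eta>" by (intro mult_mono q g) auto
      finally show ?thesis
        unfolding norm_scaleR using order_trans[OF norm_ge_zero g(2)[of "fst q" \<eta>]] by (intro mult_mono c mult_nonneg_nonneg) auto
    qed
    then show ?thesis by (simp add: mult_ac)
  qed
  ultimately show "\<exists>d>0. \<exists>g. integrable lborel g \<and> (\<forall>q\<in>ball p d. \<forall>\<eta>. norm ((snd q \<bullet> U (fst q) \<eta>) *\<^sub>R B (fst q) (snd q - \<eta>)) \<le> g \<eta>)"
    using zero_less_one[where 'a=real] by metis
next
  fix \<eta> :: 'a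
  have 1: "continuous_on UNIV (\<lambda>z::real \<times> 'a. U (fst z) \<eta>)"
    using continuous_on_compose2[OF U, of UNIV "\<lambda>z::real \<times> 'a. (fst z, \<eta>)"] by (simp add: continuous_intros)
  have 2: "continuous_on UNIV (\<lambda>z::real \<times> 'a. B (fst z) (snd z - \<eta>))"
    using continuous_on_compose2[OF B, of UNIV "\<lambda>z::real \<times> 'a. (fst z, snd z - \<eta>)"] by (simp add: continuous_intros)
  show "continuous_on UNIV (\<lambda>p. (snd p \<bullet> U (fst p) \<eta>) *\<^sub>R B (fst p) (snd p - \<eta>))"
    by (intro continuous_intros 1 2)
qed

lemma adv_minus:
  assumes [measurable]: "U \<in> borel_measurable borel" "B \<in> borel_measurable borel"
    and "\<And>\<xi>. U (- \<xi>) = - U \<xi>" "\<And>\<xi>. B (- \<xi>) = - B \<xi>"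
  shows "adv U B (- \<zeta>) = - adv U B \<zeta>"
proof -
  have "adv U B (- \<zeta>) = (LINT \<eta>|lborel. (- \<zeta> \<bullet> U (0 - \<eta>)) *\<^sub>R B (- \<zeta> - (0 - \<eta>)))"
    unfolding adv_def by (rule integral_lborel_reflect[symmetric]) measurable
  also have "B (- \<zeta> - (0 - \<eta>)) = - B (\<zeta> - \<eta>)" for \<eta> using assms(4)[of "\<zeta> - \<eta>"] by simp
  then have "(LINT \<eta>|lborel. (- \<zeta> \<bullet> U (0 - \<eta>)) *\<^sub>R B (- \<zeta> - (0 - \<eta>))) = (LINT \<eta>|lborel. - ((\<zeta> \<bullet> U \<eta>) *\<^sub>R B (\<zeta> - \<eta>)))"
    by (simp add: assms)
  finally show ?thesis by (simp add: adv_def)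
qed

lemma adv_0 [simp]: "adv U B 0 = 0"
  by (simp add: adv_def)

text \<open>After contraction with \<zeta> the integrand is symmetric under the exchange of \<eta>
  and \<zeta> - \<eta>. This is why the right side of the induction equation is divergence
  free.\<close>

lemma adv_commute_inner:
  fixes U B :: "'a::euclidean_space \<Rightarrow> 'a"
  assumes [measurable]: "U \<in> borel_measurable borel" "B \<in> borel_measurable borel"
    and "integrable lborel (\<lambda>\<eta>. (\<zeta> \<bullet> U \<eta>) *\<^sub>R B (\<zeta> - \<eta>))" "integrable lborel (\<lambda>\<eta>. (\<zeta> \<bullet> B \<eta>) *\<^sub>R U (\<zeta> - \<eta>))"
  shows "\<zeta> \<bullet> adv U B \<zeta> = \<zeta> \<bullet> adv B U \<zeta>"
proof -
  have "\<zeta> \<bullet> adv U B \<zeta> = (LINT \<eta>|lborel. (\<zeta> \<bullet> U \<eta>) * (\<zeta> \<bullet> B (\<zeta> - \<eta>)))"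
    unfolding adv_def using integral_inner_right[OF assms(3), of \<zeta>] by simp
  also have "\<dots> = (LINT \<eta>|lborel. (\<zeta> \<bullet> U (\<zeta> - \<eta>)) * (\<zeta> \<bullet> B (\<zeta> - (\<zeta> - \<eta>))))"
    by (rule integral_lborel_reflect[symmetric]) measurable
  also have "\<dots> = (LINT \<eta>|lborel. (\<zeta> \<bullet> B \<eta>) * (\<zeta> \<bullet> U (\<zeta> - \<eta>)))"
    by (simp add: mult.commute)
  also have "\<dots> = \<zeta> \<bullet> adv B U \<zeta>"
    unfolding adv_def using integral_inner_right[OF assms(4), of \<zeta>] by simp
  finally show ?thesis .
qed

lemma norm_mult_exp_le:
  assumes "r > 0"
  shows "norm x * exp (- (r * norm (x::'a::real_normed_vector))) \<le> 2 / r * exp (- (r/2 * norm x))"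
proof -
  have "r/2 * norm x \<le> exp (r/2 * norm x)"
    using exp_ge_add_one_self[of "r/2 * norm x"] by linarith
  then have "(2/r) * (r/2 * norm x) \<le> (2/r) * exp (r/2 * norm x)" using assms by (intro mult_left_mono) auto
  then have "norm x \<le> 2 / r * exp (r/2 * norm x)" using assms by simp
  then have "norm x * exp (- (r * norm x)) \<le> (2 / r * exp (r/2 * norm x)) * exp (- (r * norm x))"
    by (rule mult_right_mono) simp
  also have "\<dots> = 2 / r * exp (- (r/2 * norm x))" by (simp add: mult.assoc flip: exp_add)
  finally show ?thesis .
qed

definition gradT :: "(real^'n \<Rightarrow> real^'n) \<Rightarrow> real^'n \<Rightarrow> real^'n^'n" where
  "gradT U \<xi> = (\<chi> i. U \<xi> $ i *\<^sub>R \<xi>)"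

lemma norm_gradT: "norm (gradT U \<xi>) \<le> CARD('n) * (norm \<xi> * norm (U \<xi>))" for U :: "real^'n::finite \<Rightarrow> real^'n"
proof -
  have "norm (gradT U \<xi>) \<le> (\<Sum>i\<in>UNIV. norm (gradT U \<xi> $ i))"
    unfolding norm_vec_def by (rule L2_set_le_sum) auto
  also have "\<dots> \<le> (\<Sum>i\<in>(UNIV::'n set). norm \<xi> * norm (U \<xi>))"
    by (intro sum_mono) (simp add: gradT_def mult.commute component_le_norm_cart mult_left_mono)
  finally show ?thesis by simp
qed

lemma sinT_nth:
  fixes U :: "'a::euclidean_space \<Rightarrow> real^'n::finite"
  assumes "integrable lborel U"
  shows "sinT U x $ i = (LINT \<xi>|lborel. sin (x \<bullet> \<xi>) * U \<xi> $ i)"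
  unfolding sinT_def using integral_bounded_linear[OF bounded_linear_vec_nth[of i] integrable_sin[OF assms, of x]] by simp

lemma cosT_nth:
  fixes W :: "'a::euclidean_space \<Rightarrow> real^'n::finite^'m::finite"
  assumes "integrable lborel W"
  shows "cosT W x $ i $ j = (LINT \<xi>|lborel. cos (x \<bullet> \<xi>) * W \<xi> $ i $ j)"
  unfolding cosT_def
  using integral_bounded_linear[OF bounded_linear_compose[OF bounded_linear_vec_nth[of j] bounded_linear_vec_nth[of i]] integrable_cos[OF assms, of x]]
  by simp

lemma integrable_nth: "integrable M U \<Longrightarrow> integrable M (\<lambda>x. U x $ i)" for U :: "'a \<Rightarrow> 'b::euclidean_space^'n::finite"
  by (rule integrable_bounded_linear[OF bounded_linear_vec_nth])

text \<open>The odd parts of the trigonometric products cancel, which leaves the transform of a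
  convolution.\<close>

lemma advect_sinT:
  fixes U B :: "real^'n::finite \<Rightarrow> real^'n"
  assumes U: "continuous_on UNIV U" and B: "continuous_on UNIV B" and r: "r > 0"
    and decU: "\<And>\<xi>. norm (U \<xi>) \<le> C * exp (- (r * norm \<xi>))" and decB: "\<And>\<xi>. norm (B \<xi>) \<le> C * exp (- (r * norm \<xi>))"
    and oddB: "\<And>\<xi>. B (- \<xi>) = - B \<xi>" and orth: "\<And>\<xi>. \<xi> \<bullet> U \<xi> = 0"
    and gi: "integrable lborel (gradT B)" and ai: "integrable lborel (adv U B)"
  shows "advect (sinT U x) (cosT (gradT B) x) i = sinT (adv U B) x $ i"
proof -
  have Um[measurable]: "U \<in> borel_measurable borel" and Bm[measurable]: "B \<in> borel_measurable borel"
    using U B by (auto intro: borel_measurable_continuous_onI)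
  have Ui: "integrable lborel U" and Bi: "integrable lborel B"
    using integrable_exp_bound[OF Um r decU] integrable_exp_bound[OF Bm r decB] by auto
  have [measurable]: "(\<lambda>x. B x $ i) \<in> borel_measurable borel"
    using borel_measurable_integrable[OF integrable_nth[OF Bi]] by simp
  have Uji: "integrable lborel (\<lambda>\<eta>. sin (x \<bullet> \<eta>) * U \<eta> $ j)" for j
    using integrable_nth[OF integrable_sin[OF Ui, of x], of j] by simp
  have Bji: "integrable lborel (\<lambda>\<xi>. cos (x \<bullet> \<xi>) * gradT B \<xi> $ i $ j)" for j
    using integrable_nth[OF integrable_nth[OF integrable_cos[OF gi, of x], of i], of j] by simp
  let ?k = "\<lambda>(\<eta>, \<zeta>). sin (x \<bullet> \<zeta>) * ((\<zeta> \<bullet> U \<eta>) * B (\<zeta> - \<eta>) $ i)"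
  have inner: "(\<Sum>j\<in>UNIV. (sin (x \<bullet> \<eta>) * U \<eta> $ j) * (LINT \<xi>|lborel. cos (x \<bullet> \<xi>) * gradT B \<xi> $ i $ j)) = (LINT \<zeta>|lborel. ?k (\<eta>, \<zeta>))" for \<eta>
  proof -
    have "(\<Sum>j\<in>UNIV. (sin (x \<bullet> \<eta>) * U \<eta> $ j) * (LINT \<xi>|lborel. cos (x \<bullet> \<xi>) * gradT B \<xi> $ i $ j))
       = (LINT \<xi>|lborel. (\<Sum>j\<in>UNIV. (sin (x \<bullet> \<eta>) * U \<eta> $ j) * (cos (x \<bullet> \<xi>) * gradT B \<xi> $ i $ j)))"
      using Bji by (subst Bochner_Integration.integral_sum) auto
    also have "\<dots> = (LINT \<xi>|lborel. sin (x \<bullet> \<eta>) * cos (x \<bullet> \<xi>) * ((\<xi> \<bullet> U \<eta>) * B \<xi> $ i))"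
      by (intro Bochner_Integration.integral_cong refl)
        (simp add: gradT_def inner_vec_def sum_distrib_left sum_distrib_right mult_ac)
    finally have 1: "(\<Sum>j\<in>UNIV. (sin (x \<bullet> \<eta>) * U \<eta> $ j) * (LINT \<xi>|lborel. cos (x \<bullet> \<xi>) * gradT B \<xi> $ i $ j))
       = (LINT \<xi>|lborel. sin (x \<bullet> \<eta>) * cos (x \<bullet> \<xi>) * ((\<xi> \<bullet> U \<eta>) * B \<xi> $ i))" .
    have i0: "integrable lborel (\<lambda>\<xi>. (\<xi> \<bullet> U \<eta>) * B \<xi> $ i)"
    proof (rule integrable_dominated[OF integrable_mult_right[OF integrable_norm[OF gi], of "norm (U \<eta>)"]])
      fix \<xi>
      have "norm (gradT B \<xi> $ i) \<le> norm (gradT B \<xi>)" by (rule Finite_Cartesian_Product.norm_nth_le)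
      then have "\<bar>B \<xi> $ i\<bar> * norm \<xi> \<le> norm (gradT B \<xi>)" by (simp add: gradT_def)
      then have "norm (U \<eta>) * (\<bar>B \<xi> $ i\<bar> * norm \<xi>) \<le> norm (U \<eta>) * norm (gradT B \<xi>)" by (intro mult_left_mono) auto
      moreover have "\<bar>\<xi> \<bullet> U \<eta>\<bar> * \<bar>B \<xi> $ i\<bar> \<le> (norm \<xi> * norm (U \<eta>)) * \<bar>B \<xi> $ i\<bar>"
        by (intro mult_right_mono Cauchy_Schwarz_ineq2) auto
      ultimately show "norm ((\<xi> \<bullet> U \<eta>) * B \<xi> $ i) \<le> norm (U \<eta>) * norm (gradT B \<xi>)"
        by (simp add: abs_mult mult_ac)
    qed measurable
    have i1: "integrable lborel (\<lambda>\<xi>. sin (x \<bullet> \<eta>) * cos (x \<bullet> \<xi>) * ((\<xi> \<bullet> U \<eta>) * B \<xi> $ i))"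
      "integrable lborel (\<lambda>\<xi>. cos (x \<bullet> \<eta>) * sin (x \<bullet> \<xi>) * ((\<xi> \<bullet> U \<eta>) * B \<xi> $ i))"
      using integrable_mult_right[OF integrable_cos[OF i0, of x], of "sin (x \<bullet> \<eta>)"] integrable_mult_right[OF integrable_sin[OF i0, of x], of "cos (x \<bullet> \<eta>)"]
      by (simp_all add: mult.assoc)
    have 2: "(LINT \<xi>|lborel. cos (x \<bullet> \<eta>) * sin (x \<bullet> \<xi>) * ((\<xi> \<bullet> U \<eta>) * B \<xi> $ i)) = 0"
      by (rule integral_odd_eq_0) (measurable, simp add: oddB)
    have "(LINT \<xi>|lborel. sin (x \<bullet> \<eta>) * cos (x \<bullet> \<xi>) * ((\<xi> \<bullet> U \<eta>) * B \<xi> $ i))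
      = (LINT \<xi>|lborel. sin (x \<bullet> \<eta>) * cos (x \<bullet> \<xi>) * ((\<xi> \<bullet> U \<eta>) * B \<xi> $ i)) + (LINT \<xi>|lborel. cos (x \<bullet> \<eta>) * sin (x \<bullet> \<xi>) * ((\<xi> \<bullet> U \<eta>) * B \<xi> $ i))"
      using 2 by simp
    also have "\<dots> = (LINT \<xi>|lborel. sin (x \<bullet> (\<eta> + \<xi>)) * ((\<xi> \<bullet> U \<eta>) * B \<xi> $ i))"
      by (subst Bochner_Integration.integral_add[OF i1, symmetric]) (simp add: inner_add_right sin_add distrib_right)
    also have "\<dots> = (LINT \<zeta>|lborel. sin (x \<bullet> (\<eta> + (- \<eta> + \<zeta>))) * (((- \<eta> + \<zeta>) \<bullet> U \<eta>) * B (- \<eta> + \<zeta>) $ i))"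
      by (rule integral_lborel_translate[symmetric]) measurable
    \<comment> \<open>Orthogonality of \<eta> and U \<eta> replaces the frequency \<zeta> - \<eta>
      in the inner product by \<zeta>, as in the definition of \<open>adv\<close>.\<close>
    also have "\<dots> = (LINT \<zeta>|lborel. ?k (\<eta>, \<zeta>))"
      by (simp add: inner_diff_left orth)
    finally show ?thesis unfolding 1 .
  qed
  have "advect (sinT U x) (cosT (gradT B) x) i
      = (\<Sum>j\<in>UNIV. (LINT \<eta>|lborel. sin (x \<bullet> \<eta>) * U \<eta> $ j) * (LINT \<xi>|lborel. cos (x \<bullet> \<xi>) * gradT B \<xi> $ i $ j))"
    by (simp add: advect_def sinT_nth[OF Ui] cosT_nth[OF gi])
  also have "\<dots> = (LINT \<eta>|lborel. (\<Sum>j\<in>UNIV. (sin (x \<bullet> \<eta>) * U \<eta> $ j) * (LINT \<xi>|lborel. cos (x \<bullet> \<xi>) * gradT B \<xi> $ i $ j)))"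
    using Uji by (subst Bochner_Integration.integral_sum) auto
  also have "\<dots> = (LINT \<eta>|lborel. LINT \<zeta>|lborel. ?k (\<eta>, \<zeta>))" unfolding inner ..
  also have "\<dots> = (LINT \<zeta>|lborel. LINT \<eta>|lborel. ?k (\<eta>, \<zeta>))"
  proof -
    have "integrable (lborel \<Otimes>\<^sub>M lborel) ?k"
    proof (rule integrable_pair_bound)
      show "integrable lborel (\<lambda>\<eta>::real^'n. exp (- (r/2 * norm \<eta>)))" by (rule integrable_exp_norm) (use r in auto)
      show "integrable lborel (\<lambda>\<zeta>::real^'n. C\<^sup>2 * (norm \<zeta> * exp (- (r/2 * norm \<zeta>))))"
      proof (rule integrable_dominated[OF integrable_mult_right[OF integrable_exp_norm[of "r/2/2"], of "C\<^sup>2 * (2 / (r/2))"]])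
        show "norm (C\<^sup>2 * (norm \<zeta> * exp (- (r/2 * norm \<zeta>)))) \<le> C\<^sup>2 * (2 / (r/2)) * exp (- (r/2/2 * norm \<zeta>))" for \<zeta> :: "real^'n"
          using mult_left_mono[OF norm_mult_exp_le[of "r/2" \<zeta>], of "C\<^sup>2"] r by (simp add: abs_mult mult.assoc)
      qed (use r in auto)
      have "continuous_on UNIV (\<lambda>w::(real^'n) \<times> (real^'n). sin (x \<bullet> snd w) * ((snd w \<bullet> U (fst w)) * B (snd w - fst w) $ i))"
        by (intro continuous_intros continuous_on_compose2[OF U] continuous_on_compose2[OF B]) auto
      then show "?k \<in> borel_measurable borel"
        by (simp add: split_beta' borel_measurable_continuous_onI)
      fix \<eta> \<zeta>
      have "\<bar>(\<zeta> \<bullet> U \<eta>) * B (\<zeta> - \<eta>) $ i\<bar> \<le> norm ((\<zeta> \<bullet> U \<eta>) *\<^sub>R B (\<zeta> - \<eta>))"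
        by (simp add: abs_mult component_le_norm_cart mult_left_mono)
      also have "\<dots> \<le> (C\<^sup>2 * norm \<zeta> * exp (- (r/2 * norm \<zeta>))) * exp (- (r/2 * norm \<eta>))"
        by (rule adv_integrand_bound[of U \<eta> C r B \<zeta>, OF decU decB]) (use r in auto)
      finally have "\<bar>(\<zeta> \<bullet> U \<eta>) * B (\<zeta> - \<eta>) $ i\<bar> \<le> exp (- (r/2 * norm \<eta>)) * (C\<^sup>2 * (norm \<zeta> * exp (- (r/2 * norm \<zeta>))))"
        by (simp add: mult_ac)
      then have "1 * \<bar>(\<zeta> \<bullet> U \<eta>) * B (\<zeta> - \<eta>) $ i\<bar> \<le> exp (- (r/2 * norm \<eta>)) * (C\<^sup>2 * (norm \<zeta> * exp (- (r/2 * norm \<zeta>))))"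
        by simp
      then show "norm (?k (\<eta>, \<zeta>)) \<le> exp (- (r/2 * norm \<eta>)) * (C\<^sup>2 * (norm \<zeta> * exp (- (r/2 * norm \<zeta>))))"
        unfolding prod.case norm_mult real_norm_def[of "sin _"]
        by (intro order_trans[OF mult_right_mono[OF abs_sin_le_one]]) auto
    qed
    then show ?thesis using lborel_pair.Fubini_integral[of "\<lambda>\<eta> \<zeta>. ?k (\<eta>, \<zeta>)"] by simp
  qed
  also have "\<dots> = (LINT \<zeta>|lborel. sin (x \<bullet> \<zeta>) * adv U B \<zeta> $ i)"
  proof (intro Bochner_Integration.integral_cong refl)
    fix \<zeta>
    have "adv U B \<zeta> $ i = (LINT \<eta>|lborel. (\<zeta> \<bullet> U \<eta>) * B (\<zeta> - \<eta>) $ i)"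
      unfolding adv_def
      using integral_bounded_linear[OF bounded_linear_vec_nth[of i] integrable_adv[OF U B r decU decB, of \<zeta>]] by simp
    then show "(LINT \<eta>|lborel. ?k (\<eta>, \<zeta>)) = sin (x \<bullet> \<zeta>) * adv U B \<zeta> $ i" by simp
  qed
  also have "\<dots> = sinT (adv U B) x $ i" by (rule sinT_nth[OF ai, symmetric])
  finally show ?thesis .
qed

subsection \<open>From the Fourier side to weak solutions\<close>

text \<open>The Fourier symbol of the projection onto divergence free fields. At \<xi> = 0 division
  by zero makes it the identity, which is harmless as it is applied to convolution terms, and these
  vanish there by \<open>adv_0\<close>.\<close>

definition leray :: "'a::real_inner \<Rightarrow> 'a \<Rightarrow> 'a" where
  "leray \<xi> v = v - ((\<xi> \<bullet> v) / (norm \<xi>)\<^sup>2) *\<^sub>R \<xi>"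

text \<open>One integrable majorant for all times is what Fubini's theorem and the tests on
  space-time ask for. Joint measurability stands in place of continuity because the amplitude of the
  pressure may have no limit at frequency zero.\<close>

definition tame :: "(real \<Rightarrow> 'a::euclidean_space \<Rightarrow> real) \<Rightarrow> bool" where
  "tame H \<longleftrightarrow> (\<lambda>z. H (fst z) (snd z)) \<in> borel_measurable borel \<and>
     (\<exists>g. integrable lborel g \<and> (\<forall>t \<xi>. \<bar>H t \<xi>\<bar> \<le> g \<xi>))"

lemma tame_mono:
  assumes "tame H" "(\<lambda>z. G (fst z) (snd z)) \<in> borel_measurable borel" "\<And>t \<xi>. \<bar>G t \<xi>\<bar> \<le> K * \<bar>H t \<xi>\<bar>"
  shows "tame G"
proof -
  obtain g where g: "integrable lborel g" "\<And>t \<xi>. \<bar>H t \<xi>\<bar> \<le> g \<xi>" using assms(1) by (auto simp: tame_def)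
  have "\<bar>G t \<xi>\<bar> \<le> \<bar>K\<bar> * g \<xi>" for t \<xi>
    by (rule order_trans[OF assms(3)]) (intro mult_mono g(2), auto)
  moreover have "integrable lborel (\<lambda>\<xi>. \<bar>K\<bar> * g \<xi>)" using g by simp
  ultimately show ?thesis using assms(2) by (auto simp: tame_def)
qed

lemma tame_add:
  assumes "tame H" "tame G" shows "tame (\<lambda>t \<xi>. H t \<xi> + G t \<xi>)"
proof -
  obtain g h where g: "integrable lborel g" "\<And>t \<xi>. \<bar>H t \<xi>\<bar> \<le> g \<xi>" and h: "integrable lborel h" "\<And>t \<xi>. \<bar>G t \<xi>\<bar> \<le> h \<xi>"
    using assms by (auto simp: tame_def)
  have "\<bar>H t \<xi> + G t \<xi>\<bar> \<le> g \<xi> + h \<xi>" for t \<xi>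
    by (rule order_trans[OF abs_triangle_ineq add_mono[OF g(2) h(2)]])
  moreover have "integrable lborel (\<lambda>\<xi>. g \<xi> + h \<xi>)" using g h by simp
  ultimately show ?thesis using assms by (auto simp: tame_def intro!: borel_measurable_add)
qed

lemma tame_uminus: "tame H \<Longrightarrow> tame (\<lambda>t \<xi>. - H t \<xi>)"
  by (rule tame_mono[of H _ 1]) (auto simp: tame_def)

lemma tame_integrable: "tame H \<Longrightarrow> integrable lborel (H t)"
  using measurable_compose[of "\<lambda>\<xi>. (t, \<xi>)" borel borel "\<lambda>z. H (fst z) (snd z)"]
  by (auto simp: tame_def borel_measurable_continuous_onI continuous_intros intro!: integrable_dominated[of lborel _ "H t"])

definition sinS :: "(real \<Rightarrow> 'a::euclidean_space \<Rightarrow> real) \<Rightarrow> real \<times> 'a \<Rightarrow> real" where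
  "sinS H z = (LINT \<xi>|lborel. sin (snd z \<bullet> \<xi>) * H (fst z) \<xi>)"

definition cosS :: "(real \<Rightarrow> 'a::euclidean_space \<Rightarrow> real) \<Rightarrow> real \<times> 'a \<Rightarrow> real" where
  "cosS H z = (LINT \<xi>|lborel. cos (snd z \<bullet> \<xi>) * H (fst z) \<xi>)"

lemma
  assumes "tame H"
  shows borel_measurable_sinS: "sinS H \<in> borel_measurable borel"
    and borel_measurable_cosS: "cosS H \<in> borel_measurable borel"
    and bounded_cosS: "\<exists>M. \<forall>z. \<bar>cosS H z\<bar> \<le> M"
    and integrable_test_sinS: "integrable lborel \<psi> \<Longrightarrow> integrable lborel (\<lambda>z. \<psi> z * sinS H z)"
proof -
  obtain g where g: "integrable lborel g" "\<And>t \<xi>. \<bar>H t \<xi>\<bar> \<le> g \<xi>" and Hm: "(\<lambda>z. H (fst z) (snd z)) \<in> borel_measurable borel"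
    using assms by (auto simp: tame_def)
  have Hw: "(\<lambda>w::(real \<times> 'a) \<times> 'a. H (fst (fst w)) (snd w)) \<in> borel_measurable borel"
    using measurable_compose[of "\<lambda>w::(real \<times> 'a) \<times> 'a. (fst (fst w), snd w)" borel borel "\<lambda>w. H (fst w) (snd w)", OF _ Hm]
    by (simp_all add: borel_measurable_continuous_onI continuous_intros)
  have s: "(\<lambda>w::(real \<times> 'a) \<times> 'a. sin (snd (fst w) \<bullet> snd w)) \<in> borel_measurable borel"
    and c: "(\<lambda>w::(real \<times> 'a) \<times> 'a. cos (snd (fst w) \<bullet> snd w)) \<in> borel_measurable borel"
    by (intro borel_measurable_continuous_onI continuous_intros)+
  show "sinS H \<in> borel_measurable borel" "cosS H \<in> borel_measurable borel"
    unfolding sinS_def cosS_def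
    using borel_measurable_LINT[OF borel_measurable_times[OF s Hw]] borel_measurable_LINT[OF borel_measurable_times[OF c Hw]] by simp_all
  have b: "\<bar>sin a * x\<bar> \<le> y" "\<bar>cos a * x\<bar> \<le> y" if "\<bar>x\<bar> \<le> y" for a x y :: real
    using that abs_sin_le_one[of a] abs_cos_le_one[of a] by (auto simp: abs_mult intro: order_trans[OF mult_left_le_one_le])
  show "integrable lborel \<psi> \<Longrightarrow> integrable lborel (\<lambda>z. \<psi> z * sinS H z)"
    using integrable_test[OF _ borel_measurable_times[OF s Hw] _ g(1), of \<psi>] b(1)[OF g(2)] by (simp add: sinS_def)
  have "\<bar>cosS H z\<bar> \<le> (LINT \<xi>|lborel. g \<xi>)" for z
    unfolding cosS_def real_norm_def[symmetric]
    by (rule norm_integral_dominated[OF g(1)])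
      (use borel_measurable_integrable[OF integrable_cos[OF tame_integrable[OF assms], of "snd z" "fst z"]] b(2)[OF g(2)] in simp_all)
  then show "\<exists>M. \<forall>z. \<bar>cosS H z\<bar> \<le> M" by blast
qed

lemma sinS_add: "tame H \<Longrightarrow> tame G \<Longrightarrow> sinS (\<lambda>t \<xi>. H t \<xi> + G t \<xi>) z = sinS H z + sinS G z"
  unfolding sinS_def
  using Bochner_Integration.integral_add[OF integrable_sin[OF tame_integrable[of H "fst z"], of "snd z"] integrable_sin[OF tame_integrable[of G "fst z"], of "snd z"]]
  by (simp add: distrib_left)

lemma sinS_uminus: "sinS (\<lambda>t \<xi>. - H t \<xi>) z = - sinS H z"
  by (simp add: sinS_def)

lemma
  fixes \<phi> :: "real \<times> (real^'d) \<Rightarrow> real"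
  assumes \<phi>: "test_fun \<Omega> \<phi>" and H: "tame H" and H': "tame (\<lambda>t \<xi>. \<xi> $ j * H t \<xi>)"
  shows test_sinS: "(LINT z|lborel. d_x j \<phi> z * sinS H z) = - (LINT z|lborel. \<phi> z * cosS (\<lambda>t \<xi>. \<xi> $ j * H t \<xi>) z)"
    and test_cosS: "(LINT z|lborel. d_x j \<phi> z * cosS H z) = (LINT z|lborel. \<phi> z * sinS (\<lambda>t \<xi>. \<xi> $ j * H t \<xi>) z)"
proof -
  obtain g g' where g: "integrable lborel g" "\<And>t \<xi>. \<bar>H t \<xi>\<bar> \<le> g \<xi>" and g': "integrable lborel g'" "\<And>t \<xi>. \<bar>\<xi> $ j * H t \<xi>\<bar> \<le> g' \<xi>"
    and Hm: "(\<lambda>z. H (fst z) (snd z)) \<in> borel_measurable borel"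
    using H H' by (auto simp: tame_def)
  have Hw: "(\<lambda>w::(real \<times> (real^'d)) \<times> (real^'d). H (fst (fst w)) (snd w)) \<in> borel_measurable borel"
    using measurable_compose[of "\<lambda>w::(real \<times> (real^'d)) \<times> (real^'d). (fst (fst w), snd w)" borel borel "\<lambda>w. H (fst w) (snd w)", OF _ Hm]
    by (simp_all add: borel_measurable_continuous_onI continuous_intros)
  have e: "snd (0::real, axis j 1) \<bullet> \<xi> = \<xi> $ j" for \<xi> :: "real^'d" by (simp add: inner_axis')
  have b': "\<bar>(snd (0::real, axis j 1) \<bullet> \<xi>) * H (fst z) \<xi>\<bar> \<le> g' \<xi>" for z :: "real \<times> (real^'d)" and \<xi>
    unfolding e by (rule g')
  show "(LINT z|lborel. d_x j \<phi> z * sinS H z) = - (LINT z|lborel. \<phi> z * cosS (\<lambda>t \<xi>. \<xi> $ j * H t \<xi>) z)"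
    using test_sin[OF \<phi> bounded_linear_snd, of "\<lambda>z. H (fst z)" "(0, axis j 1)", OF Hw _ g(2) g(1) b' g'(1)]
    unfolding e sinS_def cosS_def by simp
  show "(LINT z|lborel. d_x j \<phi> z * cosS H z) = (LINT z|lborel. \<phi> z * sinS (\<lambda>t \<xi>. \<xi> $ j * H t \<xi>) z)"
    using test_cos[OF \<phi> bounded_linear_snd, of "\<lambda>z. H (fst z)" "(0, axis j 1)", OF Hw _ g(2) g(1) b' g'(1)]
    unfolding e sinS_def cosS_def by simp
qed

lemma loc_integrable_bounded:
  fixes f :: "'a::euclidean_space \<Rightarrow> 'b::euclidean_space"
  assumes m: "f \<in> borel_measurable borel" and b: "\<And>x. norm (f x) \<le> M"
  shows "loc_integrable \<Omega> f"
  unfolding loc_integrable_def set_integrable_def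
proof (intro allI impI)
  fix K :: "'a set" assume K: "compact K \<and> K \<subseteq> \<Omega>"
  have I: "integrable lborel (indicator K :: 'a \<Rightarrow> real)"
    by (rule integrable_real_indicator) (use emeasure_compact_finite[of K] compact_imp_closed[of K] K in auto)
  have M: "0 \<le> M" using order_trans[OF norm_ge_zero b] .
  have Km: "indicator K \<in> borel_measurable (borel :: 'a measure)"
    using compact_imp_closed[of K] K by (intro borel_measurable_indicator borel_closed) auto
  show "integrable lborel (\<lambda>x. indicator K x *\<^sub>R f x)"
  proof (rule integrable_dominated[OF integrable_mult_right[OF I, of M]])
    show "(\<lambda>x. indicator K x *\<^sub>R f x) \<in> borel_measurable lborel"
      using borel_measurable_scaleR[OF Km m] by simp
    show "norm (indicator K x *\<^sub>R f x) \<le> M * indicator K x" for x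
      using b[of x] M by (auto simp: indicator_def)
  qed
qed

lemma
  fixes U :: "'a::euclidean_space \<Rightarrow> 'b::euclidean_space"
  assumes U: "integrable lborel U"
  shows loc_integrable_sinT: "loc_integrable \<Omega> (sinT U)"
    and loc_integrable_cosT: "loc_integrable \<Omega> (cosT U)"
proof -
  have [measurable]: "U \<in> borel_measurable borel" using U by auto
  have "sinT U \<in> borel_measurable lborel" "cosT U \<in> borel_measurable lborel"
    unfolding sinT_def cosT_def by (rule lborel.borel_measurable_lebesgue_integral; simp add: borel_prod[symmetric])+
  moreover have "norm (sinT U x) \<le> (LINT \<xi>|lborel. norm (U \<xi>))" "norm (cosT U x) \<le> (LINT \<xi>|lborel. norm (U \<xi>))" for x
    unfolding sinT_def cosT_def
    by (rule norm_integral_dominated[OF integrable_norm[OF U]]; auto intro!: mult_left_le_one_le)+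
  ultimately show "loc_integrable \<Omega> (sinT U)" "loc_integrable \<Omega> (cosT U)"
    by (auto intro!: loc_integrable_bounded)
qed

lemma integrable_bounded_mult:
  fixes \<psi> :: "'a::euclidean_space \<Rightarrow> real"
  assumes "integrable lborel \<psi>" "f \<in> borel_measurable borel" "\<And>x. \<bar>f x\<bar> \<le> M"
  shows "integrable lborel (\<lambda>x. \<psi> x * f x)"
proof (rule integrable_dominated)
  show "integrable lborel (\<lambda>x. \<bar>\<psi> x\<bar> * M)" using assms(1) by auto
  show "norm (\<psi> x * f x) \<le> \<bar>\<psi> x\<bar> * M" for x
    using assms(3)[of x] by (simp add: abs_mult mult_left_mono)
  show "(\<lambda>x. \<psi> x * f x) \<in> borel_measurable lborel"
    using borel_measurable_integrable[OF assms(1)] assms(2) by simp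
qed

text \<open>The factor 1 + |\<xi>|^2 leaves room for two spatial derivatives, which the viscous term
  takes.\<close>

lemma tame_bound:
  assumes m: "(\<lambda>z. H (fst z) (snd z)) \<in> borel_measurable borel" and "r > 0"
    and b: "\<And>t \<xi>. \<bar>H t \<xi>\<bar> \<le> K * ((1 + (norm \<xi>)\<^sup>2) * exp (- (r * norm (\<xi>::'a::euclidean_space))))"
  shows "tame H"
proof -
  have "integrable lborel (\<lambda>\<xi>::'a. K * ((1 + (norm \<xi>)\<^sup>2) * exp (- (r * norm \<xi>))))"
  proof (rule integrable_weight_exp[of _ r 1 "\<bar>K\<bar>"])
    show "norm (K * ((1 + (norm \<xi>)\<^sup>2) * exp (- (r * norm \<xi>)))) \<le> \<bar>K\<bar> * ((1 + (norm \<xi>)\<^sup>2) powr 1 * exp (- (r * norm \<xi>)))" for \<xi> :: 'a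
      by (simp add: abs_mult add_nonneg_nonneg)
  qed (use assms in \<open>auto intro!: borel_measurable_continuous_onI continuous_intros\<close>)
  then show ?thesis using m b unfolding tame_def by blast
qed

lemma norm_le_1_square: "norm x \<le> 1 + (norm x)\<^sup>2"
proof -
  have "2 * norm x \<le> 1 + (norm x)\<^sup>2" using sum_squares_bound[of 1 "norm x"] by simp
  then show ?thesis using norm_ge_zero[of x] by linarith
qed

section \<open>Amplitudes of odd divergence free fields\<close>

text \<open>The rate r is a radius of analyticity in space, uniform in time. Both unknowns share C
  and r, so that one set of bounds serves all four bilinear terms.\<close>

definition field :: "real \<Rightarrow> real \<Rightarrow> (real \<Rightarrow> real^'d::finite \<Rightarrow> real^'d) \<Rightarrow> bool" where
  "field C r F \<longleftrightarrow> r > 0 \<and> continuous_on UNIV (\<lambda>z. F (fst z) (snd z)) \<and>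
     (\<forall>t \<xi>. norm (F t \<xi>) \<le> C * exp (- (r * norm \<xi>))) \<and> (\<forall>t \<xi>. F t (- \<xi>) = - F t \<xi>) \<and> (\<forall>t \<xi>. \<xi> \<bullet> F t \<xi> = 0)"

lemma fieldD:
  assumes "field C r F"
  shows "r > 0" "continuous_on UNIV (\<lambda>z. F (fst z) (snd z))" "norm (F t \<xi>) \<le> C * exp (- (r * norm \<xi>))"
    "F t (- \<xi>) = - F t \<xi>" "\<xi> \<bullet> F t \<xi> = 0" "continuous_on UNIV (F t)" "F t \<in> borel_measurable borel"
    "integrable lborel (F t)" "C \<ge> 0"
proof -
  show F: "r > 0" "continuous_on UNIV (\<lambda>z. F (fst z) (snd z))" "norm (F t \<xi>) \<le> C * exp (- (r * norm \<xi>))"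
    "F t (- \<xi>) = - F t \<xi>" "\<xi> \<bullet> F t \<xi> = 0" for t \<xi>
    using assms by (simp_all add: field_def)
  show c: "continuous_on UNIV (F t)" by (rule continuous_on_slice(1)[OF F(2)])
  then show m: "F t \<in> borel_measurable borel" by (rule borel_measurable_continuous_onI)
  show "integrable lborel (F t)" by (rule integrable_exp_bound[OF m F(1) F(3)])
  show "C \<ge> 0" using order_trans[OF norm_ge_zero F(3)[of 0 0]] by simp
qed

lemma field_tame:
  assumes F: "field C r F"
  shows "tame (\<lambda>t \<xi>. F t \<xi> $ i)" "tame (\<lambda>t \<xi>. \<xi> $ j * F t \<xi> $ i)" "tame (\<lambda>t \<xi>. \<xi> $ k * (\<xi> $ j * F t \<xi> $ i))"
    "tame (\<lambda>t \<xi>. (norm \<xi>)\<^sup>2 * F t \<xi> $ i)"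
proof -
  have b: "\<bar>c * F t \<xi> $ i\<bar> \<le> C * ((1 + (norm \<xi>)\<^sup>2) * exp (- (r * norm \<xi>)))" if "\<bar>c\<bar> \<le> 1 + (norm \<xi>)\<^sup>2" for c t \<xi>
  proof -
    have "\<bar>F t \<xi> $ i\<bar> \<le> C * exp (- (r * norm \<xi>))"
      by (rule order_trans[OF component_le_norm_cart fieldD(3)[OF F]])
    then have "\<bar>c\<bar> * \<bar>F t \<xi> $ i\<bar> \<le> (1 + (norm \<xi>)\<^sup>2) * (C * exp (- (r * norm \<xi>)))"
      using that by (intro mult_mono) auto
    then show ?thesis by (simp add: abs_mult mult_ac)
  qed
  have c: "continuous_on UNIV (\<lambda>z. F (fst z) (snd z) $ i)"
    by (intro continuous_intros fieldD(2)[OF F])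
  have 1: "\<bar>\<xi> $ j\<bar> \<le> 1 + (norm \<xi>)\<^sup>2" for \<xi> :: "real^'a" and j
    by (rule order_trans[OF component_le_norm_cart norm_le_1_square])
  have 2: "\<bar>\<xi> $ k * \<xi> $ j\<bar> \<le> 1 + (norm \<xi>)\<^sup>2" for \<xi> :: "real^'a"
  proof -
    have "\<bar>\<xi> $ k\<bar> * \<bar>\<xi> $ j\<bar> \<le> norm \<xi> * norm \<xi>" by (intro mult_mono component_le_norm_cart) auto
    then show ?thesis by (simp add: abs_mult power2_eq_square)
  qed
  show "tame (\<lambda>t \<xi>. F t \<xi> $ i)"
    by (rule tame_bound[OF _ fieldD(1)[OF F], of _ C]) (use b[of 1] c in \<open>auto intro: borel_measurable_continuous_onI\<close>)
  show "tame (\<lambda>t \<xi>. \<xi> $ j * F t \<xi> $ i)"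
    by (rule tame_bound[OF _ fieldD(1)[OF F] b[OF 1]]) (intro borel_measurable_continuous_onI continuous_intros c)
  show "tame (\<lambda>t \<xi>. \<xi> $ k * (\<xi> $ j * F t \<xi> $ i))"
    unfolding mult.assoc[symmetric]
    by (rule tame_bound[OF _ fieldD(1)[OF F] b[OF 2]]) (intro borel_measurable_continuous_onI continuous_intros c)
  show "tame (\<lambda>t \<xi>. (norm \<xi>)\<^sup>2 * F t \<xi> $ i)"
    by (rule tame_bound[OF _ fieldD(1)[OF F] b]) (auto intro!: borel_measurable_continuous_onI continuous_intros c)
qed

text \<open>The factor \<open>norm \<xi>\<close> is retained in the second bound because the
  pressure divides by the square of the frequency.\<close>

lemma field_adv:
  fixes F G :: "real \<Rightarrow> real^'d::finite \<Rightarrow> real^'d" and \<xi> :: "real^'d"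
  assumes F: "field C r F" and G: "field C r G"
  shows "continuous_on UNIV (\<lambda>z. adv (F (fst z)) (G (fst z)) (snd z))"
    and "\<exists>K\<ge>0. \<forall>t \<xi>. norm (adv (F t) (G t) \<xi>) \<le> K * (norm \<xi> * exp (- (r/2 * norm \<xi>)))"
    and "tame (\<lambda>t \<xi>. adv (F t) (G t) \<xi> $ i)" and "integrable lborel (adv (F t) (G t))"
    and "adv (F t) (G t) (- \<xi>) = - adv (F t) (G t) \<xi>"
proof -
  have r: "r > 0" by (rule fieldD(1)[OF F])
  have Gc: "norm (G t \<xi>) \<le> C" for t \<xi>
    by (rule order_trans[OF fieldD(3)[OF G]]) (use fieldD(9)[OF G] r in \<open>auto intro!: mult_right_le_one_le\<close>)
  show c: "continuous_on UNIV (\<lambda>z. adv (F (fst z)) (G (fst z)) (snd z))"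
    by (rule continuous_on_adv[OF fieldD(2)[OF F] fieldD(2)[OF G] _ fieldD(3)[OF F] Gc]) (intro integrable_mult_right integrable_exp_norm r)
  define K where "K = C\<^sup>2 * (LINT \<eta>|lborel. exp (- (r/2 * norm (\<eta>::real^'d))))"
  have K: "K \<ge> 0" unfolding K_def by (intro mult_nonneg_nonneg Bochner_Integration.integral_nonneg) auto
  have b: "norm (adv (F t) (G t) \<xi>) \<le> K * (norm \<xi> * exp (- (r/2 * norm \<xi>)))" for t \<xi>
    unfolding K_def by (rule norm_adv_le[OF fieldD(6)[OF F] fieldD(6)[OF G] r fieldD(3)[OF F] fieldD(3)[OF G]])
  then show "\<exists>K\<ge>0. \<forall>t \<xi>. norm (adv (F t) (G t) \<xi>) \<le> K * (norm \<xi> * exp (- (r/2 * norm \<xi>)))" using K by blast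
  show "tame (\<lambda>t \<xi>. adv (F t) (G t) \<xi> $ i)"
  proof (rule tame_bound)
    show "(\<lambda>z. adv (F (fst z)) (G (fst z)) (snd z) $ i) \<in> borel_measurable borel"
      by (intro borel_measurable_continuous_onI continuous_intros c)
    fix t and \<xi> :: "real^'d"
    have "K * (norm \<xi> * exp (- (r/2 * norm \<xi>))) \<le> K * ((1 + (norm \<xi>)\<^sup>2) * exp (- (r/2 * norm \<xi>)))"
      by (intro mult_left_mono mult_right_mono norm_le_1_square K) auto
    then show "\<bar>adv (F t) (G t) \<xi> $ i\<bar> \<le> K * ((1 + (norm \<xi>)\<^sup>2) * exp (- (r/2 * norm \<xi>)))"
      using b[of t \<xi>] component_le_norm_cart[of "adv (F t) (G t) \<xi>" i] by linarith
  qed (use r in auto)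
  show "integrable lborel (adv (F t) (G t))"
  proof (rule integrable_exp_bound)
    show "adv (F t) (G t) \<in> borel_measurable borel"
      using continuous_on_slice(1)[of "\<lambda>t. adv (F t) (G t)", OF c] by (rule borel_measurable_continuous_onI)
    show "norm (adv (F t) (G t) \<xi>) \<le> (K * (2 / (r/2))) * exp (- (r/2/2 * norm \<xi>))" for \<xi>
      using order_trans[OF b mult_left_mono[OF norm_mult_exp_le[of "r/2" \<xi>] K]] r by (simp add: mult.assoc)
  qed (use r in auto)
  show "adv (F t) (G t) (- \<xi>) = - adv (F t) (G t) \<xi>"
    by (rule adv_minus[OF fieldD(7)[OF F] fieldD(7)[OF G] fieldD(4)[OF F] fieldD(4)[OF G]])
qed

lemma field_gradT:
  assumes F: "field C r (F :: real \<Rightarrow> real^'d::finite \<Rightarrow> real^'d)"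
  shows "continuous_on UNIV (\<lambda>z. gradT (F (fst z)) (snd z))"
    and "norm (gradT (F t) \<xi>) \<le> (real CARD('d) * C * (2 / r)) * exp (- (r/2 * norm \<xi>))"
    and "gradT (F t) (- \<xi>) = gradT (F t) \<xi>" and "integrable lborel (gradT (F t))"
proof -
  have r: "r > 0" by (rule fieldD(1)[OF F])
  show c: "continuous_on UNIV (\<lambda>z. gradT (F (fst z)) (snd z))"
    unfolding gradT_def by (intro continuous_intros fieldD(2)[OF F])
  show b: "norm (gradT (F t) \<xi>) \<le> (real CARD('d) * C * (2 / r)) * exp (- (r/2 * norm \<xi>))" for \<xi>
  proof -
    have "norm (gradT (F t) \<xi>) \<le> real CARD('d) * (norm \<xi> * norm (F t \<xi>))" by (rule norm_gradT)
    also have "\<dots> \<le> real CARD('d) * (norm \<xi> * (C * exp (- (r * norm \<xi>))))"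
      by (intro mult_left_mono fieldD(3)[OF F]) auto
    also have "\<dots> = real CARD('d) * C * (norm \<xi> * exp (- (r * norm \<xi>)))" by (simp add: mult_ac)
    also have "\<dots> \<le> real CARD('d) * C * (2 / r * exp (- (r/2 * norm \<xi>)))"
      by (intro mult_left_mono norm_mult_exp_le r mult_nonneg_nonneg fieldD(9)[OF F]) auto
    finally show ?thesis by (simp add: mult.assoc)
  qed
  show "gradT (F t) (- \<xi>) = gradT (F t) \<xi>"
    by (simp add: gradT_def fieldD(4)[OF F] vec_eq_iff)
  show "integrable lborel (gradT (F t))"
    by (rule integrable_exp_bound[OF borel_measurable_continuous_onI[OF continuous_on_slice(1)[of "\<lambda>t. gradT (F t)", OF c]] _ b]) (use r in auto)
qed

lemma field_weak_gradient:
  assumes F: "field C r (F :: real \<Rightarrow> real^'d::finite \<Rightarrow> real^'d)"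
  shows "weak_gradient (sinT (F t)) (cosT (gradT (F t)))"
  unfolding weak_gradient_def
proof (intro conjI allI impI)
  show "loc_integrable UNIV (sinT (F t))" by (rule loc_integrable_sinT[OF fieldD(8)[OF F]])
  show "loc_integrable UNIV (cosT (gradT (F t)))" by (rule loc_integrable_cosT[OF field_gradT(4)[OF F]])
  fix \<phi> :: "real^'d \<Rightarrow> real" and i j :: 'd assume \<phi>: "test_fun UNIV \<phi>"
  have H: "(\<lambda>w::(real^'d) \<times> (real^'d). F t (snd w) $ i) \<in> borel_measurable borel"
    by (intro borel_measurable_continuous_onI continuous_intros continuous_on_compose2[OF fieldD(6)[OF F]]) auto
  have e: "axis j 1 \<bullet> \<xi> = \<xi> $ j" for \<xi> :: "real^'d" by (simp add: inner_axis')
  have g: "integrable lborel (\<lambda>\<xi>. \<bar>F t \<xi> $ i\<bar>)" "integrable lborel (\<lambda>\<xi>. \<bar>\<xi> $ j * F t \<xi> $ i\<bar>)"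
    using tame_integrable[OF field_tame(1)[OF F, of i], of t] tame_integrable[OF field_tame(2)[OF F, of j i], of t] by auto
  have "(LINT x|lborel. dderiv (axis j 1) \<phi> x * (LINT \<xi>|lborel. sin (x \<bullet> \<xi>) * F t \<xi> $ i))
      = - (LINT x|lborel. \<phi> x * (LINT \<xi>|lborel. cos (x \<bullet> \<xi>) * ((axis j 1 \<bullet> \<xi>) * F t \<xi> $ i)))"
    by (rule test_sin[OF \<phi> bounded_linear_ident, of "\<lambda>_ \<xi>. F t \<xi> $ i", OF H _ _ g(1) _ g(2)]) (simp_all add: e)
  then show "(LINT x|lborel. cosT (gradT (F t)) x $ i $ j * \<phi> x) = - (LINT x|lborel. sinT (F t) x $ i * dderiv (axis j 1) \<phi> x)"
    by (simp add: e sinT_nth[OF fieldD(8)[OF F]] cosT_nth[OF field_gradT(4)[OF F]] gradT_def mult_ac)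
qed

lemma field_C_Hs: "field C r F \<Longrightarrow> s > 0 \<Longrightarrow> C_Hs T s (\<lambda>t. sinT (F t))"
  by (rule C_Hs_sinT[OF fieldD(2) fieldD(1) _ fieldD(3) fieldD(4)])

lemma field_in_Hs: "field C r F \<Longrightarrow> s > 0 \<Longrightarrow> in_Hs s (sinT (F t))"
  by (rule Hs_sinT(1)[OF fieldD(6) fieldD(1) _ fieldD(3) fieldD(4)])

lemma sum_nth_field:
  assumes "field C r F" shows "(\<Sum>j\<in>UNIV. \<xi> $ j * F t \<xi> $ j) = 0"
  using fieldD(5)[OF assms, of \<xi> t] by (simp add: inner_vec_def)

lemma sinT_measurable_bounded:
  assumes U: "integrable lborel (U :: 'a::euclidean_space \<Rightarrow> 'b::euclidean_space)"
  shows "sinT U \<in> borel_measurable borel" "cosT U \<in> borel_measurable borel"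
    "norm (sinT U x) \<le> (LINT \<xi>|lborel. norm (U \<xi>))" "norm (cosT U x) \<le> (LINT \<xi>|lborel. norm (U \<xi>))"
proof -
  have [measurable]: "U \<in> borel_measurable borel" using U by auto
  have "sinT U \<in> borel_measurable lborel" "cosT U \<in> borel_measurable lborel"
    unfolding sinT_def cosT_def by (rule lborel.borel_measurable_lebesgue_integral; simp add: borel_prod[symmetric])+
  then show "sinT U \<in> borel_measurable borel" "cosT U \<in> borel_measurable borel" by simp_all
  show "norm (sinT U x) \<le> (LINT \<xi>|lborel. norm (U \<xi>))" "norm (cosT U x) \<le> (LINT \<xi>|lborel. norm (U \<xi>))"
    unfolding sinT_def cosT_def
    by (rule norm_integral_dominated[OF integrable_norm[OF U]]; auto intro!: mult_left_le_one_le)+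
qed

lemma field_weak_div_free:
  assumes F: "field C r (F :: real \<Rightarrow> real^'d::finite \<Rightarrow> real^'d)"
  shows "weak_div_free (sinT (F t))"
  unfolding weak_div_free_def
proof (intro allI impI)
  fix \<phi> :: "real^'d \<Rightarrow> real" assume \<phi>: "test_fun UNIV \<phi>"
  note Fi = fieldD(8)[OF F, of t] and gi = field_gradT(4)[OF F, of t]
  have s: "integrable lborel (\<lambda>x. dderiv (axis j 1) \<phi> x * sinT (F t) x $ j)" for j :: 'd
  proof (rule integrable_bounded_mult[OF test_fun_integrable[OF test_fun_dderiv[OF \<phi>]]])
    show "(\<lambda>x. sinT (F t) x $ j) \<in> borel_measurable borel"
      using measurable_compose[OF sinT_measurable_bounded(1)[OF Fi], of "\<lambda>v. v $ j" borel] by (simp add: borel_measurable_continuous_onI continuous_intros)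
    show "\<bar>sinT (F t) x $ j\<bar> \<le> (LINT \<xi>|lborel. norm (F t \<xi>))" for x
      by (rule order_trans[OF component_le_norm_cart sinT_measurable_bounded(3)[OF Fi]])
  qed
  have c: "integrable lborel (\<lambda>x. \<phi> x * cosT (gradT (F t)) x $ j $ j)" for j :: 'd
  proof (rule integrable_bounded_mult[OF test_fun_integrable[OF \<phi>]])
    show "(\<lambda>x. cosT (gradT (F t)) x $ j $ j) \<in> borel_measurable borel"
      using measurable_compose[OF sinT_measurable_bounded(2)[OF gi], of "\<lambda>v. v $ j $ j" borel] by (simp add: borel_measurable_continuous_onI continuous_intros)
    show "\<bar>cosT (gradT (F t)) x $ j $ j\<bar> \<le> (LINT \<xi>|lborel. norm (gradT (F t) \<xi>))" for x
      by (rule order_trans[OF component_le_norm_cart order_trans[OF Finite_Cartesian_Product.norm_nth_le sinT_measurable_bounded(4)[OF gi]]])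
  qed
  have tr: "(\<Sum>j\<in>UNIV. cosT (gradT (F t)) x $ j $ j) = 0" for x
  proof -
    have i: "integrable lborel (\<lambda>\<xi>. cos (x \<bullet> \<xi>) * gradT (F t) \<xi> $ j $ j)" for j
      using integrable_nth[OF integrable_nth[OF integrable_cos[OF gi, of x], of j], of j] by simp
    have "(\<Sum>j\<in>UNIV. cosT (gradT (F t)) x $ j $ j) = (LINT \<xi>|lborel. (\<Sum>j\<in>UNIV. cos (x \<bullet> \<xi>) * gradT (F t) \<xi> $ j $ j))"
      unfolding cosT_nth[OF gi] using i by (subst Bochner_Integration.integral_sum) auto
    also have "\<dots> = (LINT \<xi>|lborel. cos (x \<bullet> \<xi>) * (\<Sum>j\<in>UNIV. \<xi> $ j * F t \<xi> $ j))"
      by (simp add: gradT_def sum_distrib_left mult_ac)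
    finally show ?thesis by (simp add: sum_nth_field[OF F])
  qed
  have wg: "(LINT x|lborel. sinT (F t) x $ j * dderiv (axis j 1) \<phi> x) = - (LINT x|lborel. cosT (gradT (F t)) x $ j $ j * \<phi> x)" for j
    using field_weak_gradient[OF F, of t] \<phi> unfolding weak_gradient_def by simp
  have "(LINT x|lborel. (\<Sum>j\<in>UNIV. sinT (F t) x $ j * dderiv (axis j 1) \<phi> x)) = (\<Sum>j\<in>UNIV. LINT x|lborel. sinT (F t) x $ j * dderiv (axis j 1) \<phi> x)"
    using s by (intro Bochner_Integration.integral_sum) (simp add: mult.commute)
  also have "\<dots> = - (LINT x|lborel. (\<Sum>j\<in>UNIV. cosT (gradT (F t)) x $ j $ j * \<phi> x))"
    unfolding wg sum_negf using c by (subst Bochner_Integration.integral_sum) (simp_all add: mult.commute)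
  also have "\<dots> = 0" by (simp add: sum_distrib_right[symmetric] tr)
  finally show "(LINT x|lborel. (\<Sum>j\<in>UNIV. sinT (F t) x $ j * dderiv (axis j 1) \<phi> x)) = 0" .
qed

lemma sinT_eq_sinS: "integrable lborel (F t) \<Longrightarrow> sinT (F t) x $ i = sinS (\<lambda>t \<xi>. F t \<xi> $ i) (t, x)"
  by (simp add: sinT_nth sinS_def)

lemma test_fun_spacetime_0:
  assumes "test_fun (spacetime T) \<phi>" "t \<notin> {0<..<T}" shows "\<phi> (t, x) = 0"
proof -
  obtain K where "K \<subseteq> spacetime T" "\<And>z. z \<notin> K \<Longrightarrow> \<phi> z = 0" using test_fun_support[OF assms(1)] by metis
  then show ?thesis using assms(2) by blast
qed

lemma field_div_eq:
  assumes F: "field C r (F :: real \<Rightarrow> real^'d::finite \<Rightarrow> real^'d)"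
  shows "div_eq T (\<lambda>t. sinT (F t))"
  unfolding div_eq_def
proof (intro allI impI)
  fix \<phi> :: "real \<times> (real^'d) \<Rightarrow> real" assume \<phi>: "test_fun (spacetime T) \<phi>"
  note dt = test_fun_dderiv[OF \<phi>]
  note t1 = field_tame(1)[OF F] and t2 = field_tame(2)[OF F]
  have i: "integrable lborel (\<lambda>z. d_x j \<phi> z * sinS (\<lambda>t \<xi>. F t \<xi> $ j) z)" for j
    by (rule integrable_test_sinS[OF t1 test_fun_integrable[OF dt]])
  have ic: "integrable lborel (\<lambda>z. \<phi> z * cosS (\<lambda>t \<xi>. \<xi> $ j * F t \<xi> $ j) z)" for j
    using bounded_cosS[OF t2[of j j]] integrable_bounded_mult[OF test_fun_integrable[OF \<phi>] borel_measurable_cosS[OF t2[of j j]]] by blast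
  have c0: "(\<Sum>j\<in>UNIV. cosS (\<lambda>t \<xi>. \<xi> $ j * F t \<xi> $ j) z) = 0" for z
  proof -
    have "(\<Sum>j\<in>UNIV. cosS (\<lambda>t \<xi>. \<xi> $ j * F t \<xi> $ j) z) = (LINT \<xi>|lborel. (\<Sum>j\<in>UNIV. cos (snd z \<bullet> \<xi>) * (\<xi> $ j * F (fst z) \<xi> $ j)))"
      unfolding cosS_def
      using integrable_cos[OF tame_integrable[OF t2], of "snd z"] by (subst Bochner_Integration.integral_sum) auto
    also have "\<dots> = 0" by (simp add: sum_distrib_left[symmetric] sum_nth_field[OF F])
    finally show ?thesis .
  qed
  have "(LINT t:{0<..<T}|lborel. LINT x|lborel. (\<Sum>j\<in>UNIV. sinT (F t) x $ j * d_x j \<phi> (t, x)))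
    = (LINT t:{0<..<T}|lborel. LINT x|lborel. (\<lambda>z. \<Sum>j\<in>UNIV. d_x j \<phi> z * sinS (\<lambda>t \<xi>. F t \<xi> $ j) z) (t, x))"
    by (simp add: sinT_eq_sinS[of F, OF fieldD(8)[OF F]] mult.commute)
  also have "\<dots> = (LINT z|lborel. (\<Sum>j\<in>UNIV. d_x j \<phi> z * sinS (\<lambda>t \<xi>. F t \<xi> $ j) z))"
  proof (rule iterated_LINT)
    show "(\<Sum>j\<in>UNIV. d_x j \<phi> (t, x) * sinS (\<lambda>t \<xi>. F t \<xi> $ j) (t, x)) = 0" if "t \<notin> {0<..<T}" for t x
      by (simp only: test_fun_spacetime_0[OF dt that] mult_zero_left sum.neutral_const)
  qed (intro Bochner_Integration.integrable_sum i)
  also have "\<dots> = (\<Sum>j\<in>UNIV. LINT z|lborel. d_x j \<phi> z * sinS (\<lambda>t \<xi>. F t \<xi> $ j) z)"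
    by (intro Bochner_Integration.integral_sum i)
  also have "\<dots> = (\<Sum>j\<in>UNIV. - (LINT z|lborel. \<phi> z * cosS (\<lambda>t \<xi>. \<xi> $ j * F t \<xi> $ j) z))"
    by (intro sum.cong refl test_sinS[OF \<phi> t1 t2])
  also have "\<dots> = - (LINT z|lborel. (\<Sum>j\<in>UNIV. \<phi> z * cosS (\<lambda>t \<xi>. \<xi> $ j * F t \<xi> $ j) z))"
    unfolding sum_negf using ic by (subst Bochner_Integration.integral_sum) auto
  also have "\<dots> = 0" by (simp add: sum_distrib_left[symmetric] c0)
  finally show "(LINT t:{0<..<T}|lborel. LINT x|lborel. (\<Sum>j\<in>UNIV. sinT (F t) x $ j * d_x j \<phi> (t, x))) = 0" .
qed

text \<open>Continuity in time of the amplitudes makes the squared norm continuous, hence integrable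
  on a bounded interval. Joint continuity makes the pairings with test functions Borel measurable in
  time, and both facts pass to the completed measure.\<close>

lemma field_L2_Hs:
  assumes F: "field C r (F :: real \<Rightarrow> real^'d::finite \<Rightarrow> real^'d)" and s: "s > 0"
  shows "L2_Hs T s (\<lambda>t. cosT (gradT (F t)))"
  unfolding L2_Hs_def
proof (intro conjI allI impI ballI)
  let ?W = "\<lambda>t. gradT (F t)"
  note W = field_gradT[OF F]
  have r: "r/2 > 0" using fieldD(1)[OF F] by simp
  note Wc = continuous_on_slice(1)[of ?W, OF W(1)]
  note H = Hs_cosT[OF Wc r s W(2) W(3)]
  show "AE t in lborel. t \<in> {0<..<T} \<longrightarrow> in_Hs s (cosT (?W t))"
    by (intro AE_I2 impI H(1))
  have N: "(\<lambda>t. (Hs_norm s (cosT (?W t)))\<^sup>2) = (\<lambda>t. ((2 * pi) ^ DIM(real^'d) * sqrt (LINT \<xi>|lborel. (1 + (norm \<xi>)\<^sup>2) powr s * (norm (?W t \<xi>))\<^sup>2))\<^sup>2)"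
    by (simp only: H(2))
  have c: "continuous_on UNIV (\<lambda>t. (Hs_norm s (cosT (?W t)))\<^sup>2)"
    unfolding N by (intro continuous_intros continuous_on_weighted_square[OF W(1) r s W(2)])
  have "integrable lborel (\<lambda>t. indicator {0..T} t *\<^sub>R (Hs_norm s (cosT (?W t)))\<^sup>2)"
    by (rule borel_integrable_compact) (use continuous_on_subset[OF c] in auto)
  then have i: "set_integrable lborel {0..T} (\<lambda>t. (Hs_norm s (cosT (?W t)))\<^sup>2)"
    by (simp add: set_integrable_def)
  have "set_integrable lborel {0<..<T} (\<lambda>t. (Hs_norm s (cosT (?W t)))\<^sup>2)"
    by (rule set_integrable_subset[OF i]) auto
  then have j: "integrable lborel (\<lambda>t. indicator {0<..<T} t *\<^sub>R (Hs_norm s (cosT (?W t)))\<^sup>2)"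
    by (simp add: set_integrable_def)
  then show "set_integrable lebesgue {0<..<T} (\<lambda>t. (Hs_norm s (cosT (?W t)))\<^sup>2)"
    unfolding set_integrable_def by (subst integrable_completion) (auto dest: borel_measurable_integrable)
  fix \<phi> :: "real^'d \<Rightarrow> real" and e :: "real^'d^'d" assume \<phi>: "test_fun UNIV \<phi>" and e: "e \<in> Basis"
  have \<phi>m: "(\<lambda>w::real \<times> (real^'d). \<phi> (snd w)) \<in> borel_measurable borel"
    by (intro borel_measurable_continuous_onI continuous_on_compose2[OF test_fun_continuous[OF \<phi>]] continuous_intros) auto
  have eq: "cosT (?W t) x \<bullet> e = (LINT \<xi>|lborel. cos (x \<bullet> \<xi>) * (?W t \<xi> \<bullet> e))" for t x
    unfolding cosT_def using integral_inner_left[OF integrable_cos[OF W(4), of x t], of e] by simp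
  have "continuous_on UNIV (\<lambda>w::(real \<times> (real^'d)) \<times> (real^'d). cos (snd (fst w) \<bullet> snd w) * (?W (fst (fst w)) (snd w) \<bullet> e))"
  proof -
    have "continuous_on UNIV (\<lambda>w::(real \<times> (real^'d)) \<times> (real^'d). (fst (fst w), snd w))"
      by (intro continuous_intros)
    from continuous_on_compose2[OF W(1) this]
    have "continuous_on UNIV (\<lambda>w::(real \<times> (real^'d)) \<times> (real^'d). ?W (fst (fst w)) (snd w))" by simp
    then show ?thesis by (intro continuous_intros)
  qed
  from borel_measurable_LINT[OF borel_measurable_continuous_onI[OF this]]
  have "(\<lambda>w. cosT (?W (fst w)) (snd w) \<bullet> e) \<in> borel_measurable borel" by (simp add: eq)
  from borel_measurable_LINT[OF borel_measurable_times[OF this \<phi>m]]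
  have "(\<lambda>t. LINT x|lborel. (cosT (?W t) x \<bullet> e) * \<phi> x) \<in> borel_measurable borel" by simp
  then have "(\<lambda>t. indicator {0<..<T} t *\<^sub>R (LINT x|lborel. (cosT (?W t) x \<bullet> e) * \<phi> x)) \<in> borel_measurable lborel"
    by (intro borel_measurable_scaleR borel_measurable_indicator) auto
  then show "set_borel_measurable lebesgue {0<..<T} (\<lambda>t. LINT x|lborel. (cosT (?W t) x \<bullet> e) * \<phi> x)"
    unfolding set_borel_measurable_def by (rule measurable_completion)
qed

text \<open>Q is of first order at the origin, so its inner product with \<xi> is of second order
  and the quotient stays bounded there.\<close>

lemma tame_pressure:
  fixes Q :: "real \<Rightarrow> real^'d::finite \<Rightarrow> real^'d"
  assumes c: "continuous_on UNIV (\<lambda>z. Q (fst z) (snd z))" and r: "r > 0"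
    and b: "\<And>t \<xi>. norm (Q t \<xi>) \<le> K * (norm \<xi> * exp (- (r * norm \<xi>)))"
  shows "tame (\<lambda>t \<xi>. (\<xi> \<bullet> Q t \<xi>) / (norm \<xi>)\<^sup>2)" and "tame (\<lambda>t \<xi>. \<xi> $ i * ((\<xi> \<bullet> Q t \<xi>) / (norm \<xi>)\<^sup>2))"
proof -
  have m: "(\<lambda>z. (snd z \<bullet> Q (fst z) (snd z)) / (norm (snd z))\<^sup>2) \<in> borel_measurable borel"
    by (intro borel_measurable_divide borel_measurable_continuous_onI continuous_intros c)
  have p: "\<bar>(\<xi> \<bullet> Q t \<xi>) / (norm \<xi>)\<^sup>2\<bar> \<le> \<bar>K\<bar> * exp (- (r * norm \<xi>))" for t \<xi>
  proof (cases "\<xi> = 0")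
    case False
    then have n: "norm \<xi> > 0" by simp
    have "\<bar>\<xi> \<bullet> Q t \<xi>\<bar> \<le> norm \<xi> * norm (Q t \<xi>)" by (rule Cauchy_Schwarz_ineq2)
    also have "\<dots> \<le> norm \<xi> * (\<bar>K\<bar> * (norm \<xi> * exp (- (r * norm \<xi>))))"
      by (intro mult_left_mono order_trans[OF b] mult_right_mono) auto
    also have "\<dots> = (\<bar>K\<bar> * exp (- (r * norm \<xi>))) * (norm \<xi>)\<^sup>2" by (simp add: power2_eq_square)
    finally show ?thesis using n by (simp add: abs_divide pos_divide_le_eq)
  qed simp
  have le1: "\<bar>K\<bar> * exp (- (r * norm \<xi>)) \<le> \<bar>K\<bar> * ((1 + (norm \<xi>)\<^sup>2) * exp (- (r * norm \<xi>)))" for \<xi> :: "real^'d"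
    by (intro mult_left_mono) auto
  show "tame (\<lambda>t \<xi>. (\<xi> \<bullet> Q t \<xi>) / (norm \<xi>)\<^sup>2)"
    by (rule tame_bound[OF m r order_trans[OF p le1]])
  have q: "\<bar>\<xi> $ i * ((\<xi> \<bullet> Q t \<xi>) / (norm \<xi>)\<^sup>2)\<bar> \<le> \<bar>K\<bar> * ((1 + (norm \<xi>)\<^sup>2) * exp (- (r * norm \<xi>)))" for t \<xi>
  proof -
    have "\<bar>\<xi> $ i\<bar> \<le> 1 + (norm \<xi>)\<^sup>2" by (rule order_trans[OF component_le_norm_cart norm_le_1_square])
    then have "\<bar>\<xi> $ i\<bar> * \<bar>(\<xi> \<bullet> Q t \<xi>) / (norm \<xi>)\<^sup>2\<bar> \<le> (1 + (norm \<xi>)\<^sup>2) * (\<bar>K\<bar> * exp (- (r * norm \<xi>)))"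
      by (intro mult_mono p) auto
    then show ?thesis by (simp only: abs_mult mult_ac)
  qed
  have mi: "(\<lambda>z::real \<times> (real^'d). snd z $ i) \<in> borel_measurable borel"
    by (intro borel_measurable_continuous_onI continuous_intros)
  show "tame (\<lambda>t \<xi>. \<xi> $ i * ((\<xi> \<bullet> Q t \<xi>) / (norm \<xi>)\<^sup>2))"
    by (rule tame_bound[OF borel_measurable_times[OF mi m] r q])
qed

lemma has_vector_derivative_nth:
  "(f has_vector_derivative D) F \<Longrightarrow> ((\<lambda>t. f t $ i) has_vector_derivative D $ i) F"
  using bounded_linear.has_vector_derivative[OF bounded_linear_vec_nth] .

section \<open>Weak form of the equations for solutions on the Fourier side\<close>

text \<open>For each frequency the system is an ordinary differential equation in time, with the
  pressure eliminated by \<open>leray\<close>. Frequencies interact only through the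
  convolutions.\<close>

locale fourier_mhd =
  fixes U B :: "real \<Rightarrow> real^'d::finite \<Rightarrow> real^'d" and C r T :: real
  assumes fU: "field C r U" and fB: "field C r B"
    and dU: "\<And>t \<xi>. 0 < t \<Longrightarrow> t < T \<Longrightarrow> ((\<lambda>t. U t \<xi>) has_vector_derivative
      - ((norm \<xi>)\<^sup>2 *\<^sub>R U t \<xi>) - leray \<xi> (adv (U t) (U t) \<xi> - adv (B t) (B t) \<xi>)) (at t)"
    and dB: "\<And>t \<xi>. 0 < t \<Longrightarrow> t < T \<Longrightarrow> ((\<lambda>t. B t \<xi>) has_vector_derivative
      adv (B t) (U t) \<xi> - adv (U t) (B t) \<xi>) (at t)"
begin

text \<open>The cosine amplitude of the pressure. Minus the pressure gradient then has the sine
  amplitude \<open>pres t \<xi>\<close> times \<xi>, exactly the part that \<open>leray\<close>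
  removes from the quadratic terms.\<close>

definition pres :: "real \<Rightarrow> real^'d \<Rightarrow> real" where
  "pres t \<xi> = (\<xi> \<bullet> (adv (U t) (U t) \<xi> - adv (B t) (B t) \<xi>)) / (norm \<xi>)\<^sup>2"

lemma tame_pres: "tame pres" "tame (\<lambda>t \<xi>. \<xi> $ i * pres t \<xi>)"
proof -
  let ?Q = "\<lambda>t \<xi>. adv (U t) (U t) \<xi> - adv (B t) (B t) \<xi>"
  obtain K1 K2 where K: "K1 \<ge> 0" "\<And>t \<xi>. norm (adv (U t) (U t) \<xi>) \<le> K1 * (norm \<xi> * exp (- (r/2 * norm \<xi>)))"
    "\<And>t \<xi>. norm (adv (B t) (B t) \<xi>) \<le> K2 * (norm \<xi> * exp (- (r/2 * norm \<xi>)))"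
    using field_adv(2)[OF fU fU] field_adv(2)[OF fB fB] by metis
  have c: "continuous_on UNIV (\<lambda>z. ?Q (fst z) (snd z))"
    by (intro continuous_intros field_adv(1)[OF fU fU] field_adv(1)[OF fB fB])
  have b: "norm (?Q t \<xi>) \<le> (K1 + K2) * (norm \<xi> * exp (- (r/2 * norm \<xi>)))" for t \<xi>
    using norm_triangle_ineq4[of "adv (U t) (U t) \<xi>" "adv (B t) (B t) \<xi>"] K(2,3)[of t \<xi>] by (simp add: distrib_right)
  have r: "r/2 > 0" using fieldD(1)[OF fU] by simp
  show "tame pres" "tame (\<lambda>t \<xi>. \<xi> $ i * pres t \<xi>)"
    using tame_pressure[OF c r b] unfolding pres_def[abs_def] by auto
qed

lemma advect_eq:
  assumes F: "field C r F" and G: "field C r G"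
  shows "advect (sinT (F t) x) (cosT (gradT (G t)) x) i = sinS (\<lambda>t \<xi>. adv (F t) (G t) \<xi> $ i) (t, x)"
  by (subst advect_sinT[OF fieldD(6)[OF F] fieldD(6)[OF G] fieldD(1)[OF F] fieldD(3)[OF F] fieldD(3)[OF G] fieldD(4)[OF G] fieldD(5)[OF F] field_gradT(4)[OF G] field_adv(4)[OF F G]])
    (rule sinT_eq_sinS[of "\<lambda>t. adv (F t) (G t)", OF field_adv(4)[OF F G]])

lemma test_time_field:
  assumes \<phi>: "test_fun (spacetime T) \<phi>" and F: "field C r F" and D: "tame D"
    and d: "\<And>t \<xi>. 0 < t \<Longrightarrow> t < T \<Longrightarrow> ((\<lambda>t. F t \<xi> $ i) has_real_derivative D t \<xi>) (at t)"
  shows "(LINT z|lborel. d_t \<phi> z * sinS (\<lambda>t \<xi>. F t \<xi> $ i) z) = - (LINT z|lborel. \<phi> z * sinS D z)"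
proof -
  obtain g where g: "integrable lborel g" "\<And>t \<xi>. \<bar>F t \<xi> $ i\<bar> \<le> g \<xi>" and m: "(\<lambda>z. F (fst z) (snd z) $ i) \<in> borel_measurable borel"
    using field_tame(1)[OF F, of i] by (auto simp: tame_def)
  obtain g' where g': "integrable lborel g'" "\<And>t \<xi>. \<bar>D t \<xi>\<bar> \<le> g' \<xi>" and m': "(\<lambda>z. D (fst z) (snd z)) \<in> borel_measurable borel"
    using D by (auto simp: tame_def)
  show ?thesis
    unfolding sinS_def by (rule test_time[of T \<phi> "\<lambda>t \<xi>. F t \<xi> $ i" D, OF \<phi> m m' d g(2) g(1) g'(2) g'(1)])
qed

lemma momentum_equation: "momentum_eq T (\<lambda>t. sinT (U t)) (\<lambda>t. cosT (gradT (U t))) (\<lambda>t. sinT (B t)) (\<lambda>t. cosT (gradT (B t))) (cosS pres)"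
  unfolding momentum_eq_def
proof (intro allI impI)
  fix \<phi> :: "real \<times> (real^'d) \<Rightarrow> real" and i :: 'd
  assume \<phi>: "test_fun (spacetime T) \<phi>"
  \<comment> \<open>Sine amplitudes of the i-th components: a belongs to u, n to the advection of u,
    m to that of b, l to minus the Laplacian of u, and q to minus the pressure gradient. The
    equation reads a' = - l - n + m + q.\<close>
  define a where "a t \<xi> = U t \<xi> $ i" for t \<xi>
  define n where "n t \<xi> = adv (U t) (U t) \<xi> $ i" for t \<xi>
  define m where "m t \<xi> = adv (B t) (B t) \<xi> $ i" for t \<xi>
  define l where "l t \<xi> = (norm \<xi>)\<^sup>2 * U t \<xi> $ i" for t \<xi>
  define q where "q t \<xi> = \<xi> $ i * pres t \<xi>" for t \<xi>
  have ta: "tame a" and tl: "tame l" and tn: "tame n" and tm: "tame m" and tq: "tame q"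
    unfolding a_def l_def n_def m_def q_def
    using field_tame(1,4)[OF fU] field_adv(3)[OF fU fU] field_adv(3)[OF fB fB] tame_pres(2) by auto
  define a' where "a' t \<xi> = - l t \<xi> + (- n t \<xi> + (m t \<xi> + q t \<xi>))" for t \<xi>
  have ta': "tame a'" unfolding a'_def by (intro tame_add tame_uminus tl tn tm tq)
  have sa': "sinS a' z = - sinS l z + (- sinS n z + (sinS m z + sinS q z))" for z
    unfolding a'_def
    by (simp only: sinS_add[OF tame_uminus[OF tl] tame_add[OF tame_uminus[OF tn] tame_add[OF tm tq]]]
      sinS_add[OF tame_uminus[OF tn] tame_add[OF tm tq]] sinS_add[OF tm tq] sinS_uminus)
  note d1 = test_fun_dderiv[OF \<phi>]
  note \<phi>i = test_fun_integrable[OF \<phi>] and d1i = test_fun_integrable[OF d1] and d2i = test_fun_integrable[OF test_fun_dderiv[OF d1]]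
  have I: "integrable lborel (\<lambda>z. d_t \<phi> z * sinS a z)" "integrable lborel (\<lambda>z. \<phi> z * sinS n z)" "integrable lborel (\<lambda>z. \<phi> z * sinS m z)"
    "integrable lborel (\<lambda>z. \<phi> z * sinS l z)" "integrable lborel (\<lambda>z. \<phi> z * sinS q z)"
    by (intro integrable_test_sinS ta tn tm tl tq \<phi>i d1i)+
  have Ij: "integrable lborel (\<lambda>z. d_x j (d_x j \<phi>) z * sinS a z)" for j
    by (intro integrable_test_sinS ta d2i)
  have jj: "(LINT z|lborel. d_x j (d_x j \<phi>) z * sinS a z) = - (LINT z|lborel. \<phi> z * sinS (\<lambda>t \<xi>. \<xi> $ j * (\<xi> $ j * a t \<xi>)) z)" for j
    using test_sinS[OF d1[of "(0, axis j 1)"] ta, of j] test_cosS[OF \<phi>, of "\<lambda>t \<xi>. \<xi> $ j * a t \<xi>" j] field_tame(2,3)[OF fU]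
    unfolding a_def by simp
  have lsum: "(\<Sum>j\<in>UNIV. sinS (\<lambda>t \<xi>. \<xi> $ j * (\<xi> $ j * a t \<xi>)) z) = sinS l z" for z
  proof -
    have tj: "tame (\<lambda>t \<xi>. \<xi> $ j * (\<xi> $ j * a t \<xi>))" for j unfolding a_def by (rule field_tame(3)[OF fU])
    have "(\<Sum>j\<in>UNIV. sinS (\<lambda>t \<xi>. \<xi> $ j * (\<xi> $ j * a t \<xi>)) z)
       = (LINT \<xi>|lborel. (\<Sum>j\<in>UNIV. sin (snd z \<bullet> \<xi>) * (\<xi> $ j * (\<xi> $ j * a (fst z) \<xi>))))"
      unfolding sinS_def using integrable_sin[OF tame_integrable[OF tj], of "snd z"]
      by (subst Bochner_Integration.integral_sum) auto
    also have "\<dots> = sinS l z"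
      unfolding sinS_def l_def a_def
      by (intro Bochner_Integration.integral_cong refl)
        (simp add: power2_norm_eq_inner inner_vec_def sum_distrib_left sum_distrib_right mult_ac)
    finally show ?thesis .
  qed
  have Ijl: "integrable lborel (\<lambda>z. \<phi> z * sinS (\<lambda>t \<xi>. \<xi> $ j * (\<xi> $ j * a t \<xi>)) z)" for j
    unfolding a_def by (intro integrable_test_sinS field_tame(3)[OF fU] \<phi>i)
  have lap: "(LINT z|lborel. (\<Sum>j\<in>UNIV. d_x j (d_x j \<phi>) z) * sinS a z) = - (LINT z|lborel. \<phi> z * sinS l z)"
  proof -
    have "(LINT z|lborel. (\<Sum>j\<in>UNIV. d_x j (d_x j \<phi>) z) * sinS a z) = (\<Sum>j\<in>UNIV. LINT z|lborel. d_x j (d_x j \<phi>) z * sinS a z)"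
      unfolding sum_distrib_right by (intro Bochner_Integration.integral_sum Ij)
    also have "\<dots> = - (LINT z|lborel. (\<Sum>j\<in>UNIV. \<phi> z * sinS (\<lambda>t \<xi>. \<xi> $ j * (\<xi> $ j * a t \<xi>)) z))"
      unfolding jj sum_negf by (subst Bochner_Integration.integral_sum) (auto intro: Ijl)
    finally show ?thesis by (simp add: sum_distrib_left[symmetric] lsum)
  qed
  have lapi: "integrable lborel (\<lambda>z. (\<Sum>j\<in>UNIV. d_x j (d_x j \<phi>) z) * sinS a z)"
    unfolding sum_distrib_right by (intro Bochner_Integration.integrable_sum Ij)
  have time: "(LINT z|lborel. d_t \<phi> z * sinS a z) = - (LINT z|lborel. \<phi> z * sinS a' z)"
    unfolding a_def
  proof (rule test_time_field[OF \<phi> fU ta'])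
    fix t \<xi> assume "0 < t" "t < T"
    from has_vector_derivative_nth[OF dU[OF this, of \<xi>], of i]
    show "((\<lambda>t. U t \<xi> $ i) has_real_derivative a' t \<xi>) (at t)"
      unfolding has_real_derivative_iff_has_vector_derivative
      by (simp add: a'_def l_def n_def m_def q_def leray_def pres_def algebra_simps)
  qed
  have pr: "(LINT z|lborel. cosS pres z * d_x i \<phi> z) = (LINT z|lborel. \<phi> z * sinS q z)"
    using test_cosS[OF \<phi> tame_pres(1) tame_pres(2)] unfolding q_def by (simp add: mult.commute)
  let ?F = "\<lambda>z. - (d_t \<phi> z * sinS a z) + \<phi> z * sinS n z - (\<Sum>j\<in>UNIV. d_x j (d_x j \<phi>) z) * sinS a z"
  have Fi: "integrable lborel ?F" using I(1,2) lapi by auto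
  have z0: "\<phi> (t, x) = 0" "d_t \<phi> (t, x) = 0" "d_x j (d_x j \<phi>) (t, x) = 0" if "t \<notin> {0<..<T}" for t x j
    using test_fun_spacetime_0[OF \<phi> that] test_fun_spacetime_0[OF d1 that] test_fun_spacetime_0[OF test_fun_dderiv[OF d1] that] by blast+
  have "(LINT t:{0<..<T}|lborel. LINT x|lborel.
          - sinT (U t) x $ i * d_t \<phi> (t, x)
          + advect (sinT (U t) x) (cosT (gradT (U t)) x) i * \<phi> (t, x)
          - sinT (U t) x $ i * (\<Sum>j\<in>UNIV. d_x j (d_x j \<phi>) (t, x)))
      = (LINT t:{0<..<T}|lborel. LINT x|lborel. ?F (t, x))"
    unfolding advect_eq[OF fU fU] sinT_eq_sinS[of U, OF fieldD(8)[OF fU]] a_def[symmetric] n_def[symmetric]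
    by (simp only: mult.commute[of "sinS a _"] mult.commute[of "sinS n _"] mult_minus_left mult.commute[of "- sinS a _"] mult_minus_right)
  also have "\<dots> = (LINT z|lborel. ?F z)"
    by (rule iterated_LINT[OF Fi]) (simp only: z0 not_False_eq_True mult_zero_left sum.neutral_const minus_zero add_0_right diff_0_right)
  also have "\<dots> = - (LINT z|lborel. d_t \<phi> z * sinS a z) + (LINT z|lborel. \<phi> z * sinS n z) - (LINT z|lborel. (\<Sum>j\<in>UNIV. d_x j (d_x j \<phi>) z) * sinS a z)"
    using I(1,2) lapi by simp
  also have "\<dots> = (LINT z|lborel. \<phi> z * sinS a' z) + (LINT z|lborel. \<phi> z * sinS n z) + (LINT z|lborel. \<phi> z * sinS l z)"
    unfolding time lap by simp
  also have "(LINT z|lborel. \<phi> z * sinS a' z) = - (LINT z|lborel. \<phi> z * sinS l z) + (- (LINT z|lborel. \<phi> z * sinS n z) + ((LINT z|lborel. \<phi> z * sinS m z) + (LINT z|lborel. \<phi> z * sinS q z)))"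
    unfolding sa' distrib_left mult_minus_right using I by simp
  finally have L: "(LINT t:{0<..<T}|lborel. LINT x|lborel.
          - sinT (U t) x $ i * d_t \<phi> (t, x)
          + advect (sinT (U t) x) (cosT (gradT (U t)) x) i * \<phi> (t, x)
          - sinT (U t) x $ i * (\<Sum>j\<in>UNIV. d_x j (d_x j \<phi>) (t, x))) = (LINT z|lborel. \<phi> z * sinS m z) + (LINT z|lborel. \<phi> z * sinS q z)"
    by linarith
  have "(LINT t:{0<..<T}|lborel. LINT x|lborel. advect (sinT (B t) x) (cosT (gradT (B t)) x) i * \<phi> (t, x))
      = (LINT t:{0<..<T}|lborel. LINT x|lborel. (\<lambda>z. \<phi> z * sinS m z) (t, x))"
    unfolding advect_eq[OF fB fB] m_def[symmetric] by (simp only: mult.commute)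
  also have "\<dots> = (LINT z|lborel. \<phi> z * sinS m z)"
    by (rule iterated_LINT[OF I(3)]) (simp only: z0 not_False_eq_True mult_zero_left)
  finally show "(LINT t:{0<..<T}|lborel. LINT x|lborel.
          - sinT (U t) x $ i * d_t \<phi> (t, x)
          + advect (sinT (U t) x) (cosT (gradT (U t)) x) i * \<phi> (t, x)
          - sinT (U t) x $ i * (\<Sum>j\<in>UNIV. d_x j (d_x j \<phi>) (t, x)))
       - (LINT z|lborel. cosS pres z * d_x i \<phi> z)
     = (LINT t:{0<..<T}|lborel. LINT x|lborel. advect (sinT (B t) x) (cosT (gradT (B t)) x) i * \<phi> (t, x))"
    unfolding L pr by simp
qed

lemma induction_equation: "induction_eq T (\<lambda>t. sinT (U t)) (\<lambda>t. cosT (gradT (U t))) (\<lambda>t. sinT (B t)) (\<lambda>t. cosT (gradT (B t)))"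
  unfolding induction_eq_def
proof (intro allI impI)
  fix \<phi> :: "real \<times> (real^'d) \<Rightarrow> real" and i :: 'd
  assume \<phi>: "test_fun (spacetime T) \<phi>"
  define a where "a t \<xi> = B t \<xi> $ i" for t \<xi>
  define n where "n t \<xi> = adv (U t) (B t) \<xi> $ i" for t \<xi>
  define m where "m t \<xi> = adv (B t) (U t) \<xi> $ i" for t \<xi>
  have ta: "tame a" and tn: "tame n" and tm: "tame m"
    unfolding a_def n_def m_def
    using field_tame(1)[OF fB] field_adv(3)[OF fU fB] field_adv(3)[OF fB fU] by auto
  define a' where "a' t \<xi> = - n t \<xi> + m t \<xi>" for t \<xi>
  have ta': "tame a'" unfolding a'_def by (intro tame_add tame_uminus tn tm)
  have sa': "sinS a' z = - sinS n z + sinS m z" for z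
    unfolding a'_def by (simp only: sinS_add[OF tame_uminus[OF tn] tm] sinS_uminus)
  note d1 = test_fun_dderiv[OF \<phi>]
  note \<phi>i = test_fun_integrable[OF \<phi>] and d1i = test_fun_integrable[OF d1]
  have I: "integrable lborel (\<lambda>z. d_t \<phi> z * sinS a z)" "integrable lborel (\<lambda>z. \<phi> z * sinS n z)" "integrable lborel (\<lambda>z. \<phi> z * sinS m z)"
    by (intro integrable_test_sinS ta tn tm \<phi>i d1i)+
  have time: "(LINT z|lborel. d_t \<phi> z * sinS a z) = - (LINT z|lborel. \<phi> z * sinS a' z)"
    unfolding a_def
  proof (rule test_time_field[OF \<phi> fB ta'])
    fix t \<xi> assume "0 < t" "t < T"
    from has_vector_derivative_nth[OF dB[OF this, of \<xi>], of i]
    show "((\<lambda>t. B t \<xi> $ i) has_real_derivative a' t \<xi>) (at t)"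
      unfolding has_real_derivative_iff_has_vector_derivative by (simp add: a'_def n_def m_def)
  qed
  let ?F = "\<lambda>z. - (d_t \<phi> z * sinS a z) + \<phi> z * sinS n z"
  have Fi: "integrable lborel ?F" using I(1,2) by auto
  have z0: "\<phi> (t, x) = 0" "d_t \<phi> (t, x) = 0" if "t \<notin> {0<..<T}" for t x
    using test_fun_spacetime_0[OF \<phi> that] test_fun_spacetime_0[OF d1 that] by blast+
  have "(LINT t:{0<..<T}|lborel. LINT x|lborel.
          - sinT (B t) x $ i * d_t \<phi> (t, x)
          + advect (sinT (U t) x) (cosT (gradT (B t)) x) i * \<phi> (t, x))
      = (LINT t:{0<..<T}|lborel. LINT x|lborel. ?F (t, x))"
    unfolding advect_eq[OF fU fB] sinT_eq_sinS[of B, OF fieldD(8)[OF fB]] a_def[symmetric] n_def[symmetric]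
    by (simp only: mult.commute[of "sinS n _"] mult.commute[of "- sinS a _"] mult_minus_right)
  also have "\<dots> = (LINT z|lborel. ?F z)"
    by (rule iterated_LINT[OF Fi]) (simp only: z0 not_False_eq_True mult_zero_left minus_zero add_0_right)
  also have "\<dots> = - (LINT z|lborel. d_t \<phi> z * sinS a z) + (LINT z|lborel. \<phi> z * sinS n z)"
    using I(1,2) by simp
  also have "\<dots> = (LINT z|lborel. \<phi> z * sinS m z)"
    unfolding time sa' distrib_left mult_minus_right using I by simp
  also have "\<dots> = (LINT t:{0<..<T}|lborel. LINT x|lborel. (\<lambda>z. \<phi> z * sinS m z) (t, x))"
    by (rule iterated_LINT[OF I(3), symmetric]) (simp only: z0 not_False_eq_True mult_zero_left)
  also have "\<dots> = (LINT t:{0<..<T}|lborel. LINT x|lborel. advect (sinT (B t) x) (cosT (gradT (U t)) x) i * \<phi> (t, x))"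
    unfolding advect_eq[OF fB fU] m_def[symmetric] by (simp only: mult.commute)
  finally show "(LINT t:{0<..<T}|lborel. LINT x|lborel.
          - sinT (B t) x $ i * d_t \<phi> (t, x)
          + advect (sinT (U t) x) (cosT (gradT (B t)) x) i * \<phi> (t, x))
     = (LINT t:{0<..<T}|lborel. LINT x|lborel. advect (sinT (B t) x) (cosT (gradT (U t)) x) i * \<phi> (t, x))" .
qed

theorem solution:
  assumes s: "s > 0"
  shows "mhd_solution s T (sinT (U 0)) (sinT (B 0)) (\<lambda>t. sinT (U t)) (\<lambda>t. sinT (B t))"
proof -
  have P: "loc_integrable (spacetime T) (cosS pres)"
    using bounded_cosS[OF tame_pres(1)] loc_integrable_bounded[OF borel_measurable_cosS[OF tame_pres(1)]] by (metis real_norm_def)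
  have "\<exists>Du Db P.
        (\<forall>t\<in>{0..T}. weak_gradient (sinT (U t)) (Du t) \<and> weak_gradient (sinT (B t)) (Db t)) \<and>
        L2_Hs T s Du \<and> loc_integrable (spacetime T) P \<and>
        momentum_eq T (\<lambda>t. sinT (U t)) Du (\<lambda>t. sinT (B t)) Db P \<and>
        induction_eq T (\<lambda>t. sinT (U t)) Du (\<lambda>t. sinT (B t)) Db \<and>
        div_eq T (\<lambda>t. sinT (U t)) \<and> div_eq T (\<lambda>t. sinT (B t))"
    by (intro exI[of _ "\<lambda>t. cosT (gradT (U t))"] exI[of _ "\<lambda>t. cosT (gradT (B t))"] exI[of _ "cosS pres"] conjI ballI
      field_weak_gradient[OF fU] field_weak_gradient[OF fB] field_L2_Hs[OF fU s] P momentum_equation induction_equation field_div_eq[OF fU] field_div_eq[OF fB])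
  then show ?thesis
    unfolding mhd_solution_def
    by (intro conjI AE_I2 refl field_in_Hs[OF fU s] field_in_Hs[OF fB s] field_weak_div_free[OF fU] field_weak_div_free[OF fB]
      field_C_Hs[OF fU s] field_C_Hs[OF fB s])
qed

end

subsection \<open>The fixed point problem\<close>

lemma tendsto_apply_bcontfun:
  assumes "X \<longlonglongrightarrow> F" shows "(\<lambda>n. apply_bcontfun (X n) p) \<longlonglongrightarrow> apply_bcontfun F p"
proof (rule tendstoI)
  fix e :: real assume "e > 0"
  with assms have "\<forall>\<^sub>F n in sequentially. dist (X n) F < e" by (rule tendstoD)
  then show "\<forall>\<^sub>F n in sequentially. dist (apply_bcontfun (X n) p) (apply_bcontfun F p) < e"
    by eventually_elim (rule le_less_trans[OF dist_bounded])
qed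

lemma norm_leray_le: "norm (leray \<xi> v) \<le> norm v"
proof (cases "\<xi> = 0")
  case False
  then have n: "(norm \<xi>)\<^sup>2 > 0" by simp
  have "(norm (leray \<xi> v))\<^sup>2 = (norm v)\<^sup>2 - (\<xi> \<bullet> v)\<^sup>2 / (norm \<xi>)\<^sup>2"
    unfolding power2_norm_eq_inner leray_def using False
    by (simp add: inner_diff_left inner_diff_right inner_commute power2_eq_square field_simps)
  also have "\<dots> \<le> (norm v)\<^sup>2" by simp
  finally show ?thesis by (simp add: power2_le_iff_abs_le)
qed (simp add: leray_def)

lemma leray_minus: "leray (- \<xi>) (- v) = - leray \<xi> v"
  by (simp add: leray_def)

lemma inner_leray: "\<xi> \<bullet> leray \<xi> v = 0"
  by (cases "\<xi> = 0") (simp_all add: leray_def inner_diff_right power2_norm_eq_inner)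

lemma leray_linear: "leray \<xi> (u + v) = leray \<xi> u + leray \<xi> v" "leray \<xi> (c *\<^sub>R v) = c *\<^sub>R leray \<xi> v"
  "leray \<xi> (u - v) = leray \<xi> u - leray \<xi> v"
  by (simp_all add: leray_def inner_add_right inner_diff_right add_divide_distrib diff_divide_distrib scaleR_add_left scaleR_diff_left scaleR_diff_right)

text \<open>The symbol itself has no limit at frequency zero. Continuity is restored because f
  vanishes there and the projection does not increase norms.\<close>

lemma continuous_on_leray:
  fixes f :: "'p::metric_space \<Rightarrow> 'a::real_inner"
  assumes g: "continuous_on UNIV g" and f: "continuous_on UNIV f" and 0: "\<And>p. g p = 0 \<Longrightarrow> f p = 0"
  shows "continuous_on UNIV (\<lambda>p. leray (g p) (f p))"
proof (intro continuous_at_imp_continuous_on ballI)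
  fix p
  have gp: "isCont g p" and fp: "isCont f p" using g f by (auto simp: continuous_on_eq_continuous_at)
  show "isCont (\<lambda>p. leray (g p) (f p)) p"
  proof (cases "g p = 0")
    case False
    then show ?thesis unfolding leray_def by (intro continuous_intros gp fp) auto
  next
    case True
    have "(\<lambda>q. leray (g q) (f q)) \<midarrow>p\<rightarrow> 0"
    proof (rule Lim_null_comparison)
      show "\<forall>\<^sub>F q in at p. norm (leray (g q) (f q)) \<le> norm (f q)" by (simp add: norm_leray_le)
      show "(\<lambda>q. norm (f q)) \<midarrow>p\<rightarrow> 0" using fp 0[OF True] by (simp add: isCont_def tendsto_norm_zero)
    qed
    then show ?thesis using 0[OF True] by (simp add: isCont_def leray_def)
  qed
qed

lemma adv_diff:
  assumes "integrable lborel (\<lambda>\<eta>. (\<zeta> \<bullet> U \<eta>) *\<^sub>R B (\<zeta> - \<eta>))" "integrable lborel (\<lambda>\<eta>. (\<zeta> \<bullet> U' \<eta>) *\<^sub>R B (\<zeta> - \<eta>))"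
    "integrable lborel (\<lambda>\<eta>. (\<zeta> \<bullet> U' \<eta>) *\<^sub>R B' (\<zeta> - \<eta>))"
  shows "adv U B \<zeta> - adv U' B' \<zeta> = adv (\<lambda>\<xi>. U \<xi> - U' \<xi>) B \<zeta> + adv U' (\<lambda>\<xi>. B \<xi> - B' \<xi>) \<zeta>"
proof -
  have "adv (\<lambda>\<xi>. U \<xi> - U' \<xi>) B \<zeta> = adv U B \<zeta> - adv U' B \<zeta>"
    unfolding adv_def by (subst Bochner_Integration.integral_diff[symmetric]) (use assms in \<open>simp_all add: inner_diff_right scaleR_diff_left\<close>)
  moreover have "adv U' (\<lambda>\<xi>. B \<xi> - B' \<xi>) \<zeta> = adv U' B \<zeta> - adv U' B' \<zeta>"
    unfolding adv_def by (subst Bochner_Integration.integral_diff[symmetric]) (use assms in \<open>simp_all add: scaleR_diff_right\<close>)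
  ultimately show ?thesis by simp
qed

section \<open>Weights that are stable under convolution\<close>

locale conv_weight =
  fixes S :: "'a::euclidean_space \<Rightarrow> real" and K :: real
  assumes S_cont: "continuous_on UNIV S" and S_pos: "0 < S \<xi>" and S_le: "S \<xi> \<le> 1" and S_even: "S (- \<xi>) = S \<xi>"
    and S_int: "integrable lborel S" and S_conv: "(LINT \<eta>|lborel. S \<eta> * S (\<zeta> - \<eta>)) \<le> K * S \<zeta>" and K_pos: "K > 0"
begin

lemma S_meas[measurable]: "S \<in> borel_measurable borel"
  by (rule borel_measurable_continuous_onI[OF S_cont])

lemma S_conv_integrable: "integrable lborel (\<lambda>\<eta>. S \<eta> * S (\<zeta> - \<eta>))"
  by (rule integrable_dominated[OF S_int])
    (use S_pos S_le less_imp_le[OF S_pos] in \<open>simp_all add: abs_mult mult_right_le_one_le\<close>)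

text \<open>By the triangle inequality the exponential factor is submultiplicative along the
  convolution, so any rate \<rho> \<ge> 0 can be attached to S without changing K. The derivative
  survives as the factor \<open>norm \<zeta>\<close>.\<close>

lemma
  fixes U :: "'a \<Rightarrow> 'a" and V :: "'a \<Rightarrow> 'b::euclidean_space"
  assumes Um: "U \<in> borel_measurable borel" and Vm: "V \<in> borel_measurable borel" and \<rho>: "\<rho> \<ge> 0"
    and U: "\<And>\<xi>. norm (U \<xi>) \<le> a * (S \<xi> * exp (- (\<rho> * norm \<xi>)))" and V: "\<And>\<xi>. norm (V \<xi>) \<le> b * (S \<xi> * exp (- (\<rho> * norm \<xi>)))"
  shows adv_weight_integrable: "integrable lborel (\<lambda>\<eta>. (\<zeta> \<bullet> U \<eta>) *\<^sub>R V (\<zeta> - \<eta>))"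
    and norm_adv_weight: "norm (adv U V \<zeta>) \<le> a * b * K * norm \<zeta> * (S \<zeta> * exp (- (\<rho> * norm \<zeta>)))"
proof -
  have Sp: "S \<xi> * exp (- (\<rho> * norm \<xi>)) > 0" for \<xi> using S_pos by simp
  have a: "a \<ge> 0" using order_trans[OF norm_ge_zero U[of 0]] Sp[of 0] by (simp add: zero_le_mult_iff)
  have b: "b \<ge> 0" using order_trans[OF norm_ge_zero V[of 0]] Sp[of 0] by (simp add: zero_le_mult_iff)
  have e: "exp (- (\<rho> * norm \<eta>)) * exp (- (\<rho> * norm (\<zeta> - \<eta>))) \<le> exp (- (\<rho> * norm \<zeta>))" for \<eta>
  proof -
    have "norm \<zeta> \<le> norm \<eta> + norm (\<zeta> - \<eta>)" using norm_triangle_ineq[of \<eta> "\<zeta> - \<eta>"] by simp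
    then have "\<rho> * norm \<zeta> \<le> \<rho> * (norm \<eta> + norm (\<zeta> - \<eta>))" using \<rho> by (rule mult_left_mono)
    then show ?thesis by (simp add: distrib_left flip: exp_add)
  qed
  have le: "norm ((\<zeta> \<bullet> U \<eta>) *\<^sub>R V (\<zeta> - \<eta>)) \<le> (norm \<zeta> * a * b * exp (- (\<rho> * norm \<zeta>))) * (S \<eta> * S (\<zeta> - \<eta>))" for \<eta>
  proof -
    have "norm ((\<zeta> \<bullet> U \<eta>) *\<^sub>R V (\<zeta> - \<eta>)) \<le> (norm \<zeta> * norm (U \<eta>)) * norm (V (\<zeta> - \<eta>))"
      by (simp add: Cauchy_Schwarz_ineq2 mult_right_mono)
    also have "\<dots> \<le> (norm \<zeta> * (a * (S \<eta> * exp (- (\<rho> * norm \<eta>))))) * (b * (S (\<zeta> - \<eta>) * exp (- (\<rho> * norm (\<zeta> - \<eta>)))))"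
      using a less_imp_le[OF Sp] less_imp_le[OF S_pos] by (intro mult_mono mult_left_mono U V mult_nonneg_nonneg) auto
    also have "\<dots> = (norm \<zeta> * a * b * (S \<eta> * S (\<zeta> - \<eta>))) * (exp (- (\<rho> * norm \<eta>)) * exp (- (\<rho> * norm (\<zeta> - \<eta>))))"
      by (simp only: mult_ac)
    also have "\<dots> \<le> (norm \<zeta> * a * b * (S \<eta> * S (\<zeta> - \<eta>))) * exp (- (\<rho> * norm \<zeta>))"
      using a b less_imp_le[OF S_pos] by (intro mult_left_mono e mult_nonneg_nonneg) auto
    finally show ?thesis by (simp only: mult_ac)
  qed
  have m: "(\<lambda>\<eta>. (\<zeta> \<bullet> U \<eta>) *\<^sub>R V (\<zeta> - \<eta>)) \<in> borel_measurable lborel"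
    using borel_measurable_adv_integrand[OF Um Vm] by simp
  note i = integrable_mult_right[OF S_conv_integrable, of "norm \<zeta> * a * b * exp (- (\<rho> * norm \<zeta>))" \<zeta>]
  show "integrable lborel (\<lambda>\<eta>. (\<zeta> \<bullet> U \<eta>) *\<^sub>R V (\<zeta> - \<eta>))" by (rule integrable_dominated[OF i m le])
  have "norm (adv U V \<zeta>) \<le> (norm \<zeta> * a * b * exp (- (\<rho> * norm \<zeta>))) * (LINT \<eta>|lborel. S \<eta> * S (\<zeta> - \<eta>))"
    using norm_integral_dominated[OF i m le] by (simp add: adv_def)
  also have "\<dots> \<le> (norm \<zeta> * a * b * exp (- (\<rho> * norm \<zeta>))) * (K * S \<zeta>)"
    using a b by (intro mult_left_mono S_conv mult_nonneg_nonneg) auto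
  finally show "norm (adv U V \<zeta>) \<le> a * b * K * norm \<zeta> * (S \<zeta> * exp (- (\<rho> * norm \<zeta>)))" by (simp only: mult_ac)
qed

end

text \<open>The system for \<open>U = n u\<close> and \<open>B = n\<^sup>s b\<close>: the quadratic terms in \<open>(U,U)\<close> and \<open>(U,B)\<close> get the coefficient
  \<open>\<alpha> = 1/n\<close>, those in \<open>(B,B)\<close> the coefficient \<open>\<beta> = n\<^sup>1\<^sup>-\<^sup>2\<^sup>s\<close>. The bound on \<open>|\<xi>|\<^sup>2 U0\<close> is needed for the
  Taylor expansion.\<close>

locale picard = conv_weight S K for S :: "real^'d::finite \<Rightarrow> real" and K +
  fixes \<kappa> \<Lambda> \<alpha> \<beta> M :: real and U0 B0 :: "real^'d \<Rightarrow> real^'d"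
  assumes \<kappa>: "0 < \<kappa>" and \<alpha>: "0 \<le> \<alpha>" "\<alpha> \<le> \<kappa>" and \<beta>: "0 \<le> \<beta>" "\<beta> \<le> \<kappa>" and M: "M > 0"
    and \<Lambda>: "\<Lambda> \<ge> 64 * M * K"
    and U0: "continuous_on UNIV U0" "\<And>\<xi>. norm (U0 \<xi>) \<le> M * (S \<xi> * exp (- (\<kappa> * norm \<xi>)))"
      "\<And>\<xi>. (norm \<xi>)\<^sup>2 * norm (U0 \<xi>) \<le> M * (S \<xi> * exp (- (\<kappa> * norm \<xi>)))"
      "\<And>\<xi>. U0 (- \<xi>) = - U0 \<xi>" "\<And>\<xi>. \<xi> \<bullet> U0 \<xi> = 0"
    and B0: "continuous_on UNIV B0" "\<And>\<xi>. norm (B0 \<xi>) \<le> M * (S \<xi> * exp (- (\<kappa> * norm \<xi>)))"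
      "\<And>\<xi>. B0 (- \<xi>) = - B0 \<xi>" "\<And>\<xi>. \<xi> \<bullet> B0 \<xi> = 0"
begin

lemma \<Lambda>_pos: "\<Lambda> > 0"
  using \<Lambda> M K_pos by (smt (verit) mult_pos_pos)

text \<open>At this time half of the initial rate \<kappa> is left (\<open>rate\<close>). It depends
  on \<Lambda> only, not on \<kappa>, and hence not on n.\<close>

definition TT :: real where "TT = 1 / (2 * \<Lambda>)"

lemma TT_pos: "TT > 0" using \<Lambda>_pos by (simp add: TT_def)

text \<open>Freezing the time outside \<open>[0,T]\<close> lets all fields live on the whole space-time.\<close>

definition cl :: "real \<Rightarrow> real" where "cl t = max 0 (min t TT)"

lemma cl: "0 \<le> cl t" "cl t \<le> TT" "0 \<le> t \<Longrightarrow> t \<le> TT \<Longrightarrow> cl t = t"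
  using TT_pos by (auto simp: cl_def)

lemma cl_mult: "0 \<le> \<sigma> \<Longrightarrow> \<sigma> \<le> 1 \<Longrightarrow> cl (cl t * \<sigma>) = cl t * \<sigma>"
  using cl(1,2)[of t] by (intro cl(3)) (auto intro: order_trans[OF mult_right_le_one_le])

lemma cl_cont: "continuous_on UNIV f \<Longrightarrow> continuous_on UNIV (\<lambda>x. cl (f x))"
  unfolding cl_def by (intro continuous_intros)

definition wt :: "real \<Rightarrow> real^'d \<Rightarrow> real" where
  "wt t \<xi> = S \<xi> * exp (- ((\<kappa> - \<kappa> * \<Lambda> * cl t) * norm \<xi>))"

lemma rate: "\<kappa> / 2 \<le> \<kappa> - \<kappa> * \<Lambda> * cl t"
proof -
  have "\<Lambda> * cl t \<le> \<Lambda> * TT" using \<Lambda>_pos cl(2) by (intro mult_left_mono) auto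
  then have "\<Lambda> * cl t \<le> 1/2" using \<Lambda>_pos by (simp add: TT_def)
  then have "\<kappa> * (\<Lambda> * cl t) \<le> \<kappa> * (1/2)" using \<kappa> by (intro mult_left_mono) auto
  then show ?thesis by simp
qed

lemma rate_nonneg: "0 \<le> \<kappa> - \<kappa> * \<Lambda> * cl t" using rate[of t] \<kappa> by linarith

lemma wt_pos: "wt t \<xi> > 0" by (simp add: wt_def S_pos)

lemma wt_nz: "wt t \<xi> \<noteq> 0" using wt_pos[of t \<xi>] by simp

lemma wt_le_half: "wt t \<xi> \<le> S \<xi> * exp (- (\<kappa>/2 * norm \<xi>))"
proof -
  have "\<kappa>/2 * norm \<xi> \<le> (\<kappa> - \<kappa> * \<Lambda> * cl t) * norm \<xi>" by (intro mult_right_mono rate) auto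
  then show ?thesis unfolding wt_def using less_imp_le[OF S_pos] by (intro mult_left_mono) auto
qed

lemma wt_le_S: "wt t \<xi> \<le> S \<xi>"
  unfolding wt_def using rate_nonneg less_imp_le[OF S_pos] by (intro mult_right_le_one_le) auto

lemma wt_ge: "S \<xi> * exp (- (\<kappa> * norm \<xi>)) \<le> wt t \<xi>"
  unfolding wt_def using \<kappa> \<Lambda>_pos cl(1)[of t] less_imp_le[OF S_pos]
  by (intro mult_left_mono) (auto intro!: mult_right_mono)

lemma wt_even: "wt t (- \<xi>) = wt t \<xi>" by (simp add: wt_def S_even)

lemma wt_cont: "continuous_on UNIV (\<lambda>p. wt (fst p) (snd p))"
  unfolding wt_def by (intro continuous_intros continuous_on_compose2[OF S_cont] cl_cont) auto

section \<open>Bilinear estimates in the time-dependent weight\<close>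

definition adm :: "real \<Rightarrow> (real \<Rightarrow> real^'d \<Rightarrow> real^'d) \<Rightarrow> bool" where
  "adm a U \<longleftrightarrow> continuous_on UNIV (\<lambda>p. U (fst p) (snd p)) \<and> (\<forall>t \<xi>. norm (U t \<xi>) \<le> a * wt t \<xi>)"

lemma admD:
  assumes "adm a U"
  shows "continuous_on UNIV (\<lambda>p. U (fst p) (snd p))" "norm (U t \<xi>) \<le> a * wt t \<xi>"
    "U t \<in> borel_measurable borel" "a \<ge> 0" "norm (U t \<xi>) \<le> a * (S \<xi> * exp (- ((\<kappa> - \<kappa> * \<Lambda> * cl t) * norm \<xi>)))"
proof -
  show c: "continuous_on UNIV (\<lambda>p. U (fst p) (snd p))" and b: "norm (U t \<xi>) \<le> a * wt t \<xi>" for t \<xi>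
    using assms by (auto simp: adm_def)
  show "U t \<in> borel_measurable borel" by (rule borel_measurable_continuous_onI[OF continuous_on_slice(1)[OF c]])
  show "a \<ge> 0" using order_trans[OF norm_ge_zero b[of 0 0]] wt_pos[of 0 0] by (simp add: zero_le_mult_iff)
  show "norm (U t \<xi>) \<le> a * (S \<xi> * exp (- ((\<kappa> - \<kappa> * \<Lambda> * cl t) * norm \<xi>)))" using b[of t \<xi>] by (simp add: wt_def)
qed

lemma adm_diff: "adm a U \<Longrightarrow> adm b V \<Longrightarrow> (\<And>t \<xi>. norm (U t \<xi> - V t \<xi>) \<le> d * wt t \<xi>) \<Longrightarrow> adm d (\<lambda>t \<xi>. U t \<xi> - V t \<xi>)"
  unfolding adm_def by (auto intro!: continuous_intros)

lemma adm_adv: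
  assumes U: "adm a U" and V: "adm b V"
  shows "integrable lborel (\<lambda>\<eta>. (\<zeta> \<bullet> U t \<eta>) *\<^sub>R V t (\<zeta> - \<eta>))"
    and "norm (adv (U t) (V t) \<zeta>) \<le> a * b * K * norm \<zeta> * wt t \<zeta>"
    and "continuous_on UNIV (\<lambda>p. adv (U (fst p)) (V (fst p)) (snd p))"
proof -
  show "integrable lborel (\<lambda>\<eta>. (\<zeta> \<bullet> U t \<eta>) *\<^sub>R V t (\<zeta> - \<eta>))"
    by (rule adv_weight_integrable[OF admD(3)[OF U] admD(3)[OF V] rate_nonneg admD(5)[OF U] admD(5)[OF V]])
  show "norm (adv (U t) (V t) \<zeta>) \<le> a * b * K * norm \<zeta> * wt t \<zeta>"
    unfolding wt_def by (rule norm_adv_weight[OF admD(3)[OF U] admD(3)[OF V] rate_nonneg admD(5)[OF U] admD(5)[OF V]])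
  have 1: "norm (U t \<xi>) \<le> a * S \<xi>" for t \<xi>
    by (rule order_trans[OF admD(2)[OF U] mult_left_mono[OF wt_le_S admD(4)[OF U]]])
  have 2: "norm (V t \<xi>) \<le> b" for t \<xi>
    by (rule order_trans[OF admD(2)[OF V]]) (use order_trans[OF wt_le_S S_le] admD(4)[OF V] less_imp_le[OF wt_pos] in \<open>auto intro!: mult_right_le_one_le\<close>)
  show "continuous_on UNIV (\<lambda>p. adv (U (fst p)) (V (fst p)) (snd p))"
    by (rule continuous_on_adv[OF admD(1)[OF U] admD(1)[OF V] integrable_mult_right[OF S_int] 1 2])
qed

text \<open>Bilinear in pairs instead of quadratic: the pair (U, B) advects and the pair (V, C) is
  advected. A difference of two quadratic values thus splits into two bilinear ones in
  \<open>N_diff\<close>.\<close>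

definition N1 where "N1 U B V C t \<xi> = - leray \<xi> (\<alpha> *\<^sub>R adv (U t) (V t) \<xi> - \<beta> *\<^sub>R adv (B t) (C t) \<xi>)" for U B V C :: "real \<Rightarrow> real^'d \<Rightarrow> real^'d"
definition N2 where "N2 U B V C t \<xi> = \<alpha> *\<^sub>R (adv (B t) (V t) \<xi> - adv (U t) (C t) \<xi>)" for U B V C :: "real \<Rightarrow> real^'d \<Rightarrow> real^'d"

lemma N_bounds:
  assumes U: "adm a U" "adm a B" and V: "adm b V" "adm b C"
  shows "norm (N1 U B V C t \<xi>) \<le> (2 * a * b * K) * (\<kappa> * norm \<xi> * wt t \<xi>)"
    and "norm (N2 U B V C t \<xi>) \<le> (2 * a * b * K) * (\<kappa> * norm \<xi> * wt t \<xi>)"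
    and "continuous_on UNIV (\<lambda>p. N1 U B V C (fst p) (snd p))"
    and "continuous_on UNIV (\<lambda>p. N2 U B V C (fst p) (snd p))"
proof -
  let ?b = "a * b * K * norm \<xi> * wt t \<xi>"
  have b0: "?b \<ge> 0" using admD(4)[OF U(1)] admD(4)[OF V(1)] K_pos less_imp_le[OF wt_pos]
    by (intro mult_nonneg_nonneg) auto
  have A: "norm (c *\<^sub>R X) \<le> \<kappa> * ?b" if "norm X \<le> ?b" "0 \<le> c" "c \<le> \<kappa>" for c and X :: "real^'d"
    using that b0 by (simp add: mult_mono)
  have "norm (N1 U B V C t \<xi>) \<le> norm (\<alpha> *\<^sub>R adv (U t) (V t) \<xi> - \<beta> *\<^sub>R adv (B t) (C t) \<xi>)"
    unfolding N1_def norm_minus_cancel by (rule norm_leray_le)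
  also have "\<dots> \<le> \<kappa> * ?b + \<kappa> * ?b"
    by (intro order_trans[OF norm_triangle_ineq4] add_mono A adm_adv(2) U V \<alpha> \<beta>)
  finally show "norm (N1 U B V C t \<xi>) \<le> (2 * a * b * K) * (\<kappa> * norm \<xi> * wt t \<xi>)" by (simp add: mult_ac)
  have "norm (N2 U B V C t \<xi>) \<le> \<kappa> * ?b + \<kappa> * ?b"
    unfolding N2_def scaleR_diff_right
    by (intro order_trans[OF norm_triangle_ineq4] add_mono A adm_adv(2) U V \<alpha> \<beta>)
  then show "norm (N2 U B V C t \<xi>) \<le> (2 * a * b * K) * (\<kappa> * norm \<xi> * wt t \<xi>)" by (simp add: mult_ac)
  show "continuous_on UNIV (\<lambda>p. N1 U B V C (fst p) (snd p))"
    unfolding N1_def by (intro continuous_intros continuous_on_leray adm_adv(3)[OF U(1) V(1)] adm_adv(3)[OF U(2) V(2)]) auto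
  show "continuous_on UNIV (\<lambda>p. N2 U B V C (fst p) (snd p))"
    unfolding N2_def by (intro continuous_intros adm_adv(3)[OF U(2) V(1)] adm_adv(3)[OF U(1) V(2)])
qed

lemma N_diff:
  assumes U: "adm a U" "adm a B" and V: "adm b V" "adm b C"
  shows "N1 U B U B t \<xi> - N1 V C V C t \<xi> = N1 (\<lambda>t \<xi>. U t \<xi> - V t \<xi>) (\<lambda>t \<xi>. B t \<xi> - C t \<xi>) U B t \<xi> + N1 V C (\<lambda>t \<xi>. U t \<xi> - V t \<xi>) (\<lambda>t \<xi>. B t \<xi> - C t \<xi>) t \<xi>"
    and "N2 U B U B t \<xi> - N2 V C V C t \<xi> = N2 (\<lambda>t \<xi>. U t \<xi> - V t \<xi>) (\<lambda>t \<xi>. B t \<xi> - C t \<xi>) U B t \<xi> + N2 V C (\<lambda>t \<xi>. U t \<xi> - V t \<xi>) (\<lambda>t \<xi>. B t \<xi> - C t \<xi>) t \<xi>"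
proof -
  note I = adm_adv(1)
  have d: "adv (X t) (Y t) \<xi> - adv (X' t) (Y' t) \<xi> = adv (\<lambda>\<xi>. X t \<xi> - X' t \<xi>) (Y t) \<xi> + adv (X' t) (\<lambda>\<xi>. Y t \<xi> - Y' t \<xi>) \<xi>"
    if "adm a X" "adm a Y" "adm b X'" "adm b Y'" for X Y X' Y'
    by (rule adv_diff[OF I[OF that(1,2)] I[OF that(3,2)] I[OF that(3,4)]])
  have e: "X = X' + (Y + Y')" if "X - X' = Y + Y'" for X X' Y Y' :: "real^'d" using that by (simp add: algebra_simps)
  show "N1 U B U B t \<xi> - N1 V C V C t \<xi> = N1 (\<lambda>t \<xi>. U t \<xi> - V t \<xi>) (\<lambda>t \<xi>. B t \<xi> - C t \<xi>) U B t \<xi> + N1 V C (\<lambda>t \<xi>. U t \<xi> - V t \<xi>) (\<lambda>t \<xi>. B t \<xi> - C t \<xi>) t \<xi>"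
    unfolding N1_def e[OF d[OF U(1) U(1) V(1) V(1)]] e[OF d[OF U(2) U(2) V(2) V(2)]]
    by (simp add: leray_linear algebra_simps)
  show "N2 U B U B t \<xi> - N2 V C V C t \<xi> = N2 (\<lambda>t \<xi>. U t \<xi> - V t \<xi>) (\<lambda>t \<xi>. B t \<xi> - C t \<xi>) U B t \<xi> + N2 V C (\<lambda>t \<xi>. U t \<xi> - V t \<xi>) (\<lambda>t \<xi>. B t \<xi> - C t \<xi>) t \<xi>"
    unfolding N2_def e[OF d[OF U(2) U(1) V(2) V(1)]] e[OF d[OF U(1) U(2) V(1) V(2)]]
    by (simp add: algebra_simps)
qed

section \<open>The Duhamel integral\<close>

text \<open>Rescaling the time integral to the fixed interval \<open>[0,1]\<close> makes its joint continuity a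
  statement about parametric integrals.\<close>

definition duh :: "(real^'d \<Rightarrow> real) \<Rightarrow> (real \<Rightarrow> real^'d \<Rightarrow> real^'d) \<Rightarrow> real \<Rightarrow> real^'d \<Rightarrow> real^'d" where
  "duh \<mu> g t \<xi> = exp (- (cl t * \<mu> \<xi>)) *\<^sub>R (cl t *\<^sub>R integral {0..1} (\<lambda>\<sigma>. exp (cl t * \<sigma> * \<mu> \<xi>) *\<^sub>R g (cl t * \<sigma>) \<xi>))"

lemma duh_integrand_cont:
  fixes \<mu> :: "real^'d \<Rightarrow> real"
  assumes g: "continuous_on UNIV (\<lambda>p. g (fst p) (snd p))" and \<mu>: "continuous_on UNIV \<mu>"
  shows "continuous_on UNIV (\<lambda>(p, \<sigma>). exp (cl (fst p) * \<sigma> * \<mu> (snd p)) *\<^sub>R g (cl (fst p) * \<sigma>) (snd p) :: real^'d)"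
proof -
  have a: "continuous_on UNIV (\<lambda>q::(real \<times> (real^'d)) \<times> real. (cl (fst (fst q)) * snd q, snd (fst q)))"
    by (intro continuous_intros cl_cont)
  have b: "continuous_on UNIV (\<lambda>q::(real \<times> (real^'d)) \<times> real. \<mu> (snd (fst q)))"
    by (intro continuous_on_compose2[OF \<mu>] continuous_intros) auto
  have "continuous_on UNIV (\<lambda>q::(real \<times> (real^'d)) \<times> real. g (cl (fst (fst q)) * snd q) (snd (fst q)))"
    using continuous_on_compose2[OF g a] by simp
  then show ?thesis unfolding split_beta by (intro continuous_intros cl_cont b)
qed

lemma duh_cont:
  assumes g: "continuous_on UNIV (\<lambda>p. g (fst p) (snd p))" and \<mu>: "continuous_on UNIV \<mu>"
  shows "continuous_on UNIV (\<lambda>p. duh \<mu> g (fst p) (snd p))"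
proof -
  have "continuous_on UNIV (\<lambda>p::real \<times> (real^'d). integral (cbox 0 1) (\<lambda>\<sigma>. exp (cl (fst p) * \<sigma> * \<mu> (snd p)) *\<^sub>R g (cl (fst p) * \<sigma>) (snd p)))"
    by (rule integral_continuous_on_param) (rule continuous_on_subset[OF duh_integrand_cont[OF g \<mu>]], simp)
  then have c: "continuous_on UNIV (\<lambda>p::real \<times> (real^'d). integral {0..1} (\<lambda>\<sigma>. exp (cl (fst p) * \<sigma> * \<mu> (snd p)) *\<^sub>R g (cl (fst p) * \<sigma>) (snd p)))"
    by simp
  have b: "continuous_on UNIV (\<lambda>p::real \<times> (real^'d). \<mu> (snd p))"
    by (intro continuous_on_compose2[OF \<mu>] continuous_intros) auto
  show ?thesis unfolding duh_def by (intro continuous_intros cl_cont b c)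
qed

lemma duh_integrable:
  fixes \<mu> :: "real^'d \<Rightarrow> real"
  assumes g: "continuous_on UNIV (\<lambda>p. g (fst p) (snd p))" and \<mu>: "continuous_on UNIV \<mu>"
  shows "(\<lambda>\<sigma>. exp (cl t * \<sigma> * \<mu> \<xi>) *\<^sub>R g (cl t * \<sigma>) \<xi> :: real^'d) integrable_on {0..1}"
proof (rule integrable_continuous_real)
  have "continuous_on {0..1} (\<lambda>\<sigma>::real. ((t, \<xi>), \<sigma>))" by (intro continuous_intros)
  from continuous_on_compose2[OF duh_integrand_cont[OF g \<mu>] this]
  show "continuous_on {0..1} (\<lambda>\<sigma>. exp (cl t * \<sigma> * \<mu> \<xi>) *\<^sub>R g (cl t * \<sigma>) \<xi>)" by simp
qed

text \<open>The factor \<kappa>|\<xi>| in the integrand is, up to \<Lambda>, the logarithmic time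
  derivative of the growing weight. The time integral therefore returns the weight at the final time
  divided by \<Lambda>: the derivative is recovered and \<kappa> cancels. Of the damping only exp (-
  \<mu> (t - \<tau>)) \<le> 1 enters, so viscous and undamped components are treated alike.\<close>

lemma duh_bound:
  assumes g: "continuous_on UNIV (\<lambda>p. g (fst p) (snd p))" and \<mu>: "continuous_on UNIV \<mu>" "\<mu> \<xi> \<ge> 0"
    and b: "\<And>t \<xi>. norm (g t \<xi>) \<le> A * (\<kappa> * norm \<xi> * wt t \<xi>)" and A: "A \<ge> 0"
  shows "norm (duh \<mu> g t \<xi>) \<le> (A / \<Lambda>) * wt t \<xi>"
proof -
  define c where "c = cl t"
  have c: "0 \<le> c" unfolding c_def by (rule cl)
  \<comment> \<open>An explicit primitive of the majorant \<open>?p\<close>; its value at 0 is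
    nonnegative and is dropped.\<close>
  let ?P = "\<lambda>\<sigma>. (A / \<Lambda>) * (S \<xi> * exp (- ((\<kappa> - \<kappa> * \<Lambda> * (c * \<sigma>)) * norm \<xi>)))"
  let ?p = "\<lambda>\<sigma>. c * (A * (\<kappa> * norm \<xi> * (S \<xi> * exp (- ((\<kappa> - \<kappa> * \<Lambda> * (c * \<sigma>)) * norm \<xi>)))))"
  have hi: "(?p has_integral (?P 1 - ?P 0)) {0..1}"
  proof (rule fundamental_theorem_of_calculus)
    fix \<sigma> :: real
    show "(?P has_vector_derivative ?p \<sigma>) (at \<sigma> within {0..1})"
      unfolding has_real_derivative_iff_has_vector_derivative[symmetric]
      using \<Lambda>_pos by (auto intro!: derivative_eq_intros simp: field_simps)
  qed simp
  have P0: "?P 0 \<ge> 0" using A \<Lambda>_pos less_imp_le[OF S_pos] by (intro mult_nonneg_nonneg divide_nonneg_pos) auto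
  have P1: "?P 1 = (A / \<Lambda>) * wt t \<xi>" by (simp add: wt_def c_def)
  have P: "?p integrable_on {0..1}" "integral {0..1} ?p \<le> (A / \<Lambda>) * wt t \<xi>"
    using has_integral_integrable[OF hi] integral_unique[OF hi] P0 P1 by linarith+
  let ?f = "\<lambda>\<sigma>. exp (- (c * \<mu> \<xi>)) *\<^sub>R (c *\<^sub>R (exp (c * \<sigma> * \<mu> \<xi>) *\<^sub>R g (c * \<sigma>) \<xi>))"
  have fi: "?f integrable_on {0..1}"
    unfolding c_def by (intro integrable_cmul duh_integrable g \<mu>)
  have fb: "norm (?f \<sigma>) \<le> ?p \<sigma>" if \<sigma>: "\<sigma> \<in> {0..1}" for \<sigma>
  proof -
    have w: "wt (c * \<sigma>) \<xi> = S \<xi> * exp (- ((\<kappa> - \<kappa> * \<Lambda> * (c * \<sigma>)) * norm \<xi>))"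
      unfolding wt_def using cl_mult[of \<sigma> t] \<sigma> by (simp add: c_def)
    have "c * \<sigma> * \<mu> \<xi> \<le> c * \<mu> \<xi>" using \<sigma> c \<mu>(2) by (intro mult_right_mono mult_right_le_one_le) auto
    then have "exp (- (c * \<mu> \<xi>)) * exp (c * \<sigma> * \<mu> \<xi>) \<le> 1" by (simp flip: exp_add)
    then have "(exp (- (c * \<mu> \<xi>)) * exp (c * \<sigma> * \<mu> \<xi>)) * (c * norm (g (c * \<sigma>) \<xi>)) \<le> 1 * (c * norm (g (c * \<sigma>) \<xi>))"
      using c by (intro mult_right_mono) auto
    moreover have "c * norm (g (c * \<sigma>) \<xi>) \<le> c * (A * (\<kappa> * norm \<xi> * wt (c * \<sigma>) \<xi>))"
      using c b by (intro mult_left_mono) auto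
    ultimately show ?thesis unfolding w[symmetric] using c by (simp add: mult_ac)
  qed
  have "duh \<mu> g t \<xi> = integral {0..1} ?f"
    unfolding duh_def c_def by (simp only: integral_cmul)
  then have "norm (duh \<mu> g t \<xi>) \<le> integral {0..1} ?p"
    using integral_norm_bound_integral[OF fi P(1) fb] by simp
  then show ?thesis using P(2) by linarith
qed

lemma duh_diff:
  assumes g: "continuous_on UNIV (\<lambda>p. g (fst p) (snd p))" and h: "continuous_on UNIV (\<lambda>p. h (fst p) (snd p))" and \<mu>: "continuous_on UNIV \<mu>"
  shows "duh \<mu> g t \<xi> - duh \<mu> h t \<xi> = duh \<mu> (\<lambda>t \<xi>. g t \<xi> - h t \<xi>) t \<xi>"
  unfolding duh_def scaleR_diff_right[symmetric]
  by (subst Henstock_Kurzweil_Integration.integral_diff[symmetric, OF duh_integrable[OF g \<mu>] duh_integrable[OF h \<mu>]]) (simp add: scaleR_diff_right)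

lemma duh_odd:
  assumes "\<And>t \<xi>. g t (- \<xi>) = - g t \<xi>" "\<And>\<xi>. \<mu> (- \<xi>) = \<mu> \<xi>"
  shows "duh \<mu> g t (- \<xi>) = - duh \<mu> g t \<xi>"
  by (simp add: duh_def assms)

lemma duh_orth:
  assumes g: "continuous_on UNIV (\<lambda>p. g (fst p) (snd p))" and \<mu>: "continuous_on UNIV \<mu>" and o: "\<And>t. \<xi> \<bullet> g t \<xi> = 0"
  shows "\<xi> \<bullet> duh \<mu> g t \<xi> = 0"
proof -
  have "\<xi> \<bullet> integral {0..1} (\<lambda>\<sigma>. exp (cl t * \<sigma> * \<mu> \<xi>) *\<^sub>R g (cl t * \<sigma>) \<xi>)
    = integral {0..1} ((\<lambda>v. \<xi> \<bullet> v) \<circ> (\<lambda>\<sigma>. exp (cl t * \<sigma> * \<mu> \<xi>) *\<^sub>R g (cl t * \<sigma>) \<xi>))"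
    by (rule integral_linear[symmetric, OF duh_integrable[OF g \<mu>] bounded_linear_inner_right])
  also have "\<dots> = 0" by (simp add: comp_def o)
  finally show ?thesis by (simp add: duh_def)
qed

text \<open>Undoes the rescaling of time: only with a moving upper limit can the fundamental theorem
  of calculus be applied.\<close>

lemma duh_eq_integral:
  assumes g: "continuous_on UNIV (\<lambda>p. g (fst p) (snd p))" and t: "0 \<le> t" "t \<le> TT"
  shows "duh \<mu> g t \<xi> = exp (- (t * \<mu> \<xi>)) *\<^sub>R integral {0..t} (\<lambda>\<tau>. exp (\<tau> * \<mu> \<xi>) *\<^sub>R g \<tau> \<xi>)"
proof (cases "t = 0")
  case False
  then have tp: "t > 0" using t by simp
  have "continuous_on {0..t} (\<lambda>\<tau>. exp (\<tau> * \<mu> \<xi>) *\<^sub>R g \<tau> \<xi>)"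
    by (intro continuous_intros continuous_on_subset[OF continuous_on_slice(2)[OF g]]) auto
  then have "((\<lambda>\<tau>. exp (\<tau> * \<mu> \<xi>) *\<^sub>R g \<tau> \<xi>) has_integral integral {0..t} (\<lambda>\<tau>. exp (\<tau> * \<mu> \<xi>) *\<^sub>R g \<tau> \<xi>)) {0..t}"
    by (intro integrable_integral integrable_continuous_real)
  from has_integral_stretch_real[OF this, of t] tp
  have "((\<lambda>\<sigma>. exp (t * \<sigma> * \<mu> \<xi>) *\<^sub>R g (t * \<sigma>) \<xi>) has_integral (1 / t) *\<^sub>R integral {0..t} (\<lambda>\<tau>. exp (\<tau> * \<mu> \<xi>) *\<^sub>R g \<tau> \<xi>)) ((\<lambda>x. x / t) ` {0..t})"
    by simp
  moreover have "(\<lambda>x. x / t) ` {0..t} = {0..1}" using tp by simp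
  ultimately show ?thesis using tp by (simp add: duh_def cl(3)[OF t] integral_unique)
qed (simp add: duh_def cl TT_pos less_imp_le)

text \<open>The counterpart of \<open>duh_bound\<close> for short times: a factor t instead of the
  recovered derivative.\<close>

lemma duh_small:
  assumes g: "continuous_on UNIV (\<lambda>p. g (fst p) (snd p))" and \<mu>: "continuous_on UNIV \<mu>" "\<mu> \<xi> \<ge> 0"
    and t: "0 \<le> t" "t \<le> TT" and b: "\<And>\<tau>. 0 \<le> \<tau> \<Longrightarrow> \<tau> \<le> t \<Longrightarrow> norm (g \<tau> \<xi>) \<le> G"
  shows "norm (duh \<mu> g t \<xi>) \<le> t * G"
proof -
  have c: "cl t = t" by (rule cl(3)[OF t])
  have "continuous_on {0..1} (\<lambda>\<sigma>::real. ((t, \<xi>), \<sigma>))" by (intro continuous_intros)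
  from continuous_on_compose2[OF duh_integrand_cont[OF g \<mu>(1)] this]
  have cont: "continuous_on {0..1} (\<lambda>\<sigma>. exp (t * \<sigma> * \<mu> \<xi>) *\<^sub>R g (t * \<sigma>) \<xi>)" by (simp add: c)
  have "norm (integral {0..1} (\<lambda>\<sigma>. exp (t * \<sigma> * \<mu> \<xi>) *\<^sub>R g (t * \<sigma>) \<xi>)) \<le> (exp (t * \<mu> \<xi>) * G) * (1 - 0)"
  proof (rule integral_bound[OF _ cont])
    fix \<sigma> :: real assume \<sigma>: "\<sigma> \<in> {0..1}"
    have "t * \<sigma> * \<mu> \<xi> \<le> t * \<mu> \<xi>" using \<sigma> t \<mu>(2) by (intro mult_right_mono mult_right_le_one_le) auto
    moreover have "norm (g (t * \<sigma>) \<xi>) \<le> G" using \<sigma> t by (intro b) (auto intro: mult_right_le_one_le)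
    ultimately show "norm (exp (t * \<sigma> * \<mu> \<xi>) *\<^sub>R g (t * \<sigma>) \<xi>) \<le> exp (t * \<mu> \<xi>) * G"
      unfolding norm_scaleR by (intro mult_mono) auto
  qed simp
  then have "exp (- (t * \<mu> \<xi>)) * (t * norm (integral {0..1} (\<lambda>\<sigma>. exp (t * \<sigma> * \<mu> \<xi>) *\<^sub>R g (t * \<sigma>) \<xi>))) \<le> exp (- (t * \<mu> \<xi>)) * (t * (exp (t * \<mu> \<xi>) * G))"
    using t by (intro mult_left_mono) auto
  also have "\<dots> = (exp (- (t * \<mu> \<xi>)) * exp (t * \<mu> \<xi>)) * (t * G)" by (simp only: mult_ac)
  also have "\<dots> = t * G" by (simp flip: exp_add)
  finally show ?thesis using t by (simp add: duh_def c)
qed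

section \<open>The contraction argument\<close>

abbreviation sq :: "real^'d \<Rightarrow> real" where "sq \<xi> \<equiv> (norm \<xi>)\<^sup>2"

lemma sq_cont: "continuous_on UNIV sq" by (intro continuous_intros)

text \<open>The unknown F is the pair of amplitudes divided by the weight. The weighted supremum
  norm thereby becomes the norm of the complete space of bounded continuous functions.\<close>

definition uF :: "((real \<times> (real^'d)) \<Rightarrow>\<^sub>C ((real^'d) \<times> (real^'d))) \<Rightarrow> real \<Rightarrow> real^'d \<Rightarrow> real^'d" where
  "uF F t \<xi> = wt t \<xi> *\<^sub>R fst (apply_bcontfun F (t, \<xi>))"

definition bF :: "((real \<times> (real^'d)) \<Rightarrow>\<^sub>C ((real^'d) \<times> (real^'d))) \<Rightarrow> real \<Rightarrow> real^'d \<Rightarrow> real^'d" where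
  "bF F t \<xi> = wt t \<xi> *\<^sub>R snd (apply_bcontfun F (t, \<xi>))"

text \<open>The two components of Duhamel's formula: the heat semigroup has rate \<open>sq\<close>
  for the velocity, and rate zero for the magnetic field, which has no diffusion.\<close>

definition su where "su U B t \<xi> = exp (- (cl t * sq \<xi>)) *\<^sub>R U0 \<xi> + duh sq (N1 U B U B) t \<xi>"
definition sb where "sb U B t \<xi> = B0 \<xi> + duh (\<lambda>_. 0) (N2 U B U B) t \<xi>"

text \<open>The data contribute M and the nonlinear terms at most M to each component of the image,
  hence at most 4M to the pair. Oddness is built in because it passes to limits; orthogonality to
  \<xi> is recovered afterwards from the fixed point equation.\<close>

definition X :: "((real \<times> (real^'d)) \<Rightarrow>\<^sub>C ((real^'d) \<times> (real^'d))) set" where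
  "X = {F. (\<forall>p. norm (apply_bcontfun F p) \<le> 4 * M) \<and> (\<forall>t \<xi>. apply_bcontfun F (t, - \<xi>) = - apply_bcontfun F (t, \<xi>))}"

lemma X_complete: "Topological_Spaces.complete X"
  unfolding complete_eq_closed closed_sequential_limits
proof (intro allI impI, elim conjE)
  fix Y F assume Y: "\<forall>n. Y n \<in> X" and lim: "Y \<longlonglongrightarrow> F"
  note l = tendsto_apply_bcontfun[OF lim]
  have "norm (apply_bcontfun F p) \<le> 4 * M" for p
  proof (rule Lim_bounded[OF tendsto_norm[OF l], of 0])
    show "\<forall>n\<ge>0. norm (apply_bcontfun (Y n) p) \<le> 4 * M" using Y unfolding X_def by blast
  qed
  moreover have "apply_bcontfun F (t, - \<xi>) = - apply_bcontfun F (t, \<xi>)" for t \<xi>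
  proof (rule LIMSEQ_unique[OF l])
    have "(\<lambda>n. apply_bcontfun (Y n) (t, - \<xi>)) = (\<lambda>n. - apply_bcontfun (Y n) (t, \<xi>))" using Y by (auto simp: X_def)
    then show "(\<lambda>n. apply_bcontfun (Y n) (t, - \<xi>)) \<longlonglongrightarrow> - apply_bcontfun F (t, \<xi>)"
      using tendsto_minus[OF l] by simp
  qed
  ultimately show "F \<in> X" by (simp add: X_def)
qed

lemma X_adm:
  assumes "F \<in> X" shows "adm (4 * M) (uF F)" "adm (4 * M) (bF F)" "uF F t (- \<xi>) = - uF F t \<xi>" "bF F t (- \<xi>) = - bF F t \<xi>"
proof -
  have n: "norm (apply_bcontfun F p) \<le> 4 * M" for p using assms unfolding X_def by blast
  have c: "continuous_on UNIV (\<lambda>p. apply_bcontfun F (fst p, snd p))" by simp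
  have f: "norm (fst (apply_bcontfun F p)) \<le> 4 * M" "norm (snd (apply_bcontfun F p)) \<le> 4 * M" for p
    using norm_fst_le[of "fst (apply_bcontfun F p)" "snd (apply_bcontfun F p)"] norm_snd_le[of "snd (apply_bcontfun F p)" "fst (apply_bcontfun F p)"] n[of p]
    by simp_all
  show "adm (4 * M) (uF F)" "adm (4 * M) (bF F)"
    unfolding adm_def uF_def bF_def
    using f less_imp_le[OF wt_pos] by (auto intro!: continuous_intros wt_cont c mult_left_mono simp: mult.commute[of "4 * M"])
  show "uF F t (- \<xi>) = - uF F t \<xi>" "bF F t (- \<xi>) = - bF F t \<xi>"
    using assms by (auto simp: X_def uF_def bF_def wt_even)
qed

lemma step_bound:
  assumes U: "adm (4 * M) U" "adm (4 * M) B"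
  shows "norm (su U B t \<xi>) \<le> 2 * M * wt t \<xi>" "norm (sb U B t \<xi>) \<le> 2 * M * wt t \<xi>"
    and "continuous_on UNIV (\<lambda>p. su U B (fst p) (snd p))" "continuous_on UNIV (\<lambda>p. sb U B (fst p) (snd p))"
proof -
  note N = N_bounds[OF U U]
  \<comment> \<open>The bilinear constant for two arguments of size 4M, that is 32 M^2 K. Division
    by \<Lambda> \<ge> 64 M K brings it below M.\<close>
  define A where "A = 2 * (4 * M) * (4 * M) * K"
  have A0: "A \<ge> 0" using M K_pos by (simp add: A_def)
  have "A \<le> M * \<Lambda>"
  proof -
    have "A \<le> M * (64 * M * K)" using M K_pos by (simp add: A_def)
    also have "\<dots> \<le> M * \<Lambda>" using M \<Lambda> by (intro mult_left_mono) auto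
    finally show ?thesis .
  qed
  then have "A / \<Lambda> \<le> M" using \<Lambda>_pos by (simp add: pos_divide_le_eq)
  then have w: "(A / \<Lambda>) * wt t \<xi> \<le> M * wt t \<xi>" using less_imp_le[OF wt_pos] by (rule mult_right_mono)
  have "norm (exp (- (cl t * sq \<xi>)) *\<^sub>R U0 \<xi>) \<le> norm (U0 \<xi>)"
    using cl(1)[of t] by (auto intro!: mult_left_le_one_le)
  also have "\<dots> \<le> M * wt t \<xi>" using order_trans[OF U0(2) mult_left_mono[OF wt_ge]] M by auto
  finally have u: "norm (exp (- (cl t * sq \<xi>)) *\<^sub>R U0 \<xi>) \<le> M * wt t \<xi>" .
  have b: "norm (B0 \<xi>) \<le> M * wt t \<xi>" using order_trans[OF B0(2) mult_left_mono[OF wt_ge]] M by auto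
  have du: "norm (duh sq (N1 U B U B) t \<xi>) \<le> (A / \<Lambda>) * wt t \<xi>"
    by (rule duh_bound[OF N(3) sq_cont _ _ A0]) (use N(1) in \<open>simp_all add: A_def\<close>)
  have db: "norm (duh (\<lambda>_. 0) (N2 U B U B) t \<xi>) \<le> (A / \<Lambda>) * wt t \<xi>"
    by (rule duh_bound[OF N(4) continuous_on_const _ _ A0]) (use N(2) in \<open>simp_all add: A_def\<close>)
  show "norm (su U B t \<xi>) \<le> 2 * M * wt t \<xi>"
    unfolding su_def using norm_triangle_ineq[of "exp (- (cl t * sq \<xi>)) *\<^sub>R U0 \<xi>" "duh sq (N1 U B U B) t \<xi>"] u du w by linarith
  show "norm (sb U B t \<xi>) \<le> 2 * M * wt t \<xi>"
    unfolding sb_def using norm_triangle_ineq[of "B0 \<xi>" "duh (\<lambda>_. 0) (N2 U B U B) t \<xi>"] b db w by linarith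
  have c0: "continuous_on UNIV (\<lambda>p::real \<times> (real^'d). U0 (snd p))" "continuous_on UNIV (\<lambda>p::real \<times> (real^'d). B0 (snd p))"
    by (intro continuous_on_compose2[OF U0(1)] continuous_on_compose2[OF B0(1)] continuous_intros; simp)+
  show "continuous_on UNIV (\<lambda>p. su U B (fst p) (snd p))"
    unfolding su_def by (intro continuous_intros cl_cont c0 duh_cont N(3))
  show "continuous_on UNIV (\<lambda>p. sb U B (fst p) (snd p))"
    unfolding sb_def by (intro continuous_intros c0 duh_cont N(4))
qed

lemma step_odd:
  assumes U: "adm (4 * M) U" "adm (4 * M) B" and o: "\<And>t \<xi>. U t (- \<xi>) = - U t \<xi>" "\<And>t \<xi>. B t (- \<xi>) = - B t \<xi>"
  shows "su U B t (- \<xi>) = - su U B t \<xi>" "sb U B t (- \<xi>) = - sb U B t \<xi>"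
proof -
  note m = admD(3)[OF U(1)] admD(3)[OF U(2)]
  note a = adv_minus[OF m(1) m(1) o(1) o(1)] adv_minus[OF m(1) m(2) o(1) o(2)] adv_minus[OF m(2) m(1) o(2) o(1)] adv_minus[OF m(2) m(2) o(2) o(2)]
  have 1: "N1 U B U B t (- \<xi>) = - N1 U B U B t \<xi>" for t \<xi>
    using leray_minus[of \<xi> "\<alpha> *\<^sub>R adv (U t) (U t) \<xi> - \<beta> *\<^sub>R adv (B t) (B t) \<xi>"] by (simp add: N1_def a)
  have 2: "N2 U B U B t (- \<xi>) = - N2 U B U B t \<xi>" for t \<xi>
    unfolding N2_def a by (simp flip: scaleR_minus_right)
  show "su U B t (- \<xi>) = - su U B t \<xi>" by (simp add: su_def U0(4) duh_odd[of "N1 U B U B", OF 1])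
  show "sb U B t (- \<xi>) = - sb U B t \<xi>" by (simp add: sb_def B0(3) duh_odd[of "N2 U B U B", OF 2])
qed

lemma step_lipschitz:
  assumes U: "adm (4 * M) U" "adm (4 * M) B" and V: "adm (4 * M) V" "adm (4 * M) C"
    and d: "\<And>t \<xi>. norm (U t \<xi> - V t \<xi>) \<le> \<delta> * wt t \<xi>" "\<And>t \<xi>. norm (B t \<xi> - C t \<xi>) \<le> \<delta> * wt t \<xi>"
  shows "norm (su U B t \<xi> - su V C t \<xi>) \<le> \<delta> / 4 * wt t \<xi>" "norm (sb U B t \<xi> - sb V C t \<xi>) \<le> \<delta> / 4 * wt t \<xi>"
proof -
  note D = adm_diff[OF U(1) V(1) d(1)] adm_diff[OF U(2) V(2) d(2)]
  have \<delta>: "\<delta> \<ge> 0" by (rule admD(4)[OF D(1)])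
  \<comment> \<open>Here the constant 64 in the condition on \<Lambda> is consumed: the two bilinear
    differences add up to 16 \<delta> M K, so each component of the map has Lipschitz constant 1/4
    and the pair has 1/2.\<close>
  define A where "A = 4 * \<delta> * (4 * M) * K"
  have A0: "A \<ge> 0" using M K_pos \<delta> by (simp add: A_def)
  have "A \<le> \<delta>/4 * \<Lambda>"
  proof -
    have "A = \<delta>/4 * (64 * M * K)" by (simp add: A_def)
    also have "\<dots> \<le> \<delta>/4 * \<Lambda>" using \<delta> \<Lambda> by (intro mult_left_mono) auto
    finally show ?thesis .
  qed
  then have "A / \<Lambda> \<le> \<delta>/4" using \<Lambda>_pos by (simp add: pos_divide_le_eq)
  then have w: "(A / \<Lambda>) * wt t \<xi> \<le> \<delta>/4 * wt t \<xi>" using less_imp_le[OF wt_pos] by (rule mult_right_mono)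
  note N = N_bounds[OF D U] and N' = N_bounds[OF V D]
  have b: "norm (N1 U B U B t \<xi> - N1 V C V C t \<xi>) \<le> A * (\<kappa> * norm \<xi> * wt t \<xi>)"
    "norm (N2 U B U B t \<xi> - N2 V C V C t \<xi>) \<le> A * (\<kappa> * norm \<xi> * wt t \<xi>)" for t \<xi>
  proof -
    have e: "A * (\<kappa> * norm \<xi> * wt t \<xi>) = (2 * \<delta> * (4 * M) * K) * (\<kappa> * norm \<xi> * wt t \<xi>) + (2 * (4 * M) * \<delta> * K) * (\<kappa> * norm \<xi> * wt t \<xi>)"
      by (simp add: A_def algebra_simps)
    show "norm (N1 U B U B t \<xi> - N1 V C V C t \<xi>) \<le> A * (\<kappa> * norm \<xi> * wt t \<xi>)"
      unfolding N_diff(1)[OF U V] e by (intro order_trans[OF norm_triangle_ineq] add_mono N N')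
    show "norm (N2 U B U B t \<xi> - N2 V C V C t \<xi>) \<le> A * (\<kappa> * norm \<xi> * wt t \<xi>)"
      unfolding N_diff(2)[OF U V] e by (intro order_trans[OF norm_triangle_ineq] add_mono N N')
  qed
  note NU = N_bounds[OF U U] and NV = N_bounds[OF V V]
  have "su U B t \<xi> - su V C t \<xi> = duh sq (\<lambda>t \<xi>. N1 U B U B t \<xi> - N1 V C V C t \<xi>) t \<xi>"
    by (simp add: su_def duh_diff[OF NU(3) NV(3) sq_cont])
  also have "norm \<dots> \<le> (A / \<Lambda>) * wt t \<xi>"
    by (rule duh_bound[OF _ sq_cont _ b(1) A0]) (auto intro!: continuous_intros NU NV)
  finally show "norm (su U B t \<xi> - su V C t \<xi>) \<le> \<delta> / 4 * wt t \<xi>" using w by linarith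
  have "sb U B t \<xi> - sb V C t \<xi> = duh (\<lambda>_. 0) (\<lambda>t \<xi>. N2 U B U B t \<xi> - N2 V C V C t \<xi>) t \<xi>"
    by (simp add: sb_def duh_diff[OF NU(4) NV(4) continuous_on_const])
  also have "norm \<dots> \<le> (A / \<Lambda>) * wt t \<xi>"
    by (rule duh_bound[OF _ continuous_on_const _ b(2) A0]) (auto intro!: continuous_intros NU NV)
  finally show "norm (sb U B t \<xi> - sb V C t \<xi>) \<le> \<delta> / 4 * wt t \<xi>" using w by linarith
qed

lemma fixed_point:
  obtains U B where "adm (4 * M) U" "adm (4 * M) B" "\<And>t \<xi>. U t (- \<xi>) = - U t \<xi>" "\<And>t \<xi>. B t (- \<xi>) = - B t \<xi>"
    "\<And>t \<xi>. U t \<xi> = su U B t \<xi>" "\<And>t \<xi>. B t \<xi> = sb U B t \<xi>"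
proof -
  define f where "f F p = (inverse (wt (fst p) (snd p)) *\<^sub>R su (uF F) (bF F) (fst p) (snd p), inverse (wt (fst p) (snd p)) *\<^sub>R sb (uF F) (bF F) (fst p) (snd p))" for F and p :: "real \<times> (real^'d)"
  have sc: "norm (inverse (wt t \<xi>) *\<^sub>R v) \<le> a" if "norm v \<le> a * wt t \<xi>" for a t \<xi> and v :: "real^'d"
    using that wt_pos[of t \<xi>] by (simp add: field_simps)
  have pn: "norm (a, b) \<le> norm a + norm b" for a b :: "real^'d" by (rule norm_Pair_le)
  have fb: "f F \<in> bcontfun" and fn: "norm (f F p) \<le> 4 * M" if F: "F \<in> X" for F p
  proof -
    note B = step_bound[OF X_adm(1,2)[OF F]]
    have n: "norm (f F p) \<le> 4 * M" for p
      unfolding f_def using pn sc[OF B(1)] sc[OF B(2)] by (smt (verit))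
    show "norm (f F p) \<le> 4 * M" by (rule n)
    have "continuous_on UNIV (f F)"
      unfolding f_def by (intro continuous_intros wt_cont B) (simp_all add: wt_nz)
    then show "f F \<in> bcontfun" using n by (rule bcontfun_normI)
  qed
  \<comment> \<open>The abstraction to bounded continuous functions is meaningful for F in X, where
    \<open>fb\<close> holds; the fixed point theorem evaluates the map on X alone.\<close>
  define \<Phi> where "\<Phi> F = Bcontfun (f F)" for F
  have ap: "apply_bcontfun (\<Phi> F) = f F" if "F \<in> X" for F
    unfolding \<Phi>_def by (rule Bcontfun_inverse[OF fb[OF that]])
  have "\<exists>!F\<in>X. \<Phi> F = F"
  proof (rule Banach_fix[OF X_complete, of "1/2"])
    have "0 \<in> X" using M by (simp add: X_def)
    then show "X \<noteq> {}" by blast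
    show "\<Phi> ` X \<subseteq> X"
    proof safe
      fix F assume F: "F \<in> X"
      have "f F (t, - \<xi>) = - f F (t, \<xi>)" for t \<xi>
        using step_odd[OF X_adm(1,2)[OF F] X_adm(3,4)[OF F]] by (simp add: f_def wt_even)
      then show "\<Phi> F \<in> X" using ap[OF F] fn[OF F] by (simp add: X_def)
    qed
    fix F G assume F: "F \<in> X" and G: "G \<in> X"
    have "norm (fst (apply_bcontfun F p) - fst (apply_bcontfun G p)) \<le> dist F G" "norm (snd (apply_bcontfun F p) - snd (apply_bcontfun G p)) \<le> dist F G" for p
      using order_trans[OF dist_fst_le dist_bounded[of F p G]] order_trans[OF dist_snd_le dist_bounded[of F p G]] by (simp_all add: dist_norm)
    then have d: "norm (uF F t \<xi> - uF G t \<xi>) \<le> dist F G * wt t \<xi>" "norm (bF F t \<xi> - bF G t \<xi>) \<le> dist F G * wt t \<xi>" for t \<xi>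
      using less_imp_le[OF wt_pos[of t \<xi>]] by (auto simp: uF_def bF_def scaleR_diff_right[symmetric] mult.commute[of "dist F G"] intro!: mult_left_mono)
    note L = step_lipschitz[OF X_adm(1,2)[OF F] X_adm(1,2)[OF G] d]
    show "dist (\<Phi> F) (\<Phi> G) \<le> 1/2 * dist F G"
    proof (rule dist_bound)
      fix p
      have "dist (f F p) (f G p) \<le> dist F G / 4 + dist F G / 4"
        unfolding f_def dist_norm diff_Pair scaleR_diff_right[symmetric] fst_conv snd_conv
        by (intro order_trans[OF pn] add_mono sc L[unfolded dist_norm])
      then show "dist (apply_bcontfun (\<Phi> F) p) (apply_bcontfun (\<Phi> G) p) \<le> 1/2 * dist F G" by (simp add: ap F G)
    qed
  qed auto
  then obtain F where F: "F \<in> X" "\<Phi> F = F" by blast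
  have "apply_bcontfun F p = f F p" for p using ap[OF F(1)] F(2) by simp
  then have "uF F t \<xi> = su (uF F) (bF F) t \<xi>" "bF F t \<xi> = sb (uF F) (bF F) t \<xi>" for t \<xi>
    unfolding uF_def[of F t \<xi>] bF_def[of F t \<xi>] using wt_pos[of t \<xi>] by (simp_all add: f_def)
  then show thesis by (rule that[OF X_adm(1,2)[OF F(1)] X_adm(3,4)[OF F(1)]])
qed

section \<open>Taylor expansion and differential equations for the fixed point\<close>

text \<open>Half of the remaining exponential pays for \<kappa>|\<xi>|, with a constant that is free
  of \<kappa>.\<close>

lemma scaled_exp_le:
  assumes "A \<ge> 0"
  shows "\<kappa> * norm \<xi> * (S \<xi> * exp (- (\<kappa>/2 * norm \<xi>))) * A \<le> 4 * A * (S \<xi> * exp (- (\<kappa>/4 * norm \<xi>)))"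
proof -
  have "norm \<xi> * exp (- (\<kappa>/2 * norm \<xi>)) \<le> 2 / (\<kappa>/2) * exp (- (\<kappa>/2/2 * norm \<xi>))"
    by (rule norm_mult_exp_le) (use \<kappa> in auto)
  then have "(\<kappa> * S \<xi> * A) * (norm \<xi> * exp (- (\<kappa>/2 * norm \<xi>))) \<le> (\<kappa> * S \<xi> * A) * (2 / (\<kappa>/2) * exp (- (\<kappa>/2/2 * norm \<xi>)))"
    using assms \<kappa> less_imp_le[OF S_pos] by (intro mult_left_mono) auto
  then show ?thesis using \<kappa> by (simp add: mult_ac)
qed

text \<open>The remainder does not depend on \<open>\<kappa>\<close>, \<open>\<alpha>\<close> and \<open>\<beta>\<close>, which are the only parameters besides S that
  vary with n.\<close>

lemma taylor:
  assumes U: "adm (4 * M) U" "adm (4 * M) B" and fp: "\<And>t \<xi>. U t \<xi> = su U B t \<xi>" "\<And>t \<xi>. B t \<xi> = sb U B t \<xi>"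
    and t: "0 \<le> t" "t \<le> TT"
  shows "norm (B t \<xi> - B0 \<xi> - t *\<^sub>R (\<alpha> *\<^sub>R (adv B0 U0 \<xi> - adv U0 B0 \<xi>))) \<le> 64 * (M + 128 * M\<^sup>2 * K) * M * K * t\<^sup>2"
proof -
  \<comment> \<open>A bounds the rate of change of both amplitudes: M accounts for the heat
    semigroup through the bound on |\<xi>|^2 U0, and 128 M^2 K for the nonlinear terms, four times
    the bilinear constant 32 M^2 K.\<close>
  define A where "A = M + 128 * M\<^sup>2 * K"
  have A: "A \<ge> 0" using M K_pos by (simp add: A_def)
  \<comment> \<open>The rate \<kappa>/4 is what is left of \<kappa>: half may be gone by the final
    time, and half of the rest pays for the derivative in the first nonlinear estimate. It is spent
    on the second derivative in \<open>rem\<close>.\<close>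
  define E where "E \<xi> = S \<xi> * exp (- (\<kappa>/4 * norm \<xi>))" for \<xi>
  have E: "E \<xi> \<ge> 0" for \<xi> using less_imp_le[OF S_pos] by (simp add: E_def)
  have half_le: "S \<xi> * exp (- (\<kappa>/2 * norm \<xi>)) \<le> E \<xi>" "S \<xi> * exp (- (\<kappa> * norm \<xi>)) \<le> E \<xi>" for \<xi>
    unfolding E_def using \<kappa> less_imp_le[OF S_pos] by (auto intro!: mult_left_mono)
  note N = N_bounds[OF U U]
  have Nb: "norm (N1 U B U B t \<xi>) \<le> 128 * M\<^sup>2 * K * E \<xi>" "norm (N2 U B U B t \<xi>) \<le> 128 * M\<^sup>2 * K * E \<xi>" for t \<xi>
  proof -
    have c: "0 \<le> 2 * (4 * M) * (4 * M) * K" using M K_pos by simp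
    have "(2 * (4 * M) * (4 * M) * K) * (\<kappa> * norm \<xi> * wt t \<xi>) \<le> (2 * (4 * M) * (4 * M) * K) * (\<kappa> * norm \<xi> * (S \<xi> * exp (- (\<kappa>/2 * norm \<xi>))))"
      by (intro mult_left_mono[OF mult_left_mono[OF wt_le_half] c]) (use \<kappa> in auto)
    also have "\<dots> \<le> 4 * (2 * (4 * M) * (4 * M) * K) * E \<xi>"
      using scaled_exp_le[OF c, of \<xi>] by (simp only: E_def mult_ac)
    also have "\<dots> = 128 * M\<^sup>2 * K * E \<xi>" by (simp add: power2_eq_square)
    finally show "norm (N1 U B U B t \<xi>) \<le> 128 * M\<^sup>2 * K * E \<xi>" "norm (N2 U B U B t \<xi>) \<le> 128 * M\<^sup>2 * K * E \<xi>"
      using N(1,2)[of t \<xi>] by linarith+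
  qed
  have dB: "norm (B \<tau> \<xi> - B0 \<xi>) \<le> (\<tau> * A) * E \<xi>" and dU: "norm (U \<tau> \<xi> - U0 \<xi>) \<le> (\<tau> * A) * E \<xi>"
    if \<tau>: "0 \<le> \<tau>" "\<tau> \<le> TT" for \<tau> \<xi>
  proof -
    have "norm (B \<tau> \<xi> - B0 \<xi>) = norm (duh (\<lambda>_. 0) (N2 U B U B) \<tau> \<xi>)" by (subst fp(2)) (simp add: sb_def)
    also have "\<dots> \<le> \<tau> * (128 * M\<^sup>2 * K * E \<xi>)"
      by (rule duh_small[OF N(4) continuous_on_const _ \<tau> Nb(2)]) simp
    also have "\<dots> \<le> \<tau> * (A * E \<xi>)" using \<tau> M E[of \<xi>] by (intro mult_left_mono mult_right_mono) (auto simp: A_def)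
    finally show "norm (B \<tau> \<xi> - B0 \<xi>) \<le> (\<tau> * A) * E \<xi>" by simp
    have c: "cl \<tau> = \<tau>" by (rule cl(3)[OF \<tau>])
    have "U \<tau> \<xi> - U0 \<xi> = (exp (- (\<tau> * sq \<xi>)) - 1) *\<^sub>R U0 \<xi> + duh sq (N1 U B U B) \<tau> \<xi>"
      by (subst fp(1)) (simp add: su_def c scaleR_diff_left)
    moreover have "norm ((exp (- (\<tau> * sq \<xi>)) - 1) *\<^sub>R U0 \<xi>) \<le> \<tau> * (M * E \<xi>)"
    proof -
      have "\<bar>exp (- (\<tau> * sq \<xi>)) - 1\<bar> \<le> \<tau> * sq \<xi>"
      proof -
        have "0 \<le> \<tau> * sq \<xi>" using \<tau> by simp
        moreover from this have "exp (- (\<tau> * sq \<xi>)) \<le> 1" by simp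
        ultimately show ?thesis
          unfolding abs_le_iff using exp_ge_add_one_self[of "- (\<tau> * sq \<xi>)"] by linarith
      qed
      then have "norm ((exp (- (\<tau> * sq \<xi>)) - 1) *\<^sub>R U0 \<xi>) \<le> (\<tau> * sq \<xi>) * norm (U0 \<xi>)"
        unfolding norm_scaleR by (intro mult_right_mono) auto
      also have "\<dots> = \<tau> * (sq \<xi> * norm (U0 \<xi>))" by simp
      also have "\<dots> \<le> \<tau> * (M * E \<xi>)"
        using \<tau> M by (intro mult_left_mono order_trans[OF U0(3)] half_le) auto
      finally show ?thesis .
    qed
    moreover have "norm (duh sq (N1 U B U B) \<tau> \<xi>) \<le> \<tau> * (128 * M\<^sup>2 * K * E \<xi>)"
      by (rule duh_small[OF N(3) sq_cont _ \<tau> Nb(1)]) simp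
    ultimately have "norm (U \<tau> \<xi> - U0 \<xi>) \<le> \<tau> * (M * E \<xi>) + \<tau> * (128 * M\<^sup>2 * K * E \<xi>)"
      by (metis (no_types, lifting) add_mono norm_triangle_le)
    then show "norm (U \<tau> \<xi> - U0 \<xi>) \<le> (\<tau> * A) * E \<xi>" by (simp add: A_def algebra_simps)
  qed
  have bU: "norm (U \<tau> \<xi>) \<le> (4 * M) * E \<xi>" "norm (B \<tau> \<xi>) \<le> (4 * M) * E \<xi>" for \<tau> \<xi>
    using order_trans[OF admD(2)[OF U(1)] mult_left_mono[OF order_trans[OF wt_le_half half_le(1)]]]
      order_trans[OF admD(2)[OF U(2)] mult_left_mono[OF order_trans[OF wt_le_half half_le(1)]]] M by auto
  have bU0: "norm (U0 \<xi>) \<le> (4 * M) * E \<xi>" "norm (B0 \<xi>) \<le> (4 * M) * E \<xi>" for \<xi>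
    using order_trans[OF U0(2) mult_mono[OF _ half_le(2)]] order_trans[OF B0(2) mult_mono[OF _ half_le(2)]] M less_imp_le[OF S_pos] by auto
  have \<rho>: "\<kappa>/4 \<ge> 0" using \<kappa> by simp
  note m = admD(3)[OF U(1)] admD(3)[OF U(2)] borel_measurable_continuous_onI[OF U0(1)] borel_measurable_continuous_onI[OF B0(1)]
  \<comment> \<open>One factor of each bilinear term is a time increment, bounded by \<tau> A, the
    other has size 4M; the two terms together give 8 M K \<tau> A.\<close>
  have diff: "norm (adv F G \<xi> - adv F' G' \<xi>) \<le> (8 * M * K * (\<tau> * A)) * norm \<xi> * E \<xi>"
    if mm: "F \<in> borel_measurable borel" "G \<in> borel_measurable borel" "F' \<in> borel_measurable borel" "G' \<in> borel_measurable borel"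
      and b: "\<And>\<xi>. norm (G \<xi>) \<le> (4 * M) * E \<xi>" "\<And>\<xi>. norm (F' \<xi>) \<le> (4 * M) * E \<xi>" "\<And>\<xi>. norm (F \<xi>) \<le> (4 * M) * E \<xi>" "\<And>\<xi>. norm (G' \<xi>) \<le> (4 * M) * E \<xi>"
      and d: "\<And>\<xi>. norm (F \<xi> - F' \<xi>) \<le> (\<tau> * A) * E \<xi>" "\<And>\<xi>. norm (G \<xi> - G' \<xi>) \<le> (\<tau> * A) * E \<xi>"
    for F G F' G' :: "real^'d \<Rightarrow> real^'d" and \<tau> \<xi>
  proof -
    note b' = b[unfolded E_def] and d' = d[unfolded E_def]
    note I = adv_weight_integrable[OF _ _ \<rho>]
    have "adv F G \<xi> - adv F' G' \<xi> = adv (\<lambda>\<xi>. F \<xi> - F' \<xi>) G \<xi> + adv F' (\<lambda>\<xi>. G \<xi> - G' \<xi>) \<xi>"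
      by (rule adv_diff[OF I[OF mm(1,2) b'(3,1)] I[OF mm(3,2) b'(2,1)] I[OF mm(3,4) b'(2,4)]])
    moreover have "norm (adv (\<lambda>\<xi>. F \<xi> - F' \<xi>) G \<xi>) \<le> (\<tau> * A) * (4 * M) * K * norm \<xi> * E \<xi>"
      unfolding E_def by (rule norm_adv_weight[OF borel_measurable_diff[OF mm(1,3)] mm(2) \<rho> d'(1) b'(1)])
    moreover have "norm (adv F' (\<lambda>\<xi>. G \<xi> - G' \<xi>) \<xi>) \<le> (4 * M) * (\<tau> * A) * K * norm \<xi> * E \<xi>"
      unfolding E_def by (rule norm_adv_weight[OF mm(3) borel_measurable_diff[OF mm(2,4)] \<rho> b'(2) d'(2)])
    ultimately have "norm (adv F G \<xi> - adv F' G' \<xi>) \<le> (\<tau> * A) * (4 * M) * K * norm \<xi> * E \<xi> + (4 * M) * (\<tau> * A) * K * norm \<xi> * E \<xi>"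
      by (metis (no_types, lifting) add_mono norm_triangle_le)
    then show ?thesis by (simp add: algebra_simps)
  qed
  define N0 where "N0 = \<alpha> *\<^sub>R (adv B0 U0 \<xi> - adv U0 B0 \<xi>)"
  \<comment> \<open>The two differences contribute 16 M K \<tau> A, and \<kappa>|\<xi>| times the
    last exponential is at most 4, since y exp (-y) \<le> 1 for y = \<kappa>|\<xi>|/4. Nothing that
    depends on \<kappa> remains.\<close>
  have rem: "norm (N2 U B U B \<tau> \<xi> - N0) \<le> 64 * A * M * K * t" if \<tau>: "0 \<le> \<tau>" "\<tau> \<le> t" for \<tau>
  proof -
    have \<tau>T: "\<tau> \<le> TT" using \<tau> t by simp
    let ?D = "(8 * M * K * (\<tau> * A)) * norm \<xi> * E \<xi>"
    have 1: "norm (adv (B \<tau>) (U \<tau>) \<xi> - adv B0 U0 \<xi>) \<le> ?D"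
      by (rule diff[OF m(2,1,4,3) bU(1) bU0(2) bU(2) bU0(1) dB[OF \<tau>(1) \<tau>T] dU[OF \<tau>(1) \<tau>T]])
    have 2: "norm (adv (U \<tau>) (B \<tau>) \<xi> - adv U0 B0 \<xi>) \<le> ?D"
      by (rule diff[OF m(1,2,3,4) bU(2) bU0(1) bU(1) bU0(2) dU[OF \<tau>(1) \<tau>T] dB[OF \<tau>(1) \<tau>T]])
    have "N2 U B U B \<tau> \<xi> - N0 = \<alpha> *\<^sub>R ((adv (B \<tau>) (U \<tau>) \<xi> - adv B0 U0 \<xi>) - (adv (U \<tau>) (B \<tau>) \<xi> - adv U0 B0 \<xi>))"
      by (simp add: N2_def N0_def algebra_simps)
    then have "norm (N2 U B U B \<tau> \<xi> - N0) = \<alpha> * norm ((adv (B \<tau>) (U \<tau>) \<xi> - adv B0 U0 \<xi>) - (adv (U \<tau>) (B \<tau>) \<xi> - adv U0 B0 \<xi>))"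
      using \<alpha> by simp
    also have "\<dots> \<le> \<kappa> * (?D + ?D)"
      using \<alpha> \<kappa> by (intro mult_mono order_trans[OF norm_triangle_ineq4] add_mono 1 2) auto
    also have "\<dots> = (16 * M * K * (\<tau> * A)) * (\<kappa> * (norm \<xi> * (S \<xi> * exp (- (\<kappa>/4 * norm \<xi>)))))"
      by (simp add: E_def algebra_simps)
    also have "\<dots> \<le> (16 * M * K * (\<tau> * A)) * 4"
    proof (rule mult_left_mono)
      have "norm \<xi> * exp (- (\<kappa>/4 * norm \<xi>)) * 1 \<le> 4 / \<kappa>"
      proof -
        have "\<kappa>/4 * norm \<xi> \<le> exp (\<kappa>/4 * norm \<xi>)" using exp_ge_add_one_self[of "\<kappa>/4 * norm \<xi>"] by linarith
        then have "\<kappa>/4 * norm \<xi> * exp (- (\<kappa>/4 * norm \<xi>)) \<le> exp (\<kappa>/4 * norm \<xi>) * exp (- (\<kappa>/4 * norm \<xi>))"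
          by (intro mult_right_mono) auto
        then have "\<kappa>/4 * norm \<xi> * exp (- (\<kappa>/4 * norm \<xi>)) \<le> 1" by (simp flip: exp_add)
        then show ?thesis using \<kappa> by (simp add: field_simps)
      qed
      moreover have "norm \<xi> * (S \<xi> * exp (- (\<kappa>/4 * norm \<xi>))) \<le> norm \<xi> * exp (- (\<kappa>/4 * norm \<xi>)) * 1"
        using mult_left_mono[OF S_le[of \<xi>], of "norm \<xi> * exp (- (\<kappa>/4 * norm \<xi>))"] by (simp add: mult_ac)
      ultimately have "norm \<xi> * (S \<xi> * exp (- (\<kappa>/4 * norm \<xi>))) \<le> 4 / \<kappa>" by linarith
      then have "\<kappa> * (norm \<xi> * (S \<xi> * exp (- (\<kappa>/4 * norm \<xi>)))) \<le> \<kappa> * (4 / \<kappa>)" using \<kappa> by (intro mult_left_mono) auto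
      then show "\<kappa> * (norm \<xi> * (S \<xi> * exp (- (\<kappa>/4 * norm \<xi>)))) \<le> 4" using \<kappa> by simp
    qed (use M K_pos A \<tau> in auto)
    also have "\<dots> = 64 * A * M * K * \<tau>" by simp
    also have "\<dots> \<le> 64 * A * M * K * t" using \<tau> M K_pos A by (intro mult_left_mono) auto
    finally show ?thesis .
  qed
  have cN: "continuous_on UNIV (\<lambda>p::real \<times> (real^'d). N0)" by (intro continuous_intros)
  have "duh (\<lambda>_. 0) (\<lambda>_ _. N0) t \<xi> = t *\<^sub>R N0" by (simp add: duh_def cl(3)[OF t])
  then have "B t \<xi> - B0 \<xi> - t *\<^sub>R N0 = duh (\<lambda>_. 0) (N2 U B U B) t \<xi> - duh (\<lambda>_. 0) (\<lambda>_ _. N0) t \<xi>"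
    by (subst fp(2)) (simp add: sb_def)
  also have "\<dots> = duh (\<lambda>_. 0) (\<lambda>t \<xi>. N2 U B U B t \<xi> - N0) t \<xi>"
    by (rule duh_diff[OF N(4) cN continuous_on_const])
  also have "norm \<dots> \<le> t * (64 * A * M * K * t)"
    by (rule duh_small[where g="\<lambda>t \<xi>. N2 U B U B t \<xi> - N0" and \<xi>=\<xi> and \<mu>="\<lambda>_. 0", OF _ continuous_on_const _ t rem])
      (auto intro!: continuous_intros N)
  finally show ?thesis by (simp add: N0_def A_def power2_eq_square mult_ac)
qed

text \<open>Inside the interval the clamp \<open>cl\<close> is the identity. Duhamel's formula with
  a moving upper limit is then differentiated as the integrating factor times the datum plus an
  integral.\<close>

lemma fixed_point_deriv:
  assumes U: "adm (4 * M) U" "adm (4 * M) B" and fp: "\<And>t \<xi>. U t \<xi> = su U B t \<xi>" "\<And>t \<xi>. B t \<xi> = sb U B t \<xi>"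
    and t: "0 < t" "t < TT"
  shows "((\<lambda>t. U t \<xi>) has_vector_derivative - (sq \<xi> *\<^sub>R U t \<xi>) + N1 U B U B t \<xi>) (at t)"
    and "((\<lambda>t. B t \<xi>) has_vector_derivative N2 U B U B t \<xi>) (at t)"
proof -
  note N = N_bounds[OF U U]
  have ti: "t \<in> {0..TT}" and op: "open {0<..<TT}" "t \<in> {0<..<TT}" using t by auto
  have tat: "at t within {0..TT} = at t"
    using t by (intro at_within_interior) (simp add: interior_atLeastAtMost_real)
  have d: "((\<lambda>u. integral {0..u} (\<lambda>\<tau>. exp (\<tau> * m) *\<^sub>R g \<tau> \<xi>)) has_vector_derivative exp (t * m) *\<^sub>R g t \<xi>) (at t)"
    if g: "continuous_on UNIV (\<lambda>p. g (fst p) (snd p))" for g :: "real \<Rightarrow> real^'d \<Rightarrow> real^'d" and m :: real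
  proof -
    have "continuous_on {0..TT} (\<lambda>\<tau>. exp (\<tau> * m) *\<^sub>R g \<tau> \<xi>)"
      by (intro continuous_intros continuous_on_subset[OF continuous_on_slice(2)[OF g]]) auto
    from integral_has_vector_derivative[OF this ti] show ?thesis unfolding tat .
  qed
  let ?I = "\<lambda>u. integral {0..u} (\<lambda>\<tau>. exp (\<tau> * sq \<xi>) *\<^sub>R N1 U B U B \<tau> \<xi>)"
  have 1: "((\<lambda>u. exp (- (u * sq \<xi>)) *\<^sub>R (U0 \<xi> + ?I u)) has_vector_derivative
      exp (- (t * sq \<xi>)) *\<^sub>R (0 + exp (t * sq \<xi>) *\<^sub>R N1 U B U B t \<xi>) + (exp (- (t * sq \<xi>)) * (- sq \<xi>)) *\<^sub>R (U0 \<xi> + ?I t)) (at t)"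
    by (intro has_vector_derivative_scaleR has_vector_derivative_add has_vector_derivative_const d[OF N(3)])
      (auto intro!: derivative_eq_intros)
  have eqU: "exp (- (u * sq \<xi>)) *\<^sub>R (U0 \<xi> + ?I u) = U u \<xi>" if "u \<in> {0<..<TT}" for u
    using that by (subst fp(1)) (simp add: su_def cl(3) duh_eq_integral[OF N(3)] scaleR_add_right)
  have 2: "exp (- (t * sq \<xi>)) *\<^sub>R (0 + exp (t * sq \<xi>) *\<^sub>R N1 U B U B t \<xi>) + (exp (- (t * sq \<xi>)) * (- sq \<xi>)) *\<^sub>R (U0 \<xi> + ?I t)
      = - (sq \<xi> *\<^sub>R U t \<xi>) + N1 U B U B t \<xi>"
  proof -
    have "exp (- (t * sq \<xi>)) * exp (t * sq \<xi>) = 1" by (simp flip: exp_add)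
    then show ?thesis using eqU[of t, symmetric] t by (simp add: mult.commute[of "sq \<xi>"])
  qed
  show "((\<lambda>t. U t \<xi>) has_vector_derivative - (sq \<xi> *\<^sub>R U t \<xi>) + N1 U B U B t \<xi>) (at t)"
    by (rule has_vector_derivative_transform_within_open[OF 1[unfolded 2] op eqU])
  let ?J = "\<lambda>u. integral {0..u} (\<lambda>\<tau>. exp (\<tau> * 0) *\<^sub>R N2 U B U B \<tau> \<xi>)"
  have 3: "((\<lambda>u. B0 \<xi> + ?J u) has_vector_derivative 0 + exp (t * 0) *\<^sub>R N2 U B U B t \<xi>) (at t)"
    by (intro has_vector_derivative_add has_vector_derivative_const d[OF N(4)])
  have eqB: "B0 \<xi> + ?J u = B u \<xi>" if "u \<in> {0<..<TT}" for u
    using that by (subst fp(2)) (simp add: sb_def duh_eq_integral[OF N(4)])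
  show "((\<lambda>t. B t \<xi>) has_vector_derivative N2 U B U B t \<xi>) (at t)"
    using has_vector_derivative_transform_within_open[OF 3 op eqB] by simp
qed

text \<open>The velocity stays divergence free through the projection, the magnetic field through
  the symmetry \<open>adv_commute_inner\<close>. At time zero the Duhamel terms vanish.\<close>

lemma fixed_point_orth:
  assumes U: "adm (4 * M) U" "adm (4 * M) B" and fp: "\<And>t \<xi>. U t \<xi> = su U B t \<xi>" "\<And>t \<xi>. B t \<xi> = sb U B t \<xi>"
  shows "\<xi> \<bullet> U t \<xi> = 0" "\<xi> \<bullet> B t \<xi> = 0" "U 0 \<xi> = U0 \<xi>" "B 0 \<xi> = B0 \<xi>"
proof -
  note N = N_bounds[OF U U]
  have "\<xi> \<bullet> N1 U B U B t \<xi> = 0" for t by (simp add: N1_def inner_leray)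
  then show "\<xi> \<bullet> U t \<xi> = 0"
    by (subst fp(1)) (simp add: su_def inner_add_right U0(5) duh_orth[OF N(3) sq_cont])
  have "\<xi> \<bullet> N2 U B U B t \<xi> = 0" for t
  proof -
    have "\<xi> \<bullet> adv (U t) (B t) \<xi> = \<xi> \<bullet> adv (B t) (U t) \<xi>"
      by (rule adv_commute_inner[OF admD(3)[OF U(1)] admD(3)[OF U(2)] adm_adv(1)[OF U(1,2)] adm_adv(1)[OF U(2,1)]])
    then show ?thesis by (simp add: N2_def inner_diff_right)
  qed
  then show "\<xi> \<bullet> B t \<xi> = 0"
    by (subst fp(2)) (simp add: sb_def inner_add_right B0(4) duh_orth[OF N(4) continuous_on_const])
  have "cl 0 = 0" using TT_pos by (simp add: cl_def)
  then show "U 0 \<xi> = U0 \<xi>" "B 0 \<xi> = B0 \<xi>"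
    by (subst fp, simp add: su_def sb_def duh_def)+
qed

end

subsection \<open>A family of weights concentrated near the harmonics of one frequency\<close>

lemma abs_sin_add_le: "\<bar>sin (a + b)\<bar> \<le> \<bar>sin a\<bar> + \<bar>sin b\<bar>" for a b :: real
proof -
  have "\<bar>sin a * cos b\<bar> \<le> \<bar>sin a\<bar>" "\<bar>cos a * sin b\<bar> \<le> \<bar>sin b\<bar>"
    by (auto simp: abs_mult intro!: mult_right_le_one_le mult_left_le_one_le)
  then show ?thesis unfolding sin_add by linarith
qed

lemma abs_sin_add_pi_multiple: "\<bar>sin (of_int k * pi + y)\<bar> = \<bar>sin y\<bar>"
proof -
  have s: "sin (of_int k * pi) = 0" using sin_zero_iff_int2 by blast
  then have "\<bar>cos (of_int k * pi)\<bar> = 1" using sin_cos_squared_add[of "of_int k * pi"] by (simp add: power2_eq_1_iff) (metis abs_1 abs_minus_cancel)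
  then show ?thesis using s by (simp add: sin_add abs_mult)
qed

text \<open>From the Maclaurin bound |sin y - y| \<le> |y|^3/6 and |y| \<le> 2, which makes the
  error at most 2|y|/3.\<close>

lemma abs_sin_ge:
  assumes "\<bar>y\<bar> \<le> pi / 2" shows "\<bar>y\<bar> / 3 \<le> \<bar>sin y\<bar>"
proof -
  have "\<bar>sin y - (\<Sum>m<3. sin_coeff m * y ^ m)\<bar> \<le> inverse (fact 3) * \<bar>y\<bar> ^ 3"
    by (rule Maclaurin_sin_bound)
  moreover have "(\<Sum>m<3. sin_coeff m * y ^ m) = y" by (simp add: sin_coeff_def eval_nat_numeral)
  ultimately have 1: "\<bar>sin y - y\<bar> \<le> \<bar>y\<bar> ^ 3 / 6" by (simp add: eval_nat_numeral fact_numeral)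
  have "\<bar>y\<bar> \<le> 2" using assms pi_less_4 by linarith
  then have "\<bar>y\<bar> * \<bar>y\<bar> \<le> 2 * 2" by (intro mult_mono) auto
  then have "\<bar>y\<bar> * (\<bar>y\<bar> * \<bar>y\<bar>) \<le> \<bar>y\<bar> * 4" by (intro mult_left_mono) auto
  then have "\<bar>y\<bar> ^ 3 / 6 \<le> \<bar>y\<bar> * (2/3)" by (simp add: eval_nat_numeral)
  then show ?thesis using 1 by linarith
qed

text \<open>The part of the majorant of \<open>wS\<close> that sits in the coordinate i. Near the
  k-th multiple of pi n it is a peak of width of order one, with height of order (1 +
  |k|)^(-2).\<close>

definition comb :: "real \<Rightarrow> real \<Rightarrow> real" where
  "comb n x = inverse (((1 + \<bar>x\<bar> / n) * (1 + n * \<bar>sin (x / n)\<bar>))\<^sup>2)"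

text \<open>The profile that dominates one such peak; the scale 3 is the constant of
  \<open>abs_sin_ge\<close>.\<close>

definition bump :: "real \<Rightarrow> real" where "bump z = inverse (1 + (z / 3)\<^sup>2)"

lemma bump_pos: "bump z > 0" by (simp add: bump_def add_pos_nonneg)

lemma bump_meas[measurable]: "bump \<in> borel_measurable borel" unfolding bump_def by measurable

lemma integrable_bump: "integrable lborel bump"
proof -
  have "integrable lborel (\<lambda>x::real. inverse (1 + (0 + (1/3) * x)\<^sup>2))"
    by (rule lborel_integrable_real_affine[OF integrable_inverse_1_plus_square_lborel]) simp
  then show ?thesis by (simp add: bump_def[abs_def])
qed

text \<open>Rounding finds the nearest multiple of pi n, at signed distance z, and the sine is
  bounded below in terms of |z|. Passing to m = |k| and adding the bumps at both signs allows the
  peaks to be summed over the natural numbers.\<close>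

lemma comb_le:
  assumes n: "n > 0"
  obtains m :: nat where "comb n x \<le> inverse (1 + (real m)\<^sup>2) * (bump (- (n * pi * m) + x) + bump (n * pi * m + x))"
proof -
  define k where "k = round (x / (n * pi))"
  define z where "z = x - n * pi * of_int k"
  have "\<bar>of_int k - x / (n * pi)\<bar> \<le> 1/2" unfolding k_def by (rule of_int_round_abs_le)
  moreover have "z = (n * pi) * (x / (n * pi) - of_int k)" using n by (simp add: z_def right_diff_distrib)
  then have "\<bar>z\<bar> = (n * pi) * \<bar>of_int k - x / (n * pi)\<bar>" using n by (simp add: abs_mult abs_minus_commute)
  ultimately have z: "\<bar>z\<bar> \<le> (n * pi) * (1/2)" using n by (simp add: mult_left_mono del: of_int_eq_iff)
  have xz: "x / n = of_int k * pi + z / n" using n by (simp add: z_def field_simps)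
  have "\<bar>z / n\<bar> \<le> pi / 2" using z n by (simp add: field_simps)
  from abs_sin_ge[OF this] have "\<bar>z\<bar> / 3 \<le> n * \<bar>sin (x / n)\<bar>"
    unfolding xz abs_sin_add_pi_multiple using n by (simp add: field_simps)
  then have s: "(1 + \<bar>z\<bar> / 3)\<^sup>2 \<le> (1 + n * \<bar>sin (x / n)\<bar>)\<^sup>2" by (intro power_mono) auto
  have s1: "1 + (z / 3)\<^sup>2 \<le> (1 + \<bar>z\<bar> / 3)\<^sup>2" by (simp add: power2_sum power_divide)
  \<comment> \<open>For k = 0 this is trivial. Otherwise |k| pi \<le> |x|/n + pi/2 while |k| (pi -
    1) \<ge> pi - 1; the difference leaves |x|/n + 1 - pi/2, and pi > 2.\<close>
  have kx: "\<bar>of_int k\<bar> \<le> \<bar>x\<bar> / n"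
  proof (cases "k = 0")
    case False
    then have k1: "\<bar>of_int k :: real\<bar> \<ge> 1" by simp
    have "\<bar>of_int k * pi\<bar> \<le> \<bar>x / n\<bar> + \<bar>z / n\<bar>" unfolding xz by linarith
    then have "\<bar>of_int k * pi\<bar> \<le> \<bar>x / n\<bar> + pi / 2" using \<open>\<bar>z / n\<bar> \<le> pi / 2\<close> by linarith
    then have "\<bar>of_int k\<bar> * pi \<le> \<bar>x\<bar> / n + pi / 2" using n by (simp add: abs_mult)
    moreover have "\<bar>of_int k\<bar> * (pi - 1) \<ge> 1 * (pi - 1)" using k1 pi_gt3 by (intro mult_right_mono) auto
    ultimately show ?thesis using pi_gt3 by (simp add: right_diff_distrib)
  qed (use n in simp)
  then have t: "(1 + \<bar>of_int k\<bar>)\<^sup>2 \<le> (1 + \<bar>x\<bar> / n)\<^sup>2" by (intro power_mono) auto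
  have t1: "1 + (of_int k)\<^sup>2 \<le> (1 + \<bar>of_int k :: real\<bar>)\<^sup>2" by (simp add: power2_sum)
  have p: "0 < 1 + (of_int k :: real)\<^sup>2" "0 < 1 + (z / 3)\<^sup>2" by (auto intro: add_pos_nonneg)
  have "(1 + (of_int k)\<^sup>2) * (1 + (z / 3)\<^sup>2) \<le> (1 + \<bar>x\<bar> / n)\<^sup>2 * (1 + n * \<bar>sin (x / n)\<bar>)\<^sup>2"
    using p by (intro mult_mono order_trans[OF t1 t] order_trans[OF s1 s]) auto
  then have "comb n x \<le> inverse ((1 + (of_int k)\<^sup>2) * (1 + (z / 3)\<^sup>2))"
    unfolding comb_def power_mult_distrib using p by (intro le_imp_inverse_le mult_pos_pos)
  then have c: "comb n x \<le> inverse (1 + (of_int k)\<^sup>2) * bump z" by (simp add: bump_def)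
  define m where "m = nat \<bar>k\<bar>"
  have mk: "(of_int k :: real)\<^sup>2 = (real m)\<^sup>2" by (simp add: m_def)
  have "bump z \<le> bump (- (n * pi * m) + x) + bump (n * pi * m + x)"
  proof (cases "k \<ge> 0")
    case True
    then have "z = - (n * pi * m) + x" by (simp add: z_def m_def)
    then show ?thesis using less_imp_le[OF bump_pos] by simp
  next
    case False
    then have "z = n * pi * m + x" by (simp add: z_def m_def)
    then show ?thesis using less_imp_le[OF bump_pos] by simp
  qed
  then have "inverse (1 + (of_int k :: real)\<^sup>2) * bump z \<le> inverse (1 + (of_int k)\<^sup>2) * (bump (- (n * pi * m) + x) + bump (n * pi * m + x))"
    using p by (intro mult_left_mono) auto
  then show thesis using c that[of m] unfolding mk by linarith
qed

text \<open>By translation invariance each bump contributes the same integral G wherever it is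
  centred, so the sum over m converges to a value that does not involve n.\<close>

lemma comb_integral_bounded:
  obtains J where "J \<ge> 0" "\<And>n. n > 0 \<Longrightarrow> integrable lborel (comb n)" "\<And>n. n > 0 \<Longrightarrow> (LINT x|lborel. comb n x) \<le> J"
proof -
  define G where "G = (LINT x|lborel. bump x)"
  have G: "G \<ge> 0" unfolding G_def using less_imp_le[OF bump_pos] by simp
  define a where "a m = inverse (1 + (real m)\<^sup>2) * (2 * G)" for m
  have a0: "a m \<ge> 0" for m using G by (simp add: a_def add_nonneg_nonneg)
  have "summable (\<lambda>m. inverse (1 + (real m)\<^sup>2))"
  proof (rule summable_comparison_test)
    show "summable (\<lambda>m. inverse ((real m)\<^sup>2))" using inverse_power_summable[of 2, where 'a=real] by simp
    show "\<exists>N. \<forall>m\<ge>N. norm (inverse (1 + (real m)\<^sup>2)) \<le> inverse ((real m)\<^sup>2)"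
      by (intro exI[of _ 1] allI impI) (auto intro!: le_imp_inverse_le)
  qed
  then have sa: "summable a" unfolding a_def by (rule summable_mult2)
  have bn: "(\<integral>\<^sup>+ x. ennreal (bump (t + x)) \<partial>lborel) = ennreal G" for t
  proof -
    have "(\<integral>\<^sup>+ x. ennreal (bump (t + x)) \<partial>lborel) = (\<integral>\<^sup>+ x. ennreal (bump x) \<partial>lborel)"
      by (rule nn_integral_lborel_translate) measurable
    also have "\<dots> = ennreal G" unfolding G_def by (rule nn_integral_eq_integral[OF integrable_bump]) (auto simp: less_imp_le[OF bump_pos])
    finally show ?thesis .
  qed
  have le: "(\<integral>\<^sup>+ x. ennreal (comb n x) \<partial>lborel) \<le> ennreal (suminf a)" if n: "n > 0" for n
  proof -
    let ?t = "\<lambda>m x. inverse (1 + (real m)\<^sup>2) * (bump (- (n * pi * m) + x) + bump (n * pi * m + x))"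
    have "(\<integral>\<^sup>+ x. ennreal (comb n x) \<partial>lborel) \<le> (\<integral>\<^sup>+ x. (\<Sum>m. ennreal (?t m x)) \<partial>lborel)"
    proof (intro nn_integral_mono)
      fix x
      \<comment> \<open>The index m depends on x; replacing its term by the whole series makes the
        majorant a sum of functions that can be integrated one by one.\<close>
      obtain m where "comb n x \<le> ?t m x" using comb_le[OF n] by metis
      then have "ennreal (comb n x) \<le> (\<Sum>m\<in>{m}. ennreal (?t m x))" by (simp add: ennreal_leI)
      also have "\<dots> \<le> (\<Sum>m. ennreal (?t m x))" by (rule sum_le_suminf) auto
      finally show "ennreal (comb n x) \<le> (\<Sum>m. ennreal (?t m x))" .
    qed
    also have "\<dots> = (\<Sum>m. \<integral>\<^sup>+ x. ennreal (?t m x) \<partial>lborel)"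
      by (rule nn_integral_suminf) measurable
    also have "\<dots> = (\<Sum>m. ennreal (a m))"
    proof (intro suminf_cong)
      fix m :: nat
      have i: "0 \<le> inverse (1 + (real m)\<^sup>2)" by (simp add: add_nonneg_nonneg)
      have "(\<integral>\<^sup>+ x. ennreal (?t m x) \<partial>lborel) = (\<integral>\<^sup>+ x. ennreal (inverse (1 + (real m)\<^sup>2)) * (ennreal (bump (- (n * pi * m) + x)) + ennreal (bump (n * pi * m + x))) \<partial>lborel)"
        using i less_imp_le[OF bump_pos] by (intro nn_integral_cong) (simp add: ennreal_mult ennreal_plus)
      also have "\<dots> = ennreal (inverse (1 + (real m)\<^sup>2)) * (ennreal G + ennreal G)"
        by (subst nn_integral_cmult, measurable, subst nn_integral_add, measurable) (simp only: bn)
      also have "\<dots> = ennreal (a m)"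
        unfolding a_def using i G by (simp only: mult_2 ennreal_plus[symmetric] ennreal_mult add_nonneg_nonneg)
      finally show "(\<integral>\<^sup>+ x. ennreal (?t m x) \<partial>lborel) = ennreal (a m)" .
    qed
    also have "\<dots> = ennreal (suminf a)" by (rule suminf_ennreal2[OF a0 sa])
    finally show ?thesis .
  qed
  have cm: "comb n \<in> borel_measurable borel" for n unfolding comb_def by measurable
  have c0: "comb n x \<ge> 0" for n x by (simp add: comb_def)
  have ci: "integrable lborel (comb n)" if "n > 0" for n
  proof (rule integrableI_bounded)
    show "comb n \<in> borel_measurable lborel" using cm by simp
    show "(\<integral>\<^sup>+ x. ennreal (norm (comb n x)) \<partial>lborel) < \<infinity>"
      using le_less_trans[OF le[OF that] ennreal_less_top] c0 by simp
  qed
  show thesis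
  proof (rule that)
    show J: "suminf a \<ge> 0" by (rule suminf_nonneg[OF sa a0])
    show "integrable lborel (comb n)" if "n > 0" for n by (rule ci[OF that])
    show "(LINT x|lborel. comb n x) \<le> suminf a" if n: "n > 0" for n
    proof -
      have "ennreal (LINT x|lborel. comb n x) = (\<integral>\<^sup>+ x. ennreal (comb n x) \<partial>lborel)"
        by (rule nn_integral_eq_integral[OF ci[OF n], symmetric]) (simp add: c0)
      then have "ennreal (LINT x|lborel. comb n x) \<le> ennreal (suminf a)" using le[OF n] by (simp only:)
      then show ?thesis by (simp only: ennreal_le_iff[OF J])
    qed
  qed
qed

text \<open>The length \<open>len i n\<close> is subadditive since \<open>|sin|\<close> is, so its inverse powers are quasi-submultiplicative,
  and it is bounded near 0 and near \<open>\<plusminus>\<pi>n e\<^sub>i\<close>. The term \<open>|\<xi>\<^sub>i|/n\<close> makes the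
  integral over the remaining multiples of \<open>\<pi>n e\<^sub>i\<close> finite.\<close>

definition len :: "'d::finite \<Rightarrow> real \<Rightarrow> real^'d \<Rightarrow> real" where
  "len i n \<xi> = 1 + n * \<bar>sin (\<xi> $ i / n)\<bar> + \<bar>\<xi> $ i\<bar> / n + (\<Sum>j\<in>UNIV - {i}. \<bar>\<xi> $ j\<bar>)"

text \<open>The exponent is 4 + 2(d - 1): two squared factors for the coordinate i as in
  \<open>comb\<close>, and one square for each other coordinate.\<close>

abbreviation wexp :: "'d::finite itself \<Rightarrow> nat" where "wexp _ \<equiv> 2 * (CARD('d) + 1)"

definition wS :: "'d::finite \<Rightarrow> real \<Rightarrow> real^'d \<Rightarrow> real" where
  "wS i n \<xi> = inverse (len i n \<xi> ^ wexp TYPE('d))"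

lemma len_ge_1: "n > 0 \<Longrightarrow> len i n \<xi> \<ge> 1"
  unfolding len_def by (simp add: sum_nonneg)

lemma len_add:
  assumes n: "n > 0" shows "len i n (\<xi> + \<eta>) \<le> len i n \<xi> + len i n \<eta>"
proof -
  have "n * \<bar>sin ((\<xi> + \<eta>) $ i / n)\<bar> \<le> n * (\<bar>sin (\<xi> $ i / n)\<bar> + \<bar>sin (\<eta> $ i / n)\<bar>)"
    using n abs_sin_add_le[of "\<xi> $ i / n" "\<eta> $ i / n"] by (simp add: add_divide_distrib)
  moreover have "\<bar>(\<xi> + \<eta>) $ i\<bar> / n \<le> (\<bar>\<xi> $ i\<bar> + \<bar>\<eta> $ i\<bar>) / n"
    using n by (intro divide_right_mono) (auto simp: abs_triangle_ineq)
  moreover have "(\<Sum>j\<in>UNIV - {i}. \<bar>(\<xi> + \<eta>) $ j\<bar>) \<le> (\<Sum>j\<in>UNIV - {i}. \<bar>\<xi> $ j\<bar> + \<bar>\<eta> $ j\<bar>)"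
    by (intro sum_mono) (auto simp: abs_triangle_ineq)
  ultimately show ?thesis
    unfolding len_def sum.distrib by (simp add: distrib_left add_divide_distrib)
qed

text \<open>The sum x + y is at most twice the maximum, which gives
  \<open>z ^ p \<le> 2 ^ p * (x ^ p + y ^ p)\<close>; the rest is 1/(ab) = (1/a + 1/b)/(a +
  b).\<close>

lemma inverse_power_quasi_triangle:
  assumes "x \<ge> 1" "y \<ge> (1::real)" "1 \<le> z" "z \<le> x + y"
  shows "inverse (x ^ p) * inverse (y ^ p) \<le> 2 ^ p * inverse (z ^ p) * (inverse (x ^ p) + inverse (y ^ p))"
proof -
  have "z ^ p \<le> (2 * max x y) ^ p" using assms by (intro power_mono) auto
  also have "\<dots> = 2 ^ p * (max x y) ^ p" by (rule power_mult_distrib)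
  also have "(max x y) ^ p \<le> x ^ p + y ^ p" using assms by (auto simp: max_def)
  finally have z: "z ^ p \<le> 2 ^ p * (x ^ p + y ^ p)" by simp
  have p: "x ^ p > 0" "y ^ p > 0" "z ^ p > 0" using assms by auto
  have "inverse (x ^ p) * inverse (y ^ p) = (inverse (x ^ p) + inverse (y ^ p)) * inverse (x ^ p + y ^ p)"
  proof -
    have ne: "x ^ p \<noteq> 0" "y ^ p \<noteq> 0" "x ^ p + y ^ p \<noteq> 0" using p by linarith+
    have "(inverse (x ^ p) + inverse (y ^ p)) * inverse (x ^ p + y ^ p)
      = ((x ^ p + y ^ p) * inverse (x ^ p + y ^ p)) * (inverse (x ^ p) * inverse (y ^ p))"
      unfolding inverse_add[OF ne(1,2)] by (simp only: mult_ac)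
    then show ?thesis unfolding right_inverse[OF ne(3)] by simp
  qed
  also have "\<dots> \<le> (inverse (x ^ p) + inverse (y ^ p)) * (2 ^ p * inverse (z ^ p))"
  proof (rule mult_left_mono)
    have "inverse (2 ^ p * (x ^ p + y ^ p)) \<le> inverse (z ^ p)" using z p(3) by (rule le_imp_inverse_le)
    then have "2 ^ p * inverse (2 ^ p * (x ^ p + y ^ p)) \<le> 2 ^ p * inverse (z ^ p)" by (intro mult_left_mono) auto
    moreover have "2 ^ p * inverse (2 ^ p * (x ^ p + y ^ p)) = inverse (x ^ p + y ^ p)"
      unfolding inverse_mult_distrib mult.assoc[symmetric] by simp
    ultimately show "inverse (x ^ p + y ^ p) \<le> 2 ^ p * inverse (z ^ p)" by (simp only:)
  qed (use p in auto)
  finally show ?thesis by (simp add: mult_ac)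
qed

lemma wS_pos: "n > 0 \<Longrightarrow> wS i n \<xi> > 0"
  using len_ge_1[of n i \<xi>] unfolding wS_def by simp

lemma wS_le_1: "n > 0 \<Longrightarrow> wS i n \<xi> \<le> 1"
  using one_le_power[OF len_ge_1] unfolding wS_def inverse_le_1_iff by blast

lemma wS_cont: "n > 0 \<Longrightarrow> continuous_on UNIV (wS i n)"
  unfolding wS_def
proof (intro continuous_intros ballI)
  fix \<xi> assume "n > 0"
  then show "len i n \<xi> ^ wexp TYPE('a) \<noteq> 0" using len_ge_1[of n i \<xi>] by simp
next
  assume "n > 0" then show "continuous_on UNIV (len i n)" unfolding len_def by (intro continuous_intros) auto
qed

lemma wS_even: "wS i n (- \<xi>) = wS i n \<xi>"
  by (simp add: wS_def len_def)

text \<open>The power of \<open>len\<close> is distributed over the coordinates, giving a product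
  majorant with \<open>comb\<close> in the coordinate i and 1/(1 + x^2) in all others. Only the
  first factor involves n, and its integral is bounded uniformly.\<close>

lemma wS_integral_bounded:
  obtains I where "I \<ge> 0" "\<And>n. n > 0 \<Longrightarrow> integrable lborel (wS (i::'d::finite) n)" "\<And>n. n > 0 \<Longrightarrow> (LINT \<xi>|lborel. wS i n \<xi>) \<le> I"
proof -
  obtain J where J: "J \<ge> 0" "\<And>n. n > 0 \<Longrightarrow> integrable lborel (comb n)" "\<And>n. n > 0 \<Longrightarrow> (LINT x|lborel. comb n x) \<le> J"
    using comb_integral_bounded by metis
  define h where "h x = inverse (1 + x\<^sup>2)" for x :: real
  define f where "f n b = (if b = axis i 1 then comb n else h)" for n and b :: "real^'d"
  have fi: "integrable lborel (f n b)" if "n > 0" for n b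
    using J(2)[OF that] integrable_inverse_1_plus_square_lborel by (simp add: f_def h_def[abs_def])
  have f0: "f n b x \<ge> 0" for n b x by (simp add: f_def comb_def h_def add_nonneg_nonneg)
  have B: "Basis = (\<lambda>j::'d. axis j (1::real)) ` UNIV" by (auto simp: Basis_vec_def)
  have inj: "inj (\<lambda>j::'d. axis j (1::real))" by (auto simp: inj_def axis_eq_axis)
  have pr: "(\<Prod>b\<in>(Basis :: (real^'d) set). F b) = F (axis i 1) * (\<Prod>j\<in>UNIV - {i}. F (axis j 1))" for F :: "real^'d \<Rightarrow> real"
    unfolding B by (subst prod.reindex[OF inj]) (simp add: prod.remove[of UNIV i])
  have le: "wS i n \<xi> \<le> (\<Prod>b\<in>Basis. f n b (\<xi> \<bullet> b))" if n: "n > 0" for n and \<xi> :: "real^'d"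
  proof -
    have s0: "(\<Sum>j\<in>UNIV - {i}. \<bar>\<xi> $ j\<bar>) \<ge> 0" by (simp add: sum_nonneg)
    have l1: "1 + \<bar>\<xi> $ i\<bar> / n \<le> len i n \<xi>" "1 + n * \<bar>sin (\<xi> $ i / n)\<bar> \<le> len i n \<xi>"
      using n s0 unfolding len_def by auto
    have lj: "1 + \<bar>\<xi> $ j\<bar> \<le> len i n \<xi>" if "j \<in> UNIV - {i}" for j
    proof -
      have "\<bar>\<xi> $ j\<bar> \<le> (\<Sum>j\<in>UNIV - {i}. \<bar>\<xi> $ j\<bar>)" by (rule member_le_sum[OF that]) auto
      moreover have "0 \<le> n * \<bar>sin (\<xi> $ i / n)\<bar>" "0 \<le> \<bar>\<xi> $ i\<bar> / n" using n by auto
      ultimately show ?thesis unfolding len_def by linarith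
    qed
    have L: "len i n \<xi> \<ge> 1" by (rule len_ge_1[OF n])
    have A: "((1 + \<bar>\<xi> $ i\<bar> / n) * (1 + n * \<bar>sin (\<xi> $ i / n)\<bar>))\<^sup>2 \<le> (len i n \<xi> * len i n \<xi>)\<^sup>2"
      using n L by (intro power_mono mult_mono l1) auto
    have "(\<Prod>j\<in>UNIV - {i}. 1 + (\<xi> $ j)\<^sup>2) \<le> (\<Prod>j\<in>UNIV - {i}. (len i n \<xi>)\<^sup>2)"
    proof (intro prod_mono conjI)
      fix j assume j: "j \<in> UNIV - {i}"
      have "1 + (\<xi> $ j)\<^sup>2 \<le> (1 + \<bar>\<xi> $ j\<bar>)\<^sup>2" by (simp add: power2_sum)
      also have "\<dots> \<le> (len i n \<xi>)\<^sup>2" using lj[OF j] by (intro power_mono) auto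
      finally show "1 + (\<xi> $ j)\<^sup>2 \<le> (len i n \<xi>)\<^sup>2" .
    qed (simp add: add_nonneg_nonneg)
    then have "((1 + \<bar>\<xi> $ i\<bar> / n) * (1 + n * \<bar>sin (\<xi> $ i / n)\<bar>))\<^sup>2 * (\<Prod>j\<in>UNIV - {i}. 1 + (\<xi> $ j)\<^sup>2)
        \<le> (len i n \<xi> * len i n \<xi>)\<^sup>2 * (\<Prod>j\<in>UNIV - {i}. (len i n \<xi>)\<^sup>2)"
      by (intro mult_mono A) (auto intro!: prod_nonneg simp: add_nonneg_nonneg)
    also have "\<dots> = len i n \<xi> ^ wexp TYPE('d)"
    proof -
      have c: "card (UNIV - {i}) = CARD('d) - 1" by simp
      have "CARD('d) \<ge> 1" using zero_less_card_finite[where 'a='d] by linarith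
      then have e: "wexp TYPE('d) = 2 * 2 + 2 * (CARD('d) - 1)" by arith
      show ?thesis unfolding prod_constant c e power_add power_mult by (simp add: power2_eq_square)
    qed
    finally have le: "((1 + \<bar>\<xi> $ i\<bar> / n) * (1 + n * \<bar>sin (\<xi> $ i / n)\<bar>))\<^sup>2 * (\<Prod>j\<in>UNIV - {i}. 1 + (\<xi> $ j)\<^sup>2) \<le> len i n \<xi> ^ wexp TYPE('d)" .
    have pos: "0 < ((1 + \<bar>\<xi> $ i\<bar> / n) * (1 + n * \<bar>sin (\<xi> $ i / n)\<bar>))\<^sup>2 * (\<Prod>j\<in>UNIV - {i}. 1 + (\<xi> $ j)\<^sup>2)"
    proof -
      have "1 + \<bar>\<xi> $ i\<bar> / n > 0" "1 + n * \<bar>sin (\<xi> $ i / n)\<bar> > 0" using n by (auto intro!: add_pos_nonneg)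
      then show ?thesis by (intro mult_pos_pos zero_less_power prod_pos) (auto intro!: add_pos_nonneg)
    qed
    have "wS i n \<xi> \<le> inverse (((1 + \<bar>\<xi> $ i\<bar> / n) * (1 + n * \<bar>sin (\<xi> $ i / n)\<bar>))\<^sup>2 * (\<Prod>j\<in>UNIV - {i}. 1 + (\<xi> $ j)\<^sup>2))"
      unfolding wS_def using le pos by (rule le_imp_inverse_le)
    also have "\<dots> = comb n (\<xi> $ i) * (\<Prod>j\<in>UNIV - {i}. h (\<xi> $ j))"
      by (simp add: comb_def h_def prod_inversef[symmetric] comp_def)
    also have "\<dots> = (\<Prod>b\<in>Basis. f n b (\<xi> \<bullet> b))"
      unfolding pr by (simp add: f_def inner_axis axis_eq_axis cong: prod.cong) (auto intro!: prod.cong)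
    finally show ?thesis .
  qed
  define H where "H = (LINT x|lborel. h x)"
  have H: "H \<ge> 0" unfolding H_def h_def by (simp add: add_nonneg_nonneg)
  show thesis
  proof (rule that)
    show "0 \<le> J * (\<Prod>j\<in>UNIV - {i}. H)" using J(1) H by simp
    fix n :: real assume n: "n > 0"
    note P = integrable_prod_Basis[of "f n", OF fi[OF n]]
    have wi: "integrable lborel (wS i n)"
    proof (rule integrable_dominated[OF P(1)])
      show "wS i n \<in> borel_measurable lborel" using borel_measurable_continuous_onI[OF wS_cont[OF n]] by simp
      show "norm (wS i n \<xi>) \<le> (\<Prod>b\<in>Basis. f n b (\<xi> \<bullet> b))" for \<xi>
        unfolding real_norm_def abs_of_nonneg[OF less_imp_le[OF wS_pos[OF n]]] by (rule le[OF n])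
    qed
    then show "integrable lborel (wS i n)" .
    have "(LINT \<xi>|lborel. wS i n \<xi>) \<le> (LINT \<xi>|lborel. (\<Prod>b\<in>Basis. f n b (\<xi> \<bullet> b)))"
      by (rule Bochner_Integration.integral_mono[OF wi P(1) le[OF n]])
    also have "\<dots> = (\<Prod>b\<in>(Basis::(real^'d) set). LINT x|lborel. f n b x)" by (rule P(2))
    also have "\<dots> = (LINT x|lborel. comb n x) * (\<Prod>j\<in>UNIV - {i}. H)"
      unfolding pr by (simp add: f_def axis_eq_axis H_def cong: prod.cong) (auto intro!: prod.cong)
    also have "\<dots> \<le> J * (\<Prod>j\<in>UNIV - {i}. H)" using J(3)[OF n] H by (intro mult_right_mono) auto
    finally show "(LINT \<xi>|lborel. wS i n \<xi>) \<le> J * (\<Prod>j\<in>UNIV - {i}. H)" .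
  qed
qed

text \<open>Integrating the quasi-triangle inequality over \<eta> bounds the convolution by
  \<open>2 ^ p * (2 * I)\<close> times the weight, where p is the exponent of \<open>wS\<close>. The
  added 1 makes K strictly positive.\<close>

lemma conv_weight_wS:
  obtains K I where "K > 0" "I \<ge> 0" "\<And>n. n > 0 \<Longrightarrow> conv_weight (wS (i::'d::finite) n) K" "\<And>n. n > 0 \<Longrightarrow> (LINT \<xi>|lborel. wS i n \<xi>) \<le> I"
proof -
  obtain I where I: "I \<ge> 0" "\<And>n. n > 0 \<Longrightarrow> integrable lborel (wS (i::'d) n)" "\<And>n. n > 0 \<Longrightarrow> (LINT \<xi>|lborel. wS i n \<xi>) \<le> I"
    using wS_integral_bounded by metis
  let ?p = "wexp TYPE('d)"
  define K where "K = 2 ^ ?p * (2 * I) + 1"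
  have K: "K > 0" unfolding K_def using I(1) by (intro add_nonneg_pos mult_nonneg_nonneg) auto
  have "conv_weight (wS i n) K" if n: "n > 0" for n
  proof
    fix \<zeta> :: "real^'d"
    have wm: "wS i n \<in> borel_measurable borel" by (rule borel_measurable_continuous_onI[OF wS_cont[OF n]])
    have le: "wS i n \<eta> * wS i n (\<zeta> - \<eta>) \<le> 2 ^ ?p * wS i n \<zeta> * (wS i n \<eta> + wS i n (\<zeta> - \<eta>))" for \<eta>
      unfolding wS_def
      by (rule inverse_power_quasi_triangle) (use len_ge_1[OF n] len_add[OF n, of i \<eta> "\<zeta> - \<eta>"] in simp_all)
    have ir: "integrable lborel (\<lambda>\<eta>. wS i n (\<zeta> - \<eta>))" using I(2)[OF n] by (simp add: integrable_lborel_reflect[OF wm])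
    have i2: "integrable lborel (\<lambda>\<eta>. 2 ^ ?p * wS i n \<zeta> * (wS i n \<eta> + wS i n (\<zeta> - \<eta>)))"
      using ir I(2)[OF n] by simp
    have n0: "norm (wS i n \<eta> * wS i n (\<zeta> - \<eta>)) \<le> 2 ^ ?p * wS i n \<zeta> * (wS i n \<eta> + wS i n (\<zeta> - \<eta>))" for \<eta>
      using le[of \<eta>] less_imp_le[OF wS_pos[OF n, of i]] by (simp add: abs_mult)
    have m2: "(\<lambda>\<eta>. wS i n \<eta> * wS i n (\<zeta> - \<eta>)) \<in> borel_measurable lborel"
      using borel_measurable_times[OF wm borel_measurable_integrable[OF ir, simplified]] by simp
    have "(LINT \<eta>|lborel. wS i n \<eta> * wS i n (\<zeta> - \<eta>)) \<le> (LINT \<eta>|lborel. 2 ^ ?p * wS i n \<zeta> * (wS i n \<eta> + wS i n (\<zeta> - \<eta>)))"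
      using norm_integral_dominated[OF i2 m2 n0] by simp
    also have "\<dots> = 2 ^ ?p * wS i n \<zeta> * ((LINT \<eta>|lborel. wS i n \<eta>) + (LINT \<eta>|lborel. wS i n \<eta>))"
      using ir I(2)[OF n] by (simp add: integral_lborel_reflect[OF wm])
    also have "\<dots> \<le> 2 ^ ?p * wS i n \<zeta> * (I + I)"
      using less_imp_le[OF wS_pos[OF n, of i]] I(3)[OF n] by (intro mult_left_mono add_mono) auto
    also have "\<dots> \<le> K * wS i n \<zeta>"
      using less_imp_le[OF wS_pos[OF n, of i \<zeta>]] by (simp add: K_def algebra_simps)
    finally show "(LINT \<eta>|lborel. wS i n \<eta> * wS i n (\<zeta> - \<eta>)) \<le> K * wS i n \<zeta>" .
  qed (use n I(2) K in \<open>auto simp: wS_pos wS_le_1 wS_cont wS_even\<close>)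
  then show thesis using that[OF K I(1) _ I(3)] by blast
qed

subsection \<open>Initial data\<close>

text \<open>Multiplication by \<open>rot i j \<xi>\<close> is the Fourier form of the rotated gradient in the plane of the i-th and
  j-th coordinates, so that its multiples are divergence free.\<close>

definition rot :: "'d \<Rightarrow> 'd \<Rightarrow> real^'d::finite \<Rightarrow> real^'d" where
  "rot i j \<xi> = (- \<xi> $ j) *\<^sub>R axis i 1 + (\<xi> $ i) *\<^sub>R axis j 1"

lemma inner_rot: "\<zeta> \<bullet> rot i j \<xi> = - \<zeta> $ i * \<xi> $ j + \<zeta> $ j * \<xi> $ i"
  by (simp add: rot_def inner_add_right inner_diff_right inner_axis)

lemma rot_nth: "i \<noteq> j \<Longrightarrow> rot i j \<xi> $ j = \<xi> $ i"
  by (simp add: rot_def axis_def)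

lemma rot_minus: "rot i j (- \<xi>) = - rot i j \<xi>"
  by (simp add: rot_def)

lemma rot_cont: "continuous_on S f \<Longrightarrow> continuous_on S (\<lambda>x. rot i j (f x))"
  unfolding rot_def by (intro continuous_intros)

lemma norm_rot_le: "norm (rot i j \<xi>) \<le> 2 * norm \<xi>"
proof -
  have "norm (rot i j \<xi>) \<le> \<bar>\<xi> $ j\<bar> + \<bar>\<xi> $ i\<bar>"
    unfolding rot_def by (rule order_trans[OF norm_triangle_ineq]) (simp add: norm_axis_1)
  also have "\<dots> \<le> 2 * norm \<xi>" using component_le_norm_cart[of \<xi> i] component_le_norm_cart[of \<xi> j] by linarith
  finally show ?thesis .
qed

text \<open>A cut-off that is even, compactly supported and continuous, which is the regularity in
  frequency that \<open>picard\<close> demands of its data.\<close>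

definition tent :: "real \<Rightarrow> 'a::real_normed_vector \<Rightarrow> real" where "tent r x = max 0 (r - norm x)"

lemma tent_cont: "continuous_on S f \<Longrightarrow> continuous_on S (\<lambda>x. tent r (f x))"
  unfolding tent_def by (intro continuous_intros)

lemma tent_bounds: "0 \<le> tent r x" "0 \<le> r \<Longrightarrow> tent r x \<le> r" "tent r x \<noteq> 0 \<Longrightarrow> norm x < r"
  by (auto simp: tent_def)

lemma tent_minus: "tent r (- x) = tent r x" by (simp add: tent_def)

definition Vdat :: "'d \<Rightarrow> 'd \<Rightarrow> real^'d::finite \<Rightarrow> real^'d" where
  "Vdat i j \<xi> = tent 1 \<xi> *\<^sub>R rot i j \<xi>"

text \<open>The factor pi puts the centre at a zero of sin (\<xi>_i / n), where \<open>len\<close>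
  stays bounded as n grows.\<close>

definition ctr :: "'d \<Rightarrow> real \<Rightarrow> real^'d::finite" where "ctr i n = (pi * n) *\<^sub>R axis i 1"

text \<open>Two bumps make it even, so that \<open>Bdat\<close> is odd. Division by n compensates
  the size of \<open>rot i j\<close>, which is of order n on the support.\<close>

definition bdat :: "'d \<Rightarrow> real \<Rightarrow> real^'d::finite \<Rightarrow> real" where
  "bdat i n \<xi> = (tent (1/4) (\<xi> - ctr i n) + tent (1/4) (- \<xi> - ctr i n)) / n"

definition Bdat :: "'d \<Rightarrow> 'd \<Rightarrow> real \<Rightarrow> real^'d::finite \<Rightarrow> real^'d" where
  "Bdat i j n \<xi> = bdat i n \<xi> *\<^sub>R rot i j \<xi>"

lemma ctr_nth: "ctr i n $ k = (if k = i then pi * n else 0)" by (simp add: ctr_def axis_def)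

lemma Vdat_cont: "continuous_on UNIV (Vdat i j)"
  unfolding Vdat_def by (intro continuous_intros tent_cont rot_cont)

lemma Bdat_cont: "n > 0 \<Longrightarrow> continuous_on UNIV (Bdat i j n)"
  unfolding Bdat_def bdat_def by (intro continuous_intros tent_cont rot_cont) auto

lemma Vdat_minus: "Vdat i j (- \<xi>) = - Vdat i j \<xi>" by (simp add: Vdat_def rot_minus tent_minus)

lemma Bdat_minus: "Bdat i j n (- \<xi>) = - Bdat i j n \<xi>" by (simp add: Bdat_def bdat_def rot_minus add.commute)

lemma Vdat_orth: "\<xi> \<bullet> Vdat i j \<xi> = 0" by (simp add: Vdat_def inner_rot)

lemma Bdat_orth: "\<xi> \<bullet> Bdat i j n \<xi> = 0" by (simp add: Bdat_def inner_rot)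

text \<open>At the frequencies described by \<open>low\<close> the length is at most d + 7 and the
  exponential at least exp (-5). The leading 5 covers the size of both amplitudes: 2 for
  \<open>Vdat\<close> and 5 for \<open>Bdat\<close>.\<close>

definition Mdat :: "'d::finite itself \<Rightarrow> real" where
  "Mdat _ = 5 * (real CARD('d) + 7) ^ wexp TYPE('d) * exp 5"

lemma Mdat_pos: "Mdat TYPE('d::finite) > 0" by (simp add: Mdat_def add_nonneg_pos)

text \<open>The frequencies at which the weight has a lower bound independent of n. The radius 5n
  makes room for pi n + 1.\<close>

definition low :: "'d \<Rightarrow> real \<Rightarrow> real^'d::finite \<Rightarrow> bool" where
  "low i n \<xi> \<longleftrightarrow> norm \<xi> \<le> 5 * n \<and> n * \<bar>sin (\<xi> $ i / n)\<bar> \<le> 1 \<and> (\<forall>k. k \<noteq> i \<longrightarrow> \<bar>\<xi> $ k\<bar> \<le> 1)"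

lemma weight_lower:
  assumes n: "n \<ge> 1" and l: "low i n (\<xi> :: real^'d::finite)"
  shows "5 \<le> Mdat TYPE('d) * (wS i n \<xi> * exp (- (1/n * norm \<xi>)))"
proof -
  let ?p = "wexp TYPE('d)" and ?D = "real CARD('d)"
  have "\<bar>\<xi> $ i\<bar> / n \<le> 5"
    using l n component_le_norm_cart[of \<xi> i] by (simp add: low_def pos_divide_le_eq)
  moreover have "(\<Sum>k\<in>UNIV - {i}. \<bar>\<xi> $ k\<bar>) \<le> (\<Sum>k\<in>UNIV - {i}. 1)"
    using l by (intro sum_mono) (auto simp: low_def)
  then have "(\<Sum>k\<in>UNIV - {i}. \<bar>\<xi> $ k\<bar>) \<le> ?D"
    by (rule order_trans) (simp add: card_Diff_subset)
  ultimately have "len i n \<xi> \<le> ?D + 7" using l unfolding len_def low_def by linarith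
  then have "len i n \<xi> ^ ?p \<le> (?D + 7) ^ ?p" using len_ge_1[of n i \<xi>] n by (intro power_mono) auto
  then have w: "inverse ((?D + 7) ^ ?p) \<le> wS i n \<xi>"
    unfolding wS_def using len_ge_1[of n i \<xi>] n by (intro le_imp_inverse_le zero_less_power) auto
  have "1/n * norm \<xi> \<le> 5" using l n by (simp add: low_def pos_divide_le_eq)
  then have e: "exp (- 5) \<le> exp (- (1/n * norm \<xi>))" by simp
  have p: "(?D + 7) ^ ?p > 0" by (intro zero_less_power) simp
  have "5 = Mdat TYPE('d) * (inverse ((?D + 7) ^ ?p) * exp (- 5))"
  proof -
    have "(?D + 7) ^ ?p * inverse ((?D + 7) ^ ?p) = 1" using p by (intro right_inverse) linarith
    moreover have "exp 5 * exp (- 5) = (1::real)" by (simp add: exp_minus)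
    moreover have "Mdat TYPE('d) * (inverse ((?D + 7) ^ ?p) * exp (- 5)) = 5 * ((?D + 7) ^ ?p * inverse ((?D + 7) ^ ?p)) * (exp 5 * exp (- 5))"
      unfolding Mdat_def by (simp only: mult_ac)
    ultimately show ?thesis by simp
  qed
  also have "\<dots> \<le> Mdat TYPE('d) * (wS i n \<xi> * exp (- (1/n * norm \<xi>)))"
    using p less_imp_le[OF Mdat_pos[where 'd='d]] by (intro mult_left_mono mult_mono w e) (auto intro: order_trans[OF _ w])
  finally show ?thesis .
qed

lemma low_minus: "low i n (- \<xi>) = low i n \<xi>" by (simp add: low_def)

lemma low_unit:
  assumes n: "n \<ge> 1" and x: "norm \<xi> \<le> 1" shows "low i n \<xi>"
proof -
  have c: "\<bar>\<xi> $ k\<bar> \<le> 1" for k using component_le_norm_cart[of \<xi> k] x by linarith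
  have "n * \<bar>sin (\<xi> $ i / n)\<bar> \<le> n * \<bar>\<xi> $ i / n\<bar>" using n by (intro mult_left_mono abs_sin_x_le_abs_x) auto
  then have "n * \<bar>sin (\<xi> $ i / n)\<bar> \<le> 1" using c[of i] n by (simp add: abs_mult)
  then show ?thesis using c x n by (simp add: low_def)
qed

lemma low_ctr:
  assumes n: "n \<ge> 1" and x: "norm (\<xi> - ctr i n) \<le> 1" shows "low i n \<xi>"
proof -
  have c: "\<bar>(\<xi> - ctr i n) $ k\<bar> \<le> 1" for k using component_le_norm_cart[of "\<xi> - ctr i n" k] x by linarith
  have "norm (ctr i n) = pi * n" using n by (simp add: ctr_def norm_axis_1)
  then have "norm \<xi> \<le> pi * n + 1" using norm_triangle_sub[of \<xi> "ctr i n"] x by linarith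
  moreover have "pi * n \<le> 4 * n" using pi_less_4 n by (intro mult_right_mono) auto
  ultimately have 1: "norm \<xi> \<le> 5 * n" using n by linarith
  define y where "y = (\<xi> - ctr i n) $ i / n"
  have "\<xi> $ i / n = of_int 1 * pi + y" using n by (simp add: y_def ctr_nth diff_divide_distrib)
  then have "\<bar>sin (\<xi> $ i / n)\<bar> = \<bar>sin y\<bar>" using abs_sin_add_pi_multiple[of 1 y] by simp
  then have "n * \<bar>sin (\<xi> $ i / n)\<bar> \<le> n * \<bar>y\<bar>" using n abs_sin_x_le_abs_x[of y] by (simp add: mult_left_mono)
  also have "n * \<bar>y\<bar> \<le> 1" using c[of i] n by (simp add: y_def abs_divide)
  finally have 2: "n * \<bar>sin (\<xi> $ i / n)\<bar> \<le> 1" .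
  have "\<bar>\<xi> $ k\<bar> \<le> 1" if "k \<noteq> i" for k using c[of k] that by (simp add: ctr_nth)
  then show ?thesis using 1 2 by (simp add: low_def)
qed

lemma Vdat_bounds:
  assumes n: "n \<ge> 1"
  shows "norm (Vdat i j (\<xi> :: real^'d::finite)) \<le> Mdat TYPE('d) * (wS i n \<xi> * exp (- (1/n * norm \<xi>)))"
    and "(norm \<xi>)\<^sup>2 * norm (Vdat i j \<xi>) \<le> Mdat TYPE('d) * (wS i n \<xi> * exp (- (1/n * norm \<xi>)))"
    and "Vdat i j \<xi> \<noteq> 0 \<Longrightarrow> norm \<xi> \<le> 1"
proof -
  let ?R = "Mdat TYPE('d) * (wS i n \<xi> * exp (- (1/n * norm \<xi>)))"
  have R: "0 \<le> ?R" using less_imp_le[OF Mdat_pos[where 'd='d]] wS_pos[of n i \<xi>] n by (intro mult_nonneg_nonneg) auto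
  show supp: "Vdat i j \<xi> \<noteq> 0 \<Longrightarrow> norm \<xi> \<le> 1" using tent_bounds(3)[of 1 \<xi>] by (auto simp: Vdat_def)
  have "norm (Vdat i j \<xi>) \<le> ?R \<and> (norm \<xi>)\<^sup>2 * norm (Vdat i j \<xi>) \<le> ?R"
  proof (cases "Vdat i j \<xi> = 0")
    case False
    then have x: "norm \<xi> \<le> 1" by (rule supp)
    have v: "norm (Vdat i j \<xi>) \<le> 1 * (2 * 1)"
      unfolding Vdat_def norm_scaleR using tent_bounds(1,2)[of 1 \<xi>] norm_rot_le[of i j \<xi>] x by (intro mult_mono) auto
    have "(norm \<xi>)\<^sup>2 \<le> 1" using x by (simp add: power_le_one)
    then have "(norm \<xi>)\<^sup>2 * norm (Vdat i j \<xi>) \<le> 1 * (1 * (2 * 1))" using v by (intro mult_mono) auto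
    then show ?thesis using v weight_lower[OF n low_unit[OF n x], of i] by linarith
  qed (use R in simp)
  then show "norm (Vdat i j \<xi>) \<le> ?R" "(norm \<xi>)\<^sup>2 * norm (Vdat i j \<xi>) \<le> ?R" by auto
qed

lemma Bdat_bounds:
  assumes n: "n \<ge> 1"
  shows "norm (Bdat i j n (\<xi> :: real^'d::finite)) \<le> Mdat TYPE('d) * (wS i n \<xi> * exp (- (1/n * norm \<xi>)))"
    and "Bdat i j n \<xi> \<noteq> 0 \<Longrightarrow> norm \<xi> \<le> 5 * n"
proof -
  let ?R = "Mdat TYPE('d) * (wS i n \<xi> * exp (- (1/n * norm \<xi>)))"
  have R: "0 \<le> ?R" using less_imp_le[OF Mdat_pos[where 'd='d]] wS_pos[of n i \<xi>] n by (intro mult_nonneg_nonneg) auto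
  have supp: "low i n \<xi>" if "Bdat i j n \<xi> \<noteq> 0"
  proof -
    have "tent (1/4) (\<xi> - ctr i n) \<noteq> 0 \<or> tent (1/4) (- \<xi> - ctr i n) \<noteq> 0" using that by (auto simp: Bdat_def bdat_def)
    then have "norm (\<xi> - ctr i n) \<le> 1 \<or> norm (- \<xi> - ctr i n) \<le> 1"
      using tent_bounds(3)[of "1/4" "\<xi> - ctr i n"] tent_bounds(3)[of "1/4" "- \<xi> - ctr i n"] by linarith
    then show ?thesis using low_ctr[OF n, of \<xi> i] low_ctr[OF n, of "- \<xi>" i] low_minus by blast
  qed
  then show "Bdat i j n \<xi> \<noteq> 0 \<Longrightarrow> norm \<xi> \<le> 5 * n" by (simp add: low_def)
  show "norm (Bdat i j n \<xi>) \<le> ?R"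
  proof (cases "Bdat i j n \<xi> = 0")
    case False
    note l = supp[OF False]
    have t: "0 \<le> tent (1/4) (\<xi> - ctr i n) + tent (1/4) (- \<xi> - ctr i n)" "tent (1/4) (\<xi> - ctr i n) + tent (1/4) (- \<xi> - ctr i n) \<le> 1/2"
      using tent_bounds(1,2)[of "1/4" "\<xi> - ctr i n"] tent_bounds(1,2)[of "1/4" "- \<xi> - ctr i n"] by linarith+
    have "\<bar>bdat i n \<xi>\<bar> \<le> (1/2) / n" unfolding bdat_def abs_divide abs_of_nonneg[OF t(1)] using n divide_right_mono[OF t(2), of n] by simp
    then have "norm (Bdat i j n \<xi>) \<le> ((1/2) / n) * (2 * (5 * n))"
      unfolding Bdat_def norm_scaleR using norm_rot_le[of i j \<xi>] l n by (intro mult_mono) (auto simp: low_def)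
    then show ?thesis using weight_lower[OF n l] n by simp
  qed (use R in simp)
qed

section \<open>Lower bound for the first order term\<close>

lemma integral_tent_pos: "integrable lborel (tent (1/4) :: real^'d::finite \<Rightarrow> real)" "(LINT x|lborel. tent (1/4) (x :: real^'d)) > 0"
proof -
  have m: "(tent (1/4) :: real^'d \<Rightarrow> real) \<in> borel_measurable borel"
    by (intro borel_measurable_continuous_onI tent_cont continuous_on_id[unfolded id_def])
  show i: "integrable lborel (tent (1/4) :: real^'d \<Rightarrow> real)"
    by (rule integrable_compact_support[OF compact_cball[of 0 "1/4"] m, of "1/4"]) (auto simp: tent_def max_def)
  have b: "integrable lborel (indicator (cball 0 (1/8)) :: real^'d \<Rightarrow> real)"
    by (rule integrable_real_indicator) (use emeasure_compact_finite[of "cball (0::real^'d) (1/8)"] in auto)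
  have "(LINT x|lborel. (1/8) * indicator (cball 0 (1/8)) (x :: real^'d)) \<le> (LINT x|lborel. tent (1/4) (x :: real^'d))"
    by (rule Bochner_Integration.integral_mono[OF integrable_mult_right[OF b] i]) (auto simp: tent_def indicator_def)
  moreover have "(LINT x|lborel. (1/8) * indicator (cball 0 (1/8)) (x :: real^'d)) = (1/8) * measure lborel (cball (0::real^'d) (1/8))"
    by simp
  moreover have "measure lborel (cball (0::real^'d) (1/8)) > 0" by (subst content_cball) auto
  ultimately show "(LINT x|lborel. tent (1/4) (x :: real^'d)) > 0" by linarith
qed

text \<open>The factor 1/32 is 2 times 1/8 times 1/8, the lower bounds for \<zeta>_i/n, for the
  cut-off of the velocity, and for the cross term divided by n.\<close>

definition gam :: "'d::finite itself \<Rightarrow> real" where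
  "gam _ = (1/32) * (LINT x|lborel. tent (1/4) (x :: real^'d))"

lemma gam_pos: "gam TYPE('d::finite) > 0" unfolding gam_def using integral_tent_pos(2)[where 'd='d] by simp

text \<open>The shift by e_j/2 moves the output away from the axis. If \<zeta> - \<eta> lies in the
  bump of radius 1/4 around the centre, then \<eta> is within 3/8 of e_j/2, so that \<eta>_j \<ge>
  1/8 and |\<eta>| \<le> 7/8.\<close>

definition reg :: "'d \<Rightarrow> 'd \<Rightarrow> real \<Rightarrow> (real^'d::finite) set" where
  "reg i j n = cball (ctr i n + (1/2) *\<^sub>R axis j 1) (1/8)"

lemma reg_bounds:
  assumes ij: "i \<noteq> j" and n: "n \<ge> 64" and z: "\<zeta> \<in> reg i j n"
  shows "2 * n \<le> \<zeta> $ i" "\<bar>\<zeta> $ j\<bar> \<le> 1" "n \<le> norm \<zeta>"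
proof -
  let ?y = "\<zeta> - (ctr i n + (1/2) *\<^sub>R axis j 1)"
  have y: "norm ?y \<le> 1/8" using z by (simp add: reg_def dist_norm norm_minus_commute)
  have c: "\<bar>?y $ k\<bar> \<le> 1/8" for k using component_le_norm_cart[of ?y k] y by linarith
  have e: "?y $ i = \<zeta> $ i - pi * n" "?y $ j = \<zeta> $ j - 1/2" using ij by (simp_all add: ctr_nth axis_def)
  have "\<bar>\<zeta> $ i - pi * n\<bar> \<le> 1/8" "\<bar>\<zeta> $ j - 1/2\<bar> \<le> 1/8" using c[of i] c[of j] unfolding e by auto
  moreover have "3 * n \<le> pi * n" using pi_gt3 n by (intro mult_right_mono) auto
  ultimately show 1: "2 * n \<le> \<zeta> $ i" and "\<bar>\<zeta> $ j\<bar> \<le> 1" using n by linarith+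
  show "n \<le> norm \<zeta>" using 1 component_le_norm_cart[of \<zeta> i] n by linarith
qed

text \<open>On this ball the first time derivative of the magnetic field reduces to a positive integral,
  the Fourier form of the Poisson bracket of the two stream functions.\<close>

lemma first_order_lower_bound:
  assumes ij: "i \<noteq> j" and n: "n \<ge> 64" and z: "\<zeta> \<in> reg i j n" and W: "conv_weight (wS (i::'d::finite) n) K"
  shows "gam TYPE('d) \<le> ((1/n) *\<^sub>R (adv (Bdat i j n) (Vdat i j) \<zeta> - adv (Vdat i j) (Bdat i j n) \<zeta>)) $ j"
proof -
  interpret conv_weight "wS i n" K by (rule W)
  have n1: "n \<ge> 1" "n > 0" using n by auto
  have mV: "Vdat i j \<in> borel_measurable borel" and mB: "Bdat i j n \<in> borel_measurable borel"
    by (rule borel_measurable_continuous_onI[OF Vdat_cont], rule borel_measurable_continuous_onI[OF Bdat_cont[OF n1(2)]])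
  have r: "0 \<le> 1/n" using n by simp
  note IB = adv_weight_integrable[OF mB mV r Bdat_bounds(1)[OF n1(1)] Vdat_bounds(1)[OF n1(1)], of \<zeta>]
  note IV = adv_weight_integrable[OF mV mB r Vdat_bounds(1)[OF n1(1)] Bdat_bounds(1)[OF n1(1)], of \<zeta>]
  have iB: "integrable lborel (\<lambda>\<eta>. (\<zeta> \<bullet> Bdat i j n \<eta>) * Vdat i j (\<zeta> - \<eta>) $ j)" using integrable_nth[OF IB, of j] by simp
  have iV: "integrable lborel (\<lambda>\<eta>. (\<zeta> \<bullet> Vdat i j \<eta>) * Bdat i j n (\<zeta> - \<eta>) $ j)" using integrable_nth[OF IV, of j] by simp
  let ?fB = "\<lambda>\<eta>. (\<zeta> \<bullet> Bdat i j n \<eta>) * Vdat i j (\<zeta> - \<eta>) $ j"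
  have fBm: "?fB \<in> borel_measurable borel" using borel_measurable_integrable[OF iB] by simp
  \<comment> \<open>Reflection gives both convolutions the same arguments, \<eta> for the velocity
    and \<zeta> - \<eta> for the magnetic field, so that they can be combined under one
    integral.\<close>
  have iB': "integrable lborel (\<lambda>\<eta>. ?fB (\<zeta> - \<eta>))" using iB integrable_lborel_reflect[OF fBm] by blast
  have aB: "adv (Bdat i j n) (Vdat i j) \<zeta> $ j = (LINT \<eta>|lborel. ?fB (\<zeta> - \<eta>))"
    unfolding adv_def integral_lborel_reflect[OF fBm]
    using integral_bounded_linear[OF bounded_linear_vec_nth[of j] IB] by simp
  have aV: "adv (Vdat i j) (Bdat i j n) \<zeta> $ j = (LINT \<eta>|lborel. (\<zeta> \<bullet> Vdat i j \<eta>) * Bdat i j n (\<zeta> - \<eta>) $ j)"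
    unfolding adv_def using integral_bounded_linear[OF bounded_linear_vec_nth[of j] IV] by simp
  let ?g = "\<lambda>\<eta>. (1/n) * (?fB (\<zeta> - \<eta>) - (\<zeta> \<bullet> Vdat i j \<eta>) * Bdat i j n (\<zeta> - \<eta>) $ j)"
  have e: "((1/n) *\<^sub>R (adv (Bdat i j n) (Vdat i j) \<zeta> - adv (Vdat i j) (Bdat i j n) \<zeta>)) $ j = (LINT \<eta>|lborel. ?g \<eta>)"
    unfolding vector_scaleR_component vector_minus_component aB aV using iB' iV by simp
  have gi: "integrable lborel ?g" using iB' iV by (intro integrable_mult_right Bochner_Integration.integrable_diff)
  have tm: "(tent (1/4) :: real^'d \<Rightarrow> real) \<in> borel_measurable borel" using integral_tent_pos(1)[where 'd='d] by auto
  have ti: "integrable lborel (\<lambda>\<eta>. (1/32) * tent (1/4) ((\<zeta> - ctr i n) - \<eta>))"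
    using integral_tent_pos(1)[where 'd='d] integrable_lborel_reflect[OF tm] by (intro integrable_mult_right) blast
  note R = reg_bounds[OF ij n z]
  have "(1/32) * tent (1/4) ((\<zeta> - ctr i n) - \<eta>) \<le> ?g \<eta>" for \<eta>
  proof -
    define t1 where "t1 = tent (1/4) (\<zeta> - \<eta> - ctr i n)"
    define t2 where "t2 = tent (1/4) (- (\<zeta> - \<eta>) - ctr i n)"
    \<comment> \<open>Contracting \<zeta> with the rotations of \<zeta> - \<eta> and of \<eta> gives
      the same cross term with opposite signs. The two contributions therefore add up, and \<eta>_i
      + (\<zeta>_i - \<eta>_i) = \<zeta>_i.\<close>
    have g: "?g \<eta> = (\<zeta> $ i / n) * ((t1 + t2) * tent 1 \<eta>) * ((\<zeta> $ i * \<eta> $ j - \<zeta> $ j * \<eta> $ i) / n)"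
      using n1 ij by (simp add: Bdat_def Vdat_def bdat_def inner_rot rot_nth t1_def t2_def field_simps)
    \<comment> \<open>The bump around the opposite centre is out of reach: \<zeta>_i \<ge> 2n, and a
      velocity frequency has norm below 1.\<close>
    have t2: "t2 * tent 1 \<eta> = 0"
    proof (rule ccontr)
      assume "t2 * tent 1 \<eta> \<noteq> 0"
      then have "norm (- (\<zeta> - \<eta>) - ctr i n) < 1/4" "norm \<eta> < 1"
        using tent_bounds(3)[of "1/4" "- (\<zeta> - \<eta>) - ctr i n"] tent_bounds(3)[of 1 \<eta>] by (auto simp: t2_def)
      then have "\<bar>(- (\<zeta> - \<eta>) - ctr i n) $ i\<bar> < 1/4" "\<bar>\<eta> $ i\<bar> < 1"
        using component_le_norm_cart[of "- (\<zeta> - \<eta>) - ctr i n" i] component_le_norm_cart[of \<eta> i] by linarith+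
      moreover have "(- (\<zeta> - \<eta>) - ctr i n) $ i = \<eta> $ i - \<zeta> $ i - pi * n" by (simp add: ctr_nth)
      moreover have "0 \<le> pi * n" using n by simp
      ultimately show False using R(1) n by linarith
    qed
    have g': "?g \<eta> = (\<zeta> $ i / n) * (t1 * tent 1 \<eta>) * ((\<zeta> $ i * \<eta> $ j - \<zeta> $ j * \<eta> $ i) / n)"
      unfolding g distrib_right t2 by simp
    have t1e: "tent (1/4) ((\<zeta> - ctr i n) - \<eta>) = t1" by (simp add: t1_def algebra_simps)
    show ?thesis
    proof (cases "t1 = 0")
      case True
      then show ?thesis unfolding g' t1e by simp
    next
      case False
      have t1: "t1 \<ge> 0" unfolding t1_def by (rule tent_bounds)
      have "norm (\<zeta> - \<eta> - ctr i n) < 1/4" using False unfolding t1_def by (rule tent_bounds)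
      moreover have "norm (\<zeta> - (ctr i n + (1/2) *\<^sub>R axis j 1)) \<le> 1/8" using z by (simp add: reg_def dist_norm norm_minus_commute)
      moreover have e: "\<eta> - (1/2) *\<^sub>R axis j 1 = (\<zeta> - (ctr i n + (1/2) *\<^sub>R axis j 1)) - (\<zeta> - \<eta> - ctr i n)" by (simp add: algebra_simps)
      ultimately have h: "norm (\<eta> - (1/2) *\<^sub>R axis j 1) \<le> 3/8"
        using norm_triangle_ineq4[of "\<zeta> - (ctr i n + (1/2) *\<^sub>R axis j 1)" "\<zeta> - \<eta> - ctr i n"] unfolding e by linarith
      have "norm \<eta> \<le> 3/8 + 1/2" using norm_triangle_sub[of \<eta> "(1/2) *\<^sub>R axis j 1"] h by (simp add: norm_axis_1)
      then have T: "tent 1 \<eta> \<ge> 1/8" by (simp add: tent_def)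
      have "\<bar>(\<eta> - (1/2) *\<^sub>R axis j 1) $ j\<bar> \<le> 3/8" "\<bar>(\<eta> - (1/2) *\<^sub>R axis j 1) $ i\<bar> \<le> 3/8"
        using h component_le_norm_cart[of "\<eta> - (1/2) *\<^sub>R axis j 1" j] component_le_norm_cart[of "\<eta> - (1/2) *\<^sub>R axis j 1" i] by linarith+
      then have "\<bar>\<eta> $ j - 1/2\<bar> \<le> 3/8" "\<bar>\<eta> $ i\<bar> \<le> 3/8" using ij by (simp_all add: axis_def)
      then have hj: "\<eta> $ j \<ge> 1/8" and hi: "\<bar>\<eta> $ i\<bar> \<le> 1" by linarith+
      have zi: "\<zeta> $ i / n \<ge> 2" using R(1) n1 by (simp add: pos_le_divide_eq)
      have "\<bar>\<zeta> $ j * \<eta> $ i\<bar> \<le> 1 * 1" unfolding abs_mult using R(2) hi by (intro mult_mono) auto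
      moreover have "(2 * n) * (1/8) \<le> \<zeta> $ i * \<eta> $ j" using R(1) hj n1 by (intro mult_mono) auto
      ultimately have "n * (1/8) \<le> \<zeta> $ i * \<eta> $ j - \<zeta> $ j * \<eta> $ i" using n by linarith
      then have q: "(\<zeta> $ i * \<eta> $ j - \<zeta> $ j * \<eta> $ i) / n \<ge> 1/8" using n1 by (simp add: pos_le_divide_eq mult.commute)
      have "2 * (t1 * (1/8)) * (1/8) \<le> ?g \<eta>"
        unfolding g' using zi T q t1 by (intro mult_mono mult_left_mono mult_nonneg_nonneg) auto
      then show ?thesis unfolding t1e by simp
    qed
  qed
  from Bochner_Integration.integral_mono[OF ti gi this]
  have "(LINT \<eta>|lborel. (1/32) * tent (1/4) ((\<zeta> - ctr i n) - \<eta>)) \<le> (LINT \<eta>|lborel. ?g \<eta>)" .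
  moreover have "(LINT \<eta>|lborel. (1/32) * tent (1/4) ((\<zeta> - ctr i n) - \<eta>)) = gam TYPE('d)"
    unfolding gam_def integral_mult_right_zero integral_lborel_reflect[OF tm] ..
  ultimately show ?thesis unfolding e by (simp only:)
qed

subsection \<open>Two solutions with the same initial magnetic field\<close>

lemma adv_scaleR_left: "adv (\<lambda>\<xi>. a *\<^sub>R U \<xi>) V \<zeta> = a *\<^sub>R adv U V \<zeta>"
  unfolding adv_def integral_scaleR_right[symmetric] by simp

lemma adv_scaleR_right: "adv U (\<lambda>\<xi>. a *\<^sub>R V \<xi>) \<zeta> = a *\<^sub>R adv U V \<zeta>"
  unfolding adv_def integral_scaleR_right[symmetric] by (simp add: mult.commute)

text \<open>The fixed point (V, C) is scaled back to (a V, b C). The relation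
  \<open>a * \<beta> = b\<^sup>2\<close> turns the coefficient of the magnetic term in the velocity
  equation into that of the original system.\<close>

lemma (in picard) scaled_solution:
  assumes a: "0 < a" "a \<le> 1" "\<alpha> = a" and b: "0 < b" "b \<le> 1" "a * \<beta> = b\<^sup>2" and s: "s > 0" and T: "T \<le> TT"
  obtains U B where "field (4 * M) (\<kappa>/2) U" "field (4 * M) (\<kappa>/2) B"
    "mhd_solution s T (sinT (\<lambda>\<xi>. a *\<^sub>R U0 \<xi>)) (sinT (\<lambda>\<xi>. b *\<^sub>R B0 \<xi>)) (\<lambda>t. sinT (U t)) (\<lambda>t. sinT (B t))"
    "\<And>t \<xi>. 0 \<le> t \<Longrightarrow> t \<le> TT \<Longrightarrow> norm (B t \<xi> - b *\<^sub>R B0 \<xi> - (t * b) *\<^sub>R (a *\<^sub>R (adv B0 U0 \<xi> - adv U0 B0 \<xi>)))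
      \<le> b * (64 * (M + 128 * M\<^sup>2 * K) * M * K * t\<^sup>2)"
proof -
  obtain V C where A: "adm (4 * M) V" "adm (4 * M) C" and odd: "\<And>t \<xi>. V t (- \<xi>) = - V t \<xi>" "\<And>t \<xi>. C t (- \<xi>) = - C t \<xi>"
    and fp: "\<And>t \<xi>. V t \<xi> = su V C t \<xi>" "\<And>t \<xi>. C t \<xi> = sb V C t \<xi>"
    by (rule fixed_point) blast
  note orth = fixed_point_orth[OF A fp] and deriv = fixed_point_deriv[OF A fp]
  define U where "U t \<xi> = a *\<^sub>R V t \<xi>" for t \<xi>
  define B where "B t \<xi> = b *\<^sub>R C t \<xi>" for t \<xi>
  have fld: "field (4 * M) (\<kappa>/2) (\<lambda>t \<xi>. c *\<^sub>R W t \<xi>)"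
    if c: "0 < c" "c \<le> 1" and W: "adm (4 * M) W" "\<And>t \<xi>. W t (- \<xi>) = - W t \<xi>" "\<And>t \<xi>. \<xi> \<bullet> W t \<xi> = 0" for c W
  proof -
    have "norm (c *\<^sub>R W t \<xi>) \<le> 4 * M * exp (- (\<kappa>/2 * norm \<xi>))" for t \<xi>
    proof -
      have "norm (c *\<^sub>R W t \<xi>) \<le> 1 * norm (W t \<xi>)" unfolding norm_scaleR using c by (intro mult_right_mono) auto
      also have "\<dots> \<le> 4 * M * wt t \<xi>" using W(1) by (simp add: adm_def)
      also have "\<dots> \<le> 4 * M * (1 * exp (- (\<kappa>/2 * norm \<xi>)))"
        using M by (intro mult_left_mono order_trans[OF wt_le_half] mult_right_mono S_le) auto
      finally show ?thesis by simp
    qed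
    moreover have "continuous_on UNIV (\<lambda>z. c *\<^sub>R W (fst z) (snd z))" using W(1) by (intro continuous_intros) (simp add: adm_def)
    ultimately show ?thesis using \<kappa> W(2,3) by (simp add: field_def)
  qed
  have fU: "field (4 * M) (\<kappa>/2) U" unfolding U_def by (rule fld[OF a(1,2) A(1) odd(1) orth(1)])
  have fB: "field (4 * M) (\<kappa>/2) B" unfolding B_def by (rule fld[OF b(1,2) A(2) odd(2) orth(2)])
  have adv: "adv (U t) (U t) \<xi> = (a * a) *\<^sub>R adv (V t) (V t) \<xi>" "adv (B t) (B t) \<xi> = (b * b) *\<^sub>R adv (C t) (C t) \<xi>"
    "adv (B t) (U t) \<xi> = (b * a) *\<^sub>R adv (C t) (V t) \<xi>" "adv (U t) (B t) \<xi> = (b * a) *\<^sub>R adv (V t) (C t) \<xi>" for t \<xi>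
    unfolding U_def B_def adv_scaleR_left adv_scaleR_right by (simp_all add: mult.commute)
  have bb: "b * b = a * \<beta>" using b(3) by (simp add: power2_eq_square)
  interpret F: fourier_mhd U B "4 * M" "\<kappa>/2" T
  proof
    fix t \<xi> assume t: "0 < t" "t < T"
    then have t': "t < TT" using T by linarith
    have "((\<lambda>t. U t \<xi>) has_vector_derivative a *\<^sub>R (- (sq \<xi> *\<^sub>R V t \<xi>) + N1 V C V C t \<xi>)) (at t)"
      unfolding U_def by (rule bounded_linear.has_vector_derivative[OF bounded_linear_scaleR_right deriv(1)[OF t(1) t']])
    moreover have "a *\<^sub>R (- (sq \<xi> *\<^sub>R V t \<xi>) + N1 V C V C t \<xi>) = - (sq \<xi> *\<^sub>R U t \<xi>) - leray \<xi> (adv (U t) (U t) \<xi> - adv (B t) (B t) \<xi>)"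
      unfolding adv bb N1_def leray_linear unfolding U_def a(3) by (simp add: algebra_simps)
    ultimately show "((\<lambda>t. U t \<xi>) has_vector_derivative - (sq \<xi> *\<^sub>R U t \<xi>) - leray \<xi> (adv (U t) (U t) \<xi> - adv (B t) (B t) \<xi>)) (at t)"
      by (simp only:)
    have "((\<lambda>t. B t \<xi>) has_vector_derivative b *\<^sub>R N2 V C V C t \<xi>) (at t)"
      unfolding B_def by (rule bounded_linear.has_vector_derivative[OF bounded_linear_scaleR_right deriv(2)[OF t(1) t']])
    then show "((\<lambda>t. B t \<xi>) has_vector_derivative adv (B t) (U t) \<xi> - adv (U t) (B t) \<xi>) (at t)"
      unfolding adv N2_def unfolding a(3) by (simp add: algebra_simps)
  qed (rule fU fB)+
  have init: "U 0 = (\<lambda>\<xi>. a *\<^sub>R U0 \<xi>)" "B 0 = (\<lambda>\<xi>. b *\<^sub>R B0 \<xi>)"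
    unfolding U_def B_def orth(3,4) by (rule refl)+
  show thesis
  proof (rule that[OF fU fB F.solution[OF s, unfolded init]])
    fix t \<xi> assume t: "0 \<le> t" "t \<le> TT"
    have "B t \<xi> - b *\<^sub>R B0 \<xi> - (t * b) *\<^sub>R (a *\<^sub>R (adv B0 U0 \<xi> - adv U0 B0 \<xi>))
      = b *\<^sub>R (C t \<xi> - B0 \<xi> - t *\<^sub>R (\<alpha> *\<^sub>R (adv B0 U0 \<xi> - adv U0 B0 \<xi>)))"
      unfolding B_def a(3) by (simp add: algebra_simps)
    then show "norm (B t \<xi> - b *\<^sub>R B0 \<xi> - (t * b) *\<^sub>R (a *\<^sub>R (adv B0 U0 \<xi> - adv U0 B0 \<xi>)))
      \<le> b * (64 * (M + 128 * M\<^sup>2 * K) * M * K * t\<^sup>2)"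
      using taylor[OF A fp t, of \<xi>] b(1) by (simp add: mult_left_mono)
  qed
qed

definition Ldat :: "'d::finite itself \<Rightarrow> real \<Rightarrow> real" where
  "Ldat T K = 64 * (Mdat T + 128 * (Mdat T)\<^sup>2 * K) * Mdat T * K"

lemma Ldat_pos: "K > 0 \<Longrightarrow> Ldat TYPE('d::finite) K > 0"
  using Mdat_pos[where 'd='d] by (simp add: Ldat_def add_pos_nonneg)

text \<open>The scales are a = 1/n and b = n^(-s), and s \<ge> 1 gives n^(1 - 2s) \<le> 1/n. The
  parameter \<theta> switches the initial velocity on and off and enters the first order term of the
  magnetic field linearly.\<close>

lemma solution_with_data:
  assumes n: "n \<ge> 1" and s: "s \<ge> 1" and th: "0 \<le> \<theta>" "\<theta> \<le> 1" and W: "conv_weight (wS (i::'d::finite) n) K"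
    and T: "T \<le> 1 / (2 * (64 * Mdat TYPE('d) * K))"
  obtains U B where "field (4 * Mdat TYPE('d)) (1/n/2) U" "field (4 * Mdat TYPE('d)) (1/n/2) B"
    "mhd_solution s T (sinT (\<lambda>\<xi>. (1/n) *\<^sub>R (\<theta> *\<^sub>R Vdat i j \<xi>))) (sinT (\<lambda>\<xi>. (n powr - s) *\<^sub>R Bdat i j n \<xi>)) (\<lambda>t. sinT (U t)) (\<lambda>t. sinT (B t))"
    "\<And>t \<xi>. 0 \<le> t \<Longrightarrow> t \<le> T \<Longrightarrow> norm (B t \<xi> - (n powr - s) *\<^sub>R Bdat i j n \<xi>
        - (t * n powr - s * \<theta>) *\<^sub>R ((1/n) *\<^sub>R (adv (Bdat i j n) (Vdat i j) \<xi> - adv (Vdat i j) (Bdat i j n) \<xi>)))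
      \<le> n powr - s * (Ldat TYPE('d) K * t\<^sup>2)"
proof -
  interpret W: conv_weight "wS i n" K by (rule W)
  let ?M = "Mdat TYPE('d)" and ?b = "n powr - s"
  have n0: "n > 0" using n by linarith
  have b1: "?b \<le> 1" using powr_mono[of "- s" 0 n] n s by simp
  have beta: "n powr (1 - 2 * s) \<le> 1/n" using powr_mono[of "1 - 2 * s" "- 1" n] n s by (simp add: powr_minus_divide)
  have ab: "1/n * n powr (1 - 2 * s) = ?b\<^sup>2"
  proof -
    have e: "1/n = n powr - 1" using n0 by (simp add: powr_minus_divide)
    show ?thesis unfolding e power2_eq_square powr_add[symmetric] by simp
  qed
  have sc: "c * norm (\<theta> *\<^sub>R v) \<le> r" if "c * norm v \<le> r" "c \<ge> 0" for c r and v :: "real^'d"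
  proof -
    have "c * norm (\<theta> *\<^sub>R v) \<le> c * (1 * norm v)"
      unfolding norm_scaleR using th that(2) by (intro mult_left_mono mult_right_mono) auto
    then show ?thesis using that(1) by simp
  qed
  interpret P: picard "wS i n" K "1/n" "64 * ?M * K" "1/n" "n powr (1 - 2 * s)" ?M "\<lambda>\<xi>. \<theta> *\<^sub>R Vdat i j \<xi>" "Bdat i j n"
  proof
    show "continuous_on UNIV (\<lambda>\<xi>. \<theta> *\<^sub>R Vdat i j \<xi>)" by (intro continuous_intros Vdat_cont)
    show "norm (\<theta> *\<^sub>R Vdat i j \<xi>) \<le> ?M * (wS i n \<xi> * exp (- (1/n * norm \<xi>)))" for \<xi>
      using sc[of 1 "Vdat i j \<xi>"] Vdat_bounds(1)[OF n, of i j \<xi>] by simp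
    show "(norm \<xi>)\<^sup>2 * norm (\<theta> *\<^sub>R Vdat i j \<xi>) \<le> ?M * (wS i n \<xi> * exp (- (1/n * norm \<xi>)))" for \<xi>
      by (rule sc[OF Vdat_bounds(2)[OF n]]) simp
    show "norm (Bdat i j n \<xi>) \<le> ?M * (wS i n \<xi> * exp (- (1/n * norm \<xi>)))" for \<xi>
      by (rule Bdat_bounds(1)[OF n])
    show "continuous_on UNIV (Bdat i j n)" by (rule Bdat_cont[OF n0])
  qed (use n0 Mdat_pos beta in \<open>simp_all add: Vdat_minus Bdat_minus Vdat_orth Bdat_orth\<close>)
  have T': "T \<le> P.TT" unfolding P.TT_def by (rule T)
  have a: "0 < 1/n" "1/n \<le> 1" using n by simp_all
  have b0: "0 < ?b" and s0: "0 < s" using n0 s by simp_all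
  obtain U B where UB: "field (4 * ?M) (1/n/2) U" "field (4 * ?M) (1/n/2) B"
    "mhd_solution s T (sinT (\<lambda>\<xi>. (1/n) *\<^sub>R (\<theta> *\<^sub>R Vdat i j \<xi>))) (sinT (\<lambda>\<xi>. ?b *\<^sub>R Bdat i j n \<xi>)) (\<lambda>t. sinT (U t)) (\<lambda>t. sinT (B t))"
    and tay: "\<And>t \<xi>. 0 \<le> t \<Longrightarrow> t \<le> P.TT \<Longrightarrow> norm (B t \<xi> - ?b *\<^sub>R Bdat i j n \<xi>
        - (t * ?b) *\<^sub>R ((1/n) *\<^sub>R (adv (Bdat i j n) (\<lambda>\<xi>. \<theta> *\<^sub>R Vdat i j \<xi>) \<xi> - adv (\<lambda>\<xi>. \<theta> *\<^sub>R Vdat i j \<xi>) (Bdat i j n) \<xi>)))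
      \<le> ?b * (64 * (?M + 128 * ?M\<^sup>2 * K) * ?M * K * t\<^sup>2)"
    by (rule P.scaled_solution[OF a refl b0 b1 ab s0 T']) (rule that, assumption, assumption, assumption, blast)
  show thesis
  proof (rule that[OF UB])
    fix t \<xi> assume t: "0 \<le> t" "t \<le> T"
    have e: "(t * ?b) *\<^sub>R ((1/n) *\<^sub>R (\<theta> *\<^sub>R x - \<theta> *\<^sub>R y)) = (t * ?b * \<theta>) *\<^sub>R ((1/n) *\<^sub>R (x - y))" for x y :: "real^'d"
      by (simp add: scaleR_diff_right[symmetric] mult.commute)
    show "norm (B t \<xi> - ?b *\<^sub>R Bdat i j n \<xi> - (t * ?b * \<theta>) *\<^sub>R ((1/n) *\<^sub>R (adv (Bdat i j n) (Vdat i j) \<xi> - adv (Vdat i j) (Bdat i j n) \<xi>)))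
      \<le> ?b * (Ldat TYPE('d) K * t\<^sup>2)"
      using tay[OF t(1) order_trans[OF t(2) T'], of \<xi>] unfolding adv_scaleR_left adv_scaleR_right e Ldat_def .
  qed
qed

lemma Hs_norm_nonneg: "Hs_norm s f \<ge> 0"
  unfolding Hs_norm_def by (intro real_sqrt_ge_zero sum_nonneg integral_nonneg_AE) auto

lemma sinT_zero: "sinT (\<lambda>_. 0) = (\<lambda>_. 0)"
  by (simp add: sinT_def fun_eq_iff)

lemma Hs_norm_zero: "s > 0 \<Longrightarrow> Hs_norm s (\<lambda>x::'a::euclidean_space. 0::'b::euclidean_space) = 0"
  using Hs_sinT(2)[of "\<lambda>_::'a. 0::'b" 1 s 0] by (simp add: sinT_zero)

section \<open>Sobolev norms of the data and of the difference\<close>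

text \<open>On the support the Sobolev weight is at most its value at R, which the amplitude factor
  a compensates up to G. What remains is controlled through S^2 \<le> S by the integral of
  S.\<close>

lemma Hs_norm_sinT_le:
  fixes F :: "'a::euclidean_space \<Rightarrow> 'b::euclidean_space"
  assumes W: "conv_weight S K" and I: "(LINT \<xi>|lborel. S \<xi>) \<le> I" and s: "s > 0" and r: "r > 0" and M: "M \<ge> 0" and G: "G \<ge> 0"
    and F: "continuous_on UNIV F" "\<And>\<xi>. F (- \<xi>) = - F \<xi>" "\<And>\<xi>. norm (F \<xi>) \<le> M * (S \<xi> * exp (- (r * norm \<xi>)))"
    and R: "\<And>\<xi>. F \<xi> \<noteq> 0 \<Longrightarrow> norm \<xi> \<le> R" and a: "(1 + R\<^sup>2) powr s * a\<^sup>2 \<le> G\<^sup>2"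
  shows "Hs_norm s (sinT (\<lambda>\<xi>. a *\<^sub>R F \<xi>)) \<le> (2 * pi) ^ DIM('a) * (M * sqrt I) * G"
proof -
  interpret conv_weight S K by (rule W)
  have FS: "norm (F \<xi>) \<le> M * S \<xi>" for \<xi>
    by (rule order_trans[OF F(3)]) (use M less_imp_le[OF S_pos] r in \<open>auto intro!: mult_left_mono mult_right_le_one_le\<close>)
  have dec: "norm (a *\<^sub>R F \<xi>) \<le> (\<bar>a\<bar> * M) * exp (- (r * norm \<xi>))" for \<xi>
  proof -
    have "norm (F \<xi>) \<le> M * (1 * exp (- (r * norm \<xi>)))"
      by (rule order_trans[OF F(3)]) (intro mult_left_mono mult_right_mono S_le M; simp)
    then show ?thesis by (simp add: mult_left_mono mult.assoc)
  qed
  have c: "continuous_on UNIV (\<lambda>\<xi>. a *\<^sub>R F \<xi>)" by (intro continuous_intros F(1))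
  have odd: "a *\<^sub>R F (- \<xi>) = - (a *\<^sub>R F \<xi>)" for \<xi> by (simp add: F(2))
  note H = Hs_sinT[OF c r s dec odd]
  have "(1 + (norm \<xi>)\<^sup>2) powr s * (norm (a *\<^sub>R F \<xi>))\<^sup>2 \<le> (G * M)\<^sup>2 * S \<xi>" for \<xi>
  proof (cases "F \<xi> = 0")
    case False
    have "(1 + (norm \<xi>)\<^sup>2) powr s \<le> (1 + R\<^sup>2) powr s"
      using R[OF False] s by (intro powr_mono2) (auto intro: power_mono add_nonneg_nonneg)
    moreover have "(norm (F \<xi>))\<^sup>2 \<le> (M * S \<xi>)\<^sup>2" by (intro power_mono FS) auto
    ultimately have "(1 + (norm \<xi>)\<^sup>2) powr s * (a\<^sup>2 * (norm (F \<xi>))\<^sup>2) \<le> (1 + R\<^sup>2) powr s * (a\<^sup>2 * (M * S \<xi>)\<^sup>2)"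
      by (intro mult_mono) auto
    also have "\<dots> = ((1 + R\<^sup>2) powr s * a\<^sup>2) * (M * S \<xi>)\<^sup>2" by simp
    also have "\<dots> \<le> G\<^sup>2 * (M * S \<xi>)\<^sup>2" by (intro mult_right_mono a) simp
    also have "\<dots> = (G * M)\<^sup>2 * (S \<xi> * S \<xi>)" by (simp add: power_mult_distrib power2_eq_square)
    also have "\<dots> \<le> (G * M)\<^sup>2 * (S \<xi> * 1)" using less_imp_le[OF S_pos] by (intro mult_left_mono S_le) auto
    finally show ?thesis by (simp add: power_mult_distrib)
  qed (use less_imp_le[OF S_pos] in simp)
  then have "(LINT \<xi>|lborel. (1 + (norm \<xi>)\<^sup>2) powr s * (norm (a *\<^sub>R F \<xi>))\<^sup>2) \<le> (LINT \<xi>|lborel. (G * M)\<^sup>2 * S \<xi>)"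
    by (intro Bochner_Integration.integral_mono H(3) integrable_mult_right S_int)
  also have "\<dots> \<le> (G * M)\<^sup>2 * I" using I by (simp add: mult_left_mono)
  finally have "sqrt (LINT \<xi>|lborel. (1 + (norm \<xi>)\<^sup>2) powr s * (norm (a *\<^sub>R F \<xi>))\<^sup>2) \<le> G * M * sqrt I"
    using real_sqrt_le_mono[of _ "(G * M)\<^sup>2 * I"] G M by (simp add: real_sqrt_mult abs_mult)
  then have "Hs_norm s (sinT (\<lambda>\<xi>. a *\<^sub>R F \<xi>)) \<le> (2 * pi) ^ DIM('a) * (G * M * sqrt I)"
    unfolding H(2) by (intro mult_left_mono) auto
  then show ?thesis by (simp only: mult_ac)
qed

text \<open>The support radius is 1 for the velocity, whose norm decays like 1/n, and 5n for the
  magnetic field, where 1 + 25 n^2 \<le> 26 n^2 and the factor n^(-s) cancels the growth of the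
  Sobolev weight.\<close>

lemma data_Hs_norm:
  assumes n: "n \<ge> 1" and s: "s \<ge> 1" and W: "conv_weight (wS (i::'d::finite) n) K" and I: "(LINT \<xi>|lborel. wS i n \<xi>) \<le> I"
  shows "Hs_norm s (sinT (\<lambda>\<xi>. (1/n) *\<^sub>R Vdat i j \<xi>)) \<le> (2 * pi) ^ CARD('d) * (Mdat TYPE('d) * sqrt I) * (sqrt (2 powr s) * (1/n))" (is ?V)
    and "Hs_norm s (sinT (\<lambda>\<xi>. (n powr - s) *\<^sub>R Bdat i j n \<xi>)) \<le> (2 * pi) ^ CARD('d) * (Mdat TYPE('d) * sqrt I) * sqrt (26 powr s)" (is ?B)
proof -
  have n0: "n > 0" "0 < 1/n" "s > 0" using n s by auto
  have M: "Mdat TYPE('d) \<ge> 0" using Mdat_pos[where 'd='d] by simp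
  have "(1 + 1\<^sup>2) powr s * (1/n)\<^sup>2 \<le> (sqrt (2 powr s) * (1/n))\<^sup>2"
    unfolding power_mult_distrib by simp
  from Hs_norm_sinT_le[OF W I n0(3,2) M _ Vdat_cont Vdat_minus Vdat_bounds(1)[OF n] Vdat_bounds(3)[OF n] this]
  show ?V using n0 by simp
  have "(1 + (5 * n)\<^sup>2) powr s * (n powr - s)\<^sup>2 \<le> (sqrt (26 powr s))\<^sup>2"
  proof -
    have "1 + (5 * n)\<^sup>2 \<le> 26 * (n powr 2)" using one_le_power[OF n, of 2] n0 by (simp add: power_mult_distrib powr_numeral)
    then have "(1 + (5 * n)\<^sup>2) powr s \<le> (26 * (n powr 2)) powr s" using s by (intro powr_mono2) (auto intro: add_nonneg_nonneg)
    also have "\<dots> = 26 powr s * (n powr 2) powr s" by (rule powr_mult)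
    also have "(n powr 2) powr s = n powr (2 * s)" by (rule powr_powr)
    finally have "(1 + (5 * n)\<^sup>2) powr s * (n powr - s)\<^sup>2 \<le> 26 powr s * n powr (2 * s) * (n powr - s)\<^sup>2"
      by (intro mult_right_mono) auto
    also have "\<dots> = 26 powr s * (n powr (2 * s) * (n powr - s * n powr - s))" by (simp add: power2_eq_square)
    also have "\<dots> = 26 powr s" using n0 by (simp add: powr_add[symmetric])
    finally show ?thesis by simp
  qed
  from Hs_norm_sinT_le[OF W I n0(3,2) M _ Bdat_cont[OF n0(1)] Bdat_minus Bdat_bounds(1)[OF n] Bdat_bounds(2)[OF n] this]
  show ?B by simp
qed

text \<open>The factor (2 pi)^d is the normalization of the transform, one half of
  \<open>gam\<close> is what the Taylor remainders leave, and the ball is a translate of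
  \<open>reg\<close>.\<close>

definition cdat :: "'d::finite itself \<Rightarrow> real" where
  "cdat _ = (2 * pi) ^ CARD('d) * (gam TYPE('d) / 2 * sqrt (measure lborel (cball (0::real^'d) (1/8))))"

lemma cdat_pos: "cdat TYPE('d::finite) > 0"
proof -
  have "measure lborel (cball (0::real^'d) (1/8)) > 0" by (subst content_cball) auto
  then show ?thesis unfolding cdat_def using gam_pos[where 'd='d] by (intro mult_pos_pos) auto
qed

lemma diverging_solutions:
  assumes ij: "i \<noteq> j" and n: "n \<ge> 64" and s: "s \<ge> 1" and W: "conv_weight (wS (i::'d::finite) n) K"
    and T: "T \<le> 1 / (2 * (64 * Mdat TYPE('d) * K))" "T \<le> gam TYPE('d) / (4 * Ldat TYPE('d) K)"
  obtains u b v c where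
    "mhd_solution s T (sinT (\<lambda>\<xi>. (1/n) *\<^sub>R Vdat i j \<xi>)) (sinT (\<lambda>\<xi>. (n powr - s) *\<^sub>R Bdat i j n \<xi>)) u b"
    "mhd_solution s T (\<lambda>x. 0) (sinT (\<lambda>\<xi>. (n powr - s) *\<^sub>R Bdat i j n \<xi>)) v c"
    "\<And>t. 0 \<le> t \<Longrightarrow> t \<le> T \<Longrightarrow> cdat TYPE('d) * t \<le> Hs_norm s (\<lambda>x. b t x - c t x)"
proof -
  let ?M = "Mdat TYPE('d)" and ?b = "n powr - s" and ?L = "Ldat TYPE('d) K" and ?g = "gam TYPE('d)"
  interpret W: conv_weight "wS i n" K by (rule W)
  have n1: "n \<ge> 1" "n > 0" "s > 0" "1/n/2 > 0" using n s by auto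
  define A where "A \<xi> = (1/n) *\<^sub>R (adv (Bdat i j n) (Vdat i j) \<xi> - adv (Vdat i j) (Bdat i j n) \<xi>)" for \<xi>
  obtain U B where 1: "field (4 * ?M) (1/n/2) B"
    "mhd_solution s T (sinT (\<lambda>\<xi>. (1/n) *\<^sub>R (1 *\<^sub>R Vdat i j \<xi>))) (sinT (\<lambda>\<xi>. ?b *\<^sub>R Bdat i j n \<xi>)) (\<lambda>t. sinT (U t)) (\<lambda>t. sinT (B t))"
    "\<And>t \<xi>. 0 \<le> t \<Longrightarrow> t \<le> T \<Longrightarrow> norm (B t \<xi> - ?b *\<^sub>R Bdat i j n \<xi> - (t * ?b * 1) *\<^sub>R A \<xi>) \<le> ?b * (?L * t\<^sup>2)"
    unfolding A_def by (rule solution_with_data[where j = j, OF n1(1) s zero_le_one order_refl W T(1)]) blast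
  obtain V C where 2: "field (4 * ?M) (1/n/2) C"
    "mhd_solution s T (sinT (\<lambda>\<xi>. (1/n) *\<^sub>R (0 *\<^sub>R Vdat i j \<xi>))) (sinT (\<lambda>\<xi>. ?b *\<^sub>R Bdat i j n \<xi>)) (\<lambda>t. sinT (V t)) (\<lambda>t. sinT (C t))"
    "\<And>t \<xi>. 0 \<le> t \<Longrightarrow> t \<le> T \<Longrightarrow> norm (C t \<xi> - ?b *\<^sub>R Bdat i j n \<xi> - (t * ?b * 0) *\<^sub>R A \<xi>) \<le> ?b * (?L * t\<^sup>2)"
    unfolding A_def by (rule solution_with_data[where j = j, OF n1(1) s order_refl zero_le_one W T(1)]) blast
  show thesis
  proof (rule that)
    show "mhd_solution s T (sinT (\<lambda>\<xi>. (1/n) *\<^sub>R Vdat i j \<xi>)) (sinT (\<lambda>\<xi>. ?b *\<^sub>R Bdat i j n \<xi>)) (\<lambda>t. sinT (U t)) (\<lambda>t. sinT (B t))"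
      using 1(2) by simp
    show "mhd_solution s T (\<lambda>x. 0) (sinT (\<lambda>\<xi>. ?b *\<^sub>R Bdat i j n \<xi>)) (\<lambda>t. sinT (V t)) (\<lambda>t. sinT (C t))"
      using 2(2) by (simp add: sinT_zero)
    fix t assume t: "0 \<le> t" "t \<le> T"
    define D where "D \<xi> = B t \<xi> - C t \<xi>" for \<xi>
    have e: "(\<lambda>x. sinT (B t) x - sinT (C t) x) = sinT D"
      unfolding D_def using sinT_diff[OF fieldD(8)[OF 1(1)] fieldD(8)[OF 2(1)]] by blast
    have cD: "continuous_on UNIV D" unfolding D_def by (intro continuous_intros fieldD(6)[OF 1(1)] fieldD(6)[OF 2(1)])
    have oD: "D (- \<xi>) = - D \<xi>" for \<xi> by (simp add: D_def fieldD(4)[OF 1(1)] fieldD(4)[OF 2(1)])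
    have dD: "norm (D \<xi>) \<le> (8 * ?M) * exp (- (1/n/2 * norm \<xi>))" for \<xi>
      unfolding D_def using norm_triangle_ineq4[of "B t \<xi>" "C t \<xi>"] fieldD(3)[OF 1(1), of t \<xi>] fieldD(3)[OF 2(1), of t \<xi>] by linarith
    note H = Hs_sinT[OF cD n1(4,3) dD oD]
    have lower: "(t * ?g / 2)\<^sup>2 * indicator (reg i j n) \<zeta> \<le> (1 + (norm \<zeta>)\<^sup>2) powr s * (norm (D \<zeta>))\<^sup>2" for \<zeta>
    proof (cases "\<zeta> \<in> reg i j n")
      case True
      define X where "X = B t \<zeta> - ?b *\<^sub>R Bdat i j n \<zeta> - (t * ?b * 1) *\<^sub>R A \<zeta>"
      define Y where "Y = C t \<zeta> - ?b *\<^sub>R Bdat i j n \<zeta> - (t * ?b * 0) *\<^sub>R A \<zeta>"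
      have X: "norm X \<le> ?b * (?L * t\<^sup>2)" unfolding X_def by (rule 1(3)[OF t])
      have Y: "norm Y \<le> ?b * (?L * t\<^sup>2)" unfolding Y_def by (rule 2(3)[OF t])
      \<comment> \<open>The common initial magnetic amplitude cancels, and with \<theta> = 1 and
        \<theta> = 0 the first order term appears exactly once.\<close>
      have "D \<zeta> = (t * ?b) *\<^sub>R A \<zeta> + X - Y" by (simp add: D_def X_def Y_def)
      then have "D \<zeta> $ j = t * ?b * A \<zeta> $ j + X $ j - Y $ j" by simp
      moreover have "t * ?b * ?g \<le> t * ?b * A \<zeta> $ j"
        using first_order_lower_bound[OF ij n True W] t by (intro mult_left_mono) (auto simp: A_def)
      moreover have "\<bar>X $ j\<bar> \<le> norm X" "\<bar>Y $ j\<bar> \<le> norm Y" "\<bar>D \<zeta> $ j\<bar> \<le> norm (D \<zeta>)" by (rule component_le_norm_cart)+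
      ultimately have N: "t * ?b * ?g - 2 * (?b * (?L * t\<^sup>2)) \<le> norm (D \<zeta>)" using X Y by linarith
      \<comment> \<open>By the second condition on T the two remainders together take at most half
        of the first order term.\<close>
      have "?L * t \<le> ?g / 4" using order_trans[OF t(2) T(2)] Ldat_pos[OF W.K_pos, where 'd='d] by (simp add: pos_le_divide_eq mult.commute)
      then have "?L * t * (t * ?b) \<le> ?g / 4 * (t * ?b)" using t by (intro mult_right_mono) auto
      then have "2 * (?b * (?L * t\<^sup>2)) \<le> ?b * (t * ?g / 2)" by (simp add: power2_eq_square mult_ac)
      then have N': "?b * (t * ?g / 2) \<le> norm (D \<zeta>)" using N by (simp add: mult_ac)
      \<comment> \<open>On \<open>reg\<close> the Sobolev weight is at least n^(2s), which undoes
        the squared amplitude factor n^(-s) and leaves a bound free of n.\<close>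
      have "n\<^sup>2 \<le> (norm \<zeta>)\<^sup>2" using reg_bounds(3)[OF ij n True] n1(2) by (intro power_mono) auto
      moreover have "n powr 2 = n\<^sup>2" using n1(2) by (simp add: powr_numeral)
      ultimately have "n powr 2 \<le> 1 + (norm \<zeta>)\<^sup>2" by linarith
      then have "(n powr 2) powr s \<le> (1 + (norm \<zeta>)\<^sup>2) powr s" using n1 by (intro powr_mono2) auto
      moreover have "(?b * (t * ?g / 2))\<^sup>2 \<le> (norm (D \<zeta>))\<^sup>2"
        using t less_imp_le[OF gam_pos[where 'd='d]] by (intro power_mono N') auto
      ultimately have "(n powr 2) powr s * (?b * (t * ?g / 2))\<^sup>2 \<le> (1 + (norm \<zeta>)\<^sup>2) powr s * (norm (D \<zeta>))\<^sup>2"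
        by (intro mult_mono) auto
      moreover have "(n powr 2) powr s * (?b * (t * ?g / 2))\<^sup>2 = (t * ?g / 2)\<^sup>2"
      proof -
        have "(n powr 2) powr s * ?b\<^sup>2 = 1" unfolding power2_eq_square powr_powr powr_add[symmetric] using n1 by simp
        then show ?thesis unfolding power_mult_distrib[of ?b] mult.assoc[symmetric] by simp
      qed
      ultimately show ?thesis using True by simp
    qed simp
    have fin: "emeasure lborel (reg i j n) < \<infinity>" unfolding reg_def by (rule emeasure_lborel_cball_finite)
    have "integrable lborel (\<lambda>\<zeta>. (t * ?g / 2)\<^sup>2 * indicator (reg i j n) \<zeta>)"
      by (intro integrable_mult_right integrable_real_indicator fin) (simp add: reg_def)
    then have "(LINT \<zeta>|lborel. (t * ?g / 2)\<^sup>2 * indicator (reg i j n) \<zeta>) \<le> (LINT \<zeta>|lborel. (1 + (norm \<zeta>)\<^sup>2) powr s * (norm (D \<zeta>))\<^sup>2)"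
      by (rule Bochner_Integration.integral_mono[OF _ H(3) lower])
    moreover have "(LINT \<zeta>|lborel. (t * ?g / 2)\<^sup>2 * indicator (reg i j n) \<zeta>) = (t * ?g / 2)\<^sup>2 * measure lborel (cball (0::real^'d) (1/8))"
    proof -
      have "measure lborel (reg i j n) = measure lborel (cball (0::real^'d) (1/8))" unfolding reg_def by (simp add: content_cball)
      then show ?thesis by (simp add: reg_def)
    qed
    ultimately have "(t * ?g / 2)\<^sup>2 * measure lborel (cball (0::real^'d) (1/8)) \<le> (LINT \<zeta>|lborel. (1 + (norm \<zeta>)\<^sup>2) powr s * (norm (D \<zeta>))\<^sup>2)"
      by (simp only:)
    from real_sqrt_le_mono[OF this]
    have "(t * ?g / 2) * sqrt (measure lborel (cball (0::real^'d) (1/8))) \<le> sqrt (LINT \<zeta>|lborel. (1 + (norm \<zeta>)\<^sup>2) powr s * (norm (D \<zeta>))\<^sup>2)"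
      unfolding real_sqrt_mult real_sqrt_abs using t less_imp_le[OF gam_pos[where 'd='d]] by simp
    then have "(2 * pi) ^ CARD('d) * ((t * ?g / 2) * sqrt (measure lborel (cball (0::real^'d) (1/8)))) \<le> Hs_norm s (sinT D)"
      unfolding H(2) by (simp add: mult_left_mono)
    then show "cdat TYPE('d) * t \<le> Hs_norm s (\<lambda>x. sinT (B t) x - sinT (C t) x)"
      unfolding e cdat_def by (simp add: mult_ac)
  qed
qed

theorem theorem1p3:
  fixes s :: real
  assumes "CARD('d::finite) \<in> {2, 3}"
    and "s > real CARD('d) / 2"
  shows "\<exists>T>0. \<exists>C>0. \<exists>c>0.
    \<exists>(u0 :: nat \<Rightarrow> real^'d \<Rightarrow> real^'d) (b0 :: nat \<Rightarrow> real^'d \<Rightarrow> real^'d)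
     (v0 :: nat \<Rightarrow> real^'d \<Rightarrow> real^'d) (c0 :: nat \<Rightarrow> real^'d \<Rightarrow> real^'d)
     (u :: nat \<Rightarrow> real \<Rightarrow> real^'d \<Rightarrow> real^'d) (b :: nat \<Rightarrow> real \<Rightarrow> real^'d \<Rightarrow> real^'d)
     (v :: nat \<Rightarrow> real \<Rightarrow> real^'d \<Rightarrow> real^'d) (cc :: nat \<Rightarrow> real \<Rightarrow> real^'d \<Rightarrow> real^'d).
      (\<forall>n. mhd_solution s T (u0 n) (b0 n) (u n) (b n)) \<and>
      (\<forall>n. mhd_solution s T (v0 n) (c0 n) (v n) (cc n)) \<and>
      (\<forall>n. Hs_norm s (u0 n) + Hs_norm s (b0 n) + Hs_norm s (v0 n) + Hs_norm s (c0 n) \<le> C) \<and>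
      (\<lambda>n. Hs_norm s (\<lambda>x. u0 n x - v0 n x) + Hs_norm s (\<lambda>x. b0 n x - c0 n x))
        \<longlonglongrightarrow> 0 \<and>
      (\<forall>t\<in>{0..T}.
        liminf (\<lambda>n. ereal (Hs_norm s (\<lambda>x. u n t x - v n t x) + Hs_norm s (\<lambda>x. b n t x - cc n t x)))
          \<ge> ereal (c * \<bar>sin t\<bar>))"
proof -
  have s: "s \<ge> 1" "s > 0" using assms by auto
  have "card (UNIV :: 'd set) \<noteq> 1" using assms(1) by auto
  \<comment> \<open>The rotated gradient acts in the plane of two different coordinates, so the
    dimension must be at least 2.\<close>
  then obtain i j :: 'd where ij: "i \<noteq> j" by (metis (full_types) UNIV_I card_1_singleton_iff is_singletonI' is_singleton_altdef empty_iff One_nat_def)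
  obtain K I where K: "K > 0" and I: "I \<ge> 0" and W: "\<And>n. n > 0 \<Longrightarrow> conv_weight (wS i n) K" and WI: "\<And>n. n > 0 \<Longrightarrow> (LINT \<xi>|lborel. wS i n \<xi>) \<le> I"
    by (rule conv_weight_wS[of i]) blast
  \<comment> \<open>The shift by 64 puts every member of the sequence in the range of
    \<open>first_order_lower_bound\<close>, as the statement speaks of all indices.\<close>
  define N where "N k = 64 + real k" for k
  have N: "N k \<ge> 64" "N k \<ge> 1" "N k > 0" for k by (auto simp: N_def)
  define T where "T = min (1 / (2 * (64 * Mdat TYPE('d) * K))) (gam TYPE('d) / (4 * Ldat TYPE('d) K))"
  have T: "T > 0" "T \<le> 1 / (2 * (64 * Mdat TYPE('d) * K))" "T \<le> gam TYPE('d) / (4 * Ldat TYPE('d) K)"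
    unfolding T_def using K Mdat_pos[where 'd='d] gam_pos[where 'd='d] Ldat_pos[OF K, where 'd='d] by (simp_all add: min_less_iff_conj)
  define u0 where "u0 k = sinT (\<lambda>\<xi>. (1/N k) *\<^sub>R Vdat i j \<xi>)" for k
  define b0 where "b0 k = sinT (\<lambda>\<xi>. (N k powr - s) *\<^sub>R Bdat i j (N k) \<xi>)" for k
  \<comment> \<open>The four fields are packed into one tuple so that a single choice function
    provides both solutions for every k.\<close>
  have "\<forall>k. \<exists>w. mhd_solution s T (u0 k) (b0 k) (fst w) (fst (snd w)) \<and> mhd_solution s T (\<lambda>x. 0) (b0 k) (fst (snd (snd w))) (snd (snd (snd w))) \<and>
      (\<forall>t. 0 \<le> t \<longrightarrow> t \<le> T \<longrightarrow> cdat TYPE('d) * t \<le> Hs_norm s (\<lambda>x. fst (snd w) t x - snd (snd (snd w)) t x))"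
  proof
    fix k
    obtain u b v c where "mhd_solution s T (u0 k) (b0 k) u b" "mhd_solution s T (\<lambda>x. 0) (b0 k) v c"
      "\<And>t. 0 \<le> t \<Longrightarrow> t \<le> T \<Longrightarrow> cdat TYPE('d) * t \<le> Hs_norm s (\<lambda>x. b t x - c t x)"
      unfolding u0_def b0_def by (rule diverging_solutions[OF ij N(1)[of k] s(1) W[OF N(3)] T(2,3)]) blast
    then show "\<exists>w. mhd_solution s T (u0 k) (b0 k) (fst w) (fst (snd w)) \<and> mhd_solution s T (\<lambda>x. 0) (b0 k) (fst (snd (snd w))) (snd (snd (snd w))) \<and>
      (\<forall>t. 0 \<le> t \<longrightarrow> t \<le> T \<longrightarrow> cdat TYPE('d) * t \<le> Hs_norm s (\<lambda>x. fst (snd w) t x - snd (snd (snd w)) t x))"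
      by (intro exI[of _ "(u, b, v, c)"]) simp
  qed
  then obtain w where w: "\<And>k. mhd_solution s T (u0 k) (b0 k) (fst (w k)) (fst (snd (w k)))" "\<And>k. mhd_solution s T (\<lambda>x. 0) (b0 k) (fst (snd (snd (w k)))) (snd (snd (snd (w k))))"
    and low: "\<And>k t. 0 \<le> t \<Longrightarrow> t \<le> T \<Longrightarrow> cdat TYPE('d) * t \<le> Hs_norm s (\<lambda>x. fst (snd (w k)) t x - snd (snd (snd (w k))) t x)"
    by (metis (no_types))
  define Q where "Q = (2 * pi) ^ CARD('d) * (Mdat TYPE('d) * sqrt I)"
  have Q: "Q \<ge> 0" unfolding Q_def using I less_imp_le[OF Mdat_pos[where 'd='d]] by (intro mult_nonneg_nonneg) auto
  have u0b: "Hs_norm s (u0 k) \<le> Q * (sqrt (2 powr s) * (1/N k))" for k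
    unfolding u0_def Q_def by (rule data_Hs_norm(1)[OF N(2) s(1) W[OF N(3)] WI[OF N(3)]])
  have b0b: "Hs_norm s (b0 k) \<le> Q * sqrt (26 powr s)" for k
    unfolding b0_def Q_def by (rule data_Hs_norm(2)[OF N(2) s(1) W[OF N(3)] WI[OF N(3)]])
  have zero: "Hs_norm s (\<lambda>x::real^'d. 0::real^'d) = 0" by (rule Hs_norm_zero[OF s(2)])
  define C where "C = Q * sqrt (2 powr s) + 2 * (Q * sqrt (26 powr s)) + 1"
  have C: "C > 0" unfolding C_def using Q by (intro add_nonneg_pos add_nonneg_nonneg mult_nonneg_nonneg) auto
  have bound: "Hs_norm s (u0 k) + Hs_norm s (b0 k) + Hs_norm s (\<lambda>x::real^'d. 0::real^'d) + Hs_norm s (b0 k) \<le> C" for k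
  proof -
    have "Q * (sqrt (2 powr s) * (1/N k)) \<le> Q * (sqrt (2 powr s) * 1)"
      using Q N(2)[of k] by (intro mult_left_mono) auto
    then show ?thesis unfolding C_def using u0b[of k] b0b[of k] zero by linarith
  qed
  have "filterlim N at_top sequentially" unfolding N_def
    by (intro filterlim_tendsto_add_at_top[OF tendsto_const] filterlim_real_sequentially)
  then have "(\<lambda>k. Q * (sqrt (2 powr s) * (1/N k))) \<longlonglongrightarrow> Q * (sqrt (2 powr s) * 0)"
    by (intro tendsto_mult tendsto_const tendsto_divide_0[OF tendsto_const] filterlim_at_top_imp_at_infinity)
  then have "(\<lambda>k. Q * (sqrt (2 powr s) * (1/N k))) \<longlonglongrightarrow> 0" by simp
  then have u0t: "(\<lambda>k. Hs_norm s (u0 k)) \<longlonglongrightarrow> 0"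
    by (rule tendsto_sandwich[OF _ _ tendsto_const, rotated -1]) (intro always_eventually allI u0b Hs_norm_nonneg)+
  have conv: "(\<lambda>k. Hs_norm s (\<lambda>x. u0 k x - 0) + Hs_norm s (\<lambda>x. b0 k x - b0 k x)) \<longlonglongrightarrow> 0"
    using u0t by (simp add: zero)
  have lim: "ereal (cdat TYPE('d) * \<bar>sin t\<bar>) \<le> liminf (\<lambda>k. ereal (Hs_norm s (\<lambda>x. fst (w k) t x - fst (snd (snd (w k))) t x)
      + Hs_norm s (\<lambda>x. fst (snd (w k)) t x - snd (snd (snd (w k))) t x)))" if t: "t \<in> {0..T}" for t
  proof (rule Liminf_bounded, rule always_eventually, rule allI)
    fix k
    \<comment> \<open>The lower bound is linear in t and holds for every k, so the sine is dominated
      and the limit inferior needs no limit.\<close>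
    have "\<bar>sin t\<bar> \<le> t" using abs_sin_x_le_abs_x[of t] t by simp
    then have "cdat TYPE('d) * \<bar>sin t\<bar> \<le> cdat TYPE('d) * t" using cdat_pos[where 'd='d] by (intro mult_left_mono) auto
    then show "ereal (cdat TYPE('d) * \<bar>sin t\<bar>) \<le> ereal (Hs_norm s (\<lambda>x. fst (w k) t x - fst (snd (snd (w k))) t x)
      + Hs_norm s (\<lambda>x. fst (snd (w k)) t x - snd (snd (snd (w k))) t x))"
      using low[of t k] t Hs_norm_nonneg[of s "\<lambda>x. fst (w k) t x - fst (snd (snd (w k))) t x"] by simp
  qed
  show ?thesis
    by (rule exI[of _ T], rule conjI[OF T(1)], rule exI[of _ C], rule conjI[OF C], rule exI[of _ "cdat TYPE('d)"], rule conjI[OF cdat_pos],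
      rule exI[of _ u0], rule exI[of _ b0], rule exI[of _ "\<lambda>k x. 0"], rule exI[of _ b0],
      rule exI[of _ "\<lambda>k. fst (w k)"], rule exI[of _ "\<lambda>k. fst (snd (w k))"],
      rule exI[of _ "\<lambda>k. fst (snd (snd (w k)))"], rule exI[of _ "\<lambda>k. snd (snd (snd (w k)))"])
      (use w bound conv lim in blast)
qed

end
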